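(* Let $n \ge 2$ be an integer, let $K$ be a number field, and let $X \subseteq \mathbb{G}_{\rm m}^n$ be a geometrically irreducible algebraic curve defined over $K$. Suppose that $X$ is not contained in any translate of a proper algebraic subgroup of $\mathbb{G}_{\rm m}^n$. If $L$ is a field with $K\subseteq L\subseteq\overline{\mathbb{Q}}$ that has the Bogomolov Property, then there are only finitely many primitively dependent points in $X(L)$.
   Context: $\mathbb{G}_{\rm m}=\mathbb{C}^*$ is the multiplicative algebraic group over $\mathbb{C}$; number fields are regarded as subfields of $\overline{\mathbb{Q}}\subset\mathbb{C}$. For a field $L\supseteq K$, $X(L)$ is the set of $L$-rational points of $X$. A point $P=(\xi_1,\ldots,\xi_n)\in X(\overline{\mathbb{Q}})$ is called primitively dependent if there are integers $a_1,\ldots,a_n$ with $\gcd(a_1,\ldots,a_n)=1$ such that $\xi_1^{a_1}\cdots\xi_n^{a_n}=1$. Let $U\subset\overline{\mathbb{Q}}$ be the set of all roots of unity and let $\operatorname{h}:\overline{\mathbb{Q}}\to[0,\infty)$ be the absolute logarithmic Weil height. A subfield $L$ of $\overline{\mathbb{Q}}$ has the Bogomolov Property if there exists a constant $C(L)>0$, depending only on $L$, such that $\operatorname{h}(\alpha)\ge C(L)$ for every $\alpha\in L^*\setminus U$. *)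

theory Defs
  imports
    "HOL-Analysis.Analysis"
    "HOL-Library.Poly_Mapping"
    "HOL-Library.Extended_Nat"
    "HOL-Algebra.Algebraic_Closure_Type"
    "HOL-Algebra.Generated_Fields"
    "HOL-Algebra.Embedded_Algebras"
    "HOL-Algebra.Ideal_Product"
begin

no_notation fps_nth (infixl "$" 75)

section \<open>Number fields and the Weil height\<close>

abbreviation complex_field :: "complex ring" where
  "complex_field \<equiv> ring_of_type_algebra"

abbreviation field_degree :: "complex set \<Rightarrow> nat" where
  "field_degree K \<equiv> ring.dim complex_field \<rat> K"

definition number_field :: "complex set \<Rightarrow> bool" where
  "number_field K \<longleftrightarrow> subfield K complex_field \<and> ring.finite_dimension complex_field \<rat> K"

definition ring_of_integers :: "complex set \<Rightarrow> complex ring" where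
  "ring_of_integers K = complex_field \<lparr>carrier := {x \<in> K. algebraic_int x}\<rparr>"

text \<open>The functions are made extensional on \<open>K\<close> so that each embedding is counted once.\<close>

definition embeddings :: "complex set \<Rightarrow> (complex \<Rightarrow> complex) set" where
  "embeddings K = ring_hom (complex_field \<lparr>carrier := K\<rparr>) complex_field \<inter> extensional K"

definition finite_places :: "complex set \<Rightarrow> complex set set" where
  "finite_places K = {P. primeideal P (ring_of_integers K) \<and> P \<noteq> {0}}"

definition ord_integer :: "complex set \<Rightarrow> complex set \<Rightarrow> complex \<Rightarrow> nat" where
  "ord_integer K P a =
     (GREATEST m. a \<in> P [^]\<^bsub>ideals_set (ring_of_integers K)\<^esub> m)"

text \<open>The order is only meaningful at \<open>x \<noteq> 0\<close>; the value \<open>0\<close> is treated separately below.\<close>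

definition ord_at :: "complex set \<Rightarrow> complex set \<Rightarrow> complex \<Rightarrow> int" where
  "ord_at K P x =
     (THE k. \<exists>a \<in> carrier (ring_of_integers K) - {0}. \<exists>b \<in> carrier (ring_of_integers K) - {0}.
        x = a / b \<and> k = int (ord_integer K P a) - int (ord_integer K P b))"

text \<open>
  For a prime \<open>P\<close> above \<open>p\<close>, let \<open>d\<close> be the degree of the completion of \<open>K\<close> at \<open>P\<close>
  over the \<open>p\<close>-adic numbers, and let the absolute value at \<open>P\<close> be the one extending the
  standard \<open>p\<close>-adic absolute value. The quantity defined here is the \<open>d\<close>-th power of that
  absolute value; that is, the local degree is already included.
\<close>

definition finite_abs :: "complex set \<Rightarrow> complex set \<Rightarrow> complex \<Rightarrow> real" where
  "finite_abs K P x =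
     (if x = 0 then 0
      else real (card (carrier (ring_of_integers K Quot P))) powi (- ord_at K P x))"

text \<open>
  Summing over all complex embeddings counts a real place once and a complex place twice, in
  agreement with the local degrees at the infinite places.
\<close>

definition weil_height_in :: "complex set \<Rightarrow> complex \<Rightarrow> real" where
  "weil_height_in K x =
     ((\<Sum>\<sigma>\<in>embeddings K. ln (max 1 (cmod (\<sigma> x)))) +
      (\<Sum>\<^sub>\<infinity>P\<in>finite_places K. ln (max 1 (finite_abs K P x)))) / real (field_degree K)"

text \<open>
  For algebraic \<open>x\<close>, the value of \<^term>\<open>weil_height_in K x\<close> is the same for every number
  field \<open>K\<close> containing \<open>x\<close>. The absolute height is evaluated in the smallest such field.
\<close>

definition weil_height :: "complex \<Rightarrow> real" where
  "weil_height x = weil_height_in (generate_field complex_field {x}) x"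

definition roots_of_unity :: "complex set" where
  "roots_of_unity = {z. \<exists>k>0. z ^ k = 1}"

definition bogomolov_property :: "complex set \<Rightarrow> bool" where
  "bogomolov_property L \<longleftrightarrow>
     (\<exists>C>0. \<forall>\<alpha>\<in>L - {0} - roots_of_unity. C \<le> weil_height \<alpha>)"


section \<open>Subvarieties of the torus\<close>

text \<open>
  Subvarieties are represented by their sets of complex points. As the exponents of a
  polynomial we take finitely supported functions from the index type to the naturals.
\<close>

type_synonym 'n mpoly = "('n \<Rightarrow>\<^sub>0 nat) \<Rightarrow>\<^sub>0 complex"

definition poly_eval :: "('n::finite) mpoly \<Rightarrow> complex^'n \<Rightarrow> complex" where
  "poly_eval f x =
     (\<Sum>m\<in>Poly_Mapping.keys f.
        Poly_Mapping.lookup f m * (\<Prod>i\<in>UNIV. (x $ i) ^ Poly_Mapping.lookup m i))"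

definition torus :: "(complex^'n) monoid" where
  "torus = \<lparr>carrier = {x. \<forall>i. x $ i \<noteq> 0}, monoid.mult = (*), one = 1\<rparr>"

definition torus_zeros :: "('n::finite) mpoly set \<Rightarrow> (complex^'n) set" where
  "torus_zeros F = {x \<in> carrier torus. \<forall>f\<in>F. poly_eval f x = 0}"

definition defined_over :: "complex set \<Rightarrow> (complex^'n) set \<Rightarrow> bool" where
  "defined_over K V \<longleftrightarrow>
     (\<exists>F. (\<forall>f\<in>F. \<forall>m. Poly_Mapping.lookup f m \<in> K) \<and> V = torus_zeros F)"

definition zariski_closed :: "(complex^'n) set \<Rightarrow> bool" where
  "zariski_closed V \<longleftrightarrow> (\<exists>F. V = torus_zeros F)"

text \<open>
  Closed sets are those cut out by polynomials with arbitrary complex coefficients, so this is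
  geometric irreducibility.
\<close>

definition zariski_irreducible :: "(complex^'n) set \<Rightarrow> bool" where
  "zariski_irreducible V \<longleftrightarrow> V \<noteq> {} \<and>
     (\<forall>A B. zariski_closed A \<longrightarrow> zariski_closed B \<longrightarrow> V \<subseteq> A \<union> B \<longrightarrow> V \<subseteq> A \<or> V \<subseteq> B)"

definition krull_dim :: "(complex^'n) set \<Rightarrow> enat" where
  "krull_dim V = Sup {enat m | m. \<exists>Z :: nat \<Rightarrow> (complex^'n) set.
     (\<forall>i\<le>m. zariski_closed (Z i) \<and> zariski_irreducible (Z i) \<and> Z i \<subseteq> V) \<and>
     (\<forall>i<m. Z i \<subset> Z (Suc i))}"

definition algebraic_curve :: "(complex^'n) set \<Rightarrow> bool" where
  "algebraic_curve V \<longleftrightarrow> zariski_closed V \<and> krull_dim V = 1"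

definition algebraic_subgroup :: "(complex^'n) set \<Rightarrow> bool" where
  "algebraic_subgroup H \<longleftrightarrow> subgroup H torus \<and> zariski_closed H"

definition rational_points :: "(complex^'n) set \<Rightarrow> complex set \<Rightarrow> (complex^'n) set" where
  "rational_points V L = {x \<in> V. \<forall>i. x $ i \<in> L}"

definition primitively_dependent :: "complex^'n \<Rightarrow> bool" where
  "primitively_dependent x \<longleftrightarrow>
     (\<exists>a :: 'n \<Rightarrow> int. Gcd (range a) = 1 \<and> (\<Prod>i\<in>UNIV. (x $ i) powi a i) = 1)"

end

theory Submission
  imports Defs "HOL-Library.Function_Algebras"
begin

text \<open>
  Let \<open>x\<close> be a point on the curve with \<open>x\<^sup>a = 1\<close>. Approximating the direction of \<open>a\<close> by an integer vector
  \<open>b\<close> from a fixed finite set gives a monomial \<open>x\<^sup>b\<close> whose height is a small multiple of the height of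
  \<open>x\<close>. As no monomial with nonzero exponent is constant on the curve, every coordinate is algebraic over \<open>x\<^sup>b\<close>, and
  the degree in \<open>x\<^sup>b\<close> of the relation does not depend on \<open>b\<close>. Hence the height of \<open>x\<close> is bounded, and a
  finer approximation makes the height of \<open>x\<^sup>b\<close> smaller than the Bogomolov constant of \<open>L\<close>: now \<open>x\<^sup>b\<close> is
  a root of unity. If \<open>a\<close> is parallel to \<open>b\<close>, then primitivity leaves finitely many \<open>a\<close>. Otherwise a
  combination of \<open>a\<close> and \<open>b\<close> with a vanishing coordinate yields in the same way an independent
  exponent \<open>b'\<close> such that \<open>x\<^sup>b\<^sup>'\<close> is a root of unity as well. So \<open>(x\<^sup>b, x\<^sup>b\<^sup>')\<close> is a torsion point on a plane
  curve; such points satisfy one of finitely many monomial relations, each of which has finitely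
  many solutions on the original curve.
\<close>

hide_const (open) up_ring.coeff up_ring.monom Divisibility.prime module.smult Polynomials.degree
  Polynomials.lead_coeff

section \<open>Subrings, homomorphisms and algebraic integers\<close>

text \<open>The exponents need care with the order of choices. The approximation must have quality
  \<open>2 * N\<close>, where \<open>N\<close> is the degree in \<open>x^b\<close> of the relation
  for a coordinate; since \<open>b\<close> is found only after \<open>N\<close> is fixed, a degree
  depending on \<open>b\<close> would be circular. It is uniform because all functions on the curve
  lie in one finite-dimensional space over the field generated by the coordinate. Constants and
  exceptional points may depend on \<open>b\<close>, which runs through a finite set. Of the height
  only an upper bound is used: a bound close to \<open>1\<close> in the sense of
  \<open>height_at_most\<close> forces a small Weil height. A lost constant factor is harmless, as
  the bound can be brought as close to \<open>1\<close> as desired. A zero entry of an exponent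
  survives the approximation; this alone makes the second exponent independent of the first.
  Relations on the curve come with complex coefficients. Restricted to points with algebraic values
  they are linear conditions over the algebraic numbers and can be replaced by algebraic
  ones.\<close>

definition subring_on :: "'a::comm_ring_1 set \<Rightarrow> bool" where
  "subring_on A \<longleftrightarrow> 1 \<in> A \<and> (\<forall>x\<in>A. \<forall>y\<in>A. x - y \<in> A \<and> x * y \<in> A)"

lemma subring_on_1: "subring_on A \<Longrightarrow> 1 \<in> A"
  and subring_on_diff: "subring_on A \<Longrightarrow> x \<in> A \<Longrightarrow> y \<in> A \<Longrightarrow> x - y \<in> A"
  and subring_on_mult: "subring_on A \<Longrightarrow> x \<in> A \<Longrightarrow> y \<in> A \<Longrightarrow> x * y \<in> A"
  by (auto simp: subring_on_def)

lemma subring_on_0: "subring_on A \<Longrightarrow> 0 \<in> A"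
  using subring_on_diff[of A 1 1] subring_on_1[of A] by simp

lemma subring_on_uminus: "subring_on A \<Longrightarrow> x \<in> A \<Longrightarrow> - x \<in> A"
  using subring_on_diff[of A 0 x] subring_on_0[of A] by simp

lemma subring_on_add: "subring_on A \<Longrightarrow> x \<in> A \<Longrightarrow> y \<in> A \<Longrightarrow> x + y \<in> A"
  using subring_on_diff[of A x "- y"] subring_on_uminus[of A y] by simp

lemma subring_on_power: "subring_on A \<Longrightarrow> x \<in> A \<Longrightarrow> x ^ n \<in> A"
  by (induction n) (auto intro: subring_on_1 subring_on_mult)

lemma subring_on_sum: "subring_on A \<Longrightarrow> (\<And>i. i \<in> I \<Longrightarrow> f i \<in> A) \<Longrightarrow> sum f I \<in> A"
  by (induction I rule: infinite_finite_induct) (auto intro: subring_on_0 subring_on_add)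

lemma subring_on_prod: "subring_on A \<Longrightarrow> (\<And>i. i \<in> I \<Longrightarrow> f i \<in> A) \<Longrightarrow> prod f I \<in> A"
  by (induction I rule: infinite_finite_induct) (auto intro: subring_on_1 subring_on_mult)

lemma subring_on_of_nat: "subring_on A \<Longrightarrow> of_nat n \<in> A"
  by (induction n) (auto intro: subring_on_0 subring_on_add subring_on_1)

lemma subring_on_of_int: "subring_on A \<Longrightarrow> of_int n \<in> A"
  by (cases n) (auto intro: subring_on_diff subring_on_uminus subring_on_of_nat subring_on_1
      simp del: of_nat_Suc)

lemmas subring_on_intros =
  subring_on_0 subring_on_1 subring_on_add subring_on_diff subring_on_mult subring_on_uminus
  subring_on_power subring_on_sum subring_on_prod subring_on_of_nat subring_on_of_int

lemma subring_on_UNIV: "subring_on UNIV"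
  by (simp add: subring_on_def)

lemma subring_on_Ints: "subring_on (\<int> :: 'a::comm_ring_1 set)"
  by (simp add: subring_on_def)

section \<open>Polynomials with coefficients in a subring\<close>

definition polys_over :: "'a::comm_ring_1 set \<Rightarrow> 'a poly set" where
  "polys_over A = {p. \<forall>i. coeff p i \<in> A}"

lemma polys_overI: "(\<And>i. coeff p i \<in> A) \<Longrightarrow> p \<in> polys_over A"
  and polys_overD: "p \<in> polys_over A \<Longrightarrow> coeff p i \<in> A"
  by (auto simp: polys_over_def)

lemma polys_over_mono: "A \<subseteq> B \<Longrightarrow> polys_over A \<subseteq> polys_over B"
  by (auto simp: polys_over_def)

lemma subring_on_polys_over: "subring_on A \<Longrightarrow> subring_on (polys_over A)"
  by (subst subring_on_def) (auto simp: polys_over_def coeff_mult intro!: subring_on_intros)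

lemma monom_in_polys_over: "subring_on A \<Longrightarrow> a \<in> A \<Longrightarrow> monom a n \<in> polys_over A"
  by (auto simp: polys_over_def intro: subring_on_0)

lemma const_in_polys_over: "subring_on A \<Longrightarrow> a \<in> A \<Longrightarrow> [:a:] \<in> polys_over A"
  using monom_in_polys_over[of A a 0] by (simp add: monom_0)

lemma smult_in_polys_over: "subring_on A \<Longrightarrow> a \<in> A \<Longrightarrow> p \<in> polys_over A \<Longrightarrow> smult a p \<in> polys_over A"
  by (auto simp: polys_over_def intro: subring_on_mult)

lemma poly_sum_le:
  fixes p :: "'a::comm_ring_1 poly"
  assumes "degree p \<le> n"
  shows "poly p x = (\<Sum>i\<le>n. coeff p i * x ^ i)"
proof -
  have "(\<Sum>i\<le>n. coeff p i * x ^ i) = (\<Sum>i\<le>degree p. coeff p i * x ^ i)"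
    by (rule sum.mono_neutral_right) (use assms in \<open>auto simp: coeff_eq_0\<close>)
  thus ?thesis by (simp add: poly_altdef)
qed

lemma poly_in_subring: "subring_on A \<Longrightarrow> p \<in> polys_over A \<Longrightarrow> x \<in> A \<Longrightarrow> poly p x \<in> A"
  unfolding poly_altdef by (intro subring_on_intros) (auto dest: polys_overD)

definition adjoin :: "'a::comm_ring_1 set \<Rightarrow> 'a \<Rightarrow> 'a set" where
  "adjoin A y = (\<lambda>p. poly p y) ` polys_over A"

lemma subring_on_adjoin:
  assumes "subring_on A" shows "subring_on (adjoin A y)"
proof -
  note S = subring_on_polys_over[OF assms]
  have "1 \<in> adjoin A y"
    unfolding adjoin_def using subring_on_1[OF S] by (intro image_eqI[of _ _ 1]) auto
  moreover have "poly p y - poly q y \<in> adjoin A y \<and> poly p y * poly q y \<in> adjoin A y"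
    if "p \<in> polys_over A" "q \<in> polys_over A" for p q
    using imageI[OF subring_on_diff[OF S that], of "\<lambda>p. poly p y"]
      imageI[OF subring_on_mult[OF S that], of "\<lambda>p. poly p y"] by (simp add: adjoin_def)
  ultimately show ?thesis by (auto simp: subring_on_def adjoin_def)
qed

lemma adjoin_superset: "subring_on A \<Longrightarrow> A \<subseteq> adjoin A y"
proof
  fix a assume "subring_on A" "a \<in> A"
  thus "a \<in> adjoin A y"
    unfolding adjoin_def using const_in_polys_over[of A a] by (intro image_eqI[of _ _ "[:a:]"]) auto
qed

lemma adjoin_self: "subring_on A \<Longrightarrow> y \<in> adjoin A y"
  unfolding adjoin_def using monom_in_polys_over[of A 1 1] subring_on_1[of A]
  by (intro image_eqI[of _ _ "monom 1 1"]) (auto simp: poly_monom)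

section \<open>Homomorphisms on a subring\<close>

definition ring_hom_on :: "'a::comm_ring_1 set \<Rightarrow> ('a \<Rightarrow> 'b::comm_ring_1) \<Rightarrow> bool" where
  "ring_hom_on A h \<longleftrightarrow> subring_on A \<and> h 1 = 1 \<and>
     (\<forall>x\<in>A. \<forall>y\<in>A. h (x - y) = h x - h y \<and> h (x * y) = h x * h y)"

lemma ring_hom_on_subring: "ring_hom_on A h \<Longrightarrow> subring_on A"
  and ring_hom_on_1: "ring_hom_on A h \<Longrightarrow> h 1 = 1"
  and ring_hom_on_diff: "ring_hom_on A h \<Longrightarrow> x \<in> A \<Longrightarrow> y \<in> A \<Longrightarrow> h (x - y) = h x - h y"
  and ring_hom_on_mult: "ring_hom_on A h \<Longrightarrow> x \<in> A \<Longrightarrow> y \<in> A \<Longrightarrow> h (x * y) = h x * h y"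
  by (auto simp: ring_hom_on_def)

lemma ring_hom_on_0: "ring_hom_on A h \<Longrightarrow> h 0 = 0"
  using ring_hom_on_diff[of A h 1 1] subring_on_1[of A] ring_hom_on_subring[of A h] by simp

lemma ring_hom_on_uminus: "ring_hom_on A h \<Longrightarrow> x \<in> A \<Longrightarrow> h (- x) = - h x"
  using ring_hom_on_diff[of A h 0 x] ring_hom_on_0[of A h] subring_on_0[of A] ring_hom_on_subring[of A h]
  by simp

lemma ring_hom_on_add: "ring_hom_on A h \<Longrightarrow> x \<in> A \<Longrightarrow> y \<in> A \<Longrightarrow> h (x + y) = h x + h y"
  using ring_hom_on_diff[of A h x "- y"] ring_hom_on_uminus[of A h y]
    subring_on_uminus[of A y] ring_hom_on_subring[of A h] by simp

lemma ring_hom_on_power: "ring_hom_on A h \<Longrightarrow> x \<in> A \<Longrightarrow> h (x ^ n) = h x ^ n"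
  by (induction n) (auto simp: ring_hom_on_1 ring_hom_on_mult ring_hom_on_subring subring_on_power)

lemma ring_hom_on_sum:
  "ring_hom_on A h \<Longrightarrow> (\<And>i. i \<in> I \<Longrightarrow> f i \<in> A) \<Longrightarrow> h (sum f I) = (\<Sum>i\<in>I. h (f i))"
  by (induction I rule: infinite_finite_induct)
    (auto simp: ring_hom_on_0 ring_hom_on_add ring_hom_on_subring subring_on_sum)

lemma ring_hom_on_prod:
  "ring_hom_on A h \<Longrightarrow> (\<And>i. i \<in> I \<Longrightarrow> f i \<in> A) \<Longrightarrow> h (prod f I) = (\<Prod>i\<in>I. h (f i))"
  by (induction I rule: infinite_finite_induct)
    (auto simp: ring_hom_on_1 ring_hom_on_mult ring_hom_on_subring subring_on_prod)

lemma ring_hom_on_of_nat: "ring_hom_on A h \<Longrightarrow> h (of_nat n) = of_nat n"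
  by (induction n)
    (auto simp: ring_hom_on_0 ring_hom_on_1 ring_hom_on_add ring_hom_on_subring subring_on_of_nat subring_on_1)

lemma ring_hom_on_of_int: "ring_hom_on A h \<Longrightarrow> h (of_int n) = of_int n"
  by (cases n)
    (auto simp: ring_hom_on_of_nat ring_hom_on_uminus ring_hom_on_diff ring_hom_on_1 ring_hom_on_subring
      subring_on_of_nat subring_on_1 subring_on_uminus)

lemma ring_hom_on_cong:
  "ring_hom_on A h \<Longrightarrow> (\<And>x. x \<in> A \<Longrightarrow> h' x = h x) \<Longrightarrow> ring_hom_on A h'"
  unfolding ring_hom_on_def
  by (auto simp: subring_on_1 subring_on_diff subring_on_mult)

lemma coeff_map_poly_hom: "ring_hom_on A h \<Longrightarrow> coeff (map_poly h p) i = h (coeff p i)"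
  by (simp add: coeff_map_poly ring_hom_on_0)

lemma ring_hom_on_map_poly:
  assumes h: "ring_hom_on A h" shows "ring_hom_on (polys_over A) (map_poly h)"
  unfolding ring_hom_on_def
proof (intro conjI ballI)
  note A = ring_hom_on_subring[OF h]
  show "subring_on (polys_over A)" by (rule subring_on_polys_over[OF A])
  show "map_poly h 1 = 1"
    by (rule poly_eqI) (auto simp: coeff_map_poly_hom[OF h] ring_hom_on_0[OF h] ring_hom_on_1[OF h] coeff_1)
  fix p q assume pq: "p \<in> polys_over A" "q \<in> polys_over A"
  note m = polys_overD[OF pq(1)] polys_overD[OF pq(2)]
  show "map_poly h (p - q) = map_poly h p - map_poly h q"
    by (rule poly_eqI) (simp add: coeff_map_poly_hom[OF h] ring_hom_on_diff[OF h] m)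
  show "map_poly h (p * q) = map_poly h p * map_poly h q"
  proof (rule poly_eqI)
    fix n
    have "h (\<Sum>i\<le>n. coeff p i * coeff q (n - i)) = (\<Sum>i\<le>n. h (coeff p i * coeff q (n - i)))"
      by (intro ring_hom_on_sum[OF h] subring_on_mult[OF A] m)
    also have "\<dots> = (\<Sum>i\<le>n. h (coeff p i) * h (coeff q (n - i)))"
      by (intro sum.cong ring_hom_on_mult[OF h] m refl)
    finally show "coeff (map_poly h (p * q)) n = coeff (map_poly h p * map_poly h q) n"
      by (simp add: coeff_map_poly_hom[OF h] coeff_mult)
  qed
qed

lemma degree_map_poly_hom_le: "ring_hom_on A h \<Longrightarrow> degree (map_poly h p) \<le> degree p"
  by (rule degree_le) (auto simp: coeff_map_poly_hom coeff_eq_0 ring_hom_on_0)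

lemma poly_map_poly_hom:
  assumes h: "ring_hom_on A h" and p: "p \<in> polys_over A" and x: "x \<in> A"
  shows "h (poly p x) = poly (map_poly h p) (h x)"
proof -
  note A = ring_hom_on_subring[OF h]
  note m = polys_overD[OF p]
  have "h (poly p x) = (\<Sum>i\<le>degree p. h (coeff p i * x ^ i))"
    unfolding poly_altdef by (intro ring_hom_on_sum[OF h] subring_on_mult[OF A] subring_on_power[OF A] m x)
  also have "\<dots> = (\<Sum>i\<le>degree p. coeff (map_poly h p) i * h x ^ i)"
    by (intro sum.cong refl)
      (simp add: coeff_map_poly_hom[OF h] ring_hom_on_mult[OF h m subring_on_power[OF A x]] ring_hom_on_power[OF h x])
  also have "\<dots> = poly (map_poly h p) (h x)"
    by (rule poly_sum_le[symmetric, OF degree_map_poly_hom_le[OF h]])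
  finally show ?thesis .
qed

text \<open>
  Elimination of one unknown after the other in a square system whose diagonal entries are monic
  of a common degree, larger than that of all other entries. It replaces the determinant in the
  proof that a number acting on a finitely generated additive group is integral.
\<close>

lemma monic_elimination:
  fixes P :: "'i \<Rightarrow> 'i \<Rightarrow> complex poly"
  assumes "finite F" and "j \<notin> F" and "d > 0"
    and "\<And>k. k \<in> insert j F \<Longrightarrow> lead_coeff (P k k) = 1 \<and> degree (P k k) = d"
    and "\<And>k l. k \<in> insert j F \<Longrightarrow> l \<in> insert j F \<Longrightarrow> k \<noteq> l \<Longrightarrow> degree (P k l) < d"
    and "\<And>k l. P k l \<in> polys_over \<int>"
    and "\<And>k. k \<in> insert j F \<Longrightarrow> (\<Sum>l\<in>insert j F. poly (P k l) z * e l) = 0"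
  shows "\<exists>q\<in>polys_over \<int>. lead_coeff q = 1 \<and> poly q z * e j = 0"
  using assms
proof (induction F arbitrary: P d rule: finite_induct)
  case empty
  thus ?case by (intro bexI[of _ "P j j"]) auto
next
  case (insert i F)
  note S = subring_on_polys_over[OF subring_on_Ints]
  \<comment> \<open>The pivot \<open>P i i\<close> eliminates \<open>e i\<close> without division:
    each row is multiplied by it and a multiple of row \<open>i\<close> is subtracted. The product
    of two diagonal entries is monic of degree \<open>2 * d\<close> and all other products have
    smaller degree, so the shape of the system persists.\<close>
  define P' where "P' k l = P i i * P k l - P k i * P i l" for k l
  have ij: "i \<noteq> j" "j \<notin> F" "i \<notin> F" using insert by auto
  have deg: "degree (P k i * P i l) < 2 * d" if "k \<in> insert j F" "l \<in> insert j F" for k l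
  proof -
    have "degree (P k i) < d" "degree (P i l) < d"
      using insert.prems(4)[of k i] insert.prems(4)[of i l] that ij by auto
    thus ?thesis using degree_mult_le[of "P k i" "P i l"] by linarith
  qed
  show ?case
  proof (rule insert.IH[of "2 * d" P'])
    show "j \<notin> F" by (rule ij)
    show "2 * d > 0" using insert.prems by simp
    fix k assume k: "k \<in> insert j F"
    have "P i i \<noteq> 0" "P k k \<noteq> 0" "lead_coeff (P i i) = 1" "lead_coeff (P k k) = 1"
      "degree (P i i) = d" "degree (P k k) = d"
      using insert.prems(3)[of i] insert.prems(3)[of k] k insert.prems(2) by auto
    hence 1: "degree (P i i * P k k) = 2 * d" and l: "lead_coeff (P i i * P k k) = 1"
      using lead_coeff_mult[of "P i i" "P k k"] by (simp_all add: degree_mult_eq)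
    have dk: "degree (P k i * P i k) < degree (P i i * P k k)"
      using deg[OF k k] 1 by simp
    have 2: "degree (P' k k) = 2 * d"
      unfolding P'_def using degree_add_eq_left[of "- (P k i * P i k)" "P i i * P k k"] dk 1 by simp
    moreover have "coeff (P k i * P i k) (2 * d) = 0"
      using dk 1 by (intro coeff_eq_0) simp
    ultimately show "lead_coeff (P' k k) = 1 \<and> degree (P' k k) = 2 * d"
      using 1 l by (simp add: P'_def)
    show "(\<Sum>l\<in>insert j F. poly (P' k l) z * e l) = 0"
    proof -
      have *: "(\<Sum>l\<in>insert j F. poly (P k l) z * e l) = - poly (P k i) z * e i"
        if "k \<in> insert j (insert i F)" for k
      proof -
        have "(\<Sum>l\<in>insert i (insert j F). poly (P k l) z * e l) = 0"
          using insert.prems(6)[OF that] by (simp add: insert_commute)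
        thus ?thesis using ij insert.hyps by (simp add: eq_neg_iff_add_eq_0 add.commute)
      qed
      have "(\<Sum>l\<in>insert j F. poly (P' k l) z * e l) =
          poly (P i i) z * (\<Sum>l\<in>insert j F. poly (P k l) z * e l)
          - poly (P k i) z * (\<Sum>l\<in>insert j F. poly (P i l) z * e l)"
        unfolding P'_def sum_distrib_left sum_subtractf[symmetric]
        by (intro sum.cong) (simp_all add: algebra_simps)
      also have "\<dots> = 0" using *[of k] *[of i] k by (auto simp: algebra_simps)
      finally show ?thesis .
    qed
  next
    fix k l assume k: "k \<in> insert j F" "l \<in> insert j F" "k \<noteq> l"
    have "degree (P i i * P k l) < 2 * d"
      using insert.prems(3)[of i] insert.prems(4)[of k l] degree_mult_le[of "P i i" "P k l"] k by auto
    thus "degree (P' k l) < 2 * d" unfolding P'_def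
      using degree_diff_less[of "P i i * P k l" "2 * d"] deg[OF k(1,2)] by simp
  next
    fix k l show "P' k l \<in> polys_over \<int>"
      unfolding P'_def by (intro subring_on_diff[OF S] subring_on_mult[OF S] insert.prems)
  qed
qed

section \<open>Integrality through finitely generated additive groups\<close>

definition int_span :: "complex set \<Rightarrow> complex set" where
  "int_span E = {\<Sum>e\<in>E. of_int (c e) * e | c. True}"

lemma int_span_lincomb: "(\<Sum>e\<in>E. of_int (c e) * e) \<in> int_span E"
  by (auto simp: int_span_def)

lemma int_span_add: "x \<in> int_span E \<Longrightarrow> y \<in> int_span E \<Longrightarrow> x + y \<in> int_span E"
proof -
  assume "x \<in> int_span E" "y \<in> int_span E"
  then obtain c d where "x = (\<Sum>e\<in>E. of_int (c e) * e)" "y = (\<Sum>e\<in>E. of_int (d e) * e)"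
    by (auto simp: int_span_def)
  hence "x + y = (\<Sum>e\<in>E. of_int (c e + d e) * e)"
    by (simp add: sum.distrib distrib_right)
  thus ?thesis using int_span_lincomb[of "\<lambda>e. c e + d e" E] by simp
qed

lemma int_span_scale: "x \<in> int_span E \<Longrightarrow> of_int n * x \<in> int_span E"
proof -
  assume "x \<in> int_span E"
  then obtain c where "x = (\<Sum>e\<in>E. of_int (c e) * e)"
    by (auto simp: int_span_def)
  hence "of_int n * x = (\<Sum>e\<in>E. of_int (n * c e) * e)"
    by (simp add: sum_distrib_left mult.assoc)
  thus ?thesis using int_span_lincomb[of "\<lambda>e. n * c e" E] by simp
qed

lemma int_span_0: "0 \<in> int_span E"
  using int_span_lincomb[of "\<lambda>_. 0" E] by simp

lemma int_span_sum: "(\<And>i. i \<in> I \<Longrightarrow> f i \<in> int_span E) \<Longrightarrow> sum f I \<in> int_span E"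
  by (induction I rule: infinite_finite_induct) (auto simp: int_span_0 int_span_add)

lemma int_span_base: "finite E \<Longrightarrow> e \<in> E \<Longrightarrow> e \<in> int_span E"
proof -
  assume "finite E" "e \<in> E"
  hence "(\<Sum>e'\<in>E. of_int (if e' = e then 1 else 0) * e') = e"
    by (simp add: if_distrib[of of_int] if_distrib[of "\<lambda>x. x * _"] cong: if_cong)
  thus ?thesis using int_span_lincomb[of "\<lambda>e'. if e' = e then 1 else 0" E] by simp
qed

text \<open>Finite in the sense of ring extensions: finitely generated as an additive group, with
  generators inside the ring.\<close>

definition finite_ring :: "complex set \<Rightarrow> bool" where
  "finite_ring A \<longleftrightarrow> subring_on A \<and> (\<exists>E\<subseteq>A. finite E \<and> A \<subseteq> int_span E)"

lemma finite_ring_Ints: "finite_ring \<int>"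
  unfolding finite_ring_def
proof (intro conjI exI[of _ "{1}"])
  show "\<int> \<subseteq> int_span {1}"
  proof
    fix x :: complex assume "x \<in> \<int>"
    then obtain n where "x = of_int n" by (auto elim: Ints_cases)
    thus "x \<in> int_span {1}" using int_span_lincomb[of "\<lambda>_. n" "{1}"] by simp
  qed
qed (auto simp: subring_on_Ints)

text \<open>Multiplication by \<open>z\<close> maps each generator to an integer combination of
  generators, so the generators solve a square system with diagonal entries \<open>X - c k k\<close>
  and constants elsewhere. Elimination yields a monic integer polynomial whose value at
  \<open>z\<close> annihilates a nonzero generator; one exists because \<open>1\<close> is a
  combination of them.\<close>

lemma finite_ring_algebraic_int:
  assumes "finite_ring A" and z: "z \<in> A" shows "algebraic_int z"
proof -
  obtain E where A: "subring_on A" and E: "E \<subseteq> A" "finite E" "A \<subseteq> int_span E"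
    using assms by (auto simp: finite_ring_def)
  have "\<exists>c. z * e = (\<Sum>f\<in>E. of_int (c f) * f)" if "e \<in> E" for e
    using subring_on_mult[OF A z] E that by (fastforce simp: int_span_def)
  then obtain c where c: "\<And>e. e \<in> E \<Longrightarrow> z * e = (\<Sum>f\<in>E. of_int (c e f) * f)" by metis
  have "1 \<in> int_span E" using subring_on_1[OF A] E by auto
  then obtain a where "1 = (\<Sum>e\<in>E. of_int (a e) * e)" by (auto simp: int_span_def)
  hence "(\<Sum>e\<in>E. of_int (a e) * e) \<noteq> 0" by (metis zero_neq_one)
  then obtain j where j: "j \<in> E" "j \<noteq> 0"
    by (elim sum.not_neutral_contains_not_neutral) auto
  define P :: "complex \<Rightarrow> complex \<Rightarrow> complex poly" where
    "P e f = (if e = f then monom 1 1 else 0) - [:of_int (c e f):]" for e f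
  have "\<exists>q\<in>polys_over \<int>. lead_coeff q = 1 \<and> poly q z * j = 0"
  proof (rule monic_elimination[of "E - {j}" j 1 P z "\<lambda>e. e"])
    have E': "insert j (E - {j}) = E" using j by auto
    fix k l
    show "P k l \<in> polys_over \<int>"
      unfolding P_def by (intro subring_on_diff[OF subring_on_polys_over[OF subring_on_Ints]])
        (auto intro!: monom_in_polys_over const_in_polys_over subring_on_Ints
          subring_on_0[OF subring_on_polys_over[OF subring_on_Ints]])
    assume "k \<in> insert j (E - {j})"
    hence k: "k \<in> E" using j by auto
    have "P k k = [:- of_int (c k k), 1:]" by (simp add: P_def monom_Suc monom_0)
    thus "lead_coeff (P k k) = 1 \<and> degree (P k k) = 1" by simp
    have "(\<Sum>l\<in>E. poly (P k l) z * l) = (\<Sum>l\<in>E. (if k = l then z * l else 0)) - (\<Sum>l\<in>E. of_int (c k l) * l)"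
      unfolding sum_subtractf[symmetric] by (intro sum.cong) (auto simp: P_def poly_monom algebra_simps)
    thus "(\<Sum>l\<in>insert j (E - {j}). poly (P k l) z * l) = 0"
      using c[OF k] E k unfolding E' by simp
  qed (use j E in \<open>auto simp: P_def\<close>)
  then obtain q where "q \<in> polys_over \<int>" "lead_coeff q = 1" "poly q z = 0" using j by auto
  thus ?thesis by (intro algebraic_int.intros[of q]) (auto dest: polys_overD)
qed

text \<open>Division by a monic polynomial needs no inverses, hence stays over \<open>A\<close>; as
  \<open>p\<close> vanishes at \<open>y\<close>, the remainder takes the same value there.\<close>

lemma monic_reduce:
  fixes p :: "'a::idom poly"
  assumes A: "subring_on A" and p: "p \<in> polys_over A" "lead_coeff p = 1" "poly p y = 0"
    and q: "q \<in> polys_over A"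
  shows "\<exists>r\<in>polys_over A. poly r y = poly q y \<and> degree r < degree p"
  using q
proof (induction "degree q" arbitrary: q rule: less_induct)
  case less
  note S = subring_on_polys_over[OF A]
  have dp: "degree p > 0"
    using p by (metis degree_eq_zeroE gr0I lead_coeff_pCons(2) mult_zero_right poly_0 poly_pCons add.right_neutral pCons_0_0 one_neq_zero)
  show ?case
  proof (cases "degree q < degree p")
    case True thus ?thesis using less by auto
  next
    case False
    define m where "m = monom (lead_coeff q) (degree q - degree p) * p"
    have q0: "q \<noteq> 0" using False dp by auto
    have m: "degree m = degree q" "lead_coeff m = lead_coeff q" "poly m y = 0"
    proof -
      have "p \<noteq> 0" "monom (lead_coeff q) (degree q - degree p) \<noteq> 0" using p q0 by auto
      thus "degree m = degree q"
        using q0 False by (simp add: m_def degree_mult_eq degree_monom_eq)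
      show "lead_coeff m = lead_coeff q" "poly m y = 0"
        using p q0 by (simp_all add: m_def lead_coeff_mult degree_monom_eq)
    qed
    have mA: "m \<in> polys_over A"
      unfolding m_def by (intro subring_on_mult[OF S] monom_in_polys_over A polys_overD[OF less.prems] p)
    have "degree (q - m) \<le> degree q" "coeff (q - m) (degree q) = 0"
      using degree_diff_le[of q "degree q" m] m by auto
    hence "degree (q - m) < degree q"
      using degree_lessI[of "q - m" "degree q"] False dp coeff_eq_0[of "q - m"]
      by (metis le_neq_implies_less leading_coeff_0_iff degree_0 not_less)
    then obtain r where "r \<in> polys_over A" "poly r y = poly (q - m) y" "degree r < degree p"
      using less.hyps[of "q - m"] subring_on_diff[OF S less.prems mA] by auto
    thus ?thesis using m by auto
  qed
qed

text \<open>Remainders modulo \<open>p\<close> have degree below \<open>n = degree p\<close>, so the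
  products of the old generators with the powers of \<open>y\<close> below \<open>n\<close> generate
  the new ring.\<close>

lemma finite_ring_adjoin:
  assumes "finite_ring A" and p: "p \<in> polys_over A" "lead_coeff p = 1" "poly p y = 0"
  shows "finite_ring (adjoin A y)"
proof -
  obtain E where A: "subring_on A" and E: "E \<subseteq> A" "finite E" "A \<subseteq> int_span E"
    using assms by (auto simp: finite_ring_def)
  define n where "n = degree p"
  define E' where "E' = (\<lambda>(e,j). e * y ^ j) ` (E \<times> {..<n})"
  note S = subring_on_adjoin[OF A, of y]
  have fin: "finite E'" unfolding E'_def using E by auto
  have "E' \<subseteq> adjoin A y"
    unfolding E'_def using E adjoin_superset[OF A] adjoin_self[OF A, of y]
    by (auto intro!: subring_on_mult[OF S] subring_on_power[OF S])
  moreover have "adjoin A y \<subseteq> int_span E'"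
  proof
    fix x assume "x \<in> adjoin A y"
    then obtain q where q: "q \<in> polys_over A" "x = poly q y" by (auto simp: adjoin_def)
    obtain r where r: "r \<in> polys_over A" "poly r y = x" "degree r < n"
      using monic_reduce[OF A p q(1)] q(2) by (auto simp: n_def)
    have "x = (\<Sum>i\<le>degree r. coeff r i * y ^ i)" using r by (simp add: poly_altdef)
    also have "\<dots> \<in> int_span E'"
    proof (rule int_span_sum)
      fix i assume "i \<in> {..degree r}"
      hence i: "i < n" using r by auto
      have "coeff r i \<in> int_span E" using polys_overD[OF r(1)] E by auto
      then obtain c where "coeff r i = (\<Sum>e\<in>E. of_int (c e) * e)" by (auto simp: int_span_def)
      hence "coeff r i * y ^ i = (\<Sum>e\<in>E. of_int (c e) * (e * y ^ i))"
        by (simp add: sum_distrib_right mult.assoc)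
      also have "\<dots> \<in> int_span E'"
        using i by (intro int_span_sum int_span_scale int_span_base fin) (auto simp: E'_def)
      finally show "coeff r i * y ^ i \<in> int_span E'" .
    qed
    finally show "x \<in> int_span E'" .
  qed
  ultimately show ?thesis using S fin by (auto simp: finite_ring_def)
qed

lemma finite_ring_containing:
  fixes n :: nat
  assumes "\<And>i. i < n \<Longrightarrow> algebraic_int (a i)"
  shows "\<exists>A. finite_ring A \<and> (\<forall>i<n. a i \<in> A)"
  using assms
proof (induction n)
  case 0 thus ?case using finite_ring_Ints by auto
next
  case (Suc n)
  then obtain A where A: "finite_ring A" "\<forall>i<n. a i \<in> A" by auto
  have sA: "subring_on A" using A by (simp add: finite_ring_def)
  obtain p where p: "lead_coeff p = 1" "\<forall>i. coeff p i \<in> \<int>" "poly p (a n) = 0"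
    using Suc.prems[of n] by (auto elim: algebraic_int.cases)
  have "p \<in> polys_over A" using p(2) subring_on_of_int[OF sA] by (auto intro!: polys_overI elim!: Ints_cases) (metis Ints_cases)
  hence "finite_ring (adjoin A (a n))" using finite_ring_adjoin A p by blast
  thus ?case using A adjoin_superset[OF sA] adjoin_self[OF sA] by (auto simp: less_Suc_eq intro!: exI[of _ "adjoin A (a n)"])
qed

lemma subring_on_algebraic_int: "subring_on {x::complex. algebraic_int x}"
proof -
  have "algebraic_int (x - y) \<and> algebraic_int (x * y)" if "algebraic_int x" "algebraic_int y" for x y :: complex
  proof -
    define a where "a i = (if i = (0::nat) then x else y)" for i
    have "\<exists>A. finite_ring A \<and> (\<forall>i<2. a i \<in> A)"
      by (rule finite_ring_containing) (use that in \<open>auto simp: a_def\<close>)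
    then obtain A where A: "finite_ring A" "\<forall>i<2. a i \<in> A" by blast
    have "x \<in> A" "y \<in> A" using A(2)[rule_format, of 0] A(2)[rule_format, of 1] by (auto simp: a_def)
    thus ?thesis using finite_ring_algebraic_int[OF A(1)] A(1)
      by (auto simp: finite_ring_def subring_on_def)
  qed
  thus ?thesis by (auto simp: subring_on_def)
qed

text \<open>Transitivity of integrality: the finitely many coefficients lie in one finitely
  generated ring, and adjoining the root keeps it finitely generated.\<close>

lemma algebraic_int_monic_root:
  assumes p: "p \<in> polys_over {x::complex. algebraic_int x}" "lead_coeff p = 1" "poly p y = 0"
  shows "algebraic_int y"
proof -
  obtain A where A: "finite_ring A" "\<forall>i<Suc (degree p). coeff p i \<in> A"
    using finite_ring_containing[of "Suc (degree p)" "coeff p"] polys_overD[OF p(1)] by auto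
  have sA: "subring_on A" using A by (simp add: finite_ring_def)
  have "coeff p i \<in> A" for i
    using A(2) subring_on_0[OF sA] by (cases "i \<le> degree p") (auto simp: coeff_eq_0)
  hence "finite_ring (adjoin A y)" using finite_ring_adjoin[OF A(1) _ p(2,3)] by (auto intro: polys_overI)
  thus ?thesis using adjoin_self[OF sA] finite_ring_algebraic_int by blast
qed

lemma algebraic_int_add: "algebraic_int x \<Longrightarrow> algebraic_int y \<Longrightarrow> algebraic_int (x + y :: complex)"
  and algebraic_int_diff: "algebraic_int x \<Longrightarrow> algebraic_int y \<Longrightarrow> algebraic_int (x - y :: complex)"
  and algebraic_int_mult: "algebraic_int x \<Longrightarrow> algebraic_int y \<Longrightarrow> algebraic_int (x * y :: complex)"
  and algebraic_int_power: "algebraic_int x \<Longrightarrow> algebraic_int (x ^ n :: complex)"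
  using subring_on_add[OF subring_on_algebraic_int] subring_on_diff[OF subring_on_algebraic_int]
    subring_on_mult[OF subring_on_algebraic_int] subring_on_power[OF subring_on_algebraic_int] by auto

lemma algebraic_int_power_root:
  assumes "algebraic_int (x ^ n :: complex)" "n > 0" shows "algebraic_int x"
proof (rule algebraic_int_monic_root)
  let ?p = "monom 1 n - [:x ^ n:]"
  have "degree ?p = n"
    using degree_add_eq_left[of "- [:x ^ n:]" "monom 1 n"] assms
    unfolding diff_conv_add_uminus by (simp add: degree_monom_eq del: minus_pCons)
  thus "lead_coeff ?p = 1" using assms by (simp add: coeff_pCons split: nat.splits)
  show "poly ?p x = 0" by (simp add: poly_monom)
  show "?p \<in> polys_over {x. algebraic_int x}"
    using assms subring_on_algebraic_int by (intro subring_on_diff[OF subring_on_polys_over] monom_in_polys_over const_in_polys_over) auto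
qed

text \<open>With \<open>c\<close> the leading coefficient and \<open>d\<close> the degree,
  multiplying \<open>poly p x = 0\<close> by \<open>c ^ (d - 1)\<close> turns it into a monic
  equation for \<open>c * x\<close>.\<close>

lemma algebraic_int_lead_mult:
  assumes p: "p \<in> polys_over {x::complex. algebraic_int x}" "degree p > 0" "poly p x = 0"
  shows "algebraic_int (lead_coeff p * x)"
proof -
  define d where "d = degree p"
  define c where "c = lead_coeff p"
  have d0: "d > 0" using p by (simp add: d_def)
  define r where "r = (\<Sum>i<d. monom (coeff p i * c ^ (d - Suc i)) i)"
  define q where "q = monom 1 d + r"
  have cr: "coeff r j = (if j < d then coeff p j * c ^ (d - Suc j) else 0)" for j
    by (simp add: r_def coeff_sum)
  have deg: "degree r < d"
    by (rule degree_lessI) (use d0 in \<open>auto simp: cr\<close>)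
  have lq: "degree q = d" "lead_coeff q = 1"
    using degree_add_eq_left[of r "monom 1 d"] deg
    by (auto simp: q_def degree_monom_eq cr)
  have "poly q (c * x) = c ^ (d - 1) * poly p x"
  proof -
    have "poly q (c * x) = c ^ d * x ^ d + (\<Sum>i<d. coeff p i * c ^ (d - Suc i) * (c ^ i * x ^ i))"
      by (simp add: q_def r_def poly_sum poly_monom power_mult_distrib)
    also have "(\<Sum>i<d. coeff p i * c ^ (d - Suc i) * (c ^ i * x ^ i)) = c ^ (d - 1) * (\<Sum>i<d. coeff p i * x ^ i)"
      unfolding sum_distrib_left
    proof (intro sum.cong refl)
      fix i assume "i \<in> {..<d}"
      hence "c ^ (d - Suc i) * c ^ i = c ^ (d - 1)" by (simp flip: power_add)
      thus "coeff p i * c ^ (d - Suc i) * (c ^ i * x ^ i) = c ^ (d - 1) * (coeff p i * x ^ i)"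
        by (metis (no_types, lifting) mult.assoc mult.left_commute)
    qed
    also have "c ^ d * x ^ d = c ^ (d - 1) * (coeff p d * x ^ d)"
      using d0 power_Suc2[of c "d - 1"] by (simp add: c_def d_def)
    finally show ?thesis
      unfolding poly_altdef d_def[symmetric] by (simp add: lessThan_Suc_atMost[symmetric] algebra_simps)
  qed
  hence "poly q (c * x) = 0" using p by simp
  moreover have "coeff q i \<in> {x. algebraic_int x}" for i
    unfolding q_def coeff_add cr c_def
    using polys_overD[OF p(1)] by (intro subring_on_intros subring_on_algebraic_int)
      (auto intro!: algebraic_int_mult algebraic_int_power)
  ultimately show ?thesis
    using lq algebraic_int_monic_root[of q "c * x"] by (auto simp: c_def intro: polys_overI)
qed

lemma algebraic_int_multiple:
  assumes "algebraic (x::complex)"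
  shows "\<exists>n>0. algebraic_int (of_nat n * x)"
proof -
  obtain p where p: "\<forall>i. coeff p i \<in> \<int>" "p \<noteq> 0" "poly p x = 0" using assms by (auto simp: algebraic_def)
  have "degree p \<noteq> 0" using p(2,3) by (intro notI, elim degree_eq_zeroE) auto
  moreover have "p \<in> polys_over {x. algebraic_int x}"
    using p(1) by (auto simp: polys_over_def intro: int_imp_algebraic_int)
  ultimately have ai: "algebraic_int (lead_coeff p * x)"
    using algebraic_int_lead_mult p(3) by blast
  obtain k where k: "lead_coeff p = of_int k" using p(1) by (metis Ints_cases)
  have "of_nat (nat \<bar>k\<bar>) * x = lead_coeff p * x \<or> of_nat (nat \<bar>k\<bar>) * x = - (lead_coeff p * x)"
    by (cases "k \<ge> 0") (auto simp: k)
  hence "algebraic_int (of_nat (nat \<bar>k\<bar>) * x)" using ai algebraic_int_minus_iff[of "lead_coeff p * x"] by metis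
  moreover have "nat \<bar>k\<bar> > 0" using k p(2) by auto
  ultimately show ?thesis by blast
qed

section \<open>The field of algebraic numbers\<close>

definition Qbar :: "complex set" where "Qbar = {x. algebraic x}"

lemma algebraic_of_multiple: "algebraic_int (of_nat n * x :: complex) \<Longrightarrow> n > 0 \<Longrightarrow> algebraic x"
proof -
  assume a: "algebraic_int (of_nat n * x :: complex)" "n > 0"
  then obtain p where p: "lead_coeff p = 1" "\<forall>i. coeff p i \<in> \<int>" "poly p (of_nat n * x) = 0"
    by (auto elim: algebraic_int.cases)
  let ?q = "pcompose p [:0, of_nat n:]"
  have "poly ?q x = 0" using p by (simp add: poly_pcompose mult.commute)
  moreover have "?q \<noteq> 0"
  proof
    assume "?q = 0"
    hence "poly ?q (y / of_nat n) = 0" for y by simp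
    hence "poly p y = 0" for y using a by (simp add: poly_pcompose)
    hence "p = 0" using poly_all_0_iff_0[of p] by blast
    thus False using p by simp
  qed
  moreover have "coeff ?q i \<in> \<int>" for i
    using p(2) by (simp add: coeff_pcompose_linear)
  ultimately show ?thesis by (intro algebraicI[of ?q]) auto
qed

lemma subring_on_Qbar: "subring_on Qbar"
proof -
  have "algebraic (x - y) \<and> algebraic (x * y)" if xy: "algebraic x" "algebraic y" for x y :: complex
  proof -
    obtain m n where mn: "m > 0" "algebraic_int (of_nat m * x)" "n > 0" "algebraic_int (of_nat n * y)"
      using algebraic_int_multiple[OF xy(1)] algebraic_int_multiple[OF xy(2)] by auto
    have "algebraic_int (of_nat n * (of_nat m * x) - of_nat m * (of_nat n * y))"
      "algebraic_int ((of_nat m * x) * (of_nat n * y))"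
      using mn by (auto intro!: algebraic_int_diff algebraic_int_mult)
    hence "algebraic_int (of_nat (m * n) * (x - y))" "algebraic_int (of_nat (m * n) * (x * y))"
      by (simp_all add: algebra_simps)
    thus ?thesis using algebraic_of_multiple mn by (metis nat_0_less_mult_iff)
  qed
  thus ?thesis by (auto simp: subring_on_def Qbar_def)
qed

lemma Qbar_inverse: "x \<in> Qbar \<Longrightarrow> inverse x \<in> Qbar"
proof (cases "x = 0")
  case False
  assume "x \<in> Qbar"
  then obtain p where p: "\<forall>i. coeff p i \<in> \<int>" "p \<noteq> 0" "poly p x = 0" by (auto simp: algebraic_def Qbar_def)
  have "poly (reflect_poly p) (inverse x) = 0" "reflect_poly p \<noteq> 0"
    using p False by (simp_all add: poly_reflect_poly_nz)
  thus ?thesis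
    using p(1) by (auto simp: Qbar_def coeff_reflect_poly intro!: algebraicI[of "reflect_poly p"])
qed auto

section \<open>Extension of homomorphisms\<close>

text \<open>Stated relative to a subring \<open>D\<close>, so that one notion serves the zero ideal
  of the complex numbers, the primes of a ring of integers and the ideal of functions vanishing on
  the curve.\<close>

definition prime_ideal_on :: "'a::comm_ring_1 set \<Rightarrow> 'a set \<Rightarrow> bool" where
  "prime_ideal_on D Z \<longleftrightarrow> subring_on D \<and> Z \<subseteq> D \<and> 0 \<in> Z \<and> 1 \<notin> Z \<and>
     (\<forall>x\<in>Z. \<forall>y\<in>Z. x - y \<in> Z) \<and> (\<forall>x\<in>D. \<forall>z\<in>Z. x * z \<in> Z) \<and>
     (\<forall>x\<in>D. \<forall>y\<in>D. x * y \<in> Z \<longrightarrow> x \<in> Z \<or> y \<in> Z)"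

lemma prime_ideal_onD:
  assumes "prime_ideal_on D Z"
  shows "subring_on D" "Z \<subseteq> D" "0 \<in> Z" "1 \<notin> Z"
    "\<And>x y. x \<in> Z \<Longrightarrow> y \<in> Z \<Longrightarrow> x - y \<in> Z" "\<And>x z. x \<in> D \<Longrightarrow> z \<in> Z \<Longrightarrow> x * z \<in> Z"
    "\<And>x z. x \<in> D \<Longrightarrow> z \<in> Z \<Longrightarrow> z * x \<in> Z"
    "\<And>x y. x \<in> D \<Longrightarrow> y \<in> D \<Longrightarrow> x * y \<in> Z \<Longrightarrow> x \<in> Z \<or> y \<in> Z"
  using assms unfolding prime_ideal_on_def by (auto simp: mult.commute)

lemma prime_ideal_on_uminus: "prime_ideal_on D Z \<Longrightarrow> x \<in> Z \<Longrightarrow> - x \<in> Z"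
  using prime_ideal_onD(5)[of D Z 0 x] prime_ideal_onD(3)[of D Z] by simp

lemma prime_ideal_on_add: "prime_ideal_on D Z \<Longrightarrow> x \<in> Z \<Longrightarrow> y \<in> Z \<Longrightarrow> x + y \<in> Z"
  using prime_ideal_onD(5)[of D Z x "- y"] prime_ideal_on_uminus[of D Z y] by simp

lemma prime_ideal_on_sum:
  "prime_ideal_on D Z \<Longrightarrow> (\<And>i. i \<in> I \<Longrightarrow> f i \<in> Z) \<Longrightarrow> sum f I \<in> Z"
  by (induction I rule: infinite_finite_induct) (auto simp: prime_ideal_onD prime_ideal_on_add)

lemma prime_ideal_on_power: "prime_ideal_on D Z \<Longrightarrow> x \<in> D \<Longrightarrow> x ^ n \<in> Z \<Longrightarrow> x \<in> Z"
proof (induction n)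
  case (Suc n)
  thus ?case
    using prime_ideal_onD(8)[of D Z x "x ^ n"] subring_on_power[of D x n] prime_ideal_onD(1)[of D Z] by auto
qed (auto dest: prime_ideal_onD(4))

lemma prime_ideal_on_zero: "prime_ideal_on UNIV {0::'a::idom}"
  by (auto simp: prime_ideal_on_def subring_on_UNIV)

text \<open>The assumption on \<open>q\<close> says that substituting \<open>t\<close> for
  \<open>y\<close> respects every relation of \<open>y\<close> modulo \<open>Z\<close>. This makes
  the value of \<open>\<psi>\<close> independent of the representing polynomial and makes
  \<open>\<psi>\<close> vanish on \<open>Z\<close>.\<close>

lemma hom_extend:
  fixes \<phi> :: "'a::comm_ring_1 \<Rightarrow> complex"
  assumes \<phi>: "ring_hom_on R \<phi>" and "0 \<in> Z"
    and W: "\<And>q. q \<in> polys_over R \<Longrightarrow> poly q y \<in> Z \<Longrightarrow> poly (map_poly \<phi> q) t = 0"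
  shows "\<exists>\<psi>. ring_hom_on (adjoin R y) \<psi> \<and> (\<forall>r\<in>R. \<psi> r = \<phi> r) \<and> \<psi> y = t \<and>
     (\<forall>z\<in>adjoin R y \<inter> Z. \<psi> z = 0)"
proof -
  note R = ring_hom_on_subring[OF \<phi>]
  note S = subring_on_polys_over[OF R]
  note H = ring_hom_on_map_poly[OF \<phi>]
  define \<psi> where "\<psi> b = poly (map_poly \<phi> (SOME p. p \<in> polys_over R \<and> poly p y = b)) t" for b
  have \<psi>: "\<psi> (poly q y) = poly (map_poly \<phi> q) t" if q: "q \<in> polys_over R" for q
  proof -
    define p where "p = (SOME p. p \<in> polys_over R \<and> poly p y = poly q y)"
    have p: "p \<in> polys_over R" "poly p y = poly q y"
      using someI[of "\<lambda>p. p \<in> polys_over R \<and> poly p y = poly q y" q] q by (auto simp: p_def)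
    have "poly (map_poly \<phi> (p - q)) t = 0"
      using W[OF subring_on_diff[OF S p(1) q]] p assms(2) by simp
    thus ?thesis using ring_hom_on_diff[OF H p(1) q] by (simp add: \<psi>_def p_def)
  qed
  have "ring_hom_on (adjoin R y) \<psi>"
    unfolding ring_hom_on_def
  proof (intro conjI ballI)
    show "subring_on (adjoin R y)" by (rule subring_on_adjoin[OF R])
    show "\<psi> 1 = 1" using \<psi>[OF subring_on_1[OF S]] ring_hom_on_1[OF H] by simp
    fix a b assume "a \<in> adjoin R y" "b \<in> adjoin R y"
    then obtain p q where pq: "p \<in> polys_over R" "q \<in> polys_over R" "a = poly p y" "b = poly q y"
      by (auto simp: adjoin_def)
    show "\<psi> (a - b) = \<psi> a - \<psi> b"
      using \<psi>[OF subring_on_diff[OF S pq(1,2)]] \<psi>[OF pq(1)] \<psi>[OF pq(2)] ring_hom_on_diff[OF H pq(1,2)] pq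
      by simp
    show "\<psi> (a * b) = \<psi> a * \<psi> b"
      using \<psi>[OF subring_on_mult[OF S pq(1,2)]] \<psi>[OF pq(1)] \<psi>[OF pq(2)] ring_hom_on_mult[OF H pq(1,2)] pq
      by simp
  qed
  moreover have "\<psi> r = \<phi> r" if "r \<in> R" for r
    using \<psi>[OF const_in_polys_over[OF R that]] by (simp add: map_poly_pCons ring_hom_on_0[OF \<phi>])
  moreover have "\<psi> y = t"
    using \<psi>[OF monom_in_polys_over[OF R subring_on_1[OF R], of 1]]
    by (simp add: poly_monom map_poly_monom ring_hom_on_0[OF \<phi>] ring_hom_on_1[OF \<phi>])
  moreover have "\<psi> z = 0" if "z \<in> adjoin R y \<inter> Z" for z
    using that \<psi> W by (auto simp: adjoin_def)
  ultimately show ?thesis by blast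
qed

text \<open>Among the relations of \<open>y\<close> that are nontrivial modulo \<open>Z\<close>, one
  of least degree is taken. Its leading coefficient avoids \<open>Z\<close>, since otherwise
  dropping the leading term would give a smaller relation.\<close>

lemma minimal_relation:
  assumes Z: "prime_ideal_on D Z" and R: "subring_on R" "R \<subseteq> D" and y: "y \<in> D"
    and ex: "q \<in> polys_over R" "poly q y \<in> Z" "\<exists>i. coeff q i \<notin> Z"
  shows "\<exists>p\<in>polys_over R. poly p y \<in> Z \<and> lead_coeff p \<notin> Z \<and>
    (\<forall>q\<in>polys_over R. poly q y \<in> Z \<longrightarrow> degree q < degree p \<longrightarrow> (\<forall>i. coeff q i \<in> Z))"
proof -
  note S = subring_on_polys_over[OF R(1)]
  define P where "P q \<longleftrightarrow> q \<in> polys_over R \<and> poly q y \<in> Z \<and> (\<exists>i. coeff q i \<notin> Z)" for q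
  have "P q" using ex by (simp add: P_def)
  then obtain p where p: "P p" "\<And>q. P q \<Longrightarrow> degree p \<le> degree q"
    using ex_has_least_nat[of P q degree] by blast
  have "lead_coeff p \<notin> Z"
  proof
    assume l: "lead_coeff p \<in> Z"
    define q where "q = p - monom (lead_coeff p) (degree p)"
    have "monom (lead_coeff p) (degree p) \<in> polys_over R"
      using p(1) by (intro monom_in_polys_over R) (auto simp: P_def polys_overD)
    hence "q \<in> polys_over R" unfolding q_def using p(1) by (intro subring_on_diff[OF S]) (auto simp: P_def)
    moreover have "poly q y \<in> Z"
      using p(1) l prime_ideal_onD(5,7)[OF Z] subring_on_power[OF prime_ideal_onD(1)[OF Z] y]
      by (simp add: q_def P_def poly_monom)
    moreover obtain i where i: "coeff p i \<notin> Z" using p(1) by (auto simp: P_def)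
    hence "i \<noteq> degree p" using l by auto
    hence "coeff q i \<notin> Z" using i by (simp add: q_def)
    ultimately have "P q" by (auto simp: P_def)
    have "degree p > 0"
      using i \<open>i \<noteq> degree p\<close> prime_ideal_onD(3)[OF Z] by (metis coeff_eq_0 gr0I neq0_conv)
    moreover have "degree q \<le> degree p" "coeff q (degree p) = 0"
      using degree_diff_le[of p "degree p" "monom (lead_coeff p) (degree p)"] degree_monom_le
      by (auto simp: q_def)
    ultimately have "degree q < degree p"
      by (metis le_neq_implies_less leading_coeff_0_iff degree_0)
    thus False using p(2)[OF \<open>P q\<close>] by simp
  qed
  moreover have "\<forall>i. coeff q i \<in> Z" if "q \<in> polys_over R" "poly q y \<in> Z" "degree q < degree p" for q
    using p(2)[of q] that by (force simp: P_def)
  ultimately show ?thesis using p(1) by (auto simp: P_def)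
qed

text \<open>Pseudo-division: \<open>c * q\<close> minus a multiple of \<open>p\<close>, with
  \<open>c\<close> the leading coefficient of \<open>p\<close>, has smaller degree. The homomorphism
  preserves this identity, and \<open>\<phi> c \<noteq> 0\<close> allows \<open>c\<close> to be
  cancelled in the end. Relations below the degree of \<open>p\<close> vanish modulo
  \<open>Z\<close>.\<close>

lemma hom_extend_algebraic:
  fixes \<phi> :: "'a::comm_ring_1 \<Rightarrow> complex"
  assumes Z: "prime_ideal_on D Z" and R: "R \<subseteq> D" and y: "y \<in> D"
    and \<phi>: "ring_hom_on R \<phi>" "\<And>z. z \<in> R \<inter> Z \<Longrightarrow> \<phi> z = 0"
    and p: "p \<in> polys_over R" "poly p y \<in> Z" "\<phi> (lead_coeff p) \<noteq> 0"
    and min: "\<And>q. q \<in> polys_over R \<Longrightarrow> poly q y \<in> Z \<Longrightarrow> degree q < degree p \<Longrightarrow> \<forall>i. coeff q i \<in> Z"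
    and t: "poly (map_poly \<phi> p) t = 0" and q: "q \<in> polys_over R" "poly q y \<in> Z"
  shows "poly (map_poly \<phi> q) t = 0"
  using q
proof (induction "degree q" arbitrary: q rule: less_induct)
  case less
  note A = ring_hom_on_subring[OF \<phi>(1)]
  note S = subring_on_polys_over[OF A]
  note H = ring_hom_on_map_poly[OF \<phi>(1)]
  show ?case
  proof (cases "degree q < degree p")
    case True
    have "map_poly \<phi> q = 0"
      using min[OF less.prems True] \<phi>(2) polys_overD[OF less.prems(1)]
      by (intro poly_eqI) (auto simp: coeff_map_poly_hom[OF \<phi>(1)])
    thus ?thesis by simp
  next
    case False
    define c where "c = lead_coeff p"
    define m where "m = monom (lead_coeff q) (degree q - degree p)"
    define r where "r = [:c:] * q - m * p"
    have c: "c \<in> R" using p by (auto simp: c_def polys_overD)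
    have m: "m \<in> polys_over R" unfolding m_def by (intro monom_in_polys_over A polys_overD less.prems)
    have cq: "[:c:] \<in> polys_over R" by (rule const_in_polys_over[OF A c])
    have r: "r \<in> polys_over R"
      unfolding r_def by (intro subring_on_diff[OF S] subring_on_mult[OF S] cq m p less.prems)
    have pm: "poly m y \<in> D"
      using poly_in_subring[OF prime_ideal_onD(1)[OF Z] _ y, of m] m polys_over_mono[OF R] by auto
    have ry: "poly r y \<in> Z"
      using prime_ideal_onD(5,6)[OF Z] c R less.prems p pm by (auto simp: r_def)
    have mp: "poly (map_poly \<phi> (m * p)) t = 0"
      using ring_hom_on_mult[OF H m p(1)] t by simp
    have "poly (map_poly \<phi> r) t = 0"
    proof (cases "degree q = 0")
      \<comment> \<open>Here \<open>degree p\<close> is \<open>0\<close> as well and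
        \<open>r\<close> is the zero polynomial; its degree cannot drop any further.\<close>
      case True
      hence "r = 0" using False by (auto simp: r_def m_def c_def monom_0 elim!: degree_eq_zeroE)
      thus ?thesis by simp
    next
      case dq: False
      have "degree (m * p) \<le> degree q"
        using degree_mult_le[of m p] degree_monom_le[of "lead_coeff q" "degree q - degree p"] False
        by (simp add: m_def)
      moreover have "degree ([:c:] * q) \<le> degree q" using degree_mult_le[of "[:c:]" q] by simp
      ultimately have dr: "degree r \<le> degree q" unfolding r_def by (intro degree_diff_le) auto
      have "coeff (m * p) (degree q) = lead_coeff q * lead_coeff p"
        using False by (simp add: m_def coeff_monom_mult)
      hence "coeff r (degree q) = 0" by (simp add: r_def c_def)
      hence "degree r < degree q" using dr dq
        by (metis le_neq_implies_less leading_coeff_0_iff degree_0)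
      thus ?thesis using less.hyps r ry by blast
    qed
    moreover have "map_poly \<phi> r = [:\<phi> c:] * map_poly \<phi> q - map_poly \<phi> (m * p)"
      unfolding r_def ring_hom_on_diff[OF H subring_on_mult[OF S cq less.prems(1)] subring_on_mult[OF S m p(1)]]
        ring_hom_on_mult[OF H cq less.prems(1)]
      by (simp add: map_poly_pCons ring_hom_on_0[OF \<phi>(1)])
    ultimately show ?thesis using mp p(3) by (simp add: c_def)
  qed
qed

section \<open>Conjugations of algebraic numbers\<close>

text \<open>A substitute for the absolute Galois group. Values outside \<open>Qbar\<close> are
  arbitrary, so distinct members may agree on all algebraic numbers; finite sets of conjugates are
  therefore formed from values and not from maps.\<close>

definition conjugations :: "(complex \<Rightarrow> complex) set" where
  "conjugations = {s. ring_hom_on Qbar s}"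

lemma conjugationsD: "s \<in> conjugations \<Longrightarrow> ring_hom_on Qbar s"
  by (simp add: conjugations_def)

lemma Qbar_superset_Rats: "\<rat> \<subseteq> Qbar"
  by (auto simp: Qbar_def rat_imp_algebraic)

lemma Ints_subset_subring: "subring_on A \<Longrightarrow> \<int> \<subseteq> A"
  by (auto elim!: Ints_cases intro: subring_on_of_int)

lemma ring_hom_on_int_poly:
  assumes "ring_hom_on A h" "x \<in> A" "p \<in> polys_over \<int>"
  shows "poly p (h x) = h (poly p x)"
proof -
  have "map_poly h p = p"
  proof (rule poly_eqI)
    fix i
    obtain k where "coeff p i = of_int k" using polys_overD[OF assms(3), of i] by (auto elim: Ints_cases)
    thus "coeff (map_poly h p) i = coeff p i"
      by (simp add: coeff_map_poly_hom[OF assms(1)] ring_hom_on_of_int[OF assms(1)])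
  qed
  thus ?thesis
    using poly_map_poly_hom[OF assms(1) _ assms(2), of p] assms(3)
      polys_over_mono[OF Ints_subset_subring[OF ring_hom_on_subring[OF assms(1)]]] by auto
qed

text \<open>In a nonzero integer relation of least degree the constant term cannot vanish, as one
  could divide by \<open>x\<close>.\<close>

lemma relation_nonzero_const:
  assumes "x \<in> Qbar" and x0: "x \<noteq> 0"
  shows "\<exists>q\<in>polys_over \<int>. poly q x = 0 \<and> coeff q 0 \<noteq> 0"
proof -
  obtain p where p: "\<forall>i. coeff p i \<in> \<int>" "p \<noteq> 0" "poly p x = 0"
    using assms by (auto simp: algebraic_def Qbar_def)
  define P where "P q \<longleftrightarrow> q \<in> polys_over \<int> \<and> q \<noteq> 0 \<and> poly q x = 0" for q :: "complex poly"
  have "P p" using p by (auto simp: P_def polys_over_def)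
  then obtain q where q: "P q" "\<And>r. P r \<Longrightarrow> degree q \<le> degree r"
    using ex_has_least_nat[of P p degree] by blast
  obtain c r where cr: "q = pCons c r" by (cases q)
  have "c \<noteq> 0"
  proof
    assume "c = 0"
    hence "r \<in> polys_over \<int>" "r \<noteq> 0" "poly r x = 0"
      using q(1) cr x0 polys_overD[of q _ "Suc _"] by (auto simp: P_def intro!: polys_overI dest: polys_overD[of _ _ "Suc _"])
    hence "P r" by (auto simp: P_def)
    from q(2)[OF this] \<open>r \<noteq> 0\<close> show False using cr by simp
  qed
  thus ?thesis using q(1) cr by (intro bexI[of _ q]) (auto simp: P_def)
qed

text \<open>\<open>A\<close> is only a ring, so injectivity does not come from inverses. An integer
  relation of \<open>x\<close> with nonzero constant term is carried over to \<open>h x\<close>,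
  which therefore differs from \<open>0\<close>.\<close>

lemma ring_hom_on_Qbar_inj:
  fixes h :: "complex \<Rightarrow> complex"
  assumes h: "ring_hom_on A h" and "A \<subseteq> Qbar" and x: "x \<in> A" "h x = 0"
  shows "x = 0"
proof (rule ccontr)
  assume "x \<noteq> 0"
  then obtain q where q: "q \<in> polys_over \<int>" "poly q x = 0" "coeff q 0 \<noteq> 0"
    using relation_nonzero_const assms by blast
  have "poly q (h x) = h (poly q x)" by (rule ring_hom_on_int_poly[OF h x(1) q(1)])
  hence "coeff q 0 = 0" using q(2) x(2) ring_hom_on_0[OF h] by (simp add: poly_0_coeff_0)
  thus False using q(3) by simp
qed

lemma Qbar_hom_closed:
  fixes s :: "complex \<Rightarrow> complex"
  assumes "ring_hom_on A s" "A \<subseteq> Qbar" "x \<in> A" shows "s x \<in> Qbar"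
proof -
  have "algebraic x" using assms by (auto simp: Qbar_def)
  then obtain p where p: "\<forall>i. coeff p i \<in> \<int>" "p \<noteq> 0" "poly p x = 0" by (auto simp: algebraic_def)
  hence "poly p (s x) = s 0"
    using ring_hom_on_int_poly[OF assms(1,3), of p] by (auto simp: polys_over_def)
  thus ?thesis using p ring_hom_on_0[OF assms(1)] by (auto simp: Qbar_def intro: algebraicI)
qed

lemma algebraic_int_hom:
  fixes s :: "complex \<Rightarrow> complex"
  assumes "ring_hom_on A s" "x \<in> A" "algebraic_int x" shows "algebraic_int (s x)"
proof -
  obtain p where p: "lead_coeff p = 1" "\<forall>i. coeff p i \<in> \<int>" "poly p x = 0"
    using assms(3) by (auto elim: algebraic_int.cases)
  hence "poly p (s x) = s 0"
    using ring_hom_on_int_poly[OF assms(1,2), of p] by (auto simp: polys_over_def)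
  thus ?thesis using p ring_hom_on_0[OF assms(1)] by (auto intro: algebraic_int.intros)
qed

lemma finite_conjugates: "x \<in> Qbar \<Longrightarrow> finite {s x | s. s \<in> conjugations}"
proof -
  assume x: "x \<in> Qbar"
  then obtain p where p: "\<forall>i. coeff p i \<in> \<int>" "p \<noteq> 0" "poly p x = 0" by (auto simp: algebraic_def Qbar_def)
  have "poly p (s x) = 0" if "s \<in> conjugations" for s
    using ring_hom_on_int_poly[OF conjugationsD[OF that] x, of p] p ring_hom_on_0[OF conjugationsD[OF that]]
    by (auto simp: polys_over_def)
  hence "{s x | s. s \<in> conjugations} \<subseteq> {z. poly p z = 0}" by auto
  thus ?thesis using poly_roots_finite[OF p(2)] finite_subset by blast
qed

lemma conjugations_comp: "s \<in> conjugations \<Longrightarrow> t \<in> conjugations \<Longrightarrow> s \<circ> t \<in> conjugations"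
  unfolding conjugations_def using Qbar_hom_closed[of Qbar t]
  by (auto simp: ring_hom_on_def)

text \<open>The least relation of \<open>x\<close> over \<open>R\<close> keeps its degree under
  \<open>\<phi>\<close> by injectivity, so its image has a complex root, which becomes the image of
  \<open>x\<close>.\<close>

lemma hom_extend_Qbar:
  fixes \<phi> :: "complex \<Rightarrow> complex"
  assumes \<phi>: "ring_hom_on R \<phi>" and R: "R \<subseteq> Qbar" and x: "x \<in> Qbar"
  shows "\<exists>\<psi>. ring_hom_on (adjoin R x) \<psi> \<and> (\<forall>r\<in>R. \<psi> r = \<phi> r)"
proof -
  note A = ring_hom_on_subring[OF \<phi>]
  obtain q where q: "\<forall>i. coeff q i \<in> \<int>" "q \<noteq> 0" "poly q x = 0" using x by (auto simp: algebraic_def Qbar_def)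
  have "q \<in> polys_over R" using q Ints_subset_subring[OF A] by (auto simp: polys_over_def)
  moreover have "\<exists>i. coeff q i \<notin> {0}" using q(2) by (auto simp: poly_eq_iff)
  ultimately obtain p where p: "p \<in> polys_over R" "poly p x = 0" "lead_coeff p \<noteq> 0"
    "\<And>q. q \<in> polys_over R \<Longrightarrow> poly q x = 0 \<Longrightarrow> degree q < degree p \<Longrightarrow> (\<forall>i. coeff q i = 0)"
    using minimal_relation[OF prime_ideal_on_zero A, of x q] q by auto
  have l: "\<phi> (lead_coeff p) \<noteq> 0"
    using ring_hom_on_Qbar_inj[OF \<phi> R] polys_overD[OF p(1)] p(3) by blast
  have "degree p \<noteq> 0" using p(2,3) by (intro notI, elim degree_eq_zeroE) auto
  moreover have "degree (map_poly \<phi> p) = degree p"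
    using l degree_map_poly_hom_le[OF \<phi>, of p] coeff_map_poly_hom[OF \<phi>, of p "degree p"]
    by (metis le_antisym le_degree)
  ultimately have "\<not> constant (poly (map_poly \<phi> p))" by (simp add: constant_degree)
  then obtain t where t: "poly (map_poly \<phi> p) t = 0" using fundamental_theorem_of_algebra by blast
  have "poly (map_poly \<phi> q) t = 0" if "q \<in> polys_over R" "poly q x \<in> {0}" for q
    using hom_extend_algebraic[OF prime_ideal_on_zero subset_UNIV UNIV_I \<phi>, of p x t q] p l t that
      ring_hom_on_0[OF \<phi>] by auto
  from hom_extend[OF \<phi>, of "{0}" x t] this show ?thesis by auto
qed

lemma adjoin_subset: "subring_on B \<Longrightarrow> A \<subseteq> B \<Longrightarrow> y \<in> B \<Longrightarrow> adjoin A y \<subseteq> B"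
  unfolding adjoin_def using poly_in_subring[of B] polys_over_mono[of A B] by auto

text \<open>Zorn's lemma for the graphs of partial homomorphisms; with graphs the union of a chain
  is an upper bound. A maximal graph is defined on all of \<open>Qbar\<close>, since otherwise one
  more algebraic number could be adjoined.\<close>

lemma conjugation_extend:
  assumes \<phi>: "ring_hom_on R \<phi>" and R: "R \<subseteq> Qbar"
  shows "\<exists>s\<in>conjugations. \<forall>r\<in>R. s r = \<phi> r"
proof -
  define gr where "gr A h = (\<lambda>r. (r, h r)) ` A" for A :: "complex set" and h :: "complex \<Rightarrow> complex"
  define F where "F = {\<Gamma>. gr R \<phi> \<subseteq> \<Gamma> \<and> fst ` \<Gamma> \<subseteq> Qbar \<and>
    (\<forall>x y z. (x, y) \<in> \<Gamma> \<longrightarrow> (x, z) \<in> \<Gamma> \<longrightarrow> y = z) \<and>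
    (\<forall>x y x' y'. (x, y) \<in> \<Gamma> \<longrightarrow> (x', y') \<in> \<Gamma> \<longrightarrow> (x - x', y - y') \<in> \<Gamma> \<and> (x * x', y * y') \<in> \<Gamma>)}"
  have grF: "gr A h \<in> F" if "ring_hom_on A h" "A \<subseteq> Qbar" "R \<subseteq> A" "\<And>r. r \<in> R \<Longrightarrow> h r = \<phi> r" for A h
    using that ring_hom_on_subring[OF that(1)]
    by (auto simp: F_def gr_def ring_hom_on_diff ring_hom_on_mult subring_on_diff subring_on_mult)
  have "\<Union>C \<in> F" if C: "C \<noteq> {}" "subset.chain F C" for C
  proof -
    have sub: "C \<subseteq> F" using C(2) by (auto simp: subset.chain_def)
    have two: "\<exists>\<Gamma>\<in>C. a \<in> \<Gamma> \<and> b \<in> \<Gamma>" if ab: "a \<in> \<Union>C" "b \<in> \<Union>C" for a b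
    proof -
      obtain \<Gamma> \<Delta> where *: "\<Gamma> \<in> C" "\<Delta> \<in> C" "a \<in> \<Gamma>" "b \<in> \<Delta>" using ab by blast
      hence "\<Gamma> \<subseteq> \<Delta> \<or> \<Delta> \<subseteq> \<Gamma>" using C(2) by (simp add: subset_chain_def)
      thus ?thesis using * by blast
    qed
    show ?thesis unfolding F_def
    proof (intro CollectI conjI allI impI)
      obtain \<Gamma> where "\<Gamma> \<in> C" using C(1) by auto
      moreover have "gr R \<phi> \<subseteq> \<Gamma>" using calculation sub unfolding F_def by blast
      ultimately show "gr R \<phi> \<subseteq> \<Union>C" by blast
      have "fst ` \<Delta> \<subseteq> Qbar" if "\<Delta> \<in> C" for \<Delta> using that sub unfolding F_def by blast
      thus "fst ` \<Union>C \<subseteq> Qbar" by (auto simp: image_Union)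
    next
      fix x y z assume "(x, y) \<in> \<Union>C" "(x, z) \<in> \<Union>C"
      with two obtain \<Gamma> where "\<Gamma> \<in> C" "(x, y) \<in> \<Gamma>" "(x, z) \<in> \<Gamma>" by blast
      thus "y = z" using sub unfolding F_def by blast
    next
      fix x y x' y' assume "(x, y) \<in> \<Union>C" "(x', y') \<in> \<Union>C"
      with two obtain \<Gamma> where \<Gamma>: "\<Gamma> \<in> C" "(x, y) \<in> \<Gamma>" "(x', y') \<in> \<Gamma>" by blast
      hence "(x - x', y - y') \<in> \<Gamma>" "(x * x', y * y') \<in> \<Gamma>" using sub unfolding F_def by blast+
      thus "(x - x', y - y') \<in> \<Union>C" "(x * x', y * y') \<in> \<Union>C" using \<Gamma> by auto
    qed
  qed
  moreover have "F \<noteq> {}" using grF[OF \<phi> R] by auto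
  ultimately obtain \<Gamma> where \<Gamma>: "\<Gamma> \<in> F" "\<And>\<Delta>. \<Delta> \<in> F \<Longrightarrow> \<Gamma> \<subseteq> \<Delta> \<Longrightarrow> \<Delta> = \<Gamma>"
    using subset_Zorn_nonempty[of F] by blast
  define A where "A = fst ` \<Gamma>"
  define h where "h x = (THE y. (x, y) \<in> \<Gamma>)" for x
  have h: "h x = y" if "(x, y) \<in> \<Gamma>" for x y
    unfolding h_def using \<Gamma>(1) that unfolding F_def by (intro the_equality) blast+
  have hA: "(x, h x) \<in> \<Gamma>" if "x \<in> A" for x
    using that h by (auto simp: A_def)
  have gr\<Gamma>: "(r, \<phi> r) \<in> \<Gamma>" if "r \<in> R" for r
  proof -
    have "gr R \<phi> \<subseteq> \<Gamma>" using \<Gamma>(1) unfolding F_def by blast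
    thus ?thesis using that by (auto simp: gr_def)
  qed
  have RA: "R \<subseteq> A" unfolding A_def using imageI[OF gr\<Gamma>, of _ fst] by auto
  have hR: "h r = \<phi> r" if "r \<in> R" for r by (rule h[OF gr\<Gamma>[OF that]])
  have \<Gamma>gr: "\<Gamma> = gr A h"
  proof
    show "gr A h \<subseteq> \<Gamma>" unfolding gr_def using hA by blast
    show "\<Gamma> \<subseteq> gr A h"
    proof
      fix w assume w: "w \<in> \<Gamma>"
      obtain x y where xy: "w = (x, y)" by (cases w)
      have "x \<in> A" unfolding A_def using imageI[OF w, of fst] xy by simp
      moreover have "w = (x, h x)" using h[of x y] w xy by simp
      ultimately show "w \<in> gr A h" unfolding gr_def by blast
    qed
  qed
  have AQ: "A \<subseteq> Qbar" using \<Gamma>(1) unfolding F_def A_def by blast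
  have hom: "ring_hom_on A h"
  proof -
    have op: "(x - y, h x - h y) \<in> \<Gamma>" "(x * y, h x * h y) \<in> \<Gamma>" if "x \<in> A" "y \<in> A" for x y
      using \<Gamma>(1) hA[OF that(1)] hA[OF that(2)] unfolding F_def by blast+
    have cl: "x - y \<in> A" "x * y \<in> A" if "x \<in> A" "y \<in> A" for x y
      unfolding A_def using imageI[OF op(1)[OF that], of fst] imageI[OF op(2)[OF that], of fst] by simp_all
    have 1: "1 \<in> R" by (rule subring_on_1[OF ring_hom_on_subring[OF \<phi>]])
    have "subring_on A" unfolding subring_on_def using 1 RA cl by blast
    moreover have "h 1 = 1" using hR[OF 1] ring_hom_on_1[OF \<phi>] by simp
    ultimately show ?thesis unfolding ring_hom_on_def using h[OF op(1)] h[OF op(2)] by blast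
  qed
  have "Qbar \<subseteq> A"
  proof
    fix x assume x: "x \<in> Qbar"
    obtain \<psi> where \<psi>: "ring_hom_on (adjoin A x) \<psi>" "\<forall>r\<in>A. \<psi> r = h r"
      using hom_extend_Qbar[OF hom AQ x] by blast
    note sA = ring_hom_on_subring[OF hom]
    have "gr (adjoin A x) \<psi> \<in> F"
    proof (rule grF[OF \<psi>(1) adjoin_subset[OF subring_on_Qbar AQ x]])
      show "R \<subseteq> adjoin A x" using RA adjoin_superset[OF sA] by blast
      show "\<psi> r = \<phi> r" if "r \<in> R" for r using \<psi>(2) hR[OF that] RA that by auto
    qed
    moreover have "\<Gamma> \<subseteq> gr (adjoin A x) \<psi>"
    proof
      fix w assume "w \<in> \<Gamma>"
      then obtain a where a: "a \<in> A" "w = (a, h a)" unfolding \<Gamma>gr gr_def by blast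
      have "w = (a, \<psi> a)" "a \<in> adjoin A x" using a \<psi>(2) adjoin_superset[OF sA] by auto
      thus "w \<in> gr (adjoin A x) \<psi>" unfolding gr_def by blast
    qed
    ultimately have "gr (adjoin A x) \<psi> = \<Gamma>" by (rule \<Gamma>(2))
    moreover have "(x, \<psi> x) \<in> gr (adjoin A x) \<psi>"
      unfolding gr_def using adjoin_self[OF sA, of x] by blast
    ultimately show "x \<in> A" unfolding A_def using imageI[of "(x, \<psi> x)" \<Gamma> fst] by simp
  qed
  hence "A = Qbar" using AQ by auto
  thus ?thesis using hom hR by (auto simp: conjugations_def)
qed

text \<open>If \<open>x\<close> is outside \<open>K\<close>, its minimal polynomial has degree above
  one and hence a further root \<open>t\<close>. It differs from \<open>x\<close>, because the
  derivative has smaller degree and cannot vanish at \<open>x\<close>. Sending \<open>x\<close> to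
  \<open>t\<close> extends to a conjugation that fixes \<open>K\<close> and moves
  \<open>x\<close>.\<close>

lemma conjugation_fixed_field:
  assumes K: "subring_on K" "K \<subseteq> Qbar" "\<And>k. k \<in> K \<Longrightarrow> k \<noteq> 0 \<Longrightarrow> inverse k \<in> K" and x: "x \<in> Qbar"
    and fixed: "\<And>s. s \<in> conjugations \<Longrightarrow> (\<forall>k\<in>K. s k = k) \<Longrightarrow> s x = x"
  shows "x \<in> K"
proof (rule ccontr)
  assume xK: "x \<notin> K"
  obtain q where q: "\<forall>i. coeff q i \<in> \<int>" "q \<noteq> 0" "poly q x = 0" using x by (auto simp: algebraic_def Qbar_def)
  have "q \<in> polys_over K" using q Ints_subset_subring[OF K(1)] by (auto simp: polys_over_def)
  moreover have "\<exists>i. coeff q i \<notin> {0}" using q(2) by (auto simp: poly_eq_iff)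
  ultimately obtain p where p: "p \<in> polys_over K" "poly p x = 0" "lead_coeff p \<noteq> 0"
    and min: "\<And>q. q \<in> polys_over K \<Longrightarrow> poly q x = 0 \<Longrightarrow> degree q < degree p \<Longrightarrow> (\<forall>i. coeff q i = 0)"
    using minimal_relation[OF prime_ideal_on_zero K(1), of x q] q by auto
  have p0: "p \<noteq> 0" using p(3) by auto
  have "degree p \<noteq> 0" using p(2,3) by (intro notI, elim degree_eq_zeroE) auto
  obtain r where r: "p = [:- x, 1:] * r" using p(2) by (auto simp: poly_eq_0_iff_dvd elim: dvdE)
  have r0: "r \<noteq> 0" using r p0 by auto
  have "degree r \<noteq> 0"
  proof
    assume "degree r = 0"
    then obtain c where "r = [:c:]" by (auto elim: degree_eq_zeroE)
    hence c: "p = [:- x * c, c:]" "c \<noteq> 0" using r r0 by auto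
    hence cK: "- x * c \<in> K" "c \<in> K" using polys_overD[OF p(1), of 0] polys_overD[OF p(1), of 1] by auto
    have "- (- x * c * inverse c) \<in> K"
      by (rule subring_on_uminus[OF K(1) subring_on_mult[OF K(1) cK(1) K(3)[OF cK(2) c(2)]]])
    moreover have "- (- x * c * inverse c) = x" using c(2) by (simp add: mult.assoc)
    ultimately show False using xK by metis
  qed
  then obtain t where t: "poly r t = 0"
    using fundamental_theorem_of_algebra[of r] by (auto simp: constant_degree)
  have "t \<noteq> x"
  proof
    assume "t = x"
    moreover have "pderiv p = [:- x, 1:] * pderiv r + r * pderiv [:- x, 1:]"
      by (simp only: r pderiv_mult)
    ultimately have "poly (pderiv p) x = 0" using t by (simp add: pderiv_pCons)
    moreover have "pderiv p \<in> polys_over K"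
      using polys_overD[OF p(1)] by (auto simp: coeff_pderiv polys_over_def intro!: subring_on_mult[OF K(1)] subring_on_add[OF K(1)] subring_on_1[OF K(1)] subring_on_of_nat[OF K(1)])
    ultimately have "pderiv p = 0"
      using min[of "pderiv p"] \<open>degree p \<noteq> 0\<close> by (auto simp: degree_pderiv poly_eq_iff)
    thus False using \<open>degree p \<noteq> 0\<close> by (simp add: pderiv_eq_0_iff)
  qed
  have idh: "ring_hom_on K (\<lambda>x. x)" using K(1) by (simp add: ring_hom_on_def)
  have mid: "map_poly (\<lambda>x. x) q = q" for q :: "complex poly" by (rule poly_eqI) (simp add: coeff_map_poly)
  have "poly (map_poly (\<lambda>x. x) q) t = 0" if "q \<in> polys_over K" "poly q x \<in> {0}" for q
    using hom_extend_algebraic[OF prime_ideal_on_zero subset_UNIV UNIV_I idh, of p x t q] p min that t r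
    by (auto simp: mid)
  from hom_extend[OF idh, of "{0}" x t] this obtain \<psi> where
    \<psi>: "ring_hom_on (adjoin K x) \<psi>" "\<forall>r\<in>K. \<psi> r = r" "\<psi> x = t" by auto
  obtain s where s: "s \<in> conjugations" "\<forall>r\<in>adjoin K x. s r = \<psi> r"
    using conjugation_extend[OF \<psi>(1) adjoin_subset[OF subring_on_Qbar K(2) x]] by auto
  have "s x = x"
    using fixed[OF s(1)] s(2) \<psi>(2) adjoin_superset[OF K(1)] by (auto simp: subset_iff)
  moreover have "s x = t" using s(2) \<psi>(3) adjoin_self[OF K(1)] by auto
  ultimately show False using \<open>t \<noteq> x\<close> by simp
qed

lemma conjugation_Rats: "s \<in> conjugations \<Longrightarrow> r \<in> \<rat> \<Longrightarrow> s r = r"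
proof -
  assume s: "s \<in> conjugations" and "r \<in> \<rat>"
  then obtain a b where r: "r = of_int a / of_int b" "b \<noteq> 0" by (auto elim: Rats_cases')
  note h = conjugationsD[OF s]
  have "r \<in> Qbar" using \<open>r \<in> \<rat>\<close> Qbar_superset_Rats by auto
  hence "s (of_int b * r) = of_int b * s r"
    using ring_hom_on_mult[OF h subring_on_of_int[OF subring_on_Qbar]] ring_hom_on_of_int[OF h] by simp
  moreover have "of_int b * r = of_int a" using r by simp
  ultimately have "of_int b * s r = of_int a" using ring_hom_on_of_int[OF h, of a] by simp
  thus ?thesis using r by (metis nonzero_mult_div_cancel_left of_int_eq_0_iff)
qed

lemma conjugation_fixed_Rats:
  assumes "x \<in> Qbar" "\<And>s. s \<in> conjugations \<Longrightarrow> s x = x" shows "x \<in> \<rat>"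
  by (rule conjugation_fixed_field)
    (use assms Qbar_superset_Rats in \<open>auto simp: subring_on_def conjugation_Rats\<close>)

text \<open>An injective self-map of a finite set permutes it and so only reorders the
  factors.\<close>

lemma prod_fixed:
  assumes "finite \<Omega>" "\<Omega> \<subseteq> A" "ring_hom_on A f" "f ` \<Omega> \<subseteq> \<Omega>" "inj_on f \<Omega>"
  shows "f (\<Prod>x\<in>\<Omega>. x) = (\<Prod>x\<in>\<Omega>. x)"
proof -
  have "f (\<Prod>x\<in>\<Omega>. x) = (\<Prod>x\<in>\<Omega>. f x)" using assms by (intro ring_hom_on_prod[OF assms(3)]) auto
  also have "\<dots> = (\<Prod>x\<in>f ` \<Omega>. x)" using prod.reindex[OF assms(5), of "\<lambda>x. x"] by simp
  also have "f ` \<Omega> = \<Omega>" using assms by (intro endo_inj_surj)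
  finally show ?thesis .
qed

lemma Rats_algebraic_int: "x \<in> \<rat> \<Longrightarrow> algebraic_int (x::complex) \<Longrightarrow> x \<in> \<int>"
  using rational_algebraic_int_is_int by blast

section \<open>A multiplicative height bound\<close>

text \<open>
  This bounds the exponential of the Weil height, up to a factor \<open>2\<close> in the exponent, without any
  reference to number fields, primes or product formulas.
\<close>

definition height_at_most :: "complex \<Rightarrow> real \<Rightarrow> bool" where
  "height_at_most a B \<longleftrightarrow> (\<exists>l. l \<noteq> 0 \<and> algebraic_int l \<and> algebraic_int (l * a) \<and>
     (\<forall>s\<in>conjugations. cmod (s l) \<le> B \<and> cmod (s (l * a)) \<le> B))"

lemma id_conjugation: "(\<lambda>x. x) \<in> conjugations"
  by (auto simp: conjugations_def ring_hom_on_def subring_on_Qbar)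

lemma algebraic_int_in_Qbar: "algebraic_int x \<Longrightarrow> x \<in> Qbar"
  by (auto simp: Qbar_def)

lemma height_at_most_Qbar:
  assumes "height_at_most a B" shows "a \<in> Qbar"
proof -
  obtain l where l: "l \<noteq> 0" "algebraic_int l" "algebraic_int (l * a)"
    using assms by (auto simp: height_at_most_def)
  have "inverse l * (l * a) \<in> Qbar"
    using l by (intro subring_on_mult[OF subring_on_Qbar] Qbar_inverse algebraic_int_in_Qbar)
  thus ?thesis using l(1) by (simp flip: mult.assoc)
qed

lemma height_at_most_nonneg: "height_at_most a B \<Longrightarrow> B \<ge> 0"
  using id_conjugation by (auto simp: height_at_most_def intro: order_trans[OF norm_ge_zero])

lemma height_at_most_mono: "height_at_most a B \<Longrightarrow> B \<le> B' \<Longrightarrow> height_at_most a B'"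
  by (auto simp: height_at_most_def intro: order_trans)

lemma height_at_most_mult:
  assumes "height_at_most a A" "height_at_most b B" shows "height_at_most (a * b) (A * B)"
proof -
  obtain l where l: "l \<noteq> 0" "algebraic_int l" "algebraic_int (l * a)"
    "\<And>s. s \<in> conjugations \<Longrightarrow> cmod (s l) \<le> A \<and> cmod (s (l * a)) \<le> A"
    using assms(1) by (auto simp: height_at_most_def)
  obtain m where m: "m \<noteq> 0" "algebraic_int m" "algebraic_int (m * b)"
    "\<And>s. s \<in> conjugations \<Longrightarrow> cmod (s m) \<le> B \<and> cmod (s (m * b)) \<le> B"
    using assms(2) by (auto simp: height_at_most_def)
  have e: "l * m * (a * b) = (l * a) * (m * b)" by simp
  have "cmod (s (l * m)) \<le> A * B \<and> cmod (s (l * m * (a * b))) \<le> A * B" if s: "s \<in> conjugations" for s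
    unfolding e using l(4)[OF s] m(4)[OF s] height_at_most_nonneg[OF assms(1)]
    by (auto simp: ring_hom_on_mult[OF conjugationsD[OF s]] algebraic_int_in_Qbar l m norm_mult simp del: mult.assoc
        intro!: mult_mono)
  moreover have "algebraic_int (l * m)" "algebraic_int (l * m * (a * b))"
    unfolding e using l m by (auto intro: algebraic_int_mult)
  ultimately show ?thesis unfolding height_at_most_def using l(1) m(1) by (intro exI[of _ "l * m"]) auto
qed

text \<open>The definition is symmetric in \<open>l\<close> and \<open>l * a\<close>, so the
  numerator serves as a denominator of the inverse.\<close>

lemma height_at_most_inverse:
  assumes "height_at_most a B" "a \<noteq> 0" shows "height_at_most (inverse a) B"
proof -
  obtain l where l: "l \<noteq> 0" "algebraic_int l" "algebraic_int (l * a)"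
    "\<And>s. s \<in> conjugations \<Longrightarrow> cmod (s l) \<le> B \<and> cmod (s (l * a)) \<le> B"
    using assms(1) by (auto simp: height_at_most_def)
  have e: "l * a * inverse a = l" using assms(2) by simp
  show ?thesis unfolding height_at_most_def using l assms(2) by (intro exI[of _ "l * a"]) (simp add: e)
qed

lemma height_at_most_root_of_unity:
  assumes "z ^ k = 1" "k > 0" shows "height_at_most z 1"
proof -
  have ai: "algebraic_int z" using algebraic_int_power_root[of z k] assms by simp
  have "cmod (s z) = 1" if s: "s \<in> conjugations" for s
  proof -
    have "s z ^ k = 1"
      using ring_hom_on_power[OF conjugationsD[OF s] algebraic_int_in_Qbar[OF ai], of k]
        ring_hom_on_1[OF conjugationsD[OF s]] assms by simp
    hence "cmod (s z) ^ k = 1" by (metis norm_power norm_one)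
    thus ?thesis using assms(2) by (metis norm_ge_zero power_eq_1_iff neq0_conv abs_norm_cancel power_eq_iff_eq_base power_one zero_le_one)
  qed
  moreover have "cmod (s 1) = 1" if "s \<in> conjugations" for s
    using ring_hom_on_1[OF conjugationsD[OF that]] by simp
  ultimately show ?thesis unfolding height_at_most_def
    using ai by (intro exI[of _ 1]) (simp add: int_imp_algebraic_int)
qed

lemma height_at_most_1: "height_at_most 1 1"
  using height_at_most_root_of_unity[of 1 1] by simp

lemma height_at_most_power: "height_at_most a B \<Longrightarrow> height_at_most (a ^ n) (B ^ n)"
  by (induction n) (auto intro: height_at_most_1 height_at_most_mult)

lemma height_at_most_powi:
  assumes "height_at_most a B" "a \<noteq> 0" shows "height_at_most (a powi k) (B ^ nat \<bar>k\<bar>)"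
  using assms height_at_most_power[of a B "nat k"] height_at_most_power[OF height_at_most_inverse[OF assms], of "nat (- k)"]
  by (cases "k \<ge> 0") (auto simp: power_int_def)

lemma height_at_most_prod:
  assumes "\<And>i. i \<in> I \<Longrightarrow> height_at_most (f i) (B ^ g i)"
  shows "height_at_most (\<Prod>i\<in>I. f i) (B ^ (\<Sum>i\<in>I. g i))"
  using assms by (induction I rule: infinite_finite_induct)
    (auto intro: height_at_most_1 height_at_most_mult simp: power_add)

text \<open>An \<open>n\<close>-th root of the denominator of \<open>a ^ n\<close> is a denominator
  of \<open>a\<close>. This is why \<open>l\<close> ranges over all algebraic integers and not over
  those of a fixed number field.\<close>

lemma height_at_most_root:
  assumes "height_at_most (a ^ n) (B ^ n)" "n > 0" "B \<ge> 0" shows "height_at_most a B"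
proof -
  obtain l where l: "l \<noteq> 0" "algebraic_int l" "algebraic_int (l * a ^ n)"
    "\<And>s. s \<in> conjugations \<Longrightarrow> cmod (s l) \<le> B ^ n \<and> cmod (s (l * a ^ n)) \<le> B ^ n"
    using assms(1) by (auto simp: height_at_most_def)
  obtain m where m: "m ^ n = l" using exists_complex_root[of n l] assms(2) by auto
  have e: "(m * a) ^ n = l * a ^ n" by (simp add: m power_mult_distrib)
  have ai: "algebraic_int m" "algebraic_int (m * a)"
    using algebraic_int_power_root[of m n] algebraic_int_power_root[of "m * a" n] assms(2) l
    unfolding e m by auto
  have "cmod (s m) \<le> B \<and> cmod (s (m * a)) \<le> B" if s: "s \<in> conjugations" for s
  proof -
    have "cmod (s m) ^ n \<le> B ^ n" "cmod (s (m * a)) ^ n \<le> B ^ n"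
      using l(4)[OF s] ring_hom_on_power[OF conjugationsD[OF s] algebraic_int_in_Qbar[OF ai(1)], of n]
        ring_hom_on_power[OF conjugationsD[OF s] algebraic_int_in_Qbar[OF ai(2)], of n]
      unfolding m e by (simp_all flip: norm_power)
    thus ?thesis using assms(2,3) by (auto intro: power_le_imp_le_base simp: power_mono_iff)
  qed
  moreover have "m \<noteq> 0" using m l(1) assms(2) by auto
  ultimately show ?thesis unfolding height_at_most_def using ai by blast
qed

section \<open>Heights of solutions of algebraic relations\<close>

lemma conjugates_bounded:
  assumes "finite W" "W \<subseteq> Qbar"
  shows "\<exists>M\<ge>1. \<forall>x\<in>W. \<forall>s\<in>conjugations. cmod (s x) \<le> M"
proof -
  define Y where "Y = (\<Union>x\<in>W. {s x | s. s \<in> conjugations})"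
  have Y: "finite (cmod ` Y)" unfolding Y_def using assms finite_conjugates by (intro finite_imageI finite_UN_I) auto
  define M where "M = Max (insert 1 (cmod ` Y))"
  have "M \<ge> 1" "\<And>y. y \<in> Y \<Longrightarrow> cmod y \<le> M" unfolding M_def using Y by auto
  thus ?thesis unfolding Y_def by (intro exI[of _ M]) blast
qed

lemma height_at_most_exists:
  assumes "a \<in> Qbar" shows "\<exists>B\<ge>1. height_at_most a B"
proof -
  obtain n where n: "n > 0" "algebraic_int (of_nat n * a)" using algebraic_int_multiple assms by (auto simp: Qbar_def)
  have "{of_nat n, of_nat n * a} \<subseteq> Qbar" using n assms subring_on_of_nat[OF subring_on_Qbar]
    by (auto intro: subring_on_mult[OF subring_on_Qbar])
  then obtain M where "M \<ge> 1" "\<And>s. s \<in> conjugations \<Longrightarrow> cmod (s (of_nat n)) \<le> M \<and> cmod (s (of_nat n * a)) \<le> M"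
    using conjugates_bounded[of "{of_nat n, of_nat n * a}"] by auto
  thus ?thesis using n unfolding height_at_most_def
    by (intro exI[of _ M] conjI exI[of _ "of_nat n"]) (auto intro: int_imp_algebraic_int)
qed

lemma common_denominator:
  assumes "finite Y" "Y \<subseteq> Qbar"
  shows "\<exists>n>0. \<forall>x\<in>Y. algebraic_int (of_nat n * x)"
  using assms
proof (induction Y rule: finite_induct)
  case (insert x Y)
  then obtain n where n: "n > 0" "\<forall>x\<in>Y. algebraic_int (of_nat n * x)" by auto
  obtain m where m: "m > 0" "algebraic_int (of_nat m * x)" using algebraic_int_multiple insert.prems by (auto simp: Qbar_def)
  have "algebraic_int (of_nat n * (of_nat m * x))"
    using m algebraic_int_mult[of "of_nat n" "of_nat m * x"] by (simp add: int_imp_algebraic_int)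
  moreover have "algebraic_int (of_nat m * (of_nat n * y))" if "y \<in> Y" for y
    using n that algebraic_int_mult[of "of_nat m" "of_nat n * y"] by (simp add: int_imp_algebraic_int)
  ultimately show ?case using n(1) m(1) by (intro exI[of _ "m * n"]) (auto simp: mult_ac)
qed auto

text \<open>For \<open>cmod y > 1\<close> one solves for the top term: the other powers are at most
  \<open>cmod y ^ (n - 1)\<close>, which is divided out. For \<open>cmod y \<le> 1\<close> the bound
  on \<open>w n\<close> suffices, as \<open>n > 0\<close>.\<close>

lemma root_times_lead_bound:
  fixes y :: complex
  assumes "(\<Sum>e\<le>n. w e * y ^ e) = 0" "\<And>e. e \<le> n \<Longrightarrow> cmod (w e) \<le> T" "n > 0"
  shows "cmod (w n * y) \<le> real n * T"
proof -
  have T: "T \<ge> 0" using assms(2)[of 0] norm_ge_zero[of "w 0"] by linarith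
  show ?thesis
  proof (cases "cmod y \<le> 1")
    case True
    have "cmod (w n * y) \<le> T * 1" unfolding norm_mult using assms(2)[of n] True T by (intro mult_mono) auto
    also have "\<dots> \<le> real n * T" using assms(3) T by (simp add: mult_right_mono[of 1 "real n" T, simplified])
    finally show ?thesis .
  next
    case False
    hence y0: "y \<noteq> 0" by auto
    have n: "n = Suc (n - 1)" using assms(3) by simp
    have "(\<Sum>e<n. w e * y ^ e) + w n * y ^ n = 0" using assms(1) by (simp add: lessThan_Suc_atMost[symmetric])
    hence "w n * y * y ^ (n - 1) = - (\<Sum>e<n. w e * y ^ e)"
      using power_Suc[of y "n - 1"] n by (simp add: eq_neg_iff_add_eq_0 mult.assoc add.commute)
    hence "cmod (w n * y) * cmod y ^ (n - 1) = cmod (\<Sum>e<n. w e * y ^ e)"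
      by (metis norm_minus_cancel norm_mult norm_power)
    also have "\<dots> \<le> (\<Sum>e<n. T * cmod y ^ (n - 1))"
    proof (rule sum_norm_le)
      fix e assume "e \<in> {..<n}"
      hence "cmod y ^ e \<le> cmod y ^ (n - 1)" "cmod (w e) \<le> T"
        using False assms(2)[of e] by (auto intro!: power_increasing)
      thus "cmod (w e * y ^ e) \<le> T * cmod y ^ (n - 1)"
        unfolding norm_mult norm_power using T by (intro mult_mono) auto
    qed
    finally have "cmod (w n * y) * cmod y ^ (n - 1) \<le> (real n * T) * cmod y ^ (n - 1)" by simp
    thus ?thesis using y0 by (simp add: mult_le_cancel_right)
  qed
qed

text \<open>With \<open>l\<close> a denominator of \<open>u\<close>, the coefficients of the
  relation multiplied by \<open>n * l ^ D\<close> become algebraic integers \<open>w e\<close> with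
  conjugates at most a constant times \<open>B ^ D\<close>. The last nonzero one is a denominator of
  \<open>x\<close>. So the exponent of \<open>B\<close> is the degree in \<open>u\<close>, and
  \<open>C\<close> does not depend on \<open>u\<close> or \<open>x\<close>.\<close>

lemma height_at_most_relation:
  fixes c :: "nat \<Rightarrow> nat \<Rightarrow> complex"
  assumes c: "\<And>k e. k \<le> D \<Longrightarrow> e \<le> E \<Longrightarrow> c k e \<in> Qbar"
  shows "\<exists>C\<ge>1. \<forall>u x B. height_at_most u B \<longrightarrow> B \<ge> 1 \<longrightarrow>
    (\<Sum>e\<le>E. (\<Sum>k\<le>D. c k e * u ^ k) * x ^ e) = 0 \<longrightarrow> (\<exists>e\<le>E. (\<Sum>k\<le>D. c k e * u ^ k) \<noteq> 0) \<longrightarrow>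
    height_at_most x (C * B ^ D)"
proof -
  define W where "W = (\<lambda>(k,e). c k e) ` ({..D} \<times> {..E})"
  have W: "finite W" "W \<subseteq> Qbar" using c by (auto simp: W_def)
  obtain n where n: "n > 0" "\<forall>x\<in>W. algebraic_int (of_nat n * x)" using common_denominator[OF W] by blast
  define d where "d k e = of_nat n * c k e" for k e
  have ad: "algebraic_int (d k e)" if "k \<le> D" "e \<le> E" for k e using n that by (auto simp: d_def W_def)
  have "(\<lambda>(k,e). d k e) ` ({..D} \<times> {..E}) \<subseteq> Qbar" using ad by (auto intro: algebraic_int_in_Qbar)
  then obtain M where M: "M \<ge> 1" "\<And>k e s. k \<le> D \<Longrightarrow> e \<le> E \<Longrightarrow> s \<in> conjugations \<Longrightarrow> cmod (s (d k e)) \<le> M"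
    using conjugates_bounded[of "(\<lambda>(k,e). d k e) ` ({..D} \<times> {..E})"] by fastforce
  \<comment> \<open>\<open>M\<close> bounds the conjugates of the cleared coefficients,
    \<open>Suc D\<close> counts the terms of each \<open>w e\<close>, and \<open>Suc E\<close>
    dominates the degree contributed by \<open>root_times_lead_bound\<close>.\<close>
  define C where "C = real (Suc E) * (real (Suc D) * M)"
  have "C \<ge> 1" unfolding C_def using M(1) by (intro mult_ge1_I) auto
  moreover have "height_at_most x (C * B ^ D)"
    if u: "height_at_most u B" and B: "B \<ge> 1" and rel: "(\<Sum>e\<le>E. (\<Sum>k\<le>D. c k e * u ^ k) * x ^ e) = 0"
      and nz: "e \<le> E" "(\<Sum>k\<le>D. c k e * u ^ k) \<noteq> 0" for u x B e
  proof -
    obtain l where l: "l \<noteq> 0" "algebraic_int l" "algebraic_int (l * u)"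
      "\<And>s. s \<in> conjugations \<Longrightarrow> cmod (s l) \<le> B \<and> cmod (s (l * u)) \<le> B"
      using u by (auto simp: height_at_most_def)
    define w where "w e = (\<Sum>k\<le>D. d k e * (l ^ (D - k) * (l * u) ^ k))" for e
    have w: "w e = of_nat n * l ^ D * (\<Sum>k\<le>D. c k e * u ^ k)" for e
      unfolding w_def sum_distrib_left
    proof (intro sum.cong refl)
      fix k assume "k \<in> {..D}"
      hence "l ^ (D - k) * l ^ k = l ^ D" by (simp flip: power_add)
      thus "d k e * (l ^ (D - k) * (l * u) ^ k) = of_nat n * l ^ D * (c k e * u ^ k)"
        by (simp add: d_def power_mult_distrib mult_ac)
    qed
    have aw: "algebraic_int (w e)" if "e \<le> E" for e
    proof -
      have "w e \<in> {x. algebraic_int x}"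
        unfolding w_def using ad[OF _ that] l(2,3)
        by (intro subring_on_sum[OF subring_on_algebraic_int]
          subring_on_mult[OF subring_on_algebraic_int, of "d _ e"]
          subring_on_mult[OF subring_on_algebraic_int, of "l ^ _" "(l * u) ^ _"]
          subring_on_power[OF subring_on_algebraic_int]) auto
      thus ?thesis by simp
    qed
    have sw: "cmod (s (w e)) \<le> real (Suc D) * M * B ^ D" if e: "e \<le> E" and s: "s \<in> conjugations" for s e
    proof -
      note h = conjugationsD[OF s]
      note Q = subring_on_Qbar
      have m: "d k e \<in> Qbar" if "k \<le> D" for k using ad[OF that e] by (rule algebraic_int_in_Qbar)
      have lQ: "l \<in> Qbar" "l * u \<in> Qbar" using l by (auto intro: algebraic_int_in_Qbar)
      have "s (w e) = (\<Sum>k\<le>D. s (d k e * (l ^ (D - k) * (l * u) ^ k)))"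
        unfolding w_def by (intro ring_hom_on_sum[OF h] subring_on_mult[OF Q] subring_on_power[OF Q] lQ m) auto
      also have "cmod \<dots> \<le> (\<Sum>k\<le>D. M * B ^ D)"
      proof (rule sum_norm_le)
        fix k assume "k \<in> {..D}"
        hence k: "k \<le> D" by simp
        have "s (d k e * (l ^ (D - k) * (l * u) ^ k)) = s (d k e) * (s l ^ (D - k) * s (l * u) ^ k)"
          using ring_hom_on_mult[OF h m[OF k] subring_on_mult[OF Q subring_on_power[OF Q lQ(1)] subring_on_power[OF Q lQ(2)]]]
            ring_hom_on_mult[OF h subring_on_power[OF Q lQ(1)] subring_on_power[OF Q lQ(2)]]
            ring_hom_on_power[OF h lQ(1)] ring_hom_on_power[OF h lQ(2)] by simp
        also have "cmod \<dots> = cmod (s (d k e)) * (cmod (s l) ^ (D - k) * cmod (s (l * u)) ^ k)"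
          by (simp only: norm_mult norm_power)
        also have "\<dots> \<le> M * (B ^ (D - k) * B ^ k)"
          using M(2)[OF k e s] l(4)[OF s] M(1) B by (intro mult_mono power_mono) auto
        also have "B ^ (D - k) * B ^ k = B ^ D" using k by (simp flip: power_add)
        finally show "cmod (s (d k e * (l ^ (D - k) * (l * u) ^ k))) \<le> M * B ^ D" .
      qed
      finally show ?thesis by simp
    qed
    define T where "T = real (Suc D) * M * B ^ D"
    have T: "T \<ge> 1" unfolding T_def using M B by (intro mult_ge1_I one_le_power) auto
    have CT: "C * B ^ D = real (Suc E) * T" by (simp add: C_def T_def mult_ac)
    have wrel: "(\<Sum>e\<le>E. w e * x ^ e) = 0"
    proof -
      have "(\<Sum>e\<le>E. w e * x ^ e) = of_nat n * l ^ D * (\<Sum>e\<le>E. (\<Sum>k\<le>D. c k e * u ^ k) * x ^ e)"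
        unfolding w sum_distrib_left[of _ _ "{..E}"] by (intro sum.cong) (simp_all add: mult.assoc)
      thus ?thesis using rel by simp
    qed
    have "w e \<noteq> 0" using nz n(1) l(1) by (simp add: w)
    \<comment> \<open>The top coefficients may vanish at \<open>u\<close>, so the degree in
      \<open>x\<close> is lowered to the last index with \<open>w e \<noteq> 0\<close>.\<close>
    define m where "m = Max {e. e \<le> E \<and> w e \<noteq> 0}"
    have fin: "finite {e. e \<le> E \<and> w e \<noteq> 0}" by simp
    have m: "m \<le> E" "w m \<noteq> 0" "\<And>e. e \<le> E \<Longrightarrow> m < e \<Longrightarrow> w e = 0"
    proof -
      have "{e. e \<le> E \<and> w e \<noteq> 0} \<noteq> {}" using nz(1) \<open>w e \<noteq> 0\<close> by blast
      from Max_in[OF fin this] show "m \<le> E" "w m \<noteq> 0" by (auto simp: m_def)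
      show "w e = 0" if "e \<le> E" "m < e" for e
        using Max_ge[OF fin, of e] that by (fastforce simp: m_def)
    qed
    have mrel: "(\<Sum>e\<le>m. w e * x ^ e) = 0"
    proof -
      have "(\<Sum>e\<le>E. w e * x ^ e) = (\<Sum>e\<le>m. w e * x ^ e)"
        using m by (intro sum.mono_neutral_right) (auto simp: not_le)
      thus ?thesis using wrel by simp
    qed
    have m0: "m > 0" using mrel m(2) by (intro gr0I) auto
    define p where "p = (\<Sum>e\<le>m. monom (w e) e)"
    have cp: "coeff p e = (if e \<le> m then w e else 0)" for e by (simp add: p_def coeff_sum)
    have dp: "degree p = m"
      using m(2) by (intro antisym degree_le le_degree) (auto simp: cp)
    have "poly p x = 0" using mrel by (simp add: p_def poly_sum poly_monom)
    moreover have "p \<in> polys_over {x. algebraic_int x}"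
      using aw m(1) by (auto simp: polys_over_def cp)
    ultimately have ai: "algebraic_int (w m * x)"
      using algebraic_int_lead_mult[of p x] dp m0 by (simp add: cp)
    have wQ: "w e \<in> Qbar" if "e \<le> m" for e using aw that m(1) by (auto intro: algebraic_int_in_Qbar)
    have xQ: "x \<in> Qbar"
    proof -
      have "inverse (w m) * (w m * x) \<in> Qbar"
        by (intro subring_on_mult[OF subring_on_Qbar] Qbar_inverse algebraic_int_in_Qbar[OF ai] wQ) auto
      thus ?thesis using m(2) by (simp flip: mult.assoc)
    qed
    have "cmod (s (w m)) \<le> C * B ^ D \<and> cmod (s (w m * x)) \<le> C * B ^ D" if s: "s \<in> conjugations" for s
    proof
      note h = conjugationsD[OF s]
      note Q = subring_on_Qbar
      have "T \<le> C * B ^ D" unfolding CT using T by (simp add: mult_right_mono[of 1 "real (Suc E)" T, simplified])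
      thus "cmod (s (w m)) \<le> C * B ^ D" using sw[OF m(1) s] by (simp add: T_def)
      have "s (\<Sum>e\<le>m. w e * x ^ e) = (\<Sum>e\<le>m. s (w e * x ^ e))"
        by (intro ring_hom_on_sum[OF h] subring_on_mult[OF Q] subring_on_power[OF Q] wQ xQ) auto
      also have "\<dots> = (\<Sum>e\<le>m. s (w e) * s x ^ e)"
        by (intro sum.cong refl)
          (simp add: ring_hom_on_mult[OF h wQ subring_on_power[OF Q xQ]] ring_hom_on_power[OF h xQ])
      finally have "(\<Sum>e\<le>m. s (w e) * s x ^ e) = 0" using mrel ring_hom_on_0[OF h] by simp
      hence "cmod (s (w m) * s x) \<le> real m * T"
        using sw[OF _ s] m(1) m0 by (intro root_times_lead_bound) (auto simp: T_def)
      also have "\<dots> \<le> C * B ^ D" unfolding CT using m(1) T by (intro mult_right_mono) auto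
      finally show "cmod (s (w m * x)) \<le> C * B ^ D" by (simp add: ring_hom_on_mult[OF h wQ xQ])
    qed
    thus ?thesis unfolding height_at_most_def using ai aw[OF m(1)] m(2) by (intro exI[of _ "w m"]) auto
  qed
  ultimately show ?thesis by blast
qed

section \<open>Torsion points on plane curves\<close>

text \<open>The product of the distinct conjugates is fixed by all conjugations, hence a rational
  integer. Its absolute value is below \<open>1\<close>, so some conjugate is
  \<open>0\<close>.\<close>

lemma algebraic_int_conjugates_lt_1:
  assumes w: "algebraic_int w" and lt: "\<And>s. s \<in> conjugations \<Longrightarrow> cmod (s w) < 1"
  shows "w = 0"
proof -
  define \<Omega> where "\<Omega> = {s w | s. s \<in> conjugations}"
  have wQ: "w \<in> Qbar" by (rule algebraic_int_in_Qbar[OF w])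
  have fin: "finite \<Omega>" unfolding \<Omega>_def by (rule finite_conjugates[OF wQ])
  have \<Omega>Q: "\<Omega> \<subseteq> Qbar" unfolding \<Omega>_def using Qbar_hom_closed[OF conjugationsD _ wQ] by auto
  have "s (\<Prod>x\<in>\<Omega>. x) = (\<Prod>x\<in>\<Omega>. x)" if s: "s \<in> conjugations" for s
  proof (rule prod_fixed[OF fin \<Omega>Q conjugationsD[OF s]])
    show "s ` \<Omega> \<subseteq> \<Omega>"
      unfolding \<Omega>_def using conjugations_comp[OF s] by (force simp: o_def)
    show "inj_on s \<Omega>"
    proof (rule inj_onI)
      fix x y assume xy: "x \<in> \<Omega>" "y \<in> \<Omega>" "s x = s y"
      hence "s (x - y) = 0" using \<Omega>Q ring_hom_on_diff[OF conjugationsD[OF s], of x y] by auto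
      thus "x = y"
        using ring_hom_on_Qbar_inj[OF conjugationsD[OF s] order_refl, of "x - y"] xy \<Omega>Q
          subring_on_diff[OF subring_on_Qbar, of x y] by auto
    qed
  qed
  moreover have "(\<Prod>x\<in>\<Omega>. x) \<in> Qbar" using \<Omega>Q by (intro subring_on_prod[OF subring_on_Qbar]) auto
  ultimately have "(\<Prod>x\<in>\<Omega>. x) \<in> \<rat>" by (intro conjugation_fixed_Rats)
  moreover have "(\<Prod>x\<in>\<Omega>. x) \<in> {x. algebraic_int x}"
    using algebraic_int_hom[OF conjugationsD wQ w]
    by (intro subring_on_prod[OF subring_on_algebraic_int]) (auto simp: \<Omega>_def)
  ultimately have int: "(\<Prod>x\<in>\<Omega>. x) \<in> \<int>" using Rats_algebraic_int by auto
  have "w \<in> \<Omega>" using id_conjugation by (force simp: \<Omega>_def)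
  have "cmod (\<Prod>x\<in>\<Omega>. x) < 1"
  proof -
    have "(\<Prod>x\<in>\<Omega>. cmod x) = cmod w * (\<Prod>x\<in>\<Omega> - {w}. cmod x)"
      using fin \<open>w \<in> \<Omega>\<close> by (rule prod.remove)
    also have "\<dots> \<le> cmod w * 1"
      using lt by (intro mult_left_mono prod_le_1) (auto simp: \<Omega>_def intro: less_imp_le)
    also have "\<dots> < 1" using lt[OF id_conjugation] by simp
    finally show ?thesis by (simp add: prod_norm)
  qed
  hence "(\<Prod>x\<in>\<Omega>. x) = 0" using int by (auto elim!: Ints_cases)
  then obtain s where "s \<in> conjugations" "s w = 0" using fin by (auto simp: \<Omega>_def)
  thus ?thesis using ring_hom_on_Qbar_inj[OF conjugationsD order_refl wQ] by blast
qed

text \<open>A Vandermonde argument: the relations remain true with the powers replaced by any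
  polynomial, in particular by one that vanishes at all nodes except \<open>\<mu> i\<close>.\<close>

lemma exponentials_independent:
  fixes a \<mu> :: "'i \<Rightarrow> complex"
  assumes "finite I" "inj_on \<mu> I" "\<And>n. (\<Sum>i\<in>I. a i * \<mu> i ^ n) = 0" "i \<in> I"
  shows "a i = 0"
proof -
  have *: "(\<Sum>i\<in>I. a i * poly p (\<mu> i)) = 0" for p
  proof -
    have "(\<Sum>i\<in>I. a i * poly p (\<mu> i)) = (\<Sum>i\<in>I. \<Sum>n\<le>degree p. coeff p n * (a i * \<mu> i ^ n))"
      by (simp add: poly_altdef sum_distrib_left mult_ac)
    also have "\<dots> = (\<Sum>n\<le>degree p. \<Sum>i\<in>I. coeff p n * (a i * \<mu> i ^ n))" by (rule sum.swap)
    also have "\<dots> = (\<Sum>n\<le>degree p. coeff p n * (\<Sum>i\<in>I. a i * \<mu> i ^ n))" by (simp add: sum_distrib_left)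
    finally show ?thesis using assms(3) by simp
  qed
  define p where "p = (\<Prod>j\<in>I - {i}. [:- \<mu> j, 1:])"
  have p: "poly p x = (\<Prod>j\<in>I - {i}. x - \<mu> j)" for x by (simp add: p_def poly_prod)
  have "poly p (\<mu> j) = 0" if "j \<in> I - {i}" for j
    unfolding p using that assms(1) by (intro prod_zero) auto
  hence "(\<Sum>j\<in>I - {i}. a j * poly p (\<mu> j)) = 0" by simp
  hence "a i * poly p (\<mu> i) = 0" using *[of p] sum.remove[OF assms(1,4), of "\<lambda>j. a j * poly p (\<mu> j)"] by simp
  moreover have "poly p (\<mu> i) \<noteq> 0" unfolding p using assms(1,2,4) by (auto simp: inj_on_def)
  ultimately show ?thesis by simp
qed

section \<open>Frobenius congruences and vanishing sums of roots of unity\<close>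

lemma algebraic_int_frobenius_add:
  fixes x y :: complex
  assumes "prime p" "algebraic_int x" "algebraic_int y"
  shows "\<exists>w. algebraic_int w \<and> (x + y) ^ p = x ^ p + y ^ p + of_nat p * w"
proof -
  define w where "w = (\<Sum>k\<in>{1..<p}. of_nat ((p choose k) div p) * x ^ k * y ^ (p - k))"
  have p: "p > 0" using assms(1) by (simp add: prime_gt_0_nat)
  have "(x + y) ^ p = (\<Sum>k\<le>p. of_nat (p choose k) * x ^ k * y ^ (p - k))" by (rule binomial_ring)
  also have "{..p} = insert 0 (insert p {1..<p})" using p by auto
  also have "(\<Sum>k\<in>\<dots>. of_nat (p choose k) * x ^ k * y ^ (p - k)) =
      y ^ p + x ^ p + (\<Sum>k\<in>{1..<p}. of_nat (p choose k) * x ^ k * y ^ (p - k))"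
    using p by (simp add: add.assoc)
  also have "(\<Sum>k\<in>{1..<p}. of_nat (p choose k) * x ^ k * y ^ (p - k)) = of_nat p * w"
    unfolding w_def sum_distrib_left
  proof (intro sum.cong refl)
    fix k assume "k \<in> {1..<p}"
    hence "p dvd (p choose k)" using assms(1) by (intro dvd_choose_prime) auto
    hence "(p choose k) = p * ((p choose k) div p)" by simp
    hence "(of_nat (p choose k) :: complex) = of_nat p * of_nat ((p choose k) div p)"
      by (metis of_nat_mult)
    thus "of_nat (p choose k) * x ^ k * y ^ (p - k) =
        of_nat p * (of_nat ((p choose k) div p) * x ^ k * y ^ (p - k))" by simp
  qed
  finally have "(x + y) ^ p = x ^ p + y ^ p + of_nat p * w" by simp
  moreover have "w \<in> {x. algebraic_int x}"
    unfolding w_def using assms(2,3) subring_on_of_nat[OF subring_on_algebraic_int]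
    by (intro subring_on_sum[OF subring_on_algebraic_int]) (auto intro!: algebraic_int_mult algebraic_int_power)
  ultimately show ?thesis by auto
qed

lemma algebraic_int_frobenius_sum:
  fixes z :: "'i \<Rightarrow> complex"
  assumes "prime p" "finite I" "\<And>i. i \<in> I \<Longrightarrow> algebraic_int (z i)"
  shows "\<exists>w. algebraic_int w \<and> (\<Sum>i\<in>I. z i) ^ p = (\<Sum>i\<in>I. z i ^ p) + of_nat p * w"
  using assms(2,3)
proof (induction I rule: finite_induct)
  case empty
  thus ?case using assms(1) by (intro exI[of _ 0]) (auto simp: prime_gt_0_nat)
next
  case (insert i I)
  then obtain w where w: "algebraic_int w" "(\<Sum>i\<in>I. z i) ^ p = (\<Sum>i\<in>I. z i ^ p) + of_nat p * w" by auto
  have "(\<Sum>i\<in>I. z i) \<in> {x. algebraic_int x}"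
    using insert.prems by (intro subring_on_sum[OF subring_on_algebraic_int]) auto
  then obtain v where v: "algebraic_int v"
    "(z i + (\<Sum>i\<in>I. z i)) ^ p = z i ^ p + (\<Sum>i\<in>I. z i) ^ p + of_nat p * v"
    using algebraic_int_frobenius_add[OF assms(1), of "z i" "\<Sum>i\<in>I. z i"] insert.prems by auto
  have "algebraic_int (w + v)" using w v by (intro algebraic_int_add)
  moreover have "(\<Sum>i\<in>insert i I. z i) ^ p = (\<Sum>i\<in>insert i I. z i ^ p) + of_nat p * (w + v)"
    using v(2) w(2) insert.hyps by (simp add: distrib_left)
  ultimately show ?case by blast
qed

text \<open>Fermat's little theorem, as Frobenius for a sum of ones. Negative integers follow from
  Frobenius for \<open>- n + n = 0\<close>, which includes the case \<open>p = 2\<close> without a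
  separate argument.\<close>

lemma int_frobenius:
  assumes "prime p"
  shows "\<exists>w. algebraic_int w \<and> (of_int c :: complex) ^ p = of_int c + of_nat p * w"
proof -
  have nat: "\<exists>w. algebraic_int w \<and> (of_nat n :: complex) ^ p = of_nat n + of_nat p * w" for n
  proof -
    have "algebraic_int (1::complex)" by (simp add: int_imp_algebraic_int)
    thus ?thesis using algebraic_int_frobenius_sum[OF assms, of "{..<n}" "\<lambda>_. 1"] by simp
  qed
  show ?thesis
  proof (cases "c \<ge> 0")
    case True
    thus ?thesis using nat[of "nat c"] by simp
  next
    case False
    define n where "n = nat (- c)"
    have c: "(of_int c :: complex) = - of_nat n" using False by (simp add: n_def)
    obtain w where w: "algebraic_int w" "(of_nat n :: complex) ^ p = of_nat n + of_nat p * w" using nat by blast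
    have "algebraic_int (of_nat n :: complex)" by (simp add: int_imp_algebraic_int)
    then obtain v :: complex where v: "algebraic_int v" "(- of_nat n + of_nat n) ^ p = (- of_nat n) ^ p + of_nat n ^ p + of_nat p * v"
      using algebraic_int_frobenius_add[OF assms, of "- of_nat n" "of_nat n"] by auto
    have "0 = (- of_nat n) ^ p + (of_nat n + of_nat p * w) + of_nat p * v"
      using v(2) prime_gt_0_nat[OF assms] unfolding w(2) by (simp add: zero_power)
    hence "(- of_nat n) ^ p = - of_nat n + of_nat p * (- w - v)"
      by (simp add: algebra_simps eq_neg_iff_add_eq_0)
    moreover have "algebraic_int (- w - v)" using w v by (intro algebraic_int_diff) auto
    ultimately show ?thesis unfolding c by blast
  qed
qed

lemma root_of_unity_algebraic_int: "z \<in> roots_of_unity \<Longrightarrow> algebraic_int z"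
proof -
  assume "z \<in> roots_of_unity"
  then obtain k where k: "k > 0" "z ^ k = 1" by (auto simp: roots_of_unity_def)
  show ?thesis by (rule algebraic_int_power_root[OF _ k(1)]) (simp add: k(2) int_imp_algebraic_int)
qed

lemma roots_of_unity_mult: "z \<in> roots_of_unity \<Longrightarrow> w \<in> roots_of_unity \<Longrightarrow> z * w \<in> roots_of_unity"
proof -
  assume "z \<in> roots_of_unity" "w \<in> roots_of_unity"
  then obtain k m where km: "k > 0" "z ^ k = 1" "m > 0" "w ^ m = 1" by (auto simp: roots_of_unity_def)
  have "z ^ (k * m) = 1" "w ^ (m * k) = 1" using km by (simp_all add: power_mult)
  hence "(z * w) ^ (k * m) = 1" by (simp add: power_mult_distrib mult.commute)
  thus ?thesis using km by (auto simp: roots_of_unity_def intro!: exI[of _ "k * m"])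
qed

lemma roots_of_unity_power: "z \<in> roots_of_unity \<Longrightarrow> z ^ n \<in> roots_of_unity"
  by (induction n) (auto intro: roots_of_unity_mult, auto simp: roots_of_unity_def)

lemma norm_root_of_unity: "z \<in> roots_of_unity \<Longrightarrow> cmod z = 1"
proof -
  assume "z \<in> roots_of_unity"
  then obtain k where "k > 0" "z ^ k = 1" by (auto simp: roots_of_unity_def)
  hence "cmod z ^ k = 1 ^ k" by (metis norm_power norm_one power_one)
  thus ?thesis using \<open>k > 0\<close> by (subst (asm) power_eq_iff_eq_base) auto
qed

lemma conjugate_root_of_unity:
  assumes "s \<in> conjugations" "z \<in> roots_of_unity" shows "s z \<in> roots_of_unity"
proof -
  obtain k where k: "k > 0" "z ^ k = 1" using assms(2) by (auto simp: roots_of_unity_def)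
  have "s z ^ k = 1"
    using ring_hom_on_power[OF conjugationsD[OF assms(1)] algebraic_int_in_Qbar[OF root_of_unity_algebraic_int[OF assms(2)]], of k]
      ring_hom_on_1[OF conjugationsD[OF assms(1)]] k by simp
  thus ?thesis using k(1) by (auto simp: roots_of_unity_def)
qed

text \<open>
  Frobenius: raising a vanishing integer combination of roots of unity to a prime power \<open>p\<close> shows
  that the combination of the \<open>p\<close>-th powers is \<open>p\<close> times an algebraic integer. If \<open>p\<close> exceeds the sum
  of the absolute values of the coefficients, all conjugates of this integer are smaller than \<open>1\<close>.
\<close>

lemma vanishing_sum_prime_power:
  fixes c :: "'i \<Rightarrow> int" and z :: "'i \<Rightarrow> complex"
  assumes p: "prime p" "real p > (\<Sum>i\<in>I. \<bar>of_int (c i)\<bar>)" and I: "finite I"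
    and z: "\<And>i. i \<in> I \<Longrightarrow> z i \<in> roots_of_unity" and "(\<Sum>i\<in>I. of_int (c i) * z i) = 0"
  shows "(\<Sum>i\<in>I. of_int (c i) * z i ^ p) = 0"
proof -
  have p0: "p > 0" using p(1) by (simp add: prime_gt_0_nat)
  have az: "algebraic_int (z i)" if "i \<in> I" for i using z[OF that] by (rule root_of_unity_algebraic_int)
  have aci: "algebraic_int (of_int n :: complex)" for n by (simp add: int_imp_algebraic_int)
  have "algebraic_int (of_int (c i) * z i)" if "i \<in> I" for i using az[OF that] aci by (intro algebraic_int_mult)
  then obtain w where w: "algebraic_int w"
    "(\<Sum>i\<in>I. of_int (c i) * z i) ^ p = (\<Sum>i\<in>I. (of_int (c i) * z i) ^ p) + of_nat p * w"
    using algebraic_int_frobenius_sum[OF p(1) I, of "\<lambda>i. of_int (c i) * z i"] by blast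
  have "\<forall>i. \<exists>w. algebraic_int w \<and> (of_int (c i) :: complex) ^ p = of_int (c i) + of_nat p * w"
    using int_frobenius[OF p(1)] by blast
  then obtain v where v: "\<And>i. algebraic_int (v i)" "\<And>i. (of_int (c i) :: complex) ^ p = of_int (c i) + of_nat p * v i"
    by metis
  define y where "y = - w - (\<Sum>i\<in>I. v i * z i ^ p)"
  have "0 = (\<Sum>i\<in>I. (of_int (c i) + of_nat p * v i) * z i ^ p) + of_nat p * w"
    using w(2) assms(5) p0 by (simp add: power_mult_distrib v(2) zero_power)
  also have "(\<Sum>i\<in>I. (of_int (c i) + of_nat p * v i) * z i ^ p) =
      (\<Sum>i\<in>I. of_int (c i) * z i ^ p) + of_nat p * (\<Sum>i\<in>I. v i * z i ^ p)"
    unfolding sum_distrib_left sum.distrib[symmetric] by (intro sum.cong) (simp_all add: algebra_simps)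
  finally have y: "(\<Sum>i\<in>I. of_int (c i) * z i ^ p) = of_nat p * y"
    by (simp add: y_def algebra_simps eq_neg_iff_add_eq_0)
  have "(\<Sum>i\<in>I. v i * z i ^ p) \<in> {x. algebraic_int x}"
    using v(1) az by (intro subring_on_sum[OF subring_on_algebraic_int]) (auto intro!: algebraic_int_mult algebraic_int_power)
  hence ay: "algebraic_int y" unfolding y_def using w(1) by (intro algebraic_int_diff) auto
  have "y = 0"
  proof (rule algebraic_int_conjugates_lt_1[OF ay])
    fix s assume s: "s \<in> conjugations"
    note h = conjugationsD[OF s]
    note Q = subring_on_Qbar
    have zQ: "z i \<in> Qbar" if "i \<in> I" for i using az[OF that] by (rule algebraic_int_in_Qbar)
    have "s (of_nat p * y) = of_nat p * s y"
      using ring_hom_on_mult[OF h subring_on_of_nat[OF Q] algebraic_int_in_Qbar[OF ay]] ring_hom_on_of_nat[OF h] by simp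
    moreover have "s (\<Sum>i\<in>I. of_int (c i) * z i ^ p) = (\<Sum>i\<in>I. s (of_int (c i) * z i ^ p))"
      using zQ by (intro ring_hom_on_sum[OF h] subring_on_mult[OF Q] subring_on_of_int[OF Q] subring_on_power[OF Q])
    moreover have "cmod (\<Sum>i\<in>I. s (of_int (c i) * z i ^ p)) \<le> (\<Sum>i\<in>I. \<bar>of_int (c i)\<bar>)"
    proof (rule sum_norm_le)
      fix i assume i: "i \<in> I"
      have "s (of_int (c i) * z i ^ p) = of_int (c i) * s (z i) ^ p"
        using ring_hom_on_mult[OF h subring_on_of_int[OF Q] subring_on_power[OF Q zQ[OF i]]]
          ring_hom_on_of_int[OF h] ring_hom_on_power[OF h zQ[OF i]] by simp
      thus "cmod (s (of_int (c i) * z i ^ p)) \<le> \<bar>of_int (c i)\<bar>"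
        using norm_root_of_unity[OF conjugate_root_of_unity[OF s z[OF i]]] by (simp add: norm_mult norm_power)
    qed
    ultimately have "cmod (of_nat p * s y) < real p" using p(2) unfolding y by simp
    hence "real p * cmod (s y) < real p" by (simp add: norm_mult)
    thus "cmod (s y) < 1" using p0 by simp
  qed
  thus ?thesis using y by simp
qed

text \<open>The prime factors of \<open>m\<close> are used one at a time; the roots of unity change,
  but the coefficients and with them the bound on the primes stay the same.\<close>

lemma vanishing_sum_powers:
  fixes c :: "'i \<Rightarrow> int" and z :: "'i \<Rightarrow> complex"
  assumes I: "finite I" "\<And>i. i \<in> I \<Longrightarrow> z i \<in> roots_of_unity" and "(\<Sum>i\<in>I. of_int (c i) * z i) = 0"
    and "m > 0" "\<And>p. prime p \<Longrightarrow> p dvd m \<Longrightarrow> real p > (\<Sum>i\<in>I. \<bar>of_int (c i)\<bar>)"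
  shows "(\<Sum>i\<in>I. of_int (c i) * z i ^ m) = 0"
  using assms(4,5)
proof (induction m rule: less_induct)
  case (less m)
  show ?case
  proof (cases "m = 1")
    case True thus ?thesis using assms(3) by simp
  next
    case False
    then obtain p where p: "prime p" "p dvd m" using prime_factor_nat by blast
    then obtain k where k: "m = p * k" by (auto elim: dvdE)
    have "k > 0" "k < m" using k less.prems prime_gt_1_nat[OF p(1)] by auto
    hence "(\<Sum>i\<in>I. of_int (c i) * z i ^ k) = 0" using less.IH[of k] less.prems k by auto
    hence "(\<Sum>i\<in>I. of_int (c i) * (z i ^ k) ^ p) = 0"
      using p less.prems I by (intro vanishing_sum_prime_power[of p c I "\<lambda>i. z i ^ k"] roots_of_unity_power) auto
    thus ?thesis by (simp add: k mult.commute flip: power_mult)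
  qed
qed

text \<open>Every prime factor of \<open>1 + N * n\<close> with \<open>N = fact M\<close> exceeds
  \<open>M\<close>, the sum of the absolute values of the coefficients. So the relation persists for
  all exponents \<open>1 + N * n\<close>, a linear dependence between the exponentials of the
  numbers \<open>z i ^ N\<close>; hence these cannot be distinct.\<close>

lemma vanishing_sum_coincidence:
  fixes c :: "'i \<Rightarrow> int"
  assumes I: "finite I" and "k \<in> I" "c k \<noteq> 0"
  shows "\<exists>N>0. \<forall>z :: 'i \<Rightarrow> complex. (\<forall>i\<in>I. z i \<in> roots_of_unity) \<longrightarrow> (\<Sum>i\<in>I. of_int (c i) * z i) = 0 \<longrightarrow>
     (\<exists>i\<in>I. \<exists>j\<in>I. i \<noteq> j \<and> z i ^ N = z j ^ N)"
proof -
  define M where "M = nat (\<Sum>i\<in>I. \<bar>c i\<bar>)"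
  have M: "(\<Sum>i\<in>I. \<bar>of_int (c i)\<bar>) = real M"
    by (simp add: M_def sum_nonneg flip: of_int_abs of_int_sum)
  define N :: nat where "N = fact M"
  have "\<exists>i\<in>I. \<exists>j\<in>I. i \<noteq> j \<and> z i ^ N = z j ^ N"
    if z: "\<forall>i\<in>I. z i \<in> roots_of_unity" "(\<Sum>i\<in>I. of_int (c i) * z i) = 0" for z :: "'i \<Rightarrow> complex"
  proof (rule ccontr)
    assume "\<not> ?thesis"
    hence inj: "inj_on (\<lambda>i. z i ^ N) I" by (auto simp: inj_on_def)
    have "(\<Sum>i\<in>I. of_int (c i) * z i * (z i ^ N) ^ n) = 0" for n
    proof -
      have "real p > real M" if "prime p" "p dvd 1 + N * n" for p
      proof (rule ccontr)
        assume "\<not> real p > real M"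
        hence "p dvd N" using that(1) unfolding N_def by (intro dvd_fact) (auto simp: prime_gt_0_nat Suc_leI)
        hence "p dvd 1" using that(2) by (metis dvd_add_left_iff dvd_mult2)
        thus False using that(1) by simp
      qed
      hence "(\<Sum>i\<in>I. of_int (c i) * z i ^ (1 + N * n)) = 0"
        using z I M by (intro vanishing_sum_powers) auto
      thus ?thesis by (simp add: power_add power_mult mult.assoc)
    qed
    hence "of_int (c k) * z k = 0"
      using exponentials_independent[OF I inj, of "\<lambda>i. of_int (c i) * z i" k] assms(2) by blast
    moreover have "z k \<noteq> 0" using norm_root_of_unity z(1) assms(2) by force
    ultimately show False using assms(3) by simp
  qed
  moreover have "N > 0" by (simp add: N_def)
  ultimately show ?thesis by blast
qed

lemma finite_polys_degree_le:
  fixes B :: "'a::zero set"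
  assumes "finite B" shows "finite {p. degree p \<le> n \<and> (\<forall>i. coeff p i \<in> B)}"
proof -
  let ?P = "{p. degree p \<le> n \<and> (\<forall>i. coeff p i \<in> B)}"
  have "inj_on (\<lambda>p. map (coeff p) [0..<Suc n]) ?P"
  proof (rule inj_onI)
    fix p q assume pq: "p \<in> ?P" "q \<in> ?P" "map (coeff p) [0..<Suc n] = map (coeff q) [0..<Suc n]"
    show "p = q"
    proof (rule poly_eqI)
      fix i show "coeff p i = coeff q i"
        using pq by (cases "i \<le> n") (auto simp: coeff_eq_0 simp del: upt_Suc)
    qed
  qed
  moreover have "(\<lambda>p. map (coeff p) [0..<Suc n]) ` ?P \<subseteq> {xs. set xs \<subseteq> B \<and> length xs = Suc n}" by auto
  ultimately show ?thesis
    using finite_imageD finite_subset[OF _ finite_lists_length_eq[OF assms]] by blast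
qed

text \<open>\<open>G\<close> is the norm of \<open>F\<close>: the product of its distinct
  conjugates, of which there are finitely many because each coefficient has finitely many. The
  coefficients of \<open>G\<close> are integral and fixed by all conjugations, hence
  integers.\<close>

lemma integral_multiple_relation:
  fixes F :: "complex poly poly"
  assumes "F \<noteq> 0" and ai: "F \<in> polys_over (polys_over {x. algebraic_int x})"
  shows "\<exists>G. G \<noteq> 0 \<and> G \<in> polys_over (polys_over \<int>) \<and> F dvd G"
proof -
  define A where "A = polys_over (polys_over Qbar)"
  define H where "H s = map_poly (map_poly s)" for s :: "complex \<Rightarrow> complex"
  have sub: "polys_over (polys_over {x. algebraic_int x}) \<subseteq> A"
    unfolding A_def by (intro polys_over_mono) (auto intro: algebraic_int_in_Qbar)
  have H: "ring_hom_on A (H s)" if "s \<in> conjugations" for s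
    unfolding A_def H_def by (intro ring_hom_on_map_poly conjugationsD that)
  have cH: "coeff (coeff (H s P) e) k = s (coeff (coeff P e) k)" if "s \<in> conjugations" for s P e k
    using ring_hom_on_0[OF conjugationsD[OF that]] by (simp add: H_def coeff_map_poly)
  have HA: "H s P \<in> A" if "s \<in> conjugations" "P \<in> A" for s P
    unfolding A_def polys_over_def using that cH Qbar_hom_closed[OF conjugationsD[OF that(1)] order_refl]
    by (auto simp: A_def polys_over_def)
  have Hinj: "P = Q" if "s \<in> conjugations" "P \<in> A" "Q \<in> A" "H s P = H s Q" for s P Q
  proof (intro poly_eqI)
    fix e k
    have m: "coeff (coeff P e) k \<in> Qbar" "coeff (coeff Q e) k \<in> Qbar" using that(2,3) by (auto simp: A_def polys_over_def)
    have "s (coeff (coeff P e) k) = s (coeff (coeff Q e) k)" using that cH by metis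
    hence "s (coeff (coeff P e) k - coeff (coeff Q e) k) = 0"
      using ring_hom_on_diff[OF conjugationsD[OF that(1)] m] by simp
    thus "coeff (coeff P e) k = coeff (coeff Q e) k"
      using ring_hom_on_Qbar_inj[OF conjugationsD[OF that(1)] order_refl subring_on_diff[OF subring_on_Qbar m]] by simp
  qed
  define \<Omega> where "\<Omega> = {H s F | s. s \<in> conjugations}"
  have FA: "F \<in> A" using ai sub by auto
  have fin: "finite \<Omega>"
  proof -
    define d where "d = Max ((\<lambda>e. degree (coeff F e)) ` {..degree F})"
    have d: "degree (coeff F e) \<le> d" for e
    proof (cases "e \<le> degree F")
      case True thus ?thesis unfolding d_def by (intro Max_ge) auto
    qed (simp add: coeff_eq_0)
    define B where "B = insert 0 (\<Union>e\<le>degree F. \<Union>k\<le>d. {s (coeff (coeff F e) k) | s. s \<in> conjugations})"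
    have "finite B" unfolding B_def using FA by (auto simp: A_def polys_over_def intro!: finite_conjugates)
    define P where "P = {p. degree p \<le> d \<and> (\<forall>i. coeff p i \<in> B)}"
    have "finite P" unfolding P_def by (rule finite_polys_degree_le[OF \<open>finite B\<close>])
    hence "finite {p. degree p \<le> degree F \<and> (\<forall>i. coeff p i \<in> P)}" by (rule finite_polys_degree_le)
    moreover have "\<Omega> \<subseteq> {p. degree p \<le> degree F \<and> (\<forall>i. coeff p i \<in> P)}"
    proof -
      have "H s F \<in> {p. degree p \<le> degree F \<and> (\<forall>i. coeff p i \<in> P)}" if s: "s \<in> conjugations" for s
      proof (intro CollectI conjI allI)
        note s0 = ring_hom_on_0[OF conjugationsD[OF s]]
        show "degree (H s F) \<le> degree F" by (rule degree_le) (auto intro!: poly_eqI simp: cH[OF s] coeff_eq_0 s0)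
        fix e
        have "degree (coeff (H s F) e) \<le> d"
        proof (rule degree_le, intro allI impI)
          fix k assume "d < k"
          hence "coeff (coeff F e) k = 0" using d[of e] by (intro coeff_eq_0) simp
          thus "coeff (coeff (H s F) e) k = 0" by (simp add: cH[OF s] s0)
        qed
        moreover have "coeff (coeff (H s F) e) k \<in> B" for k
        proof (cases "e \<le> degree F \<and> k \<le> d")
          case True thus ?thesis using s by (auto simp: B_def cH[OF s])
        next
          case False
          hence "coeff (coeff F e) k = 0" using d[of e] by (auto simp: coeff_eq_0 not_le)
          thus ?thesis by (simp add: B_def cH[OF s] s0)
        qed
        ultimately show "coeff (H s F) e \<in> P" by (simp add: P_def)
      qed
      thus ?thesis by (auto simp: \<Omega>_def)
    qed
    ultimately show ?thesis by (rule finite_subset[rotated])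
  qed
  have \<Omega>A: "\<Omega> \<subseteq> A" unfolding \<Omega>_def using HA FA by auto
  define G where "G = (\<Prod>P\<in>\<Omega>. P)"
  have HG: "H s G = G" if s: "s \<in> conjugations" for s
    unfolding G_def
  proof (rule prod_fixed[OF fin \<Omega>A H[OF s]])
    have "H s (H t F) = H (s \<circ> t) F" if "t \<in> conjugations" for t
      by (intro poly_eqI) (simp add: cH s that conjugations_comp)
    thus "H s ` \<Omega> \<subseteq> \<Omega>" unfolding \<Omega>_def using conjugations_comp[OF s] by blast
    show "inj_on (H s) \<Omega>" using Hinj[OF s] \<Omega>A by (auto simp: inj_on_def)
  qed
  have "H s F \<noteq> 0" if s: "s \<in> conjugations" for s
    using Hinj[OF s FA subring_on_0[OF ring_hom_on_subring[OF H[OF s]]]] assms(1) ring_hom_on_0[OF H[OF s]] by auto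
  hence "G \<noteq> 0" unfolding G_def using fin by (auto simp: \<Omega>_def)
  moreover have "F dvd G"
  proof -
    have "H (\<lambda>x. x) F = F" by (intro poly_eqI) (simp add: cH[OF id_conjugation])
    hence "F \<in> \<Omega>" unfolding \<Omega>_def using id_conjugation by force
    thus ?thesis unfolding G_def using fin by (rule dvd_prodI[rotated])
  qed
  moreover have "coeff (coeff G e) k \<in> \<int>" for e k
  proof -
    have "G \<in> polys_over (polys_over {x. algebraic_int x})"
      unfolding G_def
    proof (intro subring_on_prod subring_on_polys_over subring_on_algebraic_int)
      fix P assume "P \<in> \<Omega>"
      then obtain s where s: "s \<in> conjugations" "P = H s F" by (auto simp: \<Omega>_def)
      have "algebraic_int (coeff (coeff F e) k)" for e k using ai by (auto simp: polys_over_def)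
      thus "P \<in> polys_over (polys_over {x. algebraic_int x})"
        using algebraic_int_hom[OF conjugationsD[OF s(1)] algebraic_int_in_Qbar] by (auto simp: polys_over_def s(2) cH[OF s(1)])
    qed
    hence a: "algebraic_int (coeff (coeff G e) k)" by (auto simp: polys_over_def)
    have "s (coeff (coeff G e) k) = coeff (coeff G e) k" if "s \<in> conjugations" for s
      using cH[OF that, of G e k] HG[OF that] by simp
    hence "coeff (coeff G e) k \<in> \<rat>" using a by (intro conjugation_fixed_Rats algebraic_int_in_Qbar)
    thus ?thesis using a by (rule Rats_algebraic_int)
  qed
  ultimately show ?thesis by (auto simp: polys_over_def)
qed

lemma poly_poly_double_sum:
  fixes F :: "complex poly poly"
  assumes "degree F \<le> n" "\<And>e. degree (coeff F e) \<le> d"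
  shows "poly (poly F [:v:]) u = (\<Sum>(e,k)\<in>{..n} \<times> {..d}. coeff (coeff F e) k * (u ^ k * v ^ e))"
proof -
  have "poly (poly F [:v:]) u = (\<Sum>e\<le>n. poly (coeff F e) u * v ^ e)"
    unfolding poly_sum_le[OF assms(1)] by (simp add: poly_sum poly_power)
  also have "\<dots> = (\<Sum>e\<le>n. \<Sum>k\<le>d. coeff (coeff F e) k * (u ^ k * v ^ e))"
    using poly_sum_le[OF assms(2)] by (simp add: sum_distrib_right mult.assoc)
  finally show ?thesis by (simp add: sum.cartesian_product)
qed

text \<open>With integer coefficients, a torsion point on the curve is a vanishing integer
  combination of the roots of unity \<open>u ^ k * v ^ e\<close>. Two distinct monomials then have
  equal \<open>N\<close>-th powers, with \<open>N\<close> independent of the point; \<open>T\<close>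
  consists of the differences of distinct exponents.\<close>

lemma torsion_points_on_curve:
  fixes c :: "nat \<Rightarrow> nat \<Rightarrow> complex"
  assumes c: "\<And>k e. k \<le> D \<Longrightarrow> e \<le> E \<Longrightarrow> c k e \<in> Qbar" and nz: "k0 \<le> D" "e0 \<le> E" "c k0 e0 \<noteq> 0"
  shows "\<exists>T N. finite T \<and> (0, 0) \<notin> T \<and> N > 0 \<and>
    (\<forall>u\<in>roots_of_unity. \<forall>v\<in>roots_of_unity. (\<Sum>e\<le>E. (\<Sum>k\<le>D. c k e * u ^ k) * v ^ e) = 0 \<longrightarrow>
      (\<exists>(r, s)\<in>T. (u powi r * v powi s) ^ N = 1))"
proof -
  obtain n where n: "n > 0" "\<And>k e. k \<le> D \<Longrightarrow> e \<le> E \<Longrightarrow> algebraic_int (of_nat n * c k e)"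
    using common_denominator[of "(\<lambda>(k, e). c k e) ` ({..D} \<times> {..E})"] c by fastforce
  define F where "F = (\<Sum>e\<le>E. monom (\<Sum>k\<le>D. monom (of_nat n * c k e) k) e)"
  have cF: "coeff (coeff F e) k = (if e \<le> E \<and> k \<le> D then of_nat n * c k e else 0)" for e k
    by (simp add: F_def coeff_sum)
  have "F \<noteq> 0" using cF[of e0 k0] nz n(1) by auto
  moreover have "F \<in> polys_over (polys_over {x. algebraic_int x})"
    using n(2) by (auto simp: polys_over_def cF)
  ultimately obtain G where G: "G \<noteq> 0" "G \<in> polys_over (polys_over \<int>)" "F dvd G"
    using integral_multiple_relation by blast
  define d where "d = Max ((\<lambda>e. degree (coeff G e)) ` {..degree G})"
  have d: "degree (coeff G e) \<le> d" for e
  proof (cases "e \<le> degree G")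
    case True thus ?thesis unfolding d_def by (intro Max_ge) auto
  qed (simp add: coeff_eq_0)
  define I where "I = {..degree G} \<times> {..d}"
  have "\<exists>m. coeff (coeff G e) k = of_int m" for e k
    using polys_overD[OF polys_overD[OF G(2)], of e k] by (auto elim: Ints_cases)
  then obtain g where g: "\<And>e k. coeff (coeff G e) k = of_int (g e k)" by metis
  obtain e1 k1 where "coeff (coeff G e1) k1 \<noteq> 0" using G(1) by (metis poly_eqI coeff_0)
  moreover from this have "e1 \<le> degree G" by (metis coeff_0 coeff_eq_0 not_le)
  moreover have "k1 \<le> d" using calculation(1) d[of e1] by (meson coeff_eq_0 not_le order_trans)
  ultimately have "(e1, k1) \<in> I" "(\<lambda>(e,k). g e k) (e1, k1) \<noteq> 0" by (auto simp: I_def g)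
  from vanishing_sum_coincidence[where c = "\<lambda>(e,k). g e k", OF _ this] obtain N where N: "N > 0"
    "\<And>z :: nat \<times> nat \<Rightarrow> complex. \<forall>i\<in>I. z i \<in> roots_of_unity \<Longrightarrow> (\<Sum>i\<in>I. of_int (case i of (e,k) \<Rightarrow> g e k) * z i) = 0 \<Longrightarrow>
      \<exists>i\<in>I. \<exists>j\<in>I. i \<noteq> j \<and> z i ^ N = z j ^ N"
    by (auto simp: I_def)
  define T where "T = (\<lambda>((e,k),(e',k')). (int k - int k', int e - int e')) ` {(i, j). i \<in> I \<and> j \<in> I \<and> i \<noteq> j}"
  have "finite ({(i, j). i \<in> I \<and> j \<in> I \<and> i \<noteq> j})"
    by (rule finite_subset[of _ "I \<times> I"]) (auto simp: I_def)
  hence "finite T" unfolding T_def by (rule finite_imageI)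
  moreover have "(0, 0) \<notin> T" by (auto simp: T_def)
  moreover have "\<exists>(r, s)\<in>T. (u powi r * v powi s) ^ N = 1"
    if uv: "u \<in> roots_of_unity" "v \<in> roots_of_unity" and rel: "(\<Sum>e\<le>E. (\<Sum>k\<le>D. c k e * u ^ k) * v ^ e) = 0" for u v
  proof -
    have "poly (poly F [:v:]) u = (\<Sum>e\<le>E. (\<Sum>k\<le>D. of_nat n * c k e * u ^ k) * v ^ e)"
      by (simp add: F_def poly_sum poly_monom poly_power)
    also have "\<dots> = of_nat n * (\<Sum>e\<le>E. (\<Sum>k\<le>D. c k e * u ^ k) * v ^ e)"
      by (simp add: sum_distrib_left sum_distrib_right mult.assoc)
    finally have "poly (poly G [:v:]) u = 0" using rel G(3) by (auto elim!: dvdE)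
    hence "(\<Sum>(e,k)\<in>I. of_int (g e k) * (u ^ k * v ^ e)) = 0"
      using poly_poly_double_sum[OF order_refl d] by (simp add: I_def g)
    hence *: "(\<Sum>i\<in>I. of_int (case i of (e,k) \<Rightarrow> g e k) * (case i of (e,k) \<Rightarrow> u ^ k * v ^ e)) = 0"
      by (simp add: case_prod_beta)
    have "\<forall>i\<in>I. (case i of (e,k) \<Rightarrow> u ^ k * v ^ e) \<in> roots_of_unity"
      using uv by (auto intro!: roots_of_unity_mult roots_of_unity_power)
    from N(2)[OF this *] obtain e k e' k' where i: "(e,k) \<in> I" "(e',k') \<in> I" "(e,k) \<noteq> (e',k')"
      "(u ^ k * v ^ e) ^ N = (u ^ k' * v ^ e') ^ N" by auto
    have uv0: "u \<noteq> 0" "v \<noteq> 0" using norm_root_of_unity uv by force+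
    have "u powi (int k - int k') * v powi (int e - int e') = (u ^ k * v ^ e) / (u ^ k' * v ^ e')"
      using uv0 by (simp add: power_int_diff)
    hence "(u powi (int k - int k') * v powi (int e - int e')) ^ N = (u ^ k * v ^ e) ^ N / (u ^ k' * v ^ e') ^ N"
      by (simp only: power_divide)
    hence "(u powi (int k - int k') * v powi (int e - int e')) ^ N = 1" using i(4) uv0 by simp
    moreover have "(int k - int k', int e - int e') \<in> T"
      unfolding T_def using i by (intro image_eqI[of _ _ "((e,k),(e',k'))"]) auto
    ultimately show ?thesis by blast
  qed
  ultimately show ?thesis using N(1) by blast
qed

section \<open>Rings of integers\<close>

lemma norm_of_rat_complex: "cmod (of_rat r) = \<bar>of_rat r\<bar>"
proof -
  obtain a b where "quotient_of r = (a, b)" by (cases "quotient_of r")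
  hence "r = of_int a / of_int b" by (rule quotient_of_div)
  thus ?thesis by (simp add: of_rat_divide norm_divide)
qed

text \<open>A number field presented by an integral generator whose powers span it over the
  rationals. Rounding the rational coordinates then reduces field elements modulo integers to
  elements with bounded conjugates.\<close>

locale number_ring =
  fixes K :: "complex set" and \<theta> :: complex and d :: nat
  assumes subring: "subring_on K" and inverse_closed: "x \<in> K \<Longrightarrow> inverse x \<in> K"
    and generator: "\<theta> \<in> K" "algebraic_int \<theta>"
    and span: "x \<in> K \<Longrightarrow> \<exists>r. x = (\<Sum>i<d. of_rat (r i) * \<theta> ^ i)"
begin

definition ints :: "complex set" where "ints = {x \<in> K. algebraic_int x}"

definition embs :: "(complex \<Rightarrow> complex) set" where
  "embs = {\<sigma> \<in> extensional K. ring_hom_on K \<sigma>}"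

text \<open>Absolute value of the norm from \<open>K\<close> to the rationals.\<close>

definition norm_abs :: "complex \<Rightarrow> real" where
  "norm_abs x = (\<Prod>\<sigma>\<in>embs. cmod (\<sigma> x))"

lemma rat_in_K: "of_rat r \<in> K"
proof -
  obtain a b where "quotient_of r = (a, b)" by (cases "quotient_of r")
  hence "r = of_int a / of_int b" by (rule quotient_of_div)
  hence "of_rat r = (of_int a :: complex) * inverse (of_int b)"
    by (simp add: of_rat_divide field_simps)
  thus ?thesis
    using subring_on_mult[OF subring subring_on_of_int[OF subring] inverse_closed[OF subring_on_of_int[OF subring]]]
    by simp
qed

lemma K_Qbar: "K \<subseteq> Qbar"
proof
  fix x assume "x \<in> K"
  then obtain r where x: "x = (\<Sum>i<d. of_rat (r i) * \<theta> ^ i)" using span by blast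
  show "x \<in> Qbar" unfolding x
    using generator Qbar_superset_Rats
    by (intro subring_on_sum[OF subring_on_Qbar] subring_on_mult[OF subring_on_Qbar] subring_on_power[OF subring_on_Qbar])
      (auto intro: algebraic_int_in_Qbar)
qed

lemma subring_ints: "subring_on ints"
  using subring subring_on_algebraic_int by (auto simp: subring_on_def ints_def)

lemma ints_div_commute: "(x - y) / \<mu> \<in> ints \<longleftrightarrow> (y - x) / \<mu> \<in> ints"
proof -
  have "(x - y) / \<mu> = - ((y - x) / \<mu>)" "(y - x) / \<mu> = - ((x - y) / \<mu>)"
    by (simp_all add: minus_divide_left)
  thus ?thesis using subring_on_uminus[OF subring_ints] by metis
qed

lemma ints_K: "x \<in> ints \<Longrightarrow> x \<in> K"
  by (simp add: ints_def)

lemma embs_hom: "\<sigma> \<in> embs \<Longrightarrow> ring_hom_on K \<sigma>"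
  by (simp add: embs_def)

lemma emb_rat:
  assumes "\<sigma> \<in> embs" shows "\<sigma> (of_rat r) = of_rat r"
proof -
  obtain s where "s \<in> conjugations" "\<forall>x\<in>K. s x = \<sigma> x"
    using conjugation_extend[OF embs_hom[OF assms] K_Qbar] by auto
  thus ?thesis using conjugation_Rats[of s "of_rat r"] rat_in_K by auto
qed

lemma emb_sum:
  assumes "\<sigma> \<in> embs" shows "\<sigma> (\<Sum>i<d. of_rat (r i) * \<theta> ^ i) = (\<Sum>i<d. of_rat (r i) * \<sigma> \<theta> ^ i)"
proof -
  note h = embs_hom[OF assms]
  have "\<sigma> (\<Sum>i<d. of_rat (r i) * \<theta> ^ i) = (\<Sum>i<d. \<sigma> (of_rat (r i) * \<theta> ^ i))"
    by (intro ring_hom_on_sum[OF h] subring_on_mult[OF subring] rat_in_K subring_on_power[OF subring] generator)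
  thus ?thesis
    by (simp add: ring_hom_on_mult[OF h rat_in_K subring_on_power[OF subring generator(1)]]
        ring_hom_on_power[OF h generator(1)] emb_rat[OF assms])
qed

lemma inj_on_generator: "inj_on (\<lambda>\<sigma>. \<sigma> \<theta>) embs"
proof (rule inj_onI)
  fix \<sigma> \<tau> assume st: "\<sigma> \<in> embs" "\<tau> \<in> embs" "\<sigma> \<theta> = \<tau> \<theta>"
  show "\<sigma> = \<tau>"
  proof (rule extensionalityI[of _ K])
    show "\<sigma> \<in> extensional K" "\<tau> \<in> extensional K" using st by (auto simp: embs_def)
    fix x assume "x \<in> K"
    then obtain r where "x = (\<Sum>i<d. of_rat (r i) * \<theta> ^ i)" using span by blast
    thus "\<sigma> x = \<tau> x" using emb_sum[OF st(1)] emb_sum[OF st(2)] st(3) by simp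
  qed
qed

lemma finite_embs: "finite embs"
proof -
  note inj_on_generator
  moreover have "(\<lambda>\<sigma>. \<sigma> \<theta>) ` embs \<subseteq> {s \<theta> | s. s \<in> conjugations}"
  proof
    fix y assume "y \<in> (\<lambda>\<sigma>. \<sigma> \<theta>) ` embs"
    then obtain \<sigma> where s: "\<sigma> \<in> embs" "y = \<sigma> \<theta>" by auto
    obtain s where "s \<in> conjugations" "\<forall>x\<in>K. s x = \<sigma> x"
      using conjugation_extend[OF embs_hom[OF s(1)] K_Qbar] by auto
    moreover from this have "y = s \<theta>" using s(2) generator(1) by simp
    ultimately show "y \<in> {s \<theta> | s. s \<in> conjugations}" by blast
  qed
  moreover have "finite {s \<theta> | s. s \<in> conjugations}"
    using finite_conjugates K_Qbar generator by auto
  ultimately show ?thesis using finite_imageD finite_subset by blast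
qed

lemma emb_nonzero: "\<sigma> \<in> embs \<Longrightarrow> x \<in> K \<Longrightarrow> x \<noteq> 0 \<Longrightarrow> \<sigma> x \<noteq> 0"
  using ring_hom_on_Qbar_inj[OF embs_hom K_Qbar] by blast

lemma embs_nonempty: "embs \<noteq> {}"
proof -
  have "ring_hom_on K (\<lambda>x. x)" using subring by (simp add: ring_hom_on_def)
  hence "ring_hom_on K (restrict (\<lambda>x. x) K)" by (rule ring_hom_on_cong) simp
  hence "restrict (\<lambda>x. x) K \<in> embs" by (simp add: embs_def)
  thus ?thesis by blast
qed

text \<open>Composition with a conjugation permutes the embeddings, so the norm is rational; being
  integral and nonzero, it is a nonzero integer.\<close>

lemma norm_abs_ge_1:
  assumes x: "x \<in> ints" "x \<noteq> 0" shows "norm_abs x \<ge> 1"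
proof -
  define n where "n = (\<Prod>\<sigma>\<in>embs. \<sigma> x)"
  have xK: "x \<in> K" and ax: "algebraic_int x" using x by (auto simp: ints_def)
  have mem: "\<sigma> y \<in> Qbar" if "\<sigma> \<in> embs" "y \<in> K" for \<sigma> y
    using Qbar_hom_closed[OF embs_hom[OF that(1)] K_Qbar that(2)] .
  have "s n = n" if s: "s \<in> conjugations" for s
  proof -
    note h = conjugationsD[OF s]
    \<comment> \<open>The composite is restricted to \<open>K\<close> again, since embeddings are
      extensional functions.\<close>
    define f where "f \<sigma> = restrict (s \<circ> \<sigma>) K" for \<sigma> :: "complex \<Rightarrow> complex"
    have f: "f \<sigma> \<in> embs" if "\<sigma> \<in> embs" for \<sigma>
    proof -
      have "ring_hom_on K (s \<circ> \<sigma>)"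
        using embs_hom[OF that] h mem[OF that] by (auto simp: ring_hom_on_def)
      thus ?thesis unfolding f_def embs_def by (auto intro: ring_hom_on_cong)
    qed
    have "inj_on f embs"
    proof (rule inj_onI)
      fix \<sigma> \<tau> assume st: "\<sigma> \<in> embs" "\<tau> \<in> embs" "f \<sigma> = f \<tau>"
      show "\<sigma> = \<tau>"
      proof (rule extensionalityI[of _ K])
        show "\<sigma> \<in> extensional K" "\<tau> \<in> extensional K" using st by (auto simp: embs_def)
        fix y assume y: "y \<in> K"
        have "s (\<sigma> y) = s (\<tau> y)" using fun_cong[OF st(3), of y] y by (simp add: f_def)
        hence "s (\<sigma> y - \<tau> y) = 0" using ring_hom_on_diff[OF h mem[OF st(1) y] mem[OF st(2) y]] by simp
        thus "\<sigma> y = \<tau> y"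
          using ring_hom_on_Qbar_inj[OF h order_refl subring_on_diff[OF subring_on_Qbar mem[OF st(1) y] mem[OF st(2) y]]]
          by simp
      qed
    qed
    moreover have "f ` embs = embs"
      using f calculation finite_embs by (intro endo_inj_surj) auto
    ultimately have b: "bij_betw f embs embs" by (simp add: bij_betw_def)
    have "s n = (\<Prod>\<sigma>\<in>embs. s (\<sigma> x))"
      unfolding n_def using mem xK by (intro ring_hom_on_prod[OF h]) auto
    also have "\<dots> = (\<Prod>\<sigma>\<in>embs. f \<sigma> x)" using xK by (simp add: f_def)
    also have "\<dots> = n" unfolding n_def by (rule prod.reindex_bij_betw[OF b])
    finally show ?thesis .
  qed
  moreover have an: "algebraic_int n"
  proof -
    have "n \<in> {x. algebraic_int x}"
      unfolding n_def using algebraic_int_hom[OF embs_hom xK ax] by (intro subring_on_prod[OF subring_on_algebraic_int]) auto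
    thus ?thesis by simp
  qed
  ultimately have "n \<in> \<rat>" using algebraic_int_in_Qbar by (intro conjugation_fixed_Rats) auto
  hence "n \<in> \<int>" using an by (rule Rats_algebraic_int)
  then obtain k where k: "n = of_int k" by (auto elim: Ints_cases)
  have "n \<noteq> 0" unfolding n_def using finite_embs emb_nonzero[OF _ xK x(2)] by auto
  hence "k \<noteq> 0" using k by auto
  hence "1 \<le> \<bar>k\<bar>" by simp
  hence "1 \<le> cmod n" unfolding k norm_of_int by linarith
  thus ?thesis by (simp add: norm_abs_def n_def prod_norm)
qed

lemma norm_abs_power: "x \<in> K \<Longrightarrow> norm_abs (x ^ n) = norm_abs x ^ n"
  by (simp add: norm_abs_def ring_hom_on_power[OF embs_hom] norm_power prod_power_distrib)

text \<open>
  Every residue class modulo \<open>\<mu>\<close> has a representative whose conjugates are bounded by those of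
  \<open>\<mu>\<close>. Cutting the resulting box into sufficiently small cubes, no cube contains two integers, as
  the norm of a nonzero integer is at least \<open>1\<close>. Each embedding contributes a real and an imaginary
  part, hence the square.
\<close>

lemma card_incongruent_le:
  "\<exists>C\<ge>1. \<forall>\<mu>\<in>ints - {0}. \<forall>A\<subseteq>ints. (\<forall>x\<in>A. \<forall>y\<in>A. x \<noteq> y \<longrightarrow> (x - y) / \<mu> \<notin> ints) \<longrightarrow>
     finite A \<and> real (card A) \<le> C * (norm_abs \<mu>)\<^sup>2"
proof -
  define e where "e = card embs"
  have e0: "e > 0" using finite_embs embs_nonempty by (simp add: e_def card_gt_0_iff)
  \<comment> \<open>\<open>c\<close> bounds the conjugates of all combinations of the powers of
    \<open>\<theta>\<close> with rational coefficients between \<open>0\<close> and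
    \<open>1\<close>; the summand \<open>1\<close> ensures \<open>c \<ge> 1\<close>.\<close>
  define c where "c = 1 + (\<Sum>\<sigma>\<in>embs. \<Sum>i<d. cmod (\<sigma> \<theta>) ^ i)"
  have c1: "c \<ge> 1" unfolding c_def by (simp add: sum_nonneg)
  have c: "(\<Sum>i<d. cmod (\<sigma> \<theta>) ^ i) \<le> c" if "\<sigma> \<in> embs" for \<sigma>
  proof -
    have "(\<Sum>i<d. cmod (\<sigma> \<theta>) ^ i) \<le> (\<Sum>\<sigma>\<in>embs. \<Sum>i<d. cmod (\<sigma> \<theta>) ^ i)"
      using finite_embs that by (intro member_le_sum) (auto intro: sum_nonneg)
    thus ?thesis by (simp add: c_def)
  qed
  define C where "C = (7 * c) ^ (2 * e)"
  have "C \<ge> 1" unfolding C_def using c1 by (intro one_le_power) auto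
  have "finite A \<and> real (card A) \<le> C * (norm_abs \<mu>)\<^sup>2"
    if \<mu>: "\<mu> \<in> ints" "\<mu> \<noteq> 0" and A: "A \<subseteq> ints" and inc: "\<And>x y. x \<in> A \<Longrightarrow> y \<in> A \<Longrightarrow> x \<noteq> y \<Longrightarrow> (x - y) / \<mu> \<notin> ints" for \<mu> A
  proof -
    have "\<exists>y\<in>ints. (x - y) / \<mu> \<in> ints \<and> (\<forall>\<sigma>\<in>embs. cmod (\<sigma> y) \<le> c * cmod (\<sigma> \<mu>))" if x: "x \<in> ints" for x
    proof -
      have "x * inverse \<mu> \<in> K" using x \<mu> ints_K inverse_closed by (intro subring_on_mult[OF subring]) auto
      then obtain r where r: "x * inverse \<mu> = (\<Sum>i<d. of_rat (r i) * \<theta> ^ i)" using span by blast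
      \<comment> \<open>Rounding down the coordinates of \<open>x / \<mu>\<close> splits off the
        integer \<open>z\<close>; the fractional rest \<open>w\<close> gives the small
        representative \<open>y = \<mu> * w\<close>.\<close>
      define z where "z = (\<Sum>i<d. of_int \<lfloor>r i\<rfloor> * \<theta> ^ i)"
      have z: "z \<in> ints" unfolding z_def
        using generator by (intro subring_on_sum[OF subring_ints] subring_on_mult[OF subring_ints]
            subring_on_of_int[OF subring_ints] subring_on_power[OF subring_ints]) (auto simp: ints_def)
      define w where "w = (\<Sum>i<d. of_rat (frac (r i)) * \<theta> ^ i)"
      define y where "y = x - \<mu> * z"
      have "x * inverse \<mu> - z = w"
        unfolding r z_def w_def frac_def sum_subtractf[symmetric]
        by (intro sum.cong) (auto simp: of_rat_diff algebra_simps)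
      hence y: "y = \<mu> * w" unfolding y_def using \<mu>(2) by (auto simp: field_simps)
      have "w \<in> K" unfolding w_def
        by (intro subring_on_sum[OF subring] subring_on_mult[OF subring] rat_in_K subring_on_power[OF subring] generator)
      have "cmod (\<sigma> y) \<le> c * cmod (\<sigma> \<mu>)" if s: "\<sigma> \<in> embs" for \<sigma>
      proof -
        have "cmod (\<sigma> w) \<le> (\<Sum>i<d. cmod (\<sigma> \<theta>) ^ i)"
          unfolding w_def emb_sum[OF s]
        proof (rule sum_norm_le)
          fix i
          have "(0::real) \<le> of_rat (frac (r i))" "(of_rat (frac (r i)) :: real) \<le> 1"
            using frac_ge_0[of "r i"] frac_lt_1[of "r i"] by simp_all
          hence "cmod (of_rat (frac (r i))) \<le> 1" unfolding norm_of_rat_complex by simp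
          thus "cmod (of_rat (frac (r i)) * \<sigma> \<theta> ^ i) \<le> cmod (\<sigma> \<theta>) ^ i"
            by (simp add: norm_mult norm_power mult_left_le_one_le)
        qed
        also note c[OF s]
        finally show ?thesis
          using ring_hom_on_mult[OF embs_hom[OF s] ints_K[OF \<mu>(1)] \<open>w \<in> K\<close>]
          by (simp add: y norm_mult mult.commute[of c] mult_left_mono)
      qed
      moreover have "y \<in> ints"
        unfolding y_def by (intro subring_on_diff[OF subring_ints] subring_on_mult[OF subring_ints] x \<mu> z)
      moreover have "(x - y) / \<mu> = z" using \<mu> by (simp add: y_def)
      ultimately show ?thesis using z by auto
    qed
    then obtain f where f: "\<And>x. x \<in> ints \<Longrightarrow> f x \<in> ints" "\<And>x. x \<in> ints \<Longrightarrow> (x - f x) / \<mu> \<in> ints"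
      "\<And>x \<sigma>. x \<in> ints \<Longrightarrow> \<sigma> \<in> embs \<Longrightarrow> cmod (\<sigma> (f x)) \<le> c * cmod (\<sigma> \<mu>)" by metis
    have f_inj: "x = y" if xy: "x \<in> A" "y \<in> A" "f x = f y" for x y
    proof (rule ccontr)
      assume "x \<noteq> y"
      have "(x - f x) / \<mu> - (y - f y) / \<mu> \<in> ints"
        using f(2)[of x] f(2)[of y] xy(1,2) A by (intro subring_on_diff[OF subring_ints]) blast+
      moreover have "(x - f x) / \<mu> - (y - f y) / \<mu> = (x - y) / \<mu>" using xy(3) by (simp flip: diff_divide_distrib)
      ultimately show False using inc[OF xy(1,2) \<open>x \<noteq> y\<close>] by simp
    qed
    have n1: "norm_abs \<mu> \<ge> 1" by (rule norm_abs_ge_1[OF \<mu>])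
    define R where "R = root e (norm_abs \<mu>)"
    have R: "R ^ e = norm_abs \<mu>" "R \<ge> 1"
      unfolding R_def using e0 n1 by (auto simp: real_root_pow_pos2)
    \<comment> \<open>\<open>R\<close> is the geometric mean of the conjugates of
      \<open>\<mu>\<close>. Cells have side \<open>t \<sigma> / k\<close>, and
      \<open>k > 2 * c * R\<close> makes the norm of a difference within one cell smaller than
      \<open>1\<close>.\<close>
    define k where "k = nat \<lfloor>2 * c * R\<rfloor> + 1"
    have cR: "c * R \<ge> 1" using mult_mono[of 1 c 1 R] c1 R by simp
    have k: "real k > 2 * c * R" "real k \<le> 3 * c * R"
      unfolding k_def using cR by (linarith, linarith)
    have k0: "k > 0" by (simp add: k_def)
    define t where "t \<sigma> = c * cmod (\<sigma> \<mu>)" for \<sigma> :: "complex \<Rightarrow> complex"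
    have t0: "t \<sigma> > 0" if "\<sigma> \<in> embs" for \<sigma>
      using emb_nonzero[OF that ints_K[OF \<mu>(1)] \<mu>(2)] c1 by (simp add: t_def)
    define cell where "cell x = (\<lambda>\<sigma>\<in>embs. (\<lfloor>real k * Re (\<sigma> (f x)) / t \<sigma>\<rfloor>, \<lfloor>real k * Im (\<sigma> (f x)) / t \<sigma>\<rfloor>))" for x
    define B where "B = {- int k..int k} \<times> {- int k..int k}"
    have fl: "\<lfloor>real k * v / t \<sigma>\<rfloor> \<in> {- int k..int k}" if "\<sigma> \<in> embs" "\<bar>v\<bar> \<le> t \<sigma>" for v \<sigma>
    proof -
      have "\<bar>v / t \<sigma>\<bar> \<le> 1" using that t0[OF that(1)] by simp
      hence "real k * \<bar>v / t \<sigma>\<bar> \<le> real k" by (intro mult_left_le) auto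
      moreover have "\<bar>real k * v / t \<sigma>\<bar> = real k * \<bar>v / t \<sigma>\<bar>"
        by (simp only: times_divide_eq_right[symmetric] abs_mult abs_of_nat)
      ultimately have "- real k \<le> real k * v / t \<sigma>" "real k * v / t \<sigma> \<le> real k" by linarith+
      thus ?thesis by (simp add: le_floor_iff floor_le_iff)
    qed
    have "cell x \<in> (\<Pi>\<^sub>E \<sigma>\<in>embs. B)" if "x \<in> A" for x
    proof -
      have "\<bar>Re (\<sigma> (f x))\<bar> \<le> t \<sigma> \<and> \<bar>Im (\<sigma> (f x))\<bar> \<le> t \<sigma>" if s: "\<sigma> \<in> embs" for \<sigma>
        using f(3)[of x \<sigma>] s \<open>x \<in> A\<close> A abs_Re_le_cmod[of "\<sigma> (f x)"] abs_Im_le_cmod[of "\<sigma> (f x)"]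
        unfolding t_def by (auto intro: order_trans)
      thus ?thesis unfolding cell_def B_def using fl by (auto simp: mem_Times_iff)
    qed
    hence sub: "cell ` A \<subseteq> (\<Pi>\<^sub>E \<sigma>\<in>embs. B)" by auto
    have close: "\<bar>a - b\<bar> \<le> t \<sigma> / real k" if "\<lfloor>real k * a / t \<sigma>\<rfloor> = \<lfloor>real k * b / t \<sigma>\<rfloor>" "\<sigma> \<in> embs" for a b \<sigma>
    proof -
      have "\<bar>real k * a / t \<sigma> - real k * b / t \<sigma>\<bar> < 1" using that(1) by linarith
      moreover have "\<bar>real k * a / t \<sigma> - real k * b / t \<sigma>\<bar> = \<bar>a - b\<bar> * real k / t \<sigma>"
        using t0[OF that(2)] by (simp add: abs_mult flip: diff_divide_distrib right_diff_distrib)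
      ultimately have "\<bar>a - b\<bar> * real k < t \<sigma>" using t0[OF that(2)] by (simp add: divide_less_eq)
      thus ?thesis using k0 by (simp add: pos_le_divide_eq)
    qed
    have "inj_on cell A"
    proof (rule inj_onI, rule ccontr)
      fix x y assume xy: "x \<in> A" "y \<in> A" "cell x = cell y" "x \<noteq> y"
      define w where "w = f x - f y"
      have fK: "f x \<in> K" "f y \<in> K" using f(1) A xy ints_K by auto
      have "w \<noteq> 0" using f_inj xy by (auto simp: w_def)
      moreover have "w \<in> ints" unfolding w_def using f(1) A xy by (intro subring_on_diff[OF subring_ints]) auto
      ultimately have "norm_abs w \<ge> 1" by (rule norm_abs_ge_1[rotated])
      have "cmod (\<sigma> w) \<le> (2 * c / real k) * cmod (\<sigma> \<mu>)" if s: "\<sigma> \<in> embs" for \<sigma>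
      proof -
        have "cmod (\<sigma> w) \<le> \<bar>Re (\<sigma> (f x)) - Re (\<sigma> (f y))\<bar> + \<bar>Im (\<sigma> (f x)) - Im (\<sigma> (f y))\<bar>"
          using cmod_le[of "\<sigma> w"] ring_hom_on_diff[OF embs_hom[OF s] fK] by (simp add: w_def)
        also have "\<dots> \<le> t \<sigma> / real k + t \<sigma> / real k"
          using fun_cong[OF xy(3), of \<sigma>] s by (intro add_mono close) (auto simp: cell_def)
        finally show ?thesis by (simp add: t_def mult_ac)
      qed
      hence "norm_abs w \<le> (\<Prod>\<sigma>\<in>embs. (2 * c / real k) * cmod (\<sigma> \<mu>))"
        unfolding norm_abs_def by (intro prod_mono) auto
      also have "\<dots> = (2 * c / real k) ^ e * norm_abs \<mu>"
        unfolding norm_abs_def prod.distrib prod_constant e_def ..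
      also have "\<dots> = (2 * c * R / real k) ^ e"
        unfolding R(1)[symmetric] by (simp add: power_mult_distrib power_divide)
      also have "\<dots> < 1"
        using k c1 R(2) e0 by (intro power_Suc_less_one[of _ "e - 1", simplified] power_less_one_iff[THEN iffD2]) (auto simp: divide_simps)
      finally show False using \<open>norm_abs w \<ge> 1\<close> by simp
    qed
    have finB: "finite (\<Pi>\<^sub>E \<sigma>\<in>embs. B)" using finite_embs by (intro finite_PiE) (auto simp: B_def)
    have "finite A" using finite_imageD[OF finite_subset[OF sub finB] \<open>inj_on cell A\<close>] .
    moreover have "card A \<le> card (\<Pi>\<^sub>E \<sigma>\<in>embs. B)"
      using card_inj_on_le[OF \<open>inj_on cell A\<close> sub finB] .
    moreover have "card (\<Pi>\<^sub>E \<sigma>\<in>embs. B) = ((2 * k + 1) * (2 * k + 1)) ^ e"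
    proof -
      \<comment> \<open>A coordinate divided by \<open>t \<sigma>\<close> may reach both ends of the
        interval from \<open>-1\<close> to \<open>1\<close>, hence \<open>2 * k + 1\<close> values
        of the floor.\<close>
      have "card {- int k..int k} = nat (int (2 * k + 1))" by simp
      hence "card {- int k..int k} = 2 * k + 1" by (simp only: nat_int)
      hence "card B = (2 * k + 1) * (2 * k + 1)" unfolding B_def card_cartesian_product by simp
      thus ?thesis using finite_embs by (simp only: card_PiE prod_constant e_def)
    qed
    ultimately have fin: "finite A" and le: "card A \<le> ((2 * k + 1) * (2 * k + 1)) ^ e" by auto
    have sq: "real ((2 * k + 1) * (2 * k + 1)) = (2 * real k + 1)\<^sup>2"
      by (simp add: power2_eq_square algebra_simps)
    have "real (card A) \<le> real (((2 * k + 1) * (2 * k + 1)) ^ e)" using le by (simp only: of_nat_le_iff)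
    also have "\<dots> = (2 * real k + 1) ^ (2 * e)" by (simp only: of_nat_power sq power_mult)
    \<comment> \<open>The \<open>7\<close> in \<open>C\<close> comes from
      \<open>2 * k + 1 \<le> 7 * c * R\<close>, which uses \<open>k \<le> 3 * c * R\<close> and
      \<open>1 \<le> c * R\<close>.\<close>
    also have "\<dots> \<le> (7 * c * R) ^ (2 * e)" using k cR by (intro power_mono) auto
    also have "\<dots> = C * (norm_abs \<mu>)\<^sup>2"
      unfolding R(1)[symmetric] C_def by (simp add: power_mult_distrib mult.commute flip: power_mult)
    finally show ?thesis using fin by simp
  qed
  note key = this
  show ?thesis
  proof (intro exI[of _ C] conjI ballI allI impI)
    show "C \<ge> 1" by fact
    fix \<mu> A assume "\<mu> \<in> ints - {0}" "A \<subseteq> ints" "\<forall>x\<in>A. \<forall>y\<in>A. x \<noteq> y \<longrightarrow> (x - y) / \<mu> \<notin> ints"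
    thus "finite A" "real (card A) \<le> C * (norm_abs \<mu>)\<^sup>2" using key[of \<mu> A] by blast+
  qed
qed

section \<open>Consequences of the finiteness of residue rings\<close>

lemma congruent_pair:
  assumes "\<mu> \<in> ints" "\<mu> \<noteq> 0" "\<And>n::nat. f n \<in> ints"
  shows "\<exists>i j. i < j \<and> (f i - f j) / \<mu> \<in> ints"
proof (rule ccontr)
  assume no: "\<not> ?thesis"
  have neg: "(f i - f j) / \<mu> \<notin> ints" if "i \<noteq> j" for i j
  proof (cases "i < j")
    case False
    hence "(f j - f i) / \<mu> \<notin> ints" using no that by auto
    thus ?thesis using ints_div_commute[of "f i" "f j"] by simp
  qed (use no in auto)
  have inj: "inj f"
    using neg subring_on_0[OF subring_ints] by (auto simp: inj_def) (metis diff_self div_0)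
  obtain C where "\<forall>\<mu>\<in>ints - {0}. \<forall>A\<subseteq>ints. (\<forall>x\<in>A. \<forall>y\<in>A. x \<noteq> y \<longrightarrow> (x - y) / \<mu> \<notin> ints) \<longrightarrow>
     finite A \<and> real (card A) \<le> C * (norm_abs \<mu>)\<^sup>2" using card_incongruent_le by blast
  moreover have "range f \<subseteq> ints" "\<forall>x\<in>range f. \<forall>y\<in>range f. x \<noteq> y \<longrightarrow> (x - y) / \<mu> \<notin> ints"
    using neg assms(3) by (auto, metis)
  ultimately have "finite (range f)" using assms(1,2) by blast
  thus False using inj finite_imageD[of f UNIV] by auto
qed

text \<open>Two of the integers \<open>\<delta> * x ^ k\<close> are congruent modulo
  \<open>\<delta>\<close>. So \<open>x ^ i - x ^ j\<close> is integral for some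
  \<open>i < j\<close>, which is a monic equation for \<open>x\<close>.\<close>

lemma completely_integrally_closed:
  assumes x: "x \<in> K" and "\<delta> \<in> ints" "\<delta> \<noteq> 0" "\<And>k. \<delta> * x ^ k \<in> ints"
  shows "x \<in> ints"
proof -
  obtain i j :: nat where ij: "i < j" "(\<delta> * x ^ i - \<delta> * x ^ j) / \<delta> \<in> ints"
    using congruent_pair[OF assms(2,3), of "\<lambda>k. \<delta> * x ^ k"] assms(4) by blast
  define w where "w = x ^ i - x ^ j"
  have "(\<delta> * x ^ i - \<delta> * x ^ j) / \<delta> = w" using assms(3) by (simp add: w_def flip: right_diff_distrib)
  hence w: "w \<in> ints" using ij by simp
  define r where "r = monom (-1) i + [:w:]"
  have dr: "degree r < j"
    unfolding r_def using ij degree_monom_le[of "-1::complex" i] by (intro degree_add_less) auto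
  have "algebraic_int x"
  proof (rule algebraic_int_monic_root)
    show "poly (monom 1 j + r) x = 0" by (simp add: r_def poly_monom w_def)
    have "degree (monom 1 j + r) = j"
      using degree_add_eq_left[of r "monom 1 j"] dr by (simp add: degree_monom_eq)
    thus "lead_coeff (monom 1 j + r) = 1" using dr by (simp add: coeff_eq_0)
    show "monom 1 j + r \<in> polys_over {x. algebraic_int x}"
      unfolding r_def using w
      by (intro subring_on_add[OF subring_on_polys_over[OF subring_on_algebraic_int]]
          monom_in_polys_over const_in_polys_over subring_on_algebraic_int)
        (auto simp: ints_def int_imp_algebraic_int)
  qed
  thus ?thesis using x by (simp add: ints_def)
qed

definition prime_ideal :: "complex set \<Rightarrow> bool" where
  "prime_ideal P \<longleftrightarrow> prime_ideal_on ints P \<and> P \<noteq> {0}"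

lemma prime_ideal_nonzero: "prime_ideal P \<Longrightarrow> \<exists>\<alpha>\<in>P. \<alpha> \<noteq> 0"
  using prime_ideal_onD(3)[of ints P] by (auto simp: prime_ideal_def)

text \<open>Nonzero primes are maximal: modulo a nonzero element of \<open>P\<close> the powers of
  \<open>y\<close> repeat, and primality turns this into \<open>y ^ (j - i) - 1\<close> lying in
  \<open>P\<close>.\<close>

lemma prime_inverse_mod:
  assumes P: "prime_ideal P" and y: "y \<in> ints" "y \<notin> P"
  shows "\<exists>z\<in>ints. z * y - 1 \<in> P"
proof -
  have Z: "prime_ideal_on ints P" using P by (simp add: prime_ideal_def)
  obtain \<alpha> where \<alpha>: "\<alpha> \<in> P" "\<alpha> \<noteq> 0" using prime_ideal_nonzero[OF P] by auto
  have "\<alpha> \<in> ints" using \<alpha> prime_ideal_onD(2)[OF Z] by auto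
  then obtain i j :: nat where ij: "i < j" "(y ^ i - y ^ j) / \<alpha> \<in> ints"
    using congruent_pair[OF _ \<alpha>(2), of "\<lambda>k. y ^ k"] subring_on_power[OF subring_ints y(1)] by blast
  have "(y ^ i - y ^ j) / \<alpha> * \<alpha> \<in> P" by (rule prime_ideal_onD(6)[OF Z ij(2) \<alpha>(1)])
  hence "y ^ i - y ^ j \<in> P" using \<alpha> by simp
  moreover have "y ^ j = y ^ i * y ^ (j - i)" using ij(1) by (simp flip: power_add)
  ultimately have "y ^ i * (1 - y ^ (j - i)) \<in> P" by (simp add: right_diff_distrib)
  hence "y ^ i \<in> P \<or> 1 - y ^ (j - i) \<in> P"
    using y(1) subring_on_1[OF subring_ints]
    by (intro prime_ideal_onD(8)[OF Z] subring_on_diff[OF subring_ints] subring_on_power[OF subring_ints])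
  hence "1 - y ^ (j - i) \<in> P" using prime_ideal_on_power[OF Z y(1)] y(2) by blast
  hence "y ^ (j - i) - 1 \<in> P" using prime_ideal_on_uminus[OF Z] by fastforce
  moreover have "y ^ (j - i) = y ^ (j - i - 1) * y" using ij(1) by (simp only: power_minus_mult zero_less_diff)
  ultimately show ?thesis using subring_on_power[OF subring_ints y(1)] by (intro bexI[of _ "y ^ (j - i - 1)"]) auto
qed

text \<open>
  A prime is the annihilator of a residue class \<open>\<beta>\<close> modulo any of its nonzero elements \<open>\<alpha>\<close>; then
  \<open>q = \<beta> / \<alpha>\<close> detects membership in \<open>P\<close> and, through its powers, in the powers of \<open>P\<close>.
\<close>

lemma prime_detector:
  assumes P: "prime_ideal P"
  shows "\<exists>q\<in>K. q \<notin> ints \<and> (\<forall>x\<in>ints. q * x \<in> ints \<longleftrightarrow> x \<in> P)"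
proof -
  have Z: "prime_ideal_on ints P" using P by (simp add: prime_ideal_def)
  note PO = prime_ideal_onD(2)[OF Z]
  obtain \<alpha> where \<alpha>: "\<alpha> \<in> P" "\<alpha> \<noteq> 0" using prime_ideal_nonzero[OF P] by auto
  have \<alpha>O: "\<alpha> \<in> ints" using \<alpha> PO by auto
  \<comment> \<open>\<open>W \<beta>\<close> says that the annihilator of \<open>\<beta>\<close>
    modulo \<open>\<alpha>\<close> is contained in \<open>P\<close>.\<close>
  define W where "W \<beta> \<longleftrightarrow> \<beta> \<in> ints \<and> (\<forall>x\<in>ints - P. x * \<beta> / \<alpha> \<notin> ints)" for \<beta>
  have W1: "W 1"
    unfolding W_def using subring_on_1[OF subring_ints] prime_ideal_onD(6)[OF Z _ \<alpha>(1)] \<alpha>(2)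
    by auto (metis nonzero_eq_divide_eq)
  \<comment> \<open>\<open>\<beta>\<close> is to allow no further multiplication by elements of
    \<open>P\<close>. An endless sequence of such multiplications would contain two congruent terms
    \<open>b i\<close> and \<open>b i * y\<close> with \<open>y\<close> in \<open>P\<close>; then
    \<open>1 - y\<close>, which is outside \<open>P\<close>, would annihilate
    \<open>b i\<close>.\<close>
  have "\<exists>\<beta>. W \<beta> \<and> (\<forall>y\<in>P. \<not> W (\<beta> * y))"
  proof (rule ccontr)
    assume "\<not> ?thesis"
    hence "\<forall>\<beta>. \<exists>y. W \<beta> \<longrightarrow> y \<in> P \<and> W (\<beta> * y)" by blast
    then obtain g where g: "\<And>\<beta>. W \<beta> \<Longrightarrow> g \<beta> \<in> P \<and> W (\<beta> * g \<beta>)" by metis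
    define b where "b n = ((\<lambda>\<beta>. \<beta> * g \<beta>) ^^ n) 1" for n
    have b: "W (b n)" for n unfolding b_def by (induction n) (use W1 g in auto)
    have mult: "\<exists>y\<in>P. b (Suc (n + k)) = b n * y" for n k
    proof (induction k)
      case 0 show ?case using g[OF b[of n]] by (auto simp: b_def)
    next
      case (Suc k)
      then obtain y where y: "y \<in> P" "b (Suc (n + k)) = b n * y" by blast
      have "b (Suc (n + Suc k)) = b (Suc (n + k)) * g (b (Suc (n + k)))" by (simp add: b_def)
      moreover have "y * g (b (Suc (n + k))) \<in> P" using y(1) g[OF b] PO by (intro prime_ideal_onD(6)[OF Z]) auto
      ultimately show ?case using y(2) by (intro bexI[of _ "y * g (b (Suc (n + k)))"]) (auto simp: mult.assoc)
    qed
    obtain i j :: nat where ij: "i < j" "(b i - b j) / \<alpha> \<in> ints"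
      using congruent_pair[OF \<alpha>O \<alpha>(2), of b] b by (auto simp: W_def)
    obtain y where y: "y \<in> P" "b j = b i * y" using mult[of i "j - i - 1"] ij(1) by auto
    have "(1 - y) * b i / \<alpha> \<in> ints" using ij(2) y(2) by (simp add: algebra_simps)
    moreover have "1 - y \<notin> P"
      using prime_ideal_on_add[OF Z _ y(1), of "1 - y"] prime_ideal_onD(4)[OF Z] by auto
    moreover have "1 - y \<in> ints" using y PO subring_on_1[OF subring_ints] by (intro subring_on_diff[OF subring_ints]) auto
    ultimately show False using b[of i] by (auto simp: W_def)
  qed
  then obtain \<beta> where \<beta>: "W \<beta>" "\<And>y. y \<in> P \<Longrightarrow> \<not> W (\<beta> * y)" by blast
  have \<beta>O: "\<beta> \<in> ints" using \<beta> by (simp add: W_def)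
  have "\<exists>x\<in>ints - P. x * (\<beta> * y) / \<alpha> \<in> ints" if "y \<in> P" for y
  proof -
    have "\<beta> * y \<in> ints" using \<beta>O PO that by (intro subring_on_mult[OF subring_ints]) auto
    thus ?thesis using \<beta>(2)[OF that] by (auto simp: W_def)
  qed
  then obtain h where h: "\<And>y. y \<in> P \<Longrightarrow> h y \<in> ints \<and> h y \<notin> P \<and> h y * (\<beta> * y) / \<alpha> \<in> ints" by (metis DiffE)
  have "\<exists>R\<subseteq>P. finite R \<and> (\<forall>y\<in>P. \<exists>r\<in>R. (y - r) / \<alpha> \<in> ints)"
  proof -
    define S where "S A \<longleftrightarrow> A \<subseteq> P \<and> (\<forall>x\<in>A. \<forall>y\<in>A. x \<noteq> y \<longrightarrow> (x - y) / \<alpha> \<notin> ints)" for A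
    obtain C' where "\<forall>\<mu>\<in>ints - {0}. \<forall>A\<subseteq>ints. (\<forall>x\<in>A. \<forall>y\<in>A. x \<noteq> y \<longrightarrow> (x - y) / \<mu> \<notin> ints) \<longrightarrow>
       finite A \<and> real (card A) \<le> C' * (norm_abs \<mu>)\<^sup>2" using card_incongruent_le by blast
    moreover define C where "C = C' * (norm_abs \<alpha>)\<^sup>2"
    ultimately have C: "finite A \<and> real (card A) \<le> C" if "S A" for A
      using that \<alpha>O \<alpha>(2) PO unfolding S_def C_def by blast
    have "S {}" by (simp add: S_def)
    moreover have "\<forall>A. S A \<longrightarrow> card A < Suc (nat \<lfloor>C\<rfloor>)" using C by (simp add: le_nat_floor less_Suc_eq_le)
    ultimately obtain R where R: "S R" "\<And>A. S A \<Longrightarrow> card A \<le> card R"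
      using ex_has_greatest_nat[of S "{}" card "Suc (nat \<lfloor>C\<rfloor>)"] by auto
    have "\<exists>r\<in>R. (y - r) / \<alpha> \<in> ints" if y: "y \<in> P" for y
    proof (rule ccontr)
      assume no: "\<not> ?thesis"
      have "y \<notin> R" using no subring_on_0[OF subring_ints] by auto
      have "(r - y) / \<alpha> \<notin> ints" if "r \<in> R" for r
        using no that ints_div_commute[of r y] by auto
      hence "S (insert y R)" using no R(1) y by (auto simp: S_def)
      thus False using R(2)[of "insert y R"] C[OF R(1)] \<open>y \<notin> R\<close> by simp
    qed
    thus ?thesis using R(1) C[OF R(1)] unfolding S_def by blast
  qed
  then obtain R where R: "R \<subseteq> P" "finite R" "\<And>y. y \<in> P \<Longrightarrow> \<exists>r\<in>R. (y - r) / \<alpha> \<in> ints" by blast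
  \<comment> \<open>One multiplier outside \<open>P\<close> for all of \<open>P\<close>: each
    \<open>h r\<close> annihilates \<open>\<beta> * r\<close> modulo \<open>\<alpha>\<close>, and
    every element of \<open>P\<close> is congruent modulo \<open>\<alpha>\<close> to one of the
    finitely many \<open>r\<close>.\<close>
  define x where "x = (\<Prod>r\<in>R. h r)"
  have x: "x \<in> ints \<and> x \<notin> P"
    unfolding x_def using R(2,1)
  proof (induction R rule: finite_induct)
    case (insert r R)
    thus ?case using h[of r] prime_ideal_onD(8)[OF Z, of "h r" "\<Prod>r\<in>R. h r"]
      by (auto intro: subring_on_mult[OF subring_ints])
  qed (use subring_on_1[OF subring_ints] prime_ideal_onD(4)[OF Z] in auto)
  define q where "q = x * \<beta> / \<alpha>"
  have "q * y \<in> ints \<longleftrightarrow> y \<in> P" if y: "y \<in> ints" for y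
  proof
    assume "q * y \<in> ints"
    hence "(x * y) * \<beta> / \<alpha> \<in> ints" by (simp add: q_def mult_ac)
    hence "x * y \<in> P" using \<beta>(1) x y subring_on_mult[OF subring_ints, of x y] by (auto simp: W_def)
    thus "y \<in> P" using prime_ideal_onD(8)[OF Z, of x y] x y by blast
  next
    assume yP: "y \<in> P"
    obtain r where r: "r \<in> R" "(y - r) / \<alpha> \<in> ints" using R(3)[OF yP] by blast
    have "x = (\<Prod>r\<in>R - {r}. h r) * h r" using R(2) r(1) by (simp add: x_def prod.remove mult.commute)
    moreover have "(\<Prod>r\<in>R - {r}. h r) \<in> ints"
      using h R(1) by (intro subring_on_prod[OF subring_ints]) auto
    ultimately obtain x' where x': "x' \<in> ints" "x = x' * h r" by blast
    have "q * y = x' * (h r * (\<beta> * r) / \<alpha>) + x * \<beta> * ((y - r) / \<alpha>)"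
      using \<alpha>(2) by (simp add: q_def x'(2) field_simps)
    also have "\<dots> \<in> ints"
      using x' h[of r] r R(1) x \<beta>O
      by (intro subring_on_add[OF subring_ints] subring_on_mult[OF subring_ints]) auto
    finally show "q * y \<in> ints" .
  qed
  moreover have "q \<in> K" unfolding q_def divide_inverse
    using x \<beta>O \<alpha>O by (intro subring_on_mult[OF subring] inverse_closed ints_K) auto
  moreover have "q \<notin> ints"
    using calculation(1)[of 1] subring_on_1[OF subring_ints] prime_ideal_onD(4)[OF Z] by auto
  ultimately show ?thesis by blast
qed

text \<open>An element whose denominator ideal is exactly \<open>P\<close>: a pole of order one at
  \<open>P\<close> and no other pole.\<close>

definition detector :: "complex set \<Rightarrow> complex" where
  "detector P = (SOME q. q \<in> K \<and> q \<notin> ints \<and> (\<forall>x\<in>ints. q * x \<in> ints \<longleftrightarrow> x \<in> P))"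

lemma detector:
  assumes "prime_ideal P"
  shows "detector P \<in> K" "detector P \<notin> ints" "x \<in> ints \<Longrightarrow> detector P * x \<in> ints \<longleftrightarrow> x \<in> P"
proof -
  have "\<exists>q. q \<in> K \<and> q \<notin> ints \<and> (\<forall>x\<in>ints. q * x \<in> ints \<longleftrightarrow> x \<in> P)"
    using prime_detector[OF assms] by blast
  from someI_ex[OF this] show "detector P \<in> K" "detector P \<notin> ints" "x \<in> ints \<Longrightarrow> detector P * x \<in> ints \<longleftrightarrow> x \<in> P"
    unfolding detector_def by blast+
qed

text \<open>Membership in the \<open>m\<close>-th power of \<open>P\<close>, expressed without ideal
  products; \<open>ideal_power_iff\<close> shows the agreement.\<close>

definition in_power :: "complex set \<Rightarrow> nat \<Rightarrow> complex \<Rightarrow> bool" where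
  "in_power P m x \<longleftrightarrow> x \<in> ints \<and> detector P ^ m * x \<in> ints"

lemma in_power_0: "in_power P 0 x \<longleftrightarrow> x \<in> ints"
  by (simp add: in_power_def)

text \<open>With \<open>q\<close> the detector, \<open>q ^ m * x\<close> is integral because its
  power \<open>(q ^ m * x) ^ Suc m\<close> equals \<open>(q ^ Suc m * x) ^ m * x\<close>, a product
  of integers.\<close>

lemma in_power_mono:
  assumes P: "prime_ideal P" and "in_power P n x" "m \<le> n"
  shows "in_power P m x"
proof -
  have "in_power P m x" if "in_power P (Suc m) x" for m
  proof -
    let ?q = "detector P"
    have x: "x \<in> ints" "?q ^ Suc m * x \<in> ints" using that by (auto simp: in_power_def)
    have "(?q ^ m * x) ^ Suc m = (?q ^ Suc m * x) ^ m * x"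
      by (simp add: power_mult_distrib mult_ac flip: power_mult)
    also have "\<dots> \<in> ints" by (intro subring_on_mult[OF subring_ints] subring_on_power[OF subring_ints] x)
    finally have "algebraic_int ((?q ^ m * x) ^ Suc m)" by (simp add: ints_def)
    hence "algebraic_int (?q ^ m * x)" by (rule algebraic_int_power_root) simp
    moreover have "?q ^ m * x \<in> K"
      using detector(1)[OF P] ints_K[OF x(1)] by (intro subring_on_mult[OF subring] subring_on_power[OF subring])
    ultimately show ?thesis using x by (simp add: in_power_def ints_def)
  qed
  thus ?thesis using assms(2,3) by (induction n) (auto simp: le_Suc_eq)
qed
end

context number_ring
begin

lemma in_power_mult:
  assumes "in_power P m x" "r \<in> ints" shows "in_power P m (x * r)"
  using assms subring_on_mult[OF subring_ints] by (auto simp: in_power_def simp flip: mult.assoc)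

lemma in_power_diff:
  assumes "in_power P m x" "in_power P m y" shows "in_power P m (x - y)"
  using assms subring_on_diff[OF subring_ints] by (auto simp: in_power_def right_diff_distrib)

text \<open>Otherwise \<open>x\<close> would be a common denominator of all powers of the detector,
  which would then be integral.\<close>

lemma in_power_bounded:
  assumes P: "prime_ideal P" and x: "x \<in> ints" "x \<noteq> 0"
  shows "\<exists>N. \<forall>m. in_power P m x \<longrightarrow> m \<le> N"
proof (rule ccontr)
  assume "\<not> ?thesis"
  hence "\<exists>m>n. in_power P m x" for n by (meson not_le)
  hence "in_power P n x" for n using in_power_mono[OF P] by (meson less_imp_le)
  hence "x * detector P ^ n \<in> ints" for n by (simp add: in_power_def mult.commute)
  hence "detector P \<in> ints" using completely_integrally_closed[OF detector(1)[OF P] x] by blast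
  thus False using detector(2)[OF P] by simp
qed

section \<open>Valuations of integers\<close>

definition val :: "complex set \<Rightarrow> complex \<Rightarrow> nat" where
  "val P x = (GREATEST m. in_power P m x)"

lemma in_power_iff_val:
  assumes P: "prime_ideal P" and x: "x \<in> ints" "x \<noteq> 0"
  shows "in_power P m x \<longleftrightarrow> m \<le> val P x"
proof -
  obtain N where N: "\<And>m. in_power P m x \<Longrightarrow> m \<le> N" using in_power_bounded[OF assms] by blast
  have "in_power P (val P x) x" unfolding val_def
    using x N by (intro GreatestI_nat[of "\<lambda>m. in_power P m x" 0 N]) (auto simp: in_power_0)
  moreover have "m \<le> val P x" if "in_power P m x"
    unfolding val_def using N that by (intro Greatest_le_nat[of "\<lambda>m. in_power P m x" m N]) auto
  ultimately show ?thesis using in_power_mono[OF P] by blast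
qed

lemma val_unique:
  assumes P: "prime_ideal P" and "in_power P m x" "\<not> in_power P (Suc m) x"
  shows "val P x = m"
proof -
  have x: "x \<in> ints" "x \<noteq> 0"
    using assms subring_on_0[OF subring_ints] by (auto simp: in_power_def)
  show ?thesis using in_power_iff_val[OF P x] assms(2,3) by (metis le_antisym not_less_eq_eq)
qed

text \<open>The residue class of this product modulo \<open>P\<close> acts as the leading
  coefficient of \<open>x\<close> at \<open>P\<close>; it is nonzero.\<close>

lemma leading_part:
  assumes P: "prime_ideal P" and "in_power P m x" "\<not> in_power P (Suc m) x"
  shows "detector P ^ m * x \<in> ints" "detector P ^ m * x \<notin> P"
proof -
  show w: "detector P ^ m * x \<in> ints" using assms(2) by (simp add: in_power_def)
  have "detector P * (detector P ^ m * x) \<notin> ints"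
    using assms(2,3) by (simp add: in_power_def mult.assoc)
  thus "detector P ^ m * x \<notin> P" using detector(3)[OF P w] by simp
qed

text \<open>Multiplication by an element of exact valuation \<open>m\<close> shifts the filtration
  by \<open>m\<close>: it embeds the residue ring of \<open>P\<close> into the quotient of two
  consecutive powers of \<open>P\<close>.\<close>

lemma in_power_Suc_mult_iff:
  assumes P: "prime_ideal P" and z: "in_power P m z" "\<not> in_power P (Suc m) z" and r: "r \<in> ints"
  shows "in_power P (Suc m) (z * r) \<longleftrightarrow> r \<in> P"
proof -
  have Z: "prime_ideal_on ints P" using P by (simp add: prime_ideal_def)
  note w = leading_part[OF P z]
  let ?w = "detector P ^ m * z"
  have wr: "?w * r \<in> ints" using w(1) r by (rule subring_on_mult[OF subring_ints])
  have "z * r \<in> ints" using z(1) r by (auto simp: in_power_def intro: subring_on_mult[OF subring_ints])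
  hence "in_power P (Suc m) (z * r) \<longleftrightarrow> detector P * (?w * r) \<in> ints"
    by (simp add: in_power_def mult_ac)
  also have "\<dots> \<longleftrightarrow> ?w * r \<in> P" by (rule detector(3)[OF P wr])
  also have "\<dots> \<longleftrightarrow> r \<in> P"
    using prime_ideal_onD(8)[OF Z w(1) r] prime_ideal_onD(6)[OF Z w(1)] w(2) by blast
  finally show ?thesis .
qed

text \<open>The leading parts multiply, and their product stays outside the prime
  \<open>P\<close>.\<close>

lemma val_mult:
  assumes P: "prime_ideal P" and x: "x \<in> ints" "x \<noteq> 0" and y: "y \<in> ints" "y \<noteq> 0"
  shows "val P (x * y) = val P x + val P y"
proof -
  have Z: "prime_ideal_on ints P" using P by (simp add: prime_ideal_def)
  have vx: "in_power P (val P x) x" "\<not> in_power P (Suc (val P x)) x" using in_power_iff_val[OF P x] by auto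
  have vy: "in_power P (val P y) y" "\<not> in_power P (Suc (val P y)) y" using in_power_iff_val[OF P y] by auto
  note wx = leading_part[OF P vx] and wy = leading_part[OF P vy]
  let ?w = "(detector P ^ val P x * x) * (detector P ^ val P y * y)"
  have w: "?w \<in> ints" by (rule subring_on_mult[OF subring_ints wx(1) wy(1)])
  have wP: "?w \<notin> P" using prime_ideal_onD(8)[OF Z wx(1) wy(1)] wx wy by blast
  have e: "detector P ^ (val P x + val P y) * (x * y) = ?w" by (simp add: power_add mult_ac)
  have xy: "x * y \<in> ints" using x y by (intro subring_on_mult[OF subring_ints])
  have "detector P ^ Suc (val P x + val P y) * (x * y) = detector P * ?w"
    by (simp only: power_Suc mult.assoc[of "detector P"] e)
  hence "\<not> in_power P (Suc (val P x + val P y)) (x * y)"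
    using detector(3)[OF P w] wP xy by (simp only: in_power_def) simp
  moreover have "in_power P (val P x + val P y) (x * y)" using w xy by (simp only: in_power_def e)
  ultimately show ?thesis by (intro val_unique[OF P])
qed

lemma val_1: "prime_ideal P \<Longrightarrow> val P 1 = 0"
  using subring_on_1[OF subring_ints] val_mult[of P 1 1] by simp

lemma val_power:
  assumes P: "prime_ideal P" and x: "x \<in> ints" "x \<noteq> 0"
  shows "val P (x ^ n) = n * val P x"
  by (induction n) (use x in \<open>auto simp: val_1[OF P] val_mult[OF P] subring_on_power[OF subring_ints]\<close>)

lemma val_prod:
  assumes P: "prime_ideal P" and "finite I" "\<And>i. i \<in> I \<Longrightarrow> f i \<in> ints \<and> f i \<noteq> 0"
  shows "val P (\<Prod>i\<in>I. f i) = (\<Sum>i\<in>I. val P (f i))"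
  using assms(2,3)
proof (induction I rule: finite_induct)
  case (insert i I)
  have "(\<Prod>i\<in>I. f i) \<in> ints" "(\<Prod>i\<in>I. f i) \<noteq> 0"
    using insert by (auto intro: subring_on_prod[OF subring_ints])
  thus ?case using insert by (simp add: val_mult[OF P])
qed (simp add: val_1[OF P])

text \<open>If the detector mapped \<open>P\<close> into itself, all its powers would have a common
  denominator and it would be integral.\<close>

lemma uniformizer:
  assumes P: "prime_ideal P"
  shows "\<exists>\<pi>\<in>ints. \<pi> \<noteq> 0 \<and> val P \<pi> = 1"
proof -
  have Z: "prime_ideal_on ints P" using P by (simp add: prime_ideal_def)
  note PO = prime_ideal_onD(2)[OF Z]
  have "\<exists>\<pi>\<in>P. detector P * \<pi> \<notin> P"
  proof (rule ccontr)
    assume no: "\<not> ?thesis"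
    obtain \<alpha> where \<alpha>: "\<alpha> \<in> P" "\<alpha> \<noteq> 0" using prime_ideal_nonzero[OF P] by auto
    have "detector P ^ k * \<alpha> \<in> P" for k
      by (induction k) (use no \<alpha> in \<open>auto simp: mult.assoc\<close>)
    hence "\<alpha> * detector P ^ k \<in> ints" for k using PO by (auto simp: mult.commute)
    hence "detector P \<in> ints" using \<alpha> PO by (intro completely_integrally_closed[OF detector(1)[OF P], of \<alpha>]) auto
    thus False using detector(2)[OF P] by simp
  qed
  then obtain \<pi> where \<pi>: "\<pi> \<in> P" "detector P * \<pi> \<notin> P" by blast
  have O: "\<pi> \<in> ints" "detector P * \<pi> \<in> ints" using \<pi> PO detector(3)[OF P, of \<pi>] by auto
  hence "detector P * (detector P * \<pi>) \<notin> ints" using detector(3)[OF P O(2)] \<pi>(2) by simp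
  hence "val P \<pi> = 1" using O by (intro val_unique[OF P]) (auto simp: in_power_def mult.assoc)
  moreover have "\<pi> \<noteq> 0" using \<pi>(2) prime_ideal_onD(3)[OF Z] by auto
  ultimately show ?thesis using O by blast
qed

lemma val_pos_iff:
  assumes P: "prime_ideal P" and x: "x \<in> ints" "x \<noteq> 0"
  shows "val P x > 0 \<longleftrightarrow> x \<in> P"
  using in_power_iff_val[OF P x, of 1] detector(3)[OF P x(1)] x by (auto simp: in_power_def)

text \<open>\<open>Q\<close> is maximal, so it cannot lie inside a different \<open>P\<close>;
  \<open>w\<close> is any element of \<open>Q\<close> outside \<open>P\<close>.\<close>

lemma distinct_primes:
  assumes P: "prime_ideal P" and Q: "prime_ideal Q" and "P \<noteq> Q"
  shows "\<exists>w\<in>ints. w \<noteq> 0 \<and> val Q w > 0 \<and> val P w = 0"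
proof -
  have ZP: "prime_ideal_on ints P" and ZQ: "prime_ideal_on ints Q" using P Q by (auto simp: prime_ideal_def)
  have "\<not> Q \<subseteq> P"
  proof
    assume sub: "Q \<subseteq> P"
    then obtain y where y: "y \<in> P" "y \<notin> Q" using assms(3) by blast
    have yO: "y \<in> ints" using y prime_ideal_onD(2)[OF ZP] by auto
    obtain z where z: "z \<in> ints" "z * y - 1 \<in> Q" using prime_inverse_mod[OF Q yO y(2)] by blast
    have "z * y \<in> P" by (rule prime_ideal_onD(6)[OF ZP z(1) y(1)])
    moreover have "z * y - 1 \<in> P" using z(2) sub by blast
    ultimately have "z * y - (z * y - 1) \<in> P" by (rule prime_ideal_onD(5)[OF ZP])
    thus False using prime_ideal_onD(4)[OF ZP] by simp
  qed
  then obtain w where w: "w \<in> Q" "w \<notin> P" by blast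
  have "w \<in> ints" "w \<noteq> 0" using w prime_ideal_onD(2)[OF ZQ] prime_ideal_onD(3)[OF ZP] by auto
  thus ?thesis using val_pos_iff[OF P] val_pos_iff[OF Q] w by (intro bexI[of _ w]) auto
qed

text \<open>Takes the place of the Chinese remainder theorem. The element is a power of a
  uniformizer at \<open>P0\<close> times powers of elements that are divisible by the other primes
  but not by \<open>P0\<close>.\<close>

lemma prescribed_valuation:
  assumes T: "finite T" "\<And>P. P \<in> T \<Longrightarrow> prime_ideal P" and P0: "P0 \<in> T"
  shows "\<exists>z\<in>ints. z \<noteq> 0 \<and> val P0 z = i \<and> (\<forall>P\<in>T - {P0}. e P \<le> val P z)"
proof -
  obtain \<pi> where \<pi>: "\<pi> \<in> ints" "\<pi> \<noteq> 0" "val P0 \<pi> = 1" using uniformizer[OF T(2)[OF P0]] by blast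
  have "\<exists>w\<in>ints. w \<noteq> 0 \<and> val P w > 0 \<and> val P0 w = 0" if "P \<in> T - {P0}" for P
    using distinct_primes[OF T(2)[OF P0] T(2), of P] that by auto
  then obtain w where w: "\<And>P. P \<in> T - {P0} \<Longrightarrow> w P \<in> ints \<and> w P \<noteq> 0 \<and> val P (w P) > 0 \<and> val P0 (w P) = 0" by metis
  define y where "y = (\<Prod>P\<in>T - {P0}. w P ^ e P)"
  have we: "w P ^ e P \<in> ints \<and> w P ^ e P \<noteq> 0" if "P \<in> T - {P0}" for P
    using w[OF that] subring_on_power[OF subring_ints] by auto
  have y: "y \<in> ints" "y \<noteq> 0"
    unfolding y_def using we T(1) by (auto intro!: subring_on_prod[OF subring_ints])
  have vy: "val P y = (\<Sum>Q\<in>T - {P0}. e Q * val P (w Q))" if "P \<in> T" for P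
    unfolding y_def using val_prod[OF T(2)[OF that], of "T - {P0}" "\<lambda>P. w P ^ e P"] T(1) we w
    by (simp add: val_power[OF T(2)[OF that]])
  have \<pi>i: "\<pi> ^ i \<in> ints" "\<pi> ^ i \<noteq> 0" using \<pi> subring_on_power[OF subring_ints] by auto
  have "val P0 (\<pi> ^ i * y) = i"
    using val_mult[OF T(2)[OF P0] \<pi>i y] val_power[OF T(2)[OF P0] \<pi>(1,2)] \<pi>(3) vy[OF P0] w by simp
  moreover have "e P \<le> val P (\<pi> ^ i * y)" if P: "P \<in> T - {P0}" for P
  proof -
    have "e P * 1 \<le> e P * val P (w P)" using w[OF P] by (intro mult_le_mono2) auto
    also have "\<dots> \<le> (\<Sum>Q\<in>T - {P0}. e Q * val P (w Q))"
      using P T(1) by (intro member_le_sum) auto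
    finally show ?thesis using val_mult[OF T(2) \<pi>i y, of P] vy[of P] P by simp
  qed
  moreover have "\<pi> ^ i * y \<in> ints" "\<pi> ^ i * y \<noteq> 0" using \<pi>i y by (auto intro: subring_on_mult[OF subring_ints])
  ultimately show ?thesis by blast
qed

text \<open>Induction on the total exponent: a system for the exponent \<open>i = e P0 - 1\<close>
  is refined by digits \<open>z * r\<close>. As \<open>z\<close> has valuation exactly
  \<open>i\<close> at \<open>P0\<close>, the class of \<open>r\<close> modulo \<open>P0\<close> can
  be recovered; at the other primes of \<open>T\<close> the digit is divisible by the required power
  and does not interfere.\<close>

lemma many_incongruent:
  assumes T: "finite T" "\<And>P. P \<in> T \<Longrightarrow> prime_ideal P"
    and R: "\<And>P. P \<in> T \<Longrightarrow> finite (R P) \<and> R P \<subseteq> ints"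
      "\<And>P r r'. P \<in> T \<Longrightarrow> r \<in> R P \<Longrightarrow> r' \<in> R P \<Longrightarrow> r - r' \<in> P \<Longrightarrow> r = r'"
  shows "\<exists>A\<subseteq>ints. finite A \<and> card A = (\<Prod>P\<in>T. card (R P) ^ e P) \<and>
     (\<forall>x\<in>A. \<forall>y\<in>A. (\<forall>P\<in>T. in_power P (e P) (x - y)) \<longrightarrow> x = y)"
proof (induction "\<Sum>P\<in>T. e P" arbitrary: e)
  case 0
  hence "\<forall>P\<in>T. e P = 0" using T(1) by simp
  thus ?case using subring_on_0[OF subring_ints] by (intro exI[of _ "{0}"]) auto
next
  case (Suc n)
  then obtain P0 where P0: "P0 \<in> T" "e P0 \<noteq> 0" by (metis Zero_not_Suc sum.neutral)
  define i where "i = e P0 - 1"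
  have i: "e P0 = Suc i" using P0 by (simp add: i_def)
  define e' where "e' = e(P0 := i)"
  note P = T(2)[OF P0(1)]
  have "(\<Sum>P\<in>T. e P) = Suc (\<Sum>P\<in>T. e' P)"
    using T(1) P0(1) i by (simp add: sum.remove[of T P0] e'_def)
  hence "n = (\<Sum>P\<in>T. e' P)" using Suc(2) by simp
  from Suc(1)[OF this] obtain A where A0: "A \<subseteq> ints \<and> finite A \<and> card A = (\<Prod>P\<in>T. card (R P) ^ e' P) \<and>
     (\<forall>x\<in>A. \<forall>y\<in>A. (\<forall>P\<in>T. in_power P (e' P) (x - y)) \<longrightarrow> x = y)" by (rule exE)
  note A = A0[THEN conjunct1] A0[THEN conjunct2, THEN conjunct1]
    A0[THEN conjunct2, THEN conjunct2, THEN conjunct1]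
  note A4 = A0[THEN conjunct2, THEN conjunct2, THEN conjunct2]
  obtain z where z: "z \<in> ints" "z \<noteq> 0" "val P0 z = i" "\<And>P. P \<in> T - {P0} \<Longrightarrow> e P \<le> val P z"
    using prescribed_valuation[OF T P0(1), of i e] by blast
  have zi: "in_power P0 i z" "\<not> in_power P0 (Suc i) z" using in_power_iff_val[OF P z(1,2)] z(3) by auto
  have ze: "in_power Q (e' Q) z" if "Q \<in> T" for Q
    using in_power_iff_val[OF T(2)[OF that] z(1,2)] z(4)[of Q] zi(1) that by (cases "Q = P0") (auto simp: e'_def)
  have key: "x = x' \<and> r = r'"
    if x: "x \<in> A" "x' \<in> A" and r: "r \<in> R P0" "r' \<in> R P0"
      and c: "\<forall>P\<in>T. in_power P (e P) ((x + z * r) - (x' + z * r'))" for x x' r r'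
  proof -
    have rO: "r - r' \<in> ints" using r R(1)[OF P0(1)] by (intro subring_on_diff[OF subring_ints]) auto
    have "in_power Q (e' Q) (x - x')" if "Q \<in> T" for Q
    proof -
      have "in_power Q (e' Q) ((x + z * r) - (x' + z * r'))"
      proof (rule in_power_mono[OF T(2)[OF that]])
        show "in_power Q (e Q) ((x + z * r) - (x' + z * r'))" by (rule bspec[OF c that])
        show "e' Q \<le> e Q" by (simp add: e'_def i)
      qed
      hence "in_power Q (e' Q) ((x + z * r) - (x' + z * r') - z * (r - r'))"
        using in_power_mult[OF ze[OF that] rO] by (rule in_power_diff)
      thus ?thesis by (simp add: algebra_simps)
    qed
    hence xx: "x = x'" using A4 x by blast
    have "in_power P0 (Suc i) (z * (r - r'))" using c P0(1) xx by (auto simp: i right_diff_distrib)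
    hence "r - r' \<in> P0" using in_power_Suc_mult_iff[OF P zi rO] by simp
    thus ?thesis using xx R(2)[OF P0(1) r] by simp
  qed
  define B where "B = (\<lambda>(x, r). x + z * r) ` (A \<times> R P0)"
  have zero: "\<forall>P\<in>T. in_power P (e P) 0" using subring_on_0[OF subring_ints] by (simp add: in_power_def)
  have "inj_on (\<lambda>(x, r). x + z * r) (A \<times> R P0)"
  proof (rule inj_onI, clarify)
    fix x r x' r' assume "x \<in> A" "r \<in> R P0" "x' \<in> A" "r' \<in> R P0" "x + z * r = x' + z * r'"
    thus "x = x' \<and> r = r'" using key[of x x' r r'] zero by simp
  qed
  hence "card B = card A * card (R P0)" by (simp add: B_def card_image card_cartesian_product)
  also have "\<dots> = (\<Prod>P\<in>T. card (R P) ^ e P)"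
    using T(1) P0(1) i by (simp add: A(3) prod.remove[of T P0] e'_def)
  finally have "card B = (\<Prod>P\<in>T. card (R P) ^ e P)" .
  moreover have "B \<subseteq> ints" unfolding B_def using A(1) R(1)[OF P0(1)] z(1)
    by (auto intro!: subring_on_add[OF subring_ints] subring_on_mult[OF subring_ints])
  moreover have "finite B" unfolding B_def using A(2) R(1)[OF P0(1)] by auto
  moreover have "\<forall>x\<in>B. \<forall>y\<in>B. (\<forall>P\<in>T. in_power P (e P) (x - y)) \<longrightarrow> x = y"
  proof (intro ballI impI)
    fix x y assume xy: "x \<in> B" "y \<in> B" "\<forall>P\<in>T. in_power P (e P) (x - y)"
    obtain a r a' r' where "a \<in> A" "r \<in> R P0" "x = a + z * r" "a' \<in> A" "r' \<in> R P0" "y = a' + z * r'"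
      using xy(1,2) by (auto simp: B_def)
    thus "x = y" using key[of a a' r r'] xy(3) by simp
  qed
  ultimately show ?case by (intro exI[of _ B] conjI)
qed

text \<open>Two counts of classes modulo \<open>\<mu> ^ k\<close> are compared: from below by
  \<open>many_incongruent\<close>, from above by \<open>card_incongruent_le\<close>. Letting
  \<open>k\<close> grow removes the constant \<open>C\<close>; the square in the upper count leaves
  the factor \<open>2\<close>.\<close>

lemma sum_val_le:
  assumes T: "finite T" "\<And>P. P \<in> T \<Longrightarrow> prime_ideal P"
    and R: "\<And>P. P \<in> T \<Longrightarrow> finite (R P) \<and> R P \<subseteq> ints \<and> R P \<noteq> {}"
      "\<And>P r r'. P \<in> T \<Longrightarrow> r \<in> R P \<Longrightarrow> r' \<in> R P \<Longrightarrow> r - r' \<in> P \<Longrightarrow> r = r'"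
    and \<mu>: "\<mu> \<in> ints" "\<mu> \<noteq> 0"
  shows "(\<Sum>P\<in>T. real (val P \<mu>) * ln (real (card (R P)))) \<le> 2 * ln (norm_abs \<mu>)"
proof -
  obtain C where C: "C \<ge> 1" "\<forall>\<mu>\<in>ints - {0}. \<forall>A\<subseteq>ints. (\<forall>x\<in>A. \<forall>y\<in>A. x \<noteq> y \<longrightarrow> (x - y) / \<mu> \<notin> ints) \<longrightarrow>
     finite A \<and> real (card A) \<le> C * (norm_abs \<mu>)\<^sup>2"
    using card_incongruent_le by blast
  define s where "s = (\<Sum>P\<in>T. real (val P \<mu>) * ln (real (card (R P))))"
  have n1: "norm_abs \<mu> \<ge> 1" by (rule norm_abs_ge_1[OF \<mu>])
  have c1: "real (card (R P)) \<ge> 1" if "P \<in> T" for P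
    using R(1)[OF that] by (simp add: Suc_leI card_gt_0_iff)
  have le: "real k * s \<le> ln C + real k * (2 * ln (norm_abs \<mu>))" for k
  proof -
    have \<mu>k: "\<mu> ^ k \<in> ints" "\<mu> ^ k \<noteq> 0" using \<mu> by (auto intro: subring_on_power[OF subring_ints])
    have "finite (R P) \<and> R P \<subseteq> ints" if "P \<in> T" for P using R(1)[OF that] by simp
    from many_incongruent[OF T this R(2), where e = "\<lambda>P. val P (\<mu> ^ k)"]
    obtain A where A0: "A \<subseteq> ints \<and> finite A \<and> card A = (\<Prod>P\<in>T. card (R P) ^ val P (\<mu> ^ k)) \<and>
      (\<forall>x\<in>A. \<forall>y\<in>A. (\<forall>P\<in>T. in_power P (val P (\<mu> ^ k)) (x - y)) \<longrightarrow> x = y)" by (rule exE)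
    note A = A0[THEN conjunct1] A0[THEN conjunct2, THEN conjunct1]
      A0[THEN conjunct2, THEN conjunct2, THEN conjunct1]
    note A4 = A0[THEN conjunct2, THEN conjunct2, THEN conjunct2]
    have "(x - y) / \<mu> ^ k \<notin> ints" if xy: "x \<in> A" "y \<in> A" "x \<noteq> y" for x y
    proof
      assume w: "(x - y) / \<mu> ^ k \<in> ints"
      have "in_power P (val P (\<mu> ^ k)) (\<mu> ^ k * ((x - y) / \<mu> ^ k))" if "P \<in> T" for P
        using in_power_iff_val[OF T(2)[OF that] \<mu>k] w by (intro in_power_mult) auto
      moreover have "\<mu> ^ k * ((x - y) / \<mu> ^ k) = x - y" using \<mu>(2) by simp
      ultimately show False using A4 xy by metis
    qed
    hence "real (card A) \<le> C * (norm_abs (\<mu> ^ k))\<^sup>2" using C(2) \<mu>k A(1) by blast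
    also have "real (card A) = (\<Prod>P\<in>T. real (card (R P)) ^ (k * val P \<mu>))"
      using A(3) val_power[OF T(2) \<mu>] by simp
    finally have "ln (\<Prod>P\<in>T. real (card (R P)) ^ (k * val P \<mu>)) \<le> ln (C * (norm_abs (\<mu> ^ k))\<^sup>2)"
      using c1 by (intro ln_mono prod_pos zero_less_power) (auto intro: less_le_trans[OF zero_less_one])
    also have "\<dots> = ln C + real k * (2 * ln (norm_abs \<mu>))"
      using C(1) n1 norm_abs_power[OF ints_K[OF \<mu>(1)]] by (simp add: ln_mult ln_realpow)
    also have "ln (\<Prod>P\<in>T. real (card (R P)) ^ (k * val P \<mu>)) = (\<Sum>P\<in>T. ln (real (card (R P)) ^ (k * val P \<mu>)))"
    proof -
      have "real (card (R P)) ^ (k * val P \<mu>) > 0" if "P \<in> T" for P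
        using c1[OF that] by (intro zero_less_power) linarith
      hence "\<And>P. P \<in> T \<Longrightarrow> real (card (R P)) ^ (k * val P \<mu>) \<noteq> 0" by force
      thus ?thesis by (rule ln_prod[OF T(1)])
    qed
    also have "\<dots> = real k * s"
      unfolding s_def sum_distrib_left
    proof (intro sum.cong refl)
      fix P assume "P \<in> T"
      hence "real (card (R P)) > 0" using c1[of P] by linarith
      thus "ln (real (card (R P)) ^ (k * val P \<mu>)) = real k * (real (val P \<mu>) * ln (real (card (R P))))"
        by (subst ln_realpow) simp_all
    qed
    finally show ?thesis .
  qed
  have "s \<le> 2 * ln (norm_abs \<mu>)"
  proof (rule ccontr)
    assume "\<not> ?thesis"
    hence pos: "s - 2 * ln (norm_abs \<mu>) > 0" by simp
    obtain k where "ln C < real k * (s - 2 * ln (norm_abs \<mu>))" using reals_Archimedean3[OF pos] by blast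
    thus False using le[of k] by (simp add: algebra_simps)
  qed
  thus ?thesis by (simp add: s_def)
qed

text \<open>Clearing denominators gives \<open>l * x ^ m = w * y ^ m\<close> with \<open>w\<close>
  integral, and the valuation of \<open>w\<close> is nonnegative.\<close>

lemma val_quotient_bound:
  assumes P: "prime_ideal P" and x: "x \<in> ints" "x \<noteq> 0" and y: "y \<in> ints" "y \<noteq> 0"
    and l: "l \<in> ints" "l \<noteq> 0" "l * (x / y) ^ m \<in> ints"
  shows "real m * - (real_of_int (int (val P x) - int (val P y))) \<le> real (val P l)"
proof -
  define w where "w = l * (x / y) ^ m"
  have w: "w \<in> ints" "w \<noteq> 0" using l x y by (auto simp: w_def)
  have "l * x ^ m = w * y ^ m" using y by (simp add: w_def power_divide)
  moreover have "x ^ m \<in> ints" "y ^ m \<in> ints" using x y by (auto intro: subring_on_power[OF subring_ints])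
  ultimately have "val P l + m * val P x = val P w + m * val P y"
    using val_mult[OF P l(1,2), of "x ^ m"] val_mult[OF P w, of "y ^ m"] x y val_power[OF P] by simp
  hence "real (val P l) + real m * real (val P x) = real (val P w) + real m * real (val P y)"
    by (metis of_nat_add of_nat_mult)
  thus ?thesis by (simp add: algebra_simps)
qed

end

section \<open>The Weil height\<close>

lemma ln_power_int: "x > 0 \<Longrightarrow> ln (x powi k) = of_int k * ln (x::real)"
  by (cases "k \<ge> 0") (auto simp: power_int_def ln_realpow ln_inverse)

lemma complex_field_simps [simp]:
  "carrier complex_field = UNIV" "x \<otimes>\<^bsub>complex_field\<^esub> y = x * y" "\<one>\<^bsub>complex_field\<^esub> = 1"
  "\<zero>\<^bsub>complex_field\<^esub> = 0" "x \<oplus>\<^bsub>complex_field\<^esub> y = x + y"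
  by (simp_all add: ring_of_type_algebra_def)

lemma complex_field_uminus [simp]: "\<ominus>\<^bsub>complex_field\<^esub> x = - x"
proof -
  interpret F: field complex_field by (rule field_from_type_algebra)
  show ?thesis using F.minus_equality[of "- x" x] by simp
qed

lemma complex_field_inverse [simp]: "x \<noteq> 0 \<Longrightarrow> inv\<^bsub>complex_field\<^esub> x = inverse x"
proof -
  interpret F: field complex_field by (rule field_from_type_algebra)
  show "x \<noteq> 0 \<Longrightarrow> ?thesis" using F.inv_char[of x "inverse x"] by simp
qed

lemma subfield_complexI:
  assumes "subring_on K" "\<And>x. x \<in> K \<Longrightarrow> inverse x \<in> K"
  shows "subfield K complex_field"
proof -
  interpret F: field complex_field by (rule field_from_type_algebra)
  show ?thesis
    by (intro F.subfieldI' F.subringI) (use assms in \<open>auto intro: subring_on_intros\<close>)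
qed

section \<open>The field generated by one algebraic number\<close>

definition single_field :: "complex \<Rightarrow> complex set" where
  "single_field a = generate_field complex_field {a}"

lemma single_field_rules:
  shows "1 \<in> single_field a" "a \<in> single_field a"
    "x \<in> single_field a \<Longrightarrow> - x \<in> single_field a"
    "x \<in> single_field a \<Longrightarrow> y \<in> single_field a \<Longrightarrow> x + y \<in> single_field a"
    "x \<in> single_field a \<Longrightarrow> y \<in> single_field a \<Longrightarrow> x * y \<in> single_field a"
    "x \<in> single_field a \<Longrightarrow> x \<noteq> 0 \<Longrightarrow> inverse x \<in> single_field a"
  using generate_field.one[of complex_field "{a}"] generate_field.incl[of a "{a}" complex_field]
    generate_field.a_inv[of x complex_field "{a}"] generate_field.eng_add[of x complex_field "{a}" y]
    generate_field.eng_mult[of x complex_field "{a}" y] generate_field.m_inv[of x complex_field "{a}"]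
  by (auto simp: single_field_def)

lemma subring_single_field: "subring_on (single_field a)"
  unfolding subring_on_def
proof (intro conjI ballI single_field_rules)
  fix x y assume "x \<in> single_field a" "y \<in> single_field a"
  thus "x - y \<in> single_field a" using single_field_rules(4)[OF _ single_field_rules(3), of x a y] by simp
qed

lemma inverse_single_field: "x \<in> single_field a \<Longrightarrow> inverse x \<in> single_field a"
  using single_field_rules(6)[of x a] subring_on_0[OF subring_single_field] by (cases "x = 0") auto

lemma Rats_subset_field:
  assumes "subring_on K" "\<And>x. x \<in> K \<Longrightarrow> inverse x \<in> K" shows "\<rat> \<subseteq> (K :: complex set)"
proof
  fix x :: complex assume "x \<in> \<rat>"
  then obtain a b where "x = of_int a / of_int b" by (auto elim: Rats_cases')
  thus "x \<in> K" using assms by (auto simp: divide_inverse intro!: subring_on_mult[OF assms(1)] subring_on_of_int[OF assms(1)])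
qed

lemma subring_Rats: "subring_on (\<rat> :: complex set)"
  by (auto simp: subring_on_def)

text \<open>An integer relation with nonzero constant term reads
  \<open>c + x * poly r x = 0\<close>, which exhibits the inverse as
  \<open>- (poly r x * inverse c)\<close>.\<close>

lemma inverse_in_adjoin_Rats:
  assumes x: "x \<in> adjoin \<rat> \<theta>" "x \<in> Qbar" shows "inverse x \<in> adjoin \<rat> \<theta>"
proof (cases "x = 0")
  case True thus ?thesis using x by simp
next
  case False
  note A = subring_on_adjoin[OF subring_Rats, of \<theta>]
  obtain q where q: "q \<in> polys_over \<int>" "poly q x = 0" "coeff q 0 \<noteq> 0"
    using relation_nonzero_const[OF x(2) False] by blast
  obtain c r where cr: "q = pCons c r" by (cases q)
  have c: "c \<noteq> 0" "c + x * poly r x = 0" using q cr by auto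
  have "c \<in> \<int>" using polys_overD[OF q(1), of 0] cr by simp
  hence "inverse c \<in> \<rat>" using Ints_subset_Rats by auto
  hence ic: "inverse c \<in> adjoin \<rat> \<theta>"
    using adjoin_superset[OF subring_Rats, of \<theta>] by blast
  have "r \<in> polys_over (adjoin \<rat> \<theta>)"
  proof (rule polys_overI)
    fix i show "coeff r i \<in> adjoin \<rat> \<theta>"
      using polys_overD[OF q(1), of "Suc i"] cr adjoin_superset[OF subring_Rats, of \<theta>] Ints_subset_Rats by auto
  qed
  hence "poly r x \<in> adjoin \<rat> \<theta>" using poly_in_subring[OF A _ x(1)] by blast
  hence "- (poly r x * inverse c) \<in> adjoin \<rat> \<theta>"
    using ic by (intro subring_on_uminus[OF A] subring_on_mult[OF A])
  moreover have "- (poly r x * inverse c) = inverse x"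
  proof -
    have "x * poly r x = - c" using c(2) by (simp add: eq_neg_iff_add_eq_0 add.commute)
    hence "x * (- (poly r x * inverse c)) = 1" using c(1) by (simp flip: mult.assoc)
    thus ?thesis using False by (metis inverse_unique)
  qed
  ultimately show ?thesis by simp
qed

text \<open>The factor \<open>n\<close> will make the generator integral without changing the
  field.\<close>

lemma single_field_eq_adjoin:
  assumes "a \<in> Qbar" "n > 0" shows "single_field a = adjoin \<rat> (of_nat n * a)"
proof
  let ?\<theta> = "of_nat n * a"
  note A = subring_on_adjoin[OF subring_Rats, of ?\<theta>]
  have Q: "adjoin \<rat> ?\<theta> \<subseteq> Qbar"
    using assms Qbar_superset_Rats subring_on_of_nat[OF subring_on_Qbar]
    by (intro adjoin_subset subring_on_Qbar subring_on_mult[OF subring_on_Qbar]) auto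
  have "1 / of_nat n \<in> \<rat>" by simp
  hence "(1 / of_nat n) * ?\<theta> \<in> adjoin \<rat> ?\<theta>"
    by (intro subring_on_mult[OF A] subsetD[OF adjoin_superset[OF subring_Rats]] adjoin_self[OF subring_Rats])
  hence a: "a \<in> adjoin \<rat> ?\<theta>" using assms(2) by simp
  have "x \<in> adjoin \<rat> ?\<theta>" if "x \<in> generate_field complex_field {a}" for x
    using that
  proof (induction rule: generate_field.induct)
    case (m_inv h)
    thus ?case using inverse_in_adjoin_Rats[of h ?\<theta>] Q by auto
  qed (use a A in \<open>auto intro: subring_on_intros\<close>)
  thus "single_field a \<subseteq> adjoin \<rat> ?\<theta>" by (auto simp: single_field_def)
  show "adjoin \<rat> ?\<theta> \<subseteq> single_field a"
    using Rats_subset_field[OF subring_single_field inverse_single_field] single_field_rules(2)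
    by (intro adjoin_subset subring_single_field subring_on_mult[OF subring_single_field]
        subring_on_of_nat[OF subring_single_field]) auto
qed

lemma combine_complex_field:
  "length Ks = length Us \<Longrightarrow> ring.combine complex_field Ks Us = (\<Sum>i<length Us. Ks ! i * Us ! i)"
proof -
  interpret F: field complex_field by (rule field_from_type_algebra)
  show "length Ks = length Us \<Longrightarrow> ?thesis"
    by (induction Ks Us rule: list_induct2) (simp_all add: sum.lessThan_Suc_shift del: sum.lessThan_Suc)
qed

text \<open>The degree \<open>d\<close> of the minimal polynomial of the integral generator is the
  dimension, as the powers below \<open>d\<close> form a basis; it also bounds the number of
  embeddings, as these are determined by the root to which they send the generator.\<close>

lemma single_field_number_ring:
  assumes a: "a \<in> Qbar"
  shows "\<exists>\<theta> d. number_ring (single_field a) \<theta> d \<and> d > 0 \<and> field_degree (single_field a) = d \<and>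
     card (number_ring.embs (single_field a)) \<le> d"
proof -
  let ?K = "single_field a"
  obtain n where n: "n > 0" "algebraic_int (of_nat n * a)" using algebraic_int_multiple a by (auto simp: Qbar_def)
  define \<theta> where "\<theta> = of_nat n * a"
  have K: "?K = adjoin \<rat> \<theta>" unfolding \<theta>_def by (rule single_field_eq_adjoin[OF a n(1)])
  obtain q where q: "\<forall>i. coeff q i \<in> \<rat>" "q \<noteq> 0" "poly q \<theta> = 0"
    using n(2) algebraic_int_imp_algebraic[of \<theta>] by (auto simp: \<theta>_def algebraic_altdef)
  have "q \<in> polys_over \<rat>" "\<exists>i. coeff q i \<notin> {0}" using q by (auto simp: polys_over_def poly_eq_iff)
  then obtain p0 where p0: "p0 \<in> polys_over \<rat>" "poly p0 \<theta> = 0" "lead_coeff p0 \<noteq> 0"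
    "\<And>q. q \<in> polys_over \<rat> \<Longrightarrow> poly q \<theta> = 0 \<Longrightarrow> degree q < degree p0 \<Longrightarrow> (\<forall>i. coeff q i = 0)"
    using minimal_relation[OF prime_ideal_on_zero subring_Rats, of \<theta> q] q by auto
  define p where "p = smult (inverse (lead_coeff p0)) p0"
  define d where "d = degree p"
  have pd: "degree p = degree p0" using p0(3) by (simp add: p_def)
  have p: "p \<in> polys_over \<rat>" "lead_coeff p = 1" "poly p \<theta> = 0"
    using p0 polys_overD[OF p0(1)] by (auto simp: p_def intro: smult_in_polys_over[OF subring_Rats])
  have min: "q = 0" if "q \<in> polys_over \<rat>" "poly q \<theta> = 0" "degree q < d" for q
    using p0(4)[OF that(1,2)] that(3) pd by (auto simp: d_def poly_eq_iff)
  have d0: "d > 0"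
  proof (rule gr0I)
    assume "d = 0"
    then obtain c where "p = [:c:]" by (auto simp: d_def elim: degree_eq_zeroE)
    thus False using p(2,3) by auto
  qed
  have red: "\<exists>r. (\<forall>i. r i \<in> \<rat>) \<and> x = (\<Sum>i<d. r i * \<theta> ^ i)" if x: "x \<in> ?K" for x
  proof -
    obtain q where "q \<in> polys_over \<rat>" "x = poly q \<theta>" using x by (auto simp: K adjoin_def)
    then obtain r where r: "r \<in> polys_over \<rat>" "poly r \<theta> = x" "degree r < d"
      using monic_reduce[OF subring_Rats p] by (auto simp: d_def)
    have "degree r \<le> d - 1" using r(3) by simp
    moreover have "{..d - 1} = {..<d}" using d0 by auto
    ultimately have "x = (\<Sum>i<d. coeff r i * \<theta> ^ i)"
      using poly_sum_le[of r "d - 1" \<theta>] r(2) by simp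
    thus ?thesis using polys_overD[OF r(1)] by blast
  qed
  have \<theta>K: "\<theta> \<in> ?K" unfolding K by (rule adjoin_self[OF subring_Rats])
  interpret number_ring ?K \<theta> d
  proof
    show "subring_on ?K" by (rule subring_single_field)
    show "inverse x \<in> ?K" if "x \<in> ?K" for x using that by (rule inverse_single_field)
    show "\<theta> \<in> ?K" by (rule \<theta>K)
    show "algebraic_int \<theta>" using n(2) by (simp add: \<theta>_def)
    fix x assume "x \<in> ?K"
    then obtain r where r: "\<forall>i. r i \<in> \<rat>" "x = (\<Sum>i<d. r i * \<theta> ^ i)" using red by blast
    have "\<forall>i. \<exists>s. r i = of_rat s" using r(1) by (auto elim: Rats_cases)
    then obtain s where "\<forall>i. r i = of_rat (s i)" by metis
    thus "\<exists>r. x = (\<Sum>i<d. of_rat (r i) * \<theta> ^ i)" using r(2) by auto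
  qed
  have "field_degree ?K = d"
  proof -
    interpret F: field complex_field by (rule field_from_type_algebra)
    have sQ: "subfield \<rat> complex_field" by (rule subfield_complexI[OF subring_Rats]) auto
    define Us where "Us = map (\<lambda>i. \<theta> ^ i) [0..<d]"
    have Us: "length Us = d" "set Us \<subseteq> carrier complex_field" "\<And>i. i < d \<Longrightarrow> Us ! i = \<theta> ^ i" by (auto simp: Us_def)
    have comb: "F.combine Ks Us = (\<Sum>i<d. Ks ! i * \<theta> ^ i)" if "length Ks = d" for Ks
      using combine_complex_field[of Ks Us] that Us by simp
    have "F.independent \<rat> Us"
    proof (rule ccontr)
      assume "\<not> ?thesis"
      then obtain Ks where Ks: "length Ks = length Us" "F.combine Ks Us = \<zero>\<^bsub>complex_field\<^esub>" "set Ks \<subseteq> \<rat>" "set Ks \<noteq> {\<zero>\<^bsub>complex_field\<^esub>}"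
        using F.dependent_imp_non_trivial_combine[OF sQ Us(2)] by blast
      define r where "r = (\<Sum>i<d. monom (Ks ! i) i)"
      have cr: "coeff r i = (if i < d then Ks ! i else 0)" for i by (simp add: r_def coeff_sum)
      have "r \<in> polys_over \<rat>" using Ks(1,3) Us(1) by (auto simp: polys_over_def cr)
      moreover have "poly r \<theta> = 0" using Ks(1,2) comb Us(1) by (simp add: r_def poly_sum poly_monom)
      moreover have "degree r < d" using d0 by (intro degree_lessI) (auto simp: cr)
      ultimately have "r = 0" by (rule min)
      hence "Ks ! i = 0" if "i < d" for i using cr[of i] that by simp
      hence "set Ks \<subseteq> {0}" using Ks(1) Us(1) by (auto simp: in_set_conv_nth)
      moreover have "set Ks \<noteq> {}" using Ks(1) Us(1) d0 by auto
      ultimately show False using Ks(4) subset_singletonD[of "set Ks" 0] by auto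
    qed
    hence "F.dimension (length Us) \<rat> (F.Span \<rat> Us)" by (rule F.dimension_independent)
    moreover have "F.Span \<rat> Us = ?K"
    proof
      show "F.Span \<rat> Us \<subseteq> ?K"
      proof
        fix x assume "x \<in> F.Span \<rat> Us"
        then obtain Ks where Ks: "x = F.combine Ks Us" "length Ks = d" "set Ks \<subseteq> \<rat>"
          unfolding F.Span_eq_combine_set_length_version[OF sQ Us(2)] using Us(1) by auto
        have "Ks ! i \<in> ?K" if "i < d" for i
          using Ks(2,3) that Rats_subset_field[OF subring_single_field inverse_single_field, of a]
          by (meson nth_mem subsetD)
        thus "x \<in> ?K" unfolding Ks(1) comb[OF Ks(2)]
          by (intro subring_on_sum[OF subring] subring_on_mult[OF subring] subring_on_power[OF subring] \<theta>K) auto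
      qed
      show "?K \<subseteq> F.Span \<rat> Us"
      proof
        fix x assume "x \<in> ?K"
        then obtain r where r: "\<forall>i. r i \<in> \<rat>" "x = (\<Sum>i<d. r i * \<theta> ^ i)" using red by blast
        have "F.combine (map r [0..<d]) Us = x" using comb[of "map r [0..<d]"] r(2) by simp
        moreover have "set (map r [0..<d]) \<subseteq> \<rat>" using r(1) by auto
        ultimately show "x \<in> F.Span \<rat> Us"
          unfolding F.Span_eq_combine_set_length_version[OF sQ Us(2)] using Us(1)
          by (intro CollectI exI[of _ "map r [0..<d]"]) auto
      qed
    qed
    ultimately have "F.dimension d \<rat> ?K" using Us(1) by simp
    thus ?thesis using F.dimI[OF sQ] by (simp add: over_def)
  qed
  moreover have "card embs \<le> d"
  proof -
    have "inj_on (\<lambda>\<sigma>. \<sigma> \<theta>) embs" by (rule inj_on_generator)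
    moreover have "(\<lambda>\<sigma>. \<sigma> \<theta>) ` embs \<subseteq> {x. poly p x = 0}"
    proof clarify
      fix \<sigma> assume s: "\<sigma> \<in> embs"
      note h = embs_hom[OF s]
      have pK: "p \<in> polys_over ?K"
        using p(1) polys_over_mono[OF Rats_subset_field[OF subring_single_field inverse_single_field, of a]] by blast
      have "map_poly \<sigma> p = p"
      proof (rule poly_eqI)
        fix i
        obtain r where "coeff p i = of_rat r" using polys_overD[OF p(1), of i] by (auto elim: Rats_cases)
        thus "coeff (map_poly \<sigma> p) i = coeff p i" by (simp add: coeff_map_poly_hom[OF h] emb_rat[OF s])
      qed
      thus "poly p (\<sigma> \<theta>) = 0" using poly_map_poly_hom[OF h pK \<theta>K] p(3) ring_hom_on_0[OF h] by simp
    qed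
    moreover have "p \<noteq> 0" using p(2) by auto
    ultimately have "card embs \<le> card {x. poly p x = 0}"
      by (intro card_inj_on_le poly_roots_finite)
    also have "\<dots> \<le> d" unfolding d_def by (rule card_poly_roots_bound) (use p(2) in auto)
    finally show ?thesis .
  qed
  ultimately show ?thesis using number_ring_axioms d0 by blast
qed

section \<open>Comparison with the places and the height of the definitions\<close>

context number_ring
begin

lemma embeddings_eq: "embeddings K = embs"
proof -
  have "\<sigma> \<in> ring_hom (complex_field \<lparr>carrier := K\<rparr>) complex_field \<longleftrightarrow> ring_hom_on K \<sigma>" for \<sigma>
  proof
    assume "\<sigma> \<in> ring_hom (complex_field \<lparr>carrier := K\<rparr>) complex_field"
    hence \<sigma>: "\<And>x y. x \<in> K \<Longrightarrow> y \<in> K \<Longrightarrow> \<sigma> (x * y) = \<sigma> x * \<sigma> y"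
      "\<And>x y. x \<in> K \<Longrightarrow> y \<in> K \<Longrightarrow> \<sigma> (x + y) = \<sigma> x + \<sigma> y" "\<sigma> 1 = 1"
      by (auto simp: ring_hom_def)
    have "\<sigma> (x - y) = \<sigma> x - \<sigma> y" if "x \<in> K" "y \<in> K" for x y
      using \<sigma>(2)[OF subring_on_diff[OF subring that] that(2)] by simp
    thus "ring_hom_on K \<sigma>" unfolding ring_hom_on_def using \<sigma> subring by blast
  next
    assume h: "ring_hom_on K \<sigma>"
    thus "\<sigma> \<in> ring_hom (complex_field \<lparr>carrier := K\<rparr>) complex_field"
      by (auto simp: ring_hom_def ring_hom_on_mult ring_hom_on_add ring_hom_on_1)
  qed
  thus ?thesis by (auto simp: embeddings_def embs_def)
qed

abbreviation "OK \<equiv> ring_of_integers K"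

lemma OK_simps [simp]:
  "carrier OK = ints" "x \<otimes>\<^bsub>OK\<^esub> y = x * y" "\<one>\<^bsub>OK\<^esub> = 1" "\<zero>\<^bsub>OK\<^esub> = 0" "x \<oplus>\<^bsub>OK\<^esub> y = x + y"
  by (simp_all add: ring_of_integers_def ints_def)

lemma finite_place_prime:
  assumes "P \<in> finite_places K" shows "prime_ideal P"
proof -
  interpret primeideal P OK using assms by (simp add: finite_places_def)
  have sub: "P \<subseteq> ints" using a_subset by simp
  have "1 \<notin> P" using one_imp_carrier I_notcarr by auto
  moreover have zero: "0 \<in> P" using additive_subgroup.zero_closed[OF is_additive_subgroup] by simp
  moreover have add: "x + y \<in> P" if "x \<in> P" "y \<in> P" for x y using additive_subgroup.a_closed[OF is_additive_subgroup that] by simp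
  moreover have mult: "x * z \<in> P" if "x \<in> ints" "z \<in> P" for x z using I_l_closed[of z x] that by simp
  moreover have "x - y \<in> P" if "x \<in> P" "y \<in> P" for x y
    using add[OF that(1) mult[OF subring_on_uminus[OF subring_ints subring_on_1[OF subring_ints]] that(2)]] by simp
  moreover have "x \<in> P \<or> y \<in> P" if "x \<in> ints" "y \<in> ints" "x * y \<in> P" for x y using I_prime[of x y] that by simp
  ultimately show ?thesis using sub subring_ints assms
    by (auto simp: prime_ideal_def prime_ideal_on_def finite_places_def)
qed

text \<open>Invertibility of the ideal \<open>P\<close>: the detector maps a uniformizer to an
  integer outside \<open>P\<close>, which has an inverse modulo \<open>P\<close>.\<close>

lemma prime_partition_of_unity:
  assumes P: "prime_ideal P"
  shows "\<exists>p0\<in>P. \<exists>p1\<in>P. 1 = p0 + detector P * p1"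
proof -
  have Z: "prime_ideal_on ints P" using P by (simp add: prime_ideal_def)
  obtain \<pi> where \<pi>: "\<pi> \<in> ints" "\<pi> \<noteq> 0" "val P \<pi> = 1" using uniformizer[OF P] by blast
  have "\<pi> \<in> P" using val_pos_iff[OF P \<pi>(1,2)] \<pi>(3) by simp
  have "detector P ^ 1 * \<pi> \<in> ints" "detector P ^ 1 * \<pi> \<notin> P"
    using in_power_iff_val[OF P \<pi>(1,2)] \<pi>(3) by (intro leading_part[OF P]; simp)+
  then obtain z where z: "z \<in> ints" "z * (detector P * \<pi>) - 1 \<in> P"
    using prime_inverse_mod[OF P] by auto
  have "- (z * (detector P * \<pi>) - 1) \<in> P" by (rule prime_ideal_on_uminus[OF Z z(2)])
  moreover have "z * \<pi> \<in> P" by (rule prime_ideal_onD(6)[OF Z z(1) \<open>\<pi> \<in> P\<close>])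
  moreover have "1 = - (z * (detector P * \<pi>) - 1) + detector P * (z * \<pi>)" by simp
  ultimately show ?thesis by blast
qed

text \<open>From \<open>m\<close> to \<open>Suc m\<close> the partition of unity writes
  \<open>x = x * p0 + (detector P * x) * p1\<close>, where \<open>x\<close> and
  \<open>detector P * x\<close> both lie in the \<open>m\<close>-th power.\<close>

lemma ideal_power_iff:
  assumes P: "prime_ideal P"
  shows "x \<in> P [^]\<^bsub>ideals_set OK\<^esub> m \<longleftrightarrow> in_power P m x"
proof (induction m arbitrary: x)
  case 0
  show ?case by (simp add: nat_pow_def ideals_set_def in_power_0)
next
  case (Suc m)
  have Z: "prime_ideal_on ints P" using P by (simp add: prime_ideal_def)
  note PO = prime_ideal_onD(2)[OF Z]
  have S: "P [^]\<^bsub>ideals_set OK\<^esub> Suc m = ideal_prod OK (P [^]\<^bsub>ideals_set OK\<^esub> m) P"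
    by (simp add: nat_pow_def ideals_set_def)
  show ?case unfolding S
  proof
    assume "x \<in> ideal_prod OK (P [^]\<^bsub>ideals_set OK\<^esub> m) P"
    thus "in_power P (Suc m) x"
    proof (induction rule: ideal_prod.induct)
      case (prod i j)
      hence i: "i \<in> ints" "detector P ^ m * i \<in> ints" and j: "j \<in> ints" "detector P * j \<in> ints"
        using Suc.IH[of i] detector(3)[OF P, of j] PO by (auto simp: in_power_def)
      have e: "detector P ^ Suc m * (i * j) = (detector P ^ m * i) * (detector P * j)" by simp
      show ?case unfolding in_power_def OK_simps e
        by (rule conjI[OF subring_on_mult[OF subring_ints i(1) j(1)] subring_on_mult[OF subring_ints i(2) j(2)]])
    next
      case (sum s1 s2)
      thus ?case using subring_on_add[OF subring_ints] by (auto simp: in_power_def distrib_left)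
    qed
  next
    assume x: "in_power P (Suc m) x"
    obtain p0 p1 where p: "p0 \<in> P" "p1 \<in> P" "1 = p0 + detector P * p1" using prime_partition_of_unity[OF P] by blast
    have "in_power P m x" "in_power P 1 x" using in_power_mono[OF P x, of m] in_power_mono[OF P x, of 1] by auto
    moreover from this have "in_power P m (detector P * x)"
      using x by (simp add: in_power_def mult_ac)
    ultimately have "x \<otimes>\<^bsub>OK\<^esub> p0 \<in> ideal_prod OK (P [^]\<^bsub>ideals_set OK\<^esub> m) P"
      "(detector P * x) \<otimes>\<^bsub>OK\<^esub> p1 \<in> ideal_prod OK (P [^]\<^bsub>ideals_set OK\<^esub> m) P"
      using p Suc.IH by (auto simp del: OK_simps intro!: ideal_prod.prod)
    hence "x * p0 + detector P * x * p1 \<in> ideal_prod OK (P [^]\<^bsub>ideals_set OK\<^esub> m) P"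
      using ideal_prod.sum[of "x * p0" OK _ P "detector P * x * p1"] by simp
    moreover have "x * p0 + detector P * x * p1 = x * (p0 + detector P * p1)" by (simp add: algebra_simps)
    ultimately show "x \<in> ideal_prod OK (P [^]\<^bsub>ideals_set OK\<^esub> m) P" using p(3) by simp
  qed
qed

lemma ord_integer_eq: "prime_ideal P \<Longrightarrow> ord_integer K P x = val P x"
  by (simp add: ord_integer_def val_def ideal_power_iff)

text \<open>Additivity of \<open>val\<close> makes the difference independent of the chosen
  fraction.\<close>

lemma ord_at_eq:
  assumes P: "prime_ideal P" and x: "x \<in> ints" "x \<noteq> 0" and y: "y \<in> ints" "y \<noteq> 0"
  shows "ord_at K P (x / y) = int (val P x) - int (val P y)"
  unfolding ord_at_def
proof (rule the_equality)
  show "\<exists>a\<in>carrier OK - {0}. \<exists>b\<in>carrier OK - {0}.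
     x / y = a / b \<and> int (val P x) - int (val P y) = int (ord_integer K P a) - int (ord_integer K P b)"
    using x y by (intro bexI[of _ x] bexI[of _ y]) (auto simp: ord_integer_eq[OF P])
  fix k assume "\<exists>a\<in>carrier OK - {0}. \<exists>b\<in>carrier OK - {0}.
     x / y = a / b \<and> k = int (ord_integer K P a) - int (ord_integer K P b)"
  then obtain a b where ab: "a \<in> ints" "a \<noteq> 0" "b \<in> ints" "b \<noteq> 0" "x / y = a / b"
    "k = int (val P a) - int (val P b)" by (auto simp: ord_integer_eq[OF P])
  have "x * b = a * y" using ab y by (simp add: field_simps)
  hence "val P x + val P b = val P a + val P y"
    using val_mult[OF P x ab(3,4)] val_mult[OF P ab(1,2) y] by simp
  thus "k = int (val P x) - int (val P y)" using ab(6) by linarith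
qed

text \<open>Positivity of \<open>card\<close> expresses finiteness of the quotient, because an
  infinite set has cardinality \<open>0\<close>.\<close>

lemma quotient_representatives:
  assumes P: "prime_ideal P" and c: "card (carrier (OK Quot P)) > 0"
  shows "\<exists>R. finite R \<and> R \<subseteq> ints \<and> R \<noteq> {} \<and> card R = card (carrier (OK Quot P)) \<and>
     (\<forall>r\<in>R. \<forall>r'\<in>R. r - r' \<in> P \<longrightarrow> r = r')"
proof -
  have Z: "prime_ideal_on ints P" using P by (simp add: prime_ideal_def)
  define co where "co a = {p + a | p. p \<in> P}" for a
  have car: "carrier (OK Quot P) = co ` ints"
    by (auto simp: FactRing_def A_RCOSETS_def' a_r_coset_def' co_def)
  define f where "f C = (SOME a. a \<in> ints \<and> co a = C)" for C
  have f: "f C \<in> ints" "co (f C) = C" if "C \<in> co ` ints" for C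
    using someI_ex[of "\<lambda>a. a \<in> ints \<and> co a = C"] that by (auto simp: f_def)
  have eq: "co a = co b" if "a - b \<in> P" for a b
  proof -
    have "co a \<subseteq> co b" if d: "a - b \<in> P" for a b
    proof
      fix x assume "x \<in> co a"
      then obtain p where p: "p \<in> P" "x = p + a" by (auto simp: co_def)
      hence "x = (p + (a - b)) + b" "p + (a - b) \<in> P" using prime_ideal_on_add[OF Z p(1) d] by auto
      thus "x \<in> co b" unfolding co_def by blast
    qed
    from this[OF that] this[of b a] show ?thesis using prime_ideal_on_uminus[OF Z that] by auto
  qed
  have inj: "inj_on f (co ` ints)" by (rule inj_onI) (metis f(2))
  define R where "R = f ` (co ` ints)"
  have fin: "finite (co ` ints)" using c unfolding car by (rule card_ge_0_finite)
  have "card R = card (carrier (OK Quot P))" unfolding R_def car by (rule card_image[OF inj])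
  moreover have "r = r'" if rr: "r \<in> R" "r' \<in> R" "r - r' \<in> P" for r r'
  proof -
    obtain C C' where "C \<in> co ` ints" "r = f C" "C' \<in> co ` ints" "r' = f C'" using rr(1,2) unfolding R_def by blast
    thus ?thesis using eq[OF rr(3)] f(2) by metis
  qed
  moreover have "R \<subseteq> ints" unfolding R_def using f(1) by blast
  moreover have "finite R" unfolding R_def using fin by simp
  moreover have "R \<noteq> {}" unfolding R_def using subring_on_1[OF subring_ints] by blast
  ultimately show ?thesis by blast
qed

text \<open>A pole of order \<open>v\<close> of \<open>a\<close> at \<open>P\<close> forces
  \<open>val P l \<ge> m * v\<close>, so the denominator pays for the contribution of the
  place.\<close>

lemma ln_max_finite_abs_le:
  assumes P: "prime_ideal P" and a: "a \<in> K" "a \<noteq> 0"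
    and l: "l \<in> ints" "l \<noteq> 0" "l * a ^ m \<in> ints" and m: "m > 0"
  shows "real m * ln (max 1 (finite_abs K P a)) \<le> real (val P l) * ln (real (card (carrier (OK Quot P))))"
proof -
  define N where "N = real (card (carrier (OK Quot P)))"
  obtain n where n: "n > 0" "algebraic_int (of_nat n * a)"
    using algebraic_int_multiple a(1) K_Qbar by (auto simp: Qbar_def)
  define x where "x = of_nat n * a"
  have x: "x \<in> ints" "x \<noteq> 0" using n a subring_on_mult[OF subring subring_on_of_nat[OF subring]] by (auto simp: x_def ints_def)
  have y: "of_nat n \<in> ints" "of_nat n \<noteq> (0::complex)" using n subring_on_of_nat[OF subring_ints] by auto
  have axy: "a = x / of_nat n" using n by (simp add: x_def)
  define k where "k = ord_at K P a"
  have mk: "real m * - real_of_int k \<le> real (val P l)"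
    unfolding k_def axy ord_at_eq[OF P x y] using val_quotient_bound[OF P x y l(1,2)] l(3) axy by simp
  have fa: "finite_abs K P a = N powi (- k)" using a(2) by (simp add: finite_abs_def N_def k_def)
  show ?thesis
  proof (cases "N = 0")
    \<comment> \<open>The default value for an infinite quotient: \<open>card\<close> is
      \<open>0\<close>, an integer power of \<open>0\<close> is \<open>0\<close> or
      \<open>1\<close>, and the place contributes nothing.\<close>
    case True
    hence "finite_abs K P a \<le> 1" unfolding fa by (simp add: power_int_0_left_if)
    thus ?thesis using True by (simp add: N_def[symmetric] max_def)
  next
    case False
    hence N1: "N \<ge> 1" by (simp add: N_def Suc_leI)
    have v0: "0 \<le> real (val P l) * ln N" using N1 by simp
    show ?thesis
    proof (cases "finite_abs K P a \<le> 1")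
      case True thus ?thesis using v0 by (simp add: N_def max_def)
    next
      case False
      hence "real m * ln (max 1 (finite_abs K P a)) = real m * ln (N powi (- k))" by (simp add: fa max_def)
      also have "\<dots> = (real m * - real_of_int k) * ln N" using N1 by (simp add: ln_power_int)
      also have "\<dots> \<le> real (val P l) * ln N" using mk N1 by (intro mult_right_mono) auto
      finally show ?thesis by (simp add: N_def)
    qed
  qed
qed

text \<open>With \<open>S = ln (norm_abs l)\<close> and all contributions multiplied by
  \<open>m\<close>, the infinite places give at most \<open>card embs * (m * ln B) - S\<close> and
  the finite ones at most \<open>2 * S\<close>. An exact count at the finite places would let
  \<open>S\<close> cancel; here one \<open>S\<close> remains and is again at most
  \<open>card embs * (m * ln B)\<close>, hence the factor \<open>2\<close>.\<close>

lemma weil_height_in_le: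
  assumes a: "a \<in> K" "a \<noteq> 0" and l: "l \<in> ints" "l \<noteq> 0" "l * a ^ m \<in> ints" and m: "m > 0" and B: "B \<ge> 1"
    and bd: "\<And>\<sigma>. \<sigma> \<in> embs \<Longrightarrow> cmod (\<sigma> l) \<le> B ^ m \<and> cmod (\<sigma> (l * a ^ m)) \<le> B ^ m"
    and deg: "d > 0" "field_degree K = d" "card embs \<le> d"
  shows "weil_height_in K a \<le> 2 * ln B"
proof -
  define S where "S = (\<Sum>\<sigma>\<in>embs. ln (cmod (\<sigma> l)))"
  have l0: "cmod (\<sigma> l) > 0" if "\<sigma> \<in> embs" for \<sigma> using emb_nonzero[OF that ints_K[OF l(1)] l(2)] by simp
  have lnN: "ln (norm_abs l) = S"
    unfolding S_def norm_abs_def using l0 by (intro ln_prod finite_embs) force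
  have lnB: "ln (B ^ m) = real m * ln B" using B by (simp add: ln_realpow)
  have arch: "real m * ln (max 1 (cmod (\<sigma> a))) \<le> real m * ln B - ln (cmod (\<sigma> l))" if s: "\<sigma> \<in> embs" for \<sigma>
  proof (cases "cmod (\<sigma> a) \<le> 1")
    case True
    have "ln (cmod (\<sigma> l)) \<le> ln (B ^ m)" using bd[OF s] l0[OF s] by (intro ln_mono) auto
    thus ?thesis using True lnB by (simp add: max_def)
  next
    case False
    note h = embs_hom[OF s]
    have "cmod (\<sigma> (l * a ^ m)) = cmod (\<sigma> l) * cmod (\<sigma> a) ^ m"
      using ring_hom_on_mult[OF h ints_K[OF l(1)] subring_on_power[OF subring a(1)]] ring_hom_on_power[OF h a(1)]
      by (simp add: norm_mult norm_power)
    moreover have "cmod (\<sigma> l) * cmod (\<sigma> a) ^ m > 0"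
      using l0[OF s] False by (intro mult_pos_pos zero_less_power) linarith+
    ultimately have "ln (cmod (\<sigma> l) * cmod (\<sigma> a) ^ m) \<le> ln (B ^ m)"
      using bd[OF s] by (intro ln_mono) auto
    moreover have "cmod (\<sigma> a) > 0" using False by linarith
    ultimately show ?thesis using False l0[OF s] lnB by (simp add: ln_mult ln_realpow max_def)
  qed
  have fin: "(\<Sum>P\<in>F. ln (max 1 (finite_abs K P a))) \<le> 2 * S / real m" if F: "finite F" "F \<subseteq> finite_places K" for F
  proof -
    define N where "N P = card (carrier (OK Quot P))" for P
    define F' where "F' = {P \<in> F. N P > 0}"
    have F': "finite F'" "\<And>P. P \<in> F' \<Longrightarrow> prime_ideal P" using F finite_place_prime by (auto simp: F'_def)
    have "\<forall>P\<in>F'. \<exists>R. finite R \<and> R \<subseteq> ints \<and> R \<noteq> {} \<and> card R = N P \<and> (\<forall>r\<in>R. \<forall>r'\<in>R. r - r' \<in> P \<longrightarrow> r = r')"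
      using quotient_representatives F' by (auto simp: F'_def N_def)
    then obtain R where R: "\<And>P. P \<in> F' \<Longrightarrow> finite (R P) \<and> R P \<subseteq> ints \<and> R P \<noteq> {}" "\<And>P. P \<in> F' \<Longrightarrow> card (R P) = N P"
      "\<And>P r r'. P \<in> F' \<Longrightarrow> r \<in> R P \<Longrightarrow> r' \<in> R P \<Longrightarrow> r - r' \<in> P \<Longrightarrow> r = r'" by metis
    have "real m * (\<Sum>P\<in>F. ln (max 1 (finite_abs K P a))) \<le> (\<Sum>P\<in>F. real (val P l) * ln (real (N P)))"
      unfolding sum_distrib_left N_def using F finite_place_prime a l m by (intro sum_mono ln_max_finite_abs_le) auto
    also have "\<dots> = (\<Sum>P\<in>F'. real (val P l) * ln (real (N P)))"
      using F(1) by (intro sum.mono_neutral_right) (auto simp: F'_def)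
    also have "\<dots> = (\<Sum>P\<in>F'. real (val P l) * ln (real (card (R P))))" using R(2) by simp
    also have "\<dots> \<le> 2 * S" unfolding lnN[symmetric] by (rule sum_val_le[OF F' R(1,3) l(1,2)])
    finally show ?thesis using m by (simp add: pos_le_divide_eq mult.commute)
  qed
  have infs: "(\<Sum>\<^sub>\<infinity>P\<in>finite_places K. ln (max 1 (finite_abs K P a))) \<le> 2 * S / real m"
  proof (cases "(\<lambda>P. ln (max 1 (finite_abs K P a))) summable_on finite_places K")
    case True thus ?thesis using fin by (intro infsum_le_finite_sums)
  next
    \<comment> \<open>A family that is not summable has infinite sum \<open>0\<close> by convention;
      the bound for the empty set shows that the right-hand side is nonnegative.\<close>
    case False thus ?thesis using fin[of "{}"] by (simp add: infsum_not_exists)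
  qed
  have SB: "S \<le> real (card embs) * (real m * ln B)"
  proof -
    have "S \<le> (\<Sum>\<sigma>\<in>embs. ln (B ^ m))" unfolding S_def using bd l0 by (intro sum_mono ln_mono) auto
    thus ?thesis by (simp add: lnB)
  qed
  have "real m * (\<Sum>\<sigma>\<in>embs. ln (max 1 (cmod (\<sigma> a)))) \<le> (\<Sum>\<sigma>\<in>embs. real m * ln B - ln (cmod (\<sigma> l)))"
    unfolding sum_distrib_left by (intro sum_mono arch)
  also have "\<dots> = real (card embs) * (real m * ln B) - S" by (simp add: sum_subtractf S_def)
  finally have 1: "real m * (\<Sum>\<sigma>\<in>embs. ln (max 1 (cmod (\<sigma> a)))) \<le> real (card embs) * (real m * ln B) - S" .
  have "real m * (\<Sum>\<^sub>\<infinity>P\<in>finite_places K. ln (max 1 (finite_abs K P a))) \<le> 2 * S"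
    using infs m by (simp add: pos_le_divide_eq mult.commute)
  hence "real m * ((\<Sum>\<sigma>\<in>embs. ln (max 1 (cmod (\<sigma> a)))) + (\<Sum>\<^sub>\<infinity>P\<in>finite_places K. ln (max 1 (finite_abs K P a))))
      \<le> real (card embs) * (real m * ln B) + S" using 1 by (simp add: distrib_left)
  also have "\<dots> \<le> real m * (2 * real (card embs) * ln B)" using SB by (simp add: algebra_simps)
  finally have "(\<Sum>\<sigma>\<in>embs. ln (max 1 (cmod (\<sigma> a)))) + (\<Sum>\<^sub>\<infinity>P\<in>finite_places K. ln (max 1 (finite_abs K P a)))
      \<le> 2 * real (card embs) * ln B" using m by (simp add: mult_le_cancel_left)
  also have "\<dots> \<le> 2 * real d * ln B" using deg B by (intro mult_right_mono) auto
  finally show ?thesis unfolding weil_height_in_def embeddings_eq deg(2) using deg(1) by (simp add: divide_le_eq mult_ac)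
qed

end

text \<open>The denominator \<open>l\<close> may lie outside the field generated by
  \<open>a\<close>. The product \<open>L\<close> of its conjugates over that field lies inside and
  is a denominator of \<open>a ^ m\<close>, where \<open>m\<close> is the number of these
  conjugates; the bounds multiply to \<open>B ^ m\<close>.\<close>

theorem weil_height_le:
  assumes h: "height_at_most a B" and a0: "a \<noteq> 0" and B: "B \<ge> 1"
  shows "weil_height a \<le> 2 * ln B"
proof -
  have aQ: "a \<in> Qbar" by (rule height_at_most_Qbar[OF h])
  obtain l where l: "l \<noteq> 0" "algebraic_int l" "algebraic_int (l * a)"
    "\<And>s. s \<in> conjugations \<Longrightarrow> cmod (s l) \<le> B \<and> cmod (s (l * a)) \<le> B"
    using h by (auto simp: height_at_most_def)
  obtain \<theta> d where nr: "number_ring (single_field a) \<theta> d" and d: "d > 0" "field_degree (single_field a) = d"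
    "card (number_ring.embs (single_field a)) \<le> d" using single_field_number_ring[OF aQ] by blast
  interpret number_ring "single_field a" \<theta> d by (rule nr)
  define G where "G = {s \<in> conjugations. s a = a}"
  define \<Omega> where "\<Omega> = {s l | s. s \<in> G}"
  have lQ: "l \<in> Qbar" by (rule algebraic_int_in_Qbar[OF l(2)])
  have "\<Omega> \<subseteq> {s l | s. s \<in> conjugations}" by (auto simp: \<Omega>_def G_def)
  hence fin: "finite \<Omega>" using finite_conjugates[OF lQ] finite_subset by blast
  define m where "m = card \<Omega>"
  define L where "L = (\<Prod>y\<in>\<Omega>. y)"
  have idG: "(\<lambda>x. x) \<in> G" using id_conjugation by (simp add: G_def)
  have "\<Omega> \<noteq> {}" unfolding \<Omega>_def using idG by blast
  hence m0: "m > 0" unfolding m_def using fin by (simp add: card_gt_0_iff)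
  have y: "algebraic_int y" "y \<noteq> 0" "algebraic_int (y * a)" if y\<Omega>: "y \<in> \<Omega>" for y
  proof -
    obtain s where s: "s \<in> conjugations" "s a = a" "y = s l" using y\<Omega> by (auto simp: \<Omega>_def G_def)
    note hs = conjugationsD[OF s(1)]
    have "y * a = s (l * a)" using ring_hom_on_mult[OF hs lQ aQ] s by simp
    thus "algebraic_int (y * a)" using algebraic_int_hom[OF hs algebraic_int_in_Qbar[OF l(3)] l(3)] by simp
    show "algebraic_int y" using algebraic_int_hom[OF hs lQ l(2)] s by simp
    show "y \<noteq> 0" using ring_hom_on_Qbar_inj[OF hs order_refl lQ] l(1) s(3) by auto
  qed
  have \<Omega>Q: "\<Omega> \<subseteq> Qbar" using y(1) algebraic_int_in_Qbar by blast
  have LQ: "L \<in> Qbar" unfolding L_def using \<Omega>Q by (intro subring_on_prod[OF subring_on_Qbar]) auto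
  have "L \<in> single_field a"
  proof (rule conjugation_fixed_field[OF subring K_Qbar inverse_closed LQ])
    fix s assume s: "s \<in> conjugations" "\<forall>k\<in>single_field a. s k = k"
    have sa: "s a = a" using s(2) single_field_rules(2) by blast
    show "s L = L" unfolding L_def
    proof (rule prod_fixed[OF fin \<Omega>Q conjugationsD[OF s(1)]])
      show "s ` \<Omega> \<subseteq> \<Omega>"
      proof clarify
        fix y assume "y \<in> \<Omega>"
        then obtain t where t: "t \<in> conjugations" "t a = a" "y = t l" by (auto simp: \<Omega>_def G_def)
        have "s \<circ> t \<in> G" using conjugations_comp[OF s(1) t(1)] t(2) sa by (simp add: G_def)
        thus "s y \<in> \<Omega>" unfolding \<Omega>_def using t(3) by (intro CollectI exI[of _ "s \<circ> t"]) simp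
      qed
      show "inj_on s \<Omega>"
      proof (rule inj_onI)
        fix x y assume xy: "x \<in> \<Omega>" "y \<in> \<Omega>" "s x = s y"
        hence "x \<in> Qbar" "y \<in> Qbar" using \<Omega>Q by auto
        moreover from this have "s (x - y) = 0" using xy(3) ring_hom_on_diff[OF conjugationsD[OF s(1)]] by simp
        ultimately show "x = y"
          using ring_hom_on_Qbar_inj[OF conjugationsD[OF s(1)] order_refl subring_on_diff[OF subring_on_Qbar]] by simp
      qed
    qed
  qed
  moreover have "L \<in> {x. algebraic_int x}" unfolding L_def using y(1) by (intro subring_on_prod[OF subring_on_algebraic_int]) auto
  ultimately have L: "L \<in> ints" by (simp add: ints_def)
  have La: "L * a ^ m = (\<Prod>y\<in>\<Omega>. y * a)" by (simp add: L_def m_def prod.distrib)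
  have "(\<Prod>y\<in>\<Omega>. y * a) \<in> {x. algebraic_int x}" using y(3) by (intro subring_on_prod[OF subring_on_algebraic_int]) auto
  moreover have aK: "a \<in> single_field a" by (rule single_field_rules(2))
  hence "L * a ^ m \<in> single_field a" using ints_K[OF L] by (intro subring_on_mult[OF subring] subring_on_power[OF subring])
  ultimately have La': "L * a ^ m \<in> ints" by (simp add: ints_def La)
  have bd: "cmod (\<sigma> L) \<le> B ^ m \<and> cmod (\<sigma> (L * a ^ m)) \<le> B ^ m" if \<sigma>: "\<sigma> \<in> embs" for \<sigma>
  proof -
    obtain t where t: "t \<in> conjugations" "\<forall>x\<in>single_field a. t x = \<sigma> x"
      using conjugation_extend[OF embs_hom[OF \<sigma>] K_Qbar] by auto
    note ht = conjugationsD[OF t(1)]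
    have le: "cmod (t y) \<le> B \<and> cmod (t (y * a)) \<le> B" if y\<Omega>: "y \<in> \<Omega>" for y
    proof -
      obtain s where s: "s \<in> conjugations" "s a = a" "y = s l" using y\<Omega> by (auto simp: \<Omega>_def G_def)
      have "y * a = s (l * a)" using ring_hom_on_mult[OF conjugationsD[OF s(1)] lQ aQ] s by simp
      thus ?thesis using l(4)[OF conjugations_comp[OF t(1) s(1)]] s(3) by simp
    qed
    have "\<sigma> L = (\<Prod>y\<in>\<Omega>. t y)"
      using t(2) ints_K[OF L] ring_hom_on_prod[OF ht, of \<Omega> "\<lambda>y. y"] \<Omega>Q by (auto simp: L_def)
    hence "cmod (\<sigma> L) = (\<Prod>y\<in>\<Omega>. cmod (t y))" by (simp add: prod_norm)
    also have "\<dots> \<le> (\<Prod>y\<in>\<Omega>. B)" using le by (intro prod_mono) auto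
    finally have 1: "cmod (\<sigma> L) \<le> B ^ m" by (simp add: m_def)
    have "y * a \<in> Qbar" if "y \<in> \<Omega>" for y using y(3)[OF that] by (rule algebraic_int_in_Qbar)
    hence "\<sigma> (L * a ^ m) = (\<Prod>y\<in>\<Omega>. t (y * a))"
      using t(2) ints_K[OF La'] ring_hom_on_prod[OF ht, of \<Omega> "\<lambda>y. y * a"] by (simp add: La)
    hence "cmod (\<sigma> (L * a ^ m)) = (\<Prod>y\<in>\<Omega>. cmod (t (y * a)))" by (simp add: prod_norm)
    also have "\<dots> \<le> (\<Prod>y\<in>\<Omega>. B)" using le by (intro prod_mono) auto
    finally show ?thesis using 1 by (simp add: m_def)
  qed
  have "L \<noteq> 0" unfolding L_def using fin y(2) by auto
  thus ?thesis
    using weil_height_in_le[OF aK a0 L _ La' m0 B bd d] by (simp add: weil_height_def single_field_def)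
qed

section \<open>Noetherian rings\<close>

definition seq_span :: "'a::comm_ring_1 set \<Rightarrow> (nat \<Rightarrow> 'a) \<Rightarrow> nat \<Rightarrow> 'a set" where
  "seq_span R f m = {\<Sum>i<m. c i * f i | c. \<forall>i<m. c i \<in> R}"

text \<open>The ascending chain condition in terms of generators: no sequence leaves at every step
  the ideal generated by its predecessors.\<close>

definition noetherian :: "'a::comm_ring_1 set \<Rightarrow> bool" where
  "noetherian R \<longleftrightarrow> subring_on R \<and> (\<forall>f. (\<forall>n. f n \<in> R) \<longrightarrow> (\<exists>m. f m \<in> seq_span R f m))"

lemma seq_spanI: "(\<And>i. i < m \<Longrightarrow> c i \<in> R) \<Longrightarrow> (\<Sum>i<m. c i * f i) \<in> seq_span R f m"
  by (auto simp: seq_span_def)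

lemma seq_span_cong: "(\<And>i. i < m \<Longrightarrow> f i = g i) \<Longrightarrow> seq_span R f m = seq_span R g m"
  unfolding seq_span_def by (intro Collect_cong ex_cong1 conj_cong sum.cong refl) auto

lemma seq_span_closed:
  assumes R: "subring_on R"
  shows seq_span_diff: "x \<in> seq_span R f m \<Longrightarrow> y \<in> seq_span R f m \<Longrightarrow> x - y \<in> seq_span R f m"
    and seq_span_scale: "x \<in> seq_span R f m \<Longrightarrow> r \<in> R \<Longrightarrow> r * x \<in> seq_span R f m"
    and seq_span_0: "0 \<in> seq_span R f m"
    and seq_span_mono: "m \<le> n \<Longrightarrow> seq_span R f m \<subseteq> seq_span R f n"
    and seq_span_mem: "i < m \<Longrightarrow> f i \<in> seq_span R f m"
proof -
  show "x - y \<in> seq_span R f m" if xy: "x \<in> seq_span R f m" "y \<in> seq_span R f m"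
  proof -
    obtain c d where "x = (\<Sum>i<m. c i * f i)" "\<forall>i<m. c i \<in> R" "y = (\<Sum>i<m. d i * f i)" "\<forall>i<m. d i \<in> R"
      using xy by (auto simp: seq_span_def)
    hence "x - y = (\<Sum>i<m. (c i - d i) * f i)" "\<forall>i<m. c i - d i \<in> R"
      by (auto simp: left_diff_distrib sum_subtractf intro: subring_on_diff[OF R])
    thus ?thesis by (auto simp: seq_span_def)
  qed
  show "r * x \<in> seq_span R f m" if xr: "x \<in> seq_span R f m" "r \<in> R"
  proof -
    obtain c where "x = (\<Sum>i<m. c i * f i)" "\<forall>i<m. c i \<in> R" using xr by (auto simp: seq_span_def)
    hence "r * x = (\<Sum>i<m. (r * c i) * f i)" "\<forall>i<m. r * c i \<in> R"
      using xr by (auto simp: sum_distrib_left mult.assoc intro: subring_on_mult[OF R])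
    thus ?thesis by (auto simp: seq_span_def)
  qed
  show "0 \<in> seq_span R f m" using seq_spanI[of m "\<lambda>_. 0" R f] subring_on_0[OF R] by simp
  show "seq_span R f m \<subseteq> seq_span R f n" if mn: "m \<le> n"
  proof
    fix x assume "x \<in> seq_span R f m"
    then obtain c where c: "x = (\<Sum>i<m. c i * f i)" "\<forall>i<m. c i \<in> R" by (auto simp: seq_span_def)
    have "x = (\<Sum>i<n. (if i < m then c i else 0) * f i)"
      unfolding c(1) using mn by (intro sum.mono_neutral_cong_left) auto
    also have "\<dots> \<in> seq_span R f n" using c(2) subring_on_0[OF R] by (intro seq_spanI) auto
    finally show "x \<in> seq_span R f n" .
  qed
  show "f i \<in> seq_span R f m" if "i < m"
  proof -
    have "f i = (\<Sum>j<m. (if j = i then 1 else 0) * f j)"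
      using that by (simp add: if_distrib[of "\<lambda>x. x * _"] cong: if_cong)
    also have "\<dots> \<in> seq_span R f m" using subring_on_0[OF R] subring_on_1[OF R] by (intro seq_spanI) auto
    finally show ?thesis .
  qed
qed

text \<open>If \<open>f 0\<close> vanishes it lies in the empty span; otherwise it is a unit and
  \<open>f 1\<close> is a multiple of it.\<close>

lemma noetherian_field:
  assumes R: "subring_on R" and inv: "\<And>x. x \<in> R \<Longrightarrow> x \<noteq> 0 \<Longrightarrow> \<exists>y\<in>R. x * y = 1"
  shows "noetherian R"
  unfolding noetherian_def
proof (intro conjI allI impI R)
  fix f :: "nat \<Rightarrow> 'a" assume f: "\<forall>n. f n \<in> R"
  show "\<exists>m. f m \<in> seq_span R f m"
  proof (cases "f 0 = 0")
    case True thus ?thesis using seq_span_0[OF R] by (intro exI[of _ 0]) auto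
  next
    case False
    then obtain y where y: "y \<in> R" "f 0 * y = 1" using inv f by blast
    have "(f 1 * y) * f 0 \<in> seq_span R f 1"
      using f y by (intro seq_span_scale[OF R] seq_span_mem[OF R] subring_on_mult[OF R]) auto
    moreover have "(f 1 * y) * f 0 = f 1" using y(2) by (simp add: mult.assoc mult.commute[of y])
    ultimately show ?thesis by auto
  qed
qed

text \<open>
  Hilbert's basis theorem. Out of a sequence none of whose members is a combination of the earlier
  ones one obtains another such sequence consisting of polynomials in \<open>g\<close> of least possible degree;
  a relation between its leading coefficients then produces a member of smaller degree.
\<close>

lemma noetherian_adjoin:
  assumes "noetherian R" shows "noetherian (adjoin R g)"
  unfolding noetherian_def
proof (intro conjI allI impI)
  have R: "subring_on R" and N: "\<And>f. (\<forall>n. f n \<in> R) \<Longrightarrow> \<exists>m. f m \<in> seq_span R f m"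
    using assms by (auto simp: noetherian_def)
  let ?S = "adjoin R g"
  show S: "subring_on ?S" by (rule subring_on_adjoin[OF R])
  fix f :: "nat \<Rightarrow> 'a" assume fS: "\<forall>n. f n \<in> ?S"
  show "\<exists>m. f m \<in> seq_span ?S f m"
  proof (rule ccontr)
    assume "\<not> ?thesis"
    hence bad: "f m \<notin> seq_span ?S f m" for m by blast
    define I where "I = (\<Union>m. seq_span ?S f m)"
    have I_common: "\<exists>m. x \<in> seq_span ?S f m \<and> y \<in> seq_span ?S f m" if xy: "x \<in> I" "y \<in> I" for x y
    proof -
      obtain a b where ab: "x \<in> seq_span ?S f a" "y \<in> seq_span ?S f b" using xy by (auto simp: I_def)
      thus ?thesis using seq_span_mono[OF S, of a "max a b" f] seq_span_mono[OF S, of b "max a b" f]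
        by (intro exI[of _ "max a b"]) auto
    qed
    have I_diff: "x - y \<in> I" if "x \<in> I" "y \<in> I" for x y
      using I_common[OF that] seq_span_diff[OF S] unfolding I_def by blast
    have I_scale: "r * x \<in> I" if "r \<in> ?S" "x \<in> I" for r x
      using that seq_span_scale[OF S] unfolding I_def by blast
    have I_0: "0 \<in> I" using seq_span_0[OF S] unfolding I_def by blast
    have I_S: "I \<subseteq> ?S"
      using fS by (auto simp: I_def seq_span_def intro!: subring_on_sum[OF S] subring_on_mult[OF S])
    have I_sum: "sum h A \<in> I" if "\<And>i. i \<in> A \<Longrightarrow> h i \<in> I" for h :: "nat \<Rightarrow> 'a" and A
      using that
    proof (induction A rule: infinite_finite_induct)
      case (insert x F)
      thus ?case using I_diff[of "h x" "- sum h F"] I_diff[of 0 "sum h F"] I_0 by simp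
    qed (use I_0 in auto)
    have span_I: "seq_span ?S h k \<subseteq> I" if "\<And>i. i < k \<Longrightarrow> h i \<in> I" for h k
      using that by (auto simp: seq_span_def intro!: I_sum I_scale)
    \<comment> \<open>Finitely many elements of \<open>I\<close> lie in some
      \<open>seq_span ?S f m\<close>, which misses \<open>f m\<close>.\<close>
    have ex: "\<exists>x. x \<in> I \<and> x \<notin> seq_span ?S h k" if h: "\<And>i. i < k \<Longrightarrow> h i \<in> I" for h :: "nat \<Rightarrow> 'a" and k
    proof -
      have "\<exists>m. \<forall>i<k. h i \<in> seq_span ?S f m" using h
      proof (induction k)
        case (Suc k)
        then obtain m where m: "\<forall>i<k. h i \<in> seq_span ?S f m" by auto
        obtain n where n: "h k \<in> seq_span ?S f n" using Suc.prems by (auto simp: I_def)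
        have "\<forall>i<Suc k. h i \<in> seq_span ?S f (max m n)"
          using m n seq_span_mono[OF S, of m "max m n" f] seq_span_mono[OF S, of n "max m n" f]
          by (auto simp: less_Suc_eq)
        thus ?case by blast
      qed auto
      then obtain m where m: "\<forall>i<k. h i \<in> seq_span ?S f m" by blast
      have "x \<in> seq_span ?S f m" if xk: "x \<in> seq_span ?S h k" for x
      proof -
        obtain c where c: "x = (\<Sum>i<k. c i * h i)" "\<forall>i<k. c i \<in> ?S" using xk by (auto simp: seq_span_def)
        have "(\<Sum>i<j. c i * h i) \<in> seq_span ?S f m" if "j \<le> k" for j
          using that
        proof (induction j)
          case (Suc j)
          hence "c j * h j \<in> seq_span ?S f m" using c(2) m by (intro seq_span_scale[OF S]) auto
          hence *: "0 - c j * h j \<in> seq_span ?S f m" by (rule seq_span_diff[OF S seq_span_0[OF S]])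
          have "(\<Sum>i<j. c i * h i) \<in> seq_span ?S f m" using Suc by simp
          hence "(\<Sum>i<j. c i * h i) - (0 - c j * h j) \<in> seq_span ?S f m" using * by (rule seq_span_diff[OF S])
          thus ?case by simp
        qed (use seq_span_0[OF S] in auto)
        thus ?thesis using c(1) by simp
      qed
      hence "f m \<notin> seq_span ?S h k" using bad[of m] by blast
      moreover have "f m \<in> I" unfolding I_def using seq_span_mem[OF S, of m "Suc m"] by blast
      ultimately show ?thesis by blast
    qed
    \<comment> \<open>\<open>g\<close> may satisfy relations, so the polynomial representing
      \<open>x\<close> is not unique; \<open>dg x\<close> is the least bound on the degree among the
      representing polynomials.\<close>
    define dg where "dg x = (LEAST d. \<exists>p\<in>polys_over R. degree p \<le> d \<and> poly p g = x)" for x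
    have dg: "\<exists>p\<in>polys_over R. degree p \<le> dg x \<and> poly p g = x" if "x \<in> I" for x
    proof -
      have "x \<in> ?S" using that I_S by blast
      then obtain p where p: "p \<in> polys_over R" "poly p g = x" by (auto simp: adjoin_def)
      have "\<exists>q\<in>polys_over R. degree q \<le> degree p \<and> poly q g = x" using p by blast
      thus ?thesis unfolding dg_def by (rule LeastI)
    qed
    have dg_le: "dg x \<le> d" if "p \<in> polys_over R" "degree p \<le> d" "poly p g = x" for x p d
      unfolding dg_def using that by (intro Least_le) blast
    define N' where "N' h k = (SOME x. x \<in> I \<and> x \<notin> seq_span ?S h k \<and>
      (\<forall>y. y \<in> I \<and> y \<notin> seq_span ?S h k \<longrightarrow> dg x \<le> dg y))" for h :: "nat \<Rightarrow> 'a" and k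
    have N': "N' h k \<in> I \<and> N' h k \<notin> seq_span ?S h k \<and> (\<forall>y. y \<in> I \<and> y \<notin> seq_span ?S h k \<longrightarrow> dg (N' h k) \<le> dg y)"
      if h: "\<And>i. i < k \<Longrightarrow> h i \<in> I" for h k
    proof -
      have "\<exists>x. x \<in> I \<and> x \<notin> seq_span ?S h k" by (rule ex) (rule h)
      then obtain x where "x \<in> I \<and> x \<notin> seq_span ?S h k" by (rule exE)
      from ex_has_least_nat[of "\<lambda>x. x \<in> I \<and> x \<notin> seq_span ?S h k" x dg, OF this]
      have "\<exists>x. x \<in> I \<and> x \<notin> seq_span ?S h k \<and> (\<forall>y. y \<in> I \<and> y \<notin> seq_span ?S h k \<longrightarrow> dg x \<le> dg y)"
        by (simp only: conj_assoc)
      from someI_ex[OF this] show ?thesis unfolding N'_def .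
    qed
    \<comment> \<open>\<open>H k\<close> records the first \<open>k\<close> choices, so that each
      new choice can refer to all earlier ones.\<close>
    define H where "H = rec_nat (\<lambda>_. 0) (\<lambda>k h. h(k := N' h k))"
    have H_Suc: "H (Suc k) = (H k)(k := N' (H k) k)" for k by (simp add: H_def)
    define h where "h k = N' (H k) k" for k
    have Hh: "H k i = h i" if "i < k" for i k using that by (induction k) (auto simp: H_Suc h_def less_Suc_eq)
    have hI: "h k \<in> I" for k
    proof (induction k rule: less_induct)
      case (less k)
      hence "H k i \<in> I" if "i < k" for i using Hh[OF that] that by simp
      from N'[OF this] show ?case by (simp add: h_def)
    qed
    have h: "h k \<notin> seq_span ?S h k" "\<And>y. y \<in> I \<Longrightarrow> y \<notin> seq_span ?S h k \<Longrightarrow> dg (h k) \<le> dg y" for k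
    proof -
      have e: "seq_span ?S (H k) k = seq_span ?S h k" by (rule seq_span_cong[OF Hh])
      from N'[of k "H k"] Hh hI show "h k \<notin> seq_span ?S h k" "\<And>y. y \<in> I \<Longrightarrow> y \<notin> seq_span ?S h k \<Longrightarrow> dg (h k) \<le> dg y"
        unfolding e h_def[symmetric] by auto
    qed
    have "\<exists>p. \<forall>k. p k \<in> polys_over R \<and> degree (p k) \<le> dg (h k) \<and> poly (p k) g = h k"
      using dg[OF hI] by metis
    then obtain p where p: "\<And>k. p k \<in> polys_over R" "\<And>k. degree (p k) \<le> dg (h k)" "\<And>k. poly (p k) g = h k" by blast
    \<comment> \<open>The top coefficients, read in degree \<open>dg (h k)\<close>. The chain
      condition for \<open>R\<close> is applied to them.\<close>
    define a where "a k = coeff (p k) (dg (h k))" for k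
    have "\<forall>k. a k \<in> R" using p(1) by (auto simp: a_def polys_overD)
    then obtain m where "a m \<in> seq_span R a m" using N by blast
    then obtain r where r: "a m = (\<Sum>i<m. r i * a i)" "\<And>i. i < m \<Longrightarrow> r i \<in> R" by (auto simp: seq_span_def)
    define d where "d = dg (h m)"
    have di: "dg (h i) \<le> d" if "i < m" for i
      unfolding d_def using h(1)[of m] seq_span_mono[OF S, of i m h] that by (intro h(2) hI) auto
    define q where "q = p m - (\<Sum>i<m. monom (r i) (d - dg (h i)) * p i)"
    note SP = subring_on_polys_over[OF R]
    have q: "q \<in> polys_over R" unfolding q_def
      using r(2) p(1) by (intro subring_on_diff[OF SP] subring_on_sum[OF SP] subring_on_mult[OF SP] monom_in_polys_over R) auto
    have qd: "degree (monom (r i) (d - dg (h i)) * p i) \<le> d" if "i < m" for i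
    proof -
      have "degree (monom (r i) (d - dg (h i)) * p i) \<le> (d - dg (h i)) + dg (h i)"
        using degree_mult_le[of "monom (r i) (d - dg (h i))" "p i"] degree_monom_le[of "r i" "d - dg (h i)"] p(2)[of i]
        by linarith
      thus ?thesis using di[OF that] by simp
    qed
    have dq: "degree q \<le> d"
      unfolding q_def using p(2)[of m] qd by (intro degree_diff_le degree_sum_le) (auto simp: d_def)
    have "coeff (monom (r i) (d - dg (h i)) * p i) d = r i * a i" if "i < m" for i
      using di[OF that] by (simp add: coeff_monom_mult a_def)
    hence cq: "coeff q d = 0"
      using r(1) by (simp add: q_def coeff_sum a_def d_def)
    \<comment> \<open>\<open>x\<close> differs from \<open>h m\<close> by a combination of earlier
      members, so it is outside their span as well; but its polynomial has lost the top coefficient,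
      against the minimal choice of \<open>h m\<close>.\<close>
    define x where "x = poly q g"
    have px: "poly (monom (r i) (d - dg (h i)) * p i) g = (r i * g ^ (d - dg (h i))) * h i" for i
      by (simp add: poly_monom p(3))
    have x: "x = h m - (\<Sum>i<m. (r i * g ^ (d - dg (h i))) * h i)"
      unfolding x_def q_def by (simp add: poly_sum poly_monom p(3))
    have cS: "r i * g ^ (d - dg (h i)) \<in> ?S" if "i < m" for i
      using r(2)[OF that] adjoin_superset[OF R, of g] adjoin_self[OF R, of g]
      by (intro subring_on_mult[OF S] subring_on_power[OF S]) auto
    have sp: "(\<Sum>i<m. (r i * g ^ (d - dg (h i))) * h i) \<in> seq_span ?S h m" using cS by (intro seq_spanI)
    have xI: "x \<in> I" unfolding x using span_I[of m h] hI sp by (intro I_diff) auto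
    have "x \<notin> seq_span ?S h m"
    proof
      assume "x \<in> seq_span ?S h m"
      hence "x - (0 - (\<Sum>i<m. (r i * g ^ (d - dg (h i))) * h i)) \<in> seq_span ?S h m"
        using sp seq_span_0[OF S] by (intro seq_span_diff[OF S])
      thus False using h(1)[of m] by (simp add: x)
    qed
    hence "d \<le> dg x" unfolding d_def using h(2) xI by blast
    moreover have "x = 0 \<or> dg x < d"
    proof (cases "d = 0")
      case True
      hence "q = 0" using dq cq by (metis le_zero_eq leading_coeff_0_iff)
      thus ?thesis by (simp add: x_def)
    next
      case False
      hence "degree q \<le> d - 1" using dq cq by (metis Suc_pred' degree_0 le_SucE leading_coeff_0_iff neq0_conv zero_le)
      hence "dg x \<le> d - 1" using dg_le[OF q _ refl] by (simp add: x_def)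
      thus ?thesis using False by (intro disjI2) linarith
    qed
    moreover have "x \<noteq> 0" using \<open>x \<notin> seq_span ?S h m\<close> seq_span_0[OF S] by auto
    ultimately show False by simp
  qed
qed

section \<open>Linear dependence and algebraic elements modulo a prime ideal\<close>

text \<open>Gaussian elimination for more unknowns than equations, with cross-multiplication instead
  of division; a pivot outside the prime \<open>Z\<close> keeps the solution nontrivial modulo
  \<open>Z\<close>.\<close>

lemma homogeneous_system_mod_prime:
  assumes Z: "prime_ideal_on D Z" and R: "subring_on R" "R \<subseteq> D"
    and "finite E" "finite J" "card E < card J" "\<And>j e. j \<in> J \<Longrightarrow> e \<in> E \<Longrightarrow> M j e \<in> R"
  shows "\<exists>c. (\<forall>j\<in>J. c j \<in> R) \<and> (\<exists>j\<in>J. c j \<notin> Z) \<and> (\<forall>e\<in>E. (\<Sum>j\<in>J. c j * M j e) \<in> Z)"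
  using assms(4-7)
proof (induction E arbitrary: J M rule: finite_induct)
  case empty
  then obtain j where "j \<in> J" by fastforce
  thus ?case using prime_ideal_onD(4)[OF Z] subring_on_1[OF R(1)] by (intro exI[of _ "\<lambda>_. 1"]) auto
next
  case (insert e E)
  note S = R(1)
  show ?case
  proof (cases "\<forall>j\<in>J. M j e \<in> Z")
    case True
    have "card E < card J" using insert.prems(2) insert.hyps by simp
    then obtain c where c: "\<forall>j\<in>J. c j \<in> R" "\<exists>j\<in>J. c j \<notin> Z" "\<forall>e\<in>E. (\<Sum>j\<in>J. c j * M j e) \<in> Z"
      using insert.IH[of J M] insert.prems by auto
    have "(\<Sum>j\<in>J. c j * M j e) \<in> Z"
      using c(1) True R(2) by (intro prime_ideal_on_sum[OF Z] prime_ideal_onD(6)[OF Z]) auto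
    thus ?thesis using c by auto
  next
    case False
    then obtain k where k: "k \<in> J" "M k e \<notin> Z" by blast
    define p where "p = M k e"
    define J' where "J' = J - {k}"
    define M' where "M' j f = p * M j f - M j e * M k f" for j f
    have pR: "p \<in> R" using insert.prems(3)[of k e] k by (simp add: p_def)
    have MR: "M j f \<in> R" if "j \<in> J" "f \<in> insert e E" for j f using insert.prems(3) that by blast
    have J: "J = insert k J'" "k \<notin> J'" "finite J'" using k insert.prems(1) by (auto simp: J'_def)
    have "card E < card J'" using insert.prems(2) insert.hyps J by simp
    moreover have "M' j f \<in> R" if "j \<in> J'" "f \<in> E" for j f
      unfolding M'_def using that k by (intro subring_on_diff[OF S] subring_on_mult[OF S] pR MR) (auto simp: J'_def)
    ultimately obtain c where c: "\<forall>j\<in>J'. c j \<in> R" "\<exists>j\<in>J'. c j \<notin> Z" "\<forall>f\<in>E. (\<Sum>j\<in>J'. c j * M' j f) \<in> Z"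
      using insert.IH[of J' M'] J(3) by blast
    define s where "s = (\<Sum>j\<in>J'. c j * M j e)"
    define c' where "c' j = (if j = k then - s else p * c j)" for j
    have sR: "s \<in> R" unfolding s_def using c(1) by (intro subring_on_sum[OF S] subring_on_mult[OF S] MR) (auto simp: J'_def)
    have sum: "(\<Sum>j\<in>J. c' j * M j f) = (\<Sum>j\<in>J'. p * c j * M j f) - s * M k f" for f
    proof -
      have "(\<Sum>j\<in>J'. c' j * M j f) = (\<Sum>j\<in>J'. p * c j * M j f)"
        using J(2) by (intro sum.cong) (auto simp: c'_def)
      thus ?thesis using J by (simp add: c'_def)
    qed
    have "(\<Sum>j\<in>J. c' j * M j e) = 0"
      unfolding sum s_def p_def[symmetric] sum_distrib_right by (simp add: sum_subtractf[symmetric] mult_ac)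
    moreover have "(\<Sum>j\<in>J. c' j * M j f) = (\<Sum>j\<in>J'. c j * M' j f)" for f
      unfolding sum s_def M'_def sum_distrib_right sum_subtractf[symmetric]
      by (intro sum.cong) (simp_all add: algebra_simps)
    ultimately have "\<forall>f\<in>insert e E. (\<Sum>j\<in>J. c' j * M j f) \<in> Z"
      using c(3) prime_ideal_onD(3)[OF Z] by auto
    moreover have "\<forall>j\<in>J. c' j \<in> R"
      using c(1) pR sR J by (auto simp: c'_def intro: subring_on_uminus[OF S] subring_on_mult[OF S])
    moreover obtain j where j: "j \<in> J'" "c j \<notin> Z" using c(2) by blast
    hence "p * c j \<notin> Z" using prime_ideal_onD(8)[OF Z, of p "c j"] k(2) pR c(1) R(2) by (auto simp: p_def)
    hence "c' j \<notin> Z" using j J(2) by (auto simp: c'_def)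
    hence "\<exists>j\<in>J. c' j \<notin> Z" using j J by auto
    ultimately show ?thesis by blast
  qed
qed

text \<open>The vector space spanned by \<open>E\<close> over the fraction field of \<open>R\<close>
  modulo \<open>Z\<close>. The multiplier \<open>a\<close> acts as a common denominator, which
  avoids constructing quotients and fractions.\<close>

definition span_mod :: "'a::comm_ring_1 set \<Rightarrow> 'a set \<Rightarrow> 'a set \<Rightarrow> 'a set \<Rightarrow> 'a set" where
  "span_mod D Z R E = {b \<in> D. \<exists>a\<in>R - Z. \<exists>c. (\<forall>e\<in>E. c e \<in> R) \<and> a * b - (\<Sum>e\<in>E. c e * e) \<in> Z}"

locale ring_mod_prime =
  fixes D Z R :: "'a::comm_ring_1 set"
  assumes Z: "prime_ideal_on D Z" and R: "subring_on R" and RD: "R \<subseteq> D"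
begin

lemma D: "subring_on D" by (rule prime_ideal_onD(1)[OF Z])

lemma ZD: "Z \<subseteq> D" by (rule prime_ideal_onD(2)[OF Z])

lemma not_Z_mult: "a \<in> R - Z \<Longrightarrow> b \<in> R - Z \<Longrightarrow> a * b \<in> R - Z"
  using prime_ideal_onD(8)[OF Z, of a b] RD subring_on_mult[OF R] by auto

lemma span_modI:
  assumes "b \<in> D" "a \<in> R - Z" "\<forall>e\<in>E. c e \<in> R" "a * b - (\<Sum>e\<in>E. c e * e) \<in> Z"
  shows "b \<in> span_mod D Z R E"
  using assms unfolding span_mod_def by blast

lemma span_modE:
  assumes "b \<in> span_mod D Z R E"
  obtains a c where "b \<in> D" "a \<in> R - Z" "\<forall>e\<in>E. c e \<in> R" "a * b - (\<Sum>e\<in>E. c e * e) \<in> Z"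
  using assms unfolding span_mod_def by blast

lemma one_not_Z: "1 \<in> R - Z"
  using subring_on_1[OF R] prime_ideal_onD(4)[OF Z] by blast

lemma span_mod_add:
  assumes "x \<in> span_mod D Z R E" "y \<in> span_mod D Z R E" shows "x + y \<in> span_mod D Z R E"
proof -
  obtain a c where a: "x \<in> D" "a \<in> R - Z" "\<forall>e\<in>E. c e \<in> R" "a * x - (\<Sum>e\<in>E. c e * e) \<in> Z"
    using assms(1) by (rule span_modE)
  obtain b d where b: "y \<in> D" "b \<in> R - Z" "\<forall>e\<in>E. d e \<in> R" "b * y - (\<Sum>e\<in>E. d e * e) \<in> Z"
    using assms(2) by (rule span_modE)
  have "b * (a * x - (\<Sum>e\<in>E. c e * e)) + a * (b * y - (\<Sum>e\<in>E. d e * e)) \<in> Z"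
    using a b RD by (intro prime_ideal_on_add[OF Z] prime_ideal_onD(6)[OF Z]) auto
  also have "b * (a * x - (\<Sum>e\<in>E. c e * e)) + a * (b * y - (\<Sum>e\<in>E. d e * e)) =
      a * b * (x + y) - (\<Sum>e\<in>E. (b * c e + a * d e) * e)"
    by (simp add: algebra_simps sum.distrib sum_distrib_left)
  finally show ?thesis
    using a b by (intro span_modI[of _ "a * b" E "\<lambda>e. b * c e + a * d e"] not_Z_mult subring_on_add[OF D])
      (auto intro!: subring_on_add[OF R] subring_on_mult[OF R])
qed

lemma span_mod_cancel:
  assumes "a * x \<in> span_mod D Z R E" "a \<in> R - Z" "x \<in> D" shows "x \<in> span_mod D Z R E"
proof -
  obtain b c where b: "b \<in> R - Z" "\<forall>e\<in>E. c e \<in> R" "b * (a * x) - (\<Sum>e\<in>E. c e * e) \<in> Z"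
    using assms(1) by (rule span_modE)
  thus ?thesis using assms by (intro span_modI[of x "b * a" E c] not_Z_mult) (auto simp: mult.assoc)
qed

lemma span_mod_scale:
  assumes "x \<in> span_mod D Z R E" "r \<in> R" shows "r * x \<in> span_mod D Z R E"
proof -
  obtain b c where b: "x \<in> D" "b \<in> R - Z" "\<forall>e\<in>E. c e \<in> R" "b * x - (\<Sum>e\<in>E. c e * e) \<in> Z"
    using assms(1) by (rule span_modE)
  have "r * (b * x - (\<Sum>e\<in>E. c e * e)) \<in> Z" using b assms RD by (intro prime_ideal_onD(6)[OF Z]) auto
  also have "r * (b * x - (\<Sum>e\<in>E. c e * e)) = b * (r * x) - (\<Sum>e\<in>E. (r * c e) * e)"
    by (simp add: algebra_simps sum_distrib_left)
  finally show ?thesis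
    using b assms RD by (intro span_modI[of _ b E "\<lambda>e. r * c e"]) (auto intro: subring_on_mult[OF D] subring_on_mult[OF R])
qed

lemma Z_in_span_mod: "z \<in> Z \<Longrightarrow> z \<in> span_mod D Z R E"
  using ZD one_not_Z subring_on_0[OF R] by (intro span_modI[of z 1 E "\<lambda>_. 0"]) auto

lemma span_mod_sum: "(\<And>i. i \<in> I \<Longrightarrow> f i \<in> span_mod D Z R E) \<Longrightarrow> sum f I \<in> span_mod D Z R E"
  by (induction I rule: infinite_finite_induct)
    (auto intro: span_mod_add Z_in_span_mod[OF prime_ideal_onD(3)[OF Z]])

lemma span_mod_base: "finite E \<Longrightarrow> e \<in> E \<Longrightarrow> e \<in> D \<Longrightarrow> e \<in> span_mod D Z R E"
proof -
  assume e: "finite E" "e \<in> E" "e \<in> D"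
  have "(\<Sum>f\<in>E. (if f = e then 1 else 0) * f) = e"
    using e by (simp add: if_distrib[of "\<lambda>x. x * _"] cong: if_cong)
  thus ?thesis using e one_not_Z subring_on_0[OF R] subring_on_1[OF R] prime_ideal_onD(3)[OF Z]
    by (intro span_modI[of e 1 E "\<lambda>f. if f = e then 1 else 0"]) auto
qed

lemma span_mod_mult:
  assumes x: "x \<in> span_mod D Z R E" and w: "w \<in> D" and e: "\<And>e. e \<in> E \<Longrightarrow> e * w \<in> span_mod D Z R E'"
  shows "x * w \<in> span_mod D Z R E'"
proof -
  obtain a c where a: "x \<in> D" "a \<in> R - Z" "\<forall>e\<in>E. c e \<in> R" "a * x - (\<Sum>e\<in>E. c e * e) \<in> Z"
    using x by (rule span_modE)
  have "(a * x - (\<Sum>e\<in>E. c e * e)) * w \<in> Z" using a w by (intro prime_ideal_onD(7)[OF Z])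
  hence "(a * x - (\<Sum>e\<in>E. c e * e)) * w \<in> span_mod D Z R E'" by (rule Z_in_span_mod)
  moreover have "(\<Sum>e\<in>E. c e * (e * w)) \<in> span_mod D Z R E'"
    using a e by (intro span_mod_sum) (simp add: span_mod_scale)
  ultimately have "(a * x - (\<Sum>e\<in>E. c e * e)) * w + (\<Sum>e\<in>E. c e * (e * w)) \<in> span_mod D Z R E'"
    by (rule span_mod_add)
  also have "(a * x - (\<Sum>e\<in>E. c e * e)) * w + (\<Sum>e\<in>E. c e * (e * w)) = a * (x * w)"
    by (simp add: algebra_simps sum_distrib_left)
  finally show ?thesis by (rule span_mod_cancel[OF _ a(2) subring_on_mult[OF D a(1) w]])
qed

text \<open>The class of \<open>y\<close> modulo \<open>Z\<close> is algebraic over the fraction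
  field of \<open>R\<close> modulo \<open>Z\<close>.\<close>

definition algebraic_mod :: "'a \<Rightarrow> bool" where
  "algebraic_mod y \<longleftrightarrow> (\<exists>q\<in>polys_over R. poly q y \<in> Z \<and> (\<exists>i. coeff q i \<notin> Z))"

text \<open>The relation expresses a multiple of \<open>y ^ degree p\<close> by lower powers; its
  leading coefficient is outside \<open>Z\<close> and may serve as a denominator.\<close>

lemma power_span_mod:
  assumes y: "y \<in> D" and p: "p \<in> polys_over R" "poly p y \<in> Z" "lead_coeff p \<notin> Z"
  shows "y ^ k \<in> span_mod D Z R ((\<lambda>j. y ^ j) ` {..<degree p})"
proof (induction k rule: less_induct)
  case (less k)
  let ?E = "(\<lambda>j. y ^ j) ` {..<degree p}"
  let ?d = "degree p"
  have yk: "y ^ k \<in> D" by (rule subring_on_power[OF D y])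
  show ?case
  proof (cases "k < ?d")
    case True thus ?thesis using yk by (intro span_mod_base) auto
  next
    case False
    have "poly p y = (\<Sum>i<?d. coeff p i * y ^ i) + lead_coeff p * y ^ ?d"
      by (simp add: poly_altdef lessThan_Suc_atMost[symmetric])
    hence e: "lead_coeff p * y ^ k = poly p y * y ^ (k - ?d) + (\<Sum>i<?d. (- coeff p i) * y ^ (i + (k - ?d)))"
      using False by (simp add: algebra_simps sum_distrib_left sum_negf flip: power_add)
    have "poly p y * y ^ (k - ?d) + (\<Sum>i<?d. (- coeff p i) * y ^ (i + (k - ?d))) \<in> span_mod D Z R ?E"
    proof (rule span_mod_add)
      show "poly p y * y ^ (k - ?d) \<in> span_mod D Z R ?E"
        by (rule Z_in_span_mod[OF prime_ideal_onD(7)[OF Z subring_on_power[OF D y] p(2)]])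
      show "(\<Sum>i<?d. (- coeff p i) * y ^ (i + (k - ?d))) \<in> span_mod D Z R ?E"
      proof (rule span_mod_sum)
        fix i assume "i \<in> {..<?d}"
        hence "y ^ (i + (k - ?d)) \<in> span_mod D Z R ?E" using False by (intro less) auto
        thus "(- coeff p i) * y ^ (i + (k - ?d)) \<in> span_mod D Z R ?E"
          by (rule span_mod_scale) (intro subring_on_uminus[OF R] polys_overD[OF p(1)])
      qed
    qed
    hence "lead_coeff p * y ^ k \<in> span_mod D Z R ?E" by (simp only: e)
    moreover have "lead_coeff p \<in> R - Z" using p(3) polys_overD[OF p(1)] by blast
    ultimately show ?thesis using yk by (rule span_mod_cancel)
  qed
qed

text \<open>Finitely many powers of \<open>y\<close> span all of them, and their products with the
  elements of \<open>E\<close> span the larger ring.\<close>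

lemma span_mod_adjoin:
  assumes S: "subring_on S" "S \<subseteq> span_mod D Z R E" "finite E" "E \<subseteq> D" and y: "y \<in> D" "algebraic_mod y"
  shows "\<exists>E'. finite E' \<and> E' \<subseteq> D \<and> adjoin S y \<subseteq> span_mod D Z R E'"
proof -
  obtain p where p: "p \<in> polys_over R" "poly p y \<in> Z" "lead_coeff p \<notin> Z"
    using y minimal_relation[OF Z R RD y(1)] unfolding algebraic_mod_def by blast
  define P where "P = (\<lambda>j. y ^ j) ` {..<degree p}"
  define E' where "E' = (\<lambda>(e, w). e * w) ` (E \<times> P)"
  have PD: "P \<subseteq> D" using subring_on_power[OF D y(1)] by (auto simp: P_def)
  have E': "finite E'" "E' \<subseteq> D" using S(3,4) PD by (auto simp: E'_def P_def intro!: subring_on_mult[OF D])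
  have ey: "e * y ^ k \<in> span_mod D Z R E'" if e: "e \<in> E" for e k
  proof -
    have "y ^ k * e \<in> span_mod D Z R E'"
    proof (rule span_mod_mult[where E = P])
      show "y ^ k \<in> span_mod D Z R P" unfolding P_def by (rule power_span_mod[OF y(1) p])
      show "e \<in> D" using e S(4) by blast
      fix w assume "w \<in> P"
      hence "e * w \<in> E'" using e by (auto simp: E'_def)
      hence "w * e \<in> E'" by (simp only: mult.commute)
      thus "w * e \<in> span_mod D Z R E'" using E' by (intro span_mod_base) auto
    qed
    thus ?thesis by (simp add: mult.commute)
  qed
  have "adjoin S y \<subseteq> span_mod D Z R E'"
  proof
    fix x assume "x \<in> adjoin S y"
    then obtain q where q: "q \<in> polys_over S" "x = poly q y" by (auto simp: adjoin_def)
    have "coeff q i * y ^ i \<in> span_mod D Z R E'" for i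
    proof (rule span_mod_mult[where E = E])
      show "coeff q i \<in> span_mod D Z R E" using polys_overD[OF q(1), of i] S(2) by blast
      show "y ^ i \<in> D" by (rule subring_on_power[OF D y(1)])
    qed (rule ey)
    thus "x \<in> span_mod D Z R E'" unfolding q(2) poly_altdef by (intro span_mod_sum)
  qed
  thus ?thesis using E' by blast
qed

lemma foldr_adjoin:
  assumes "\<And>y. y \<in> set ys \<Longrightarrow> y \<in> D"
  shows "subring_on (foldr (\<lambda>y S. adjoin S y) ys R) \<and> R \<subseteq> foldr (\<lambda>y S. adjoin S y) ys R \<and>
    foldr (\<lambda>y S. adjoin S y) ys R \<subseteq> D \<and> set ys \<subseteq> foldr (\<lambda>y S. adjoin S y) ys R"
  using assms
proof (induction ys)
  case (Cons y ys)
  let ?S = "foldr (\<lambda>y S. adjoin S y) ys R"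
  have S: "subring_on ?S" "R \<subseteq> ?S" "?S \<subseteq> D" "set ys \<subseteq> ?S" using Cons by auto
  have "adjoin ?S y \<subseteq> D" using Cons.prems by (intro adjoin_subset[OF D S(3)]) auto
  thus ?case using S subring_on_adjoin[OF S(1), of y] adjoin_superset[OF S(1), of y] adjoin_self[OF S(1), of y]
    by (simp add: subset_iff)
qed (use R RD in auto)

lemma span_mod_adjoin_list:
  assumes "\<And>y. y \<in> set ys \<Longrightarrow> y \<in> D \<and> algebraic_mod y"
  shows "\<exists>E. finite E \<and> E \<subseteq> D \<and> foldr (\<lambda>y S. adjoin S y) ys R \<subseteq> span_mod D Z R E"
  using assms
proof (induction ys)
  case Nil
  have "r \<in> span_mod D Z R {1}" if "r \<in> R" for r
    using span_mod_scale[OF span_mod_base[of "{1}" 1] that] subring_on_1[OF D] by simp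
  thus ?case using subring_on_1[OF D] by (intro exI[of _ "{1}"]) auto
next
  case (Cons y ys)
  then obtain E where E: "finite E" "E \<subseteq> D" "foldr (\<lambda>y S. adjoin S y) ys R \<subseteq> span_mod D Z R E" by auto
  have "subring_on (foldr (\<lambda>y S. adjoin S y) ys R)" using foldr_adjoin[of ys] Cons.prems by auto
  thus ?case using span_mod_adjoin[OF _ E(3,1,2), of y] Cons.prems by auto
qed

text \<open>These are \<open>card E + 1\<close> powers in a space spanned by \<open>card E\<close>
  elements. The degree of the relation is bounded in terms of \<open>E\<close> and not of
  \<open>b\<close>; this is the origin of the uniform exponent in the height bound.\<close>

lemma powers_dependent:
  assumes E: "finite E" "E \<subseteq> D" and b: "b \<in> D" "\<And>i. i \<le> card E \<Longrightarrow> b ^ i \<in> span_mod D Z R E"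
  shows "\<exists>c. (\<forall>i. c i \<in> R) \<and> (\<exists>i\<le>card E. c i \<notin> Z) \<and> (\<Sum>i\<le>card E. c i * b ^ i) \<in> Z"
proof -
  have "\<forall>i. \<exists>a M. i \<le> card E \<longrightarrow> a \<in> R - Z \<and> (\<forall>e\<in>E. M e \<in> R) \<and> a * b ^ i - (\<Sum>e\<in>E. M e * e) \<in> Z"
    using b(2) unfolding span_mod_def by blast
  then obtain a M where "\<forall>i. i \<le> card E \<longrightarrow> a i \<in> R - Z \<and> (\<forall>e\<in>E. M i e \<in> R) \<and> a i * b ^ i - (\<Sum>e\<in>E. M i e * e) \<in> Z"
    by metis
  hence aM: "\<And>i. i \<le> card E \<Longrightarrow> a i \<in> R - Z" "\<And>i e. i \<le> card E \<Longrightarrow> e \<in> E \<Longrightarrow> M i e \<in> R"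
    "\<And>i. i \<le> card E \<Longrightarrow> a i * b ^ i - (\<Sum>e\<in>E. M i e * e) \<in> Z" by auto
  obtain c where c: "\<forall>i\<in>{..card E}. c i \<in> R" "\<exists>i\<in>{..card E}. c i \<notin> Z" "\<forall>e\<in>E. (\<Sum>i\<in>{..card E}. c i * M i e) \<in> Z"
    using homogeneous_system_mod_prime[OF Z R RD E(1), of "{..card E}" M] aM by auto
  define c' where "c' i = (if i \<le> card E then c i * a i else 0)" for i
  have "\<forall>i. c' i \<in> R" using c(1) aM(1) subring_on_0[OF R] by (auto simp: c'_def intro: subring_on_mult[OF R])
  moreover obtain i where i: "i \<le> card E" "c i \<notin> Z" using c(2) by auto
  hence "c i * a i \<in> R - Z" using c(1) aM(1) by (intro not_Z_mult) auto
  hence "\<exists>i\<le>card E. c' i \<notin> Z" using i by (auto simp: c'_def)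
  moreover have "(\<Sum>i\<le>card E. c' i * b ^ i) \<in> Z"
  proof -
    have "(\<Sum>i\<le>card E. c i * (a i * b ^ i - (\<Sum>e\<in>E. M i e * e))) \<in> Z"
      using aM(3) c(1) RD by (intro prime_ideal_on_sum[OF Z] prime_ideal_onD(6)[OF Z]) auto
    moreover have "(\<Sum>e\<in>E. (\<Sum>i\<in>{..card E}. c i * M i e) * e) \<in> Z"
    proof (rule prime_ideal_on_sum[OF Z])
      fix e assume "e \<in> E"
      thus "(\<Sum>i\<in>{..card E}. c i * M i e) * e \<in> Z" using c(3) E(2) by (intro prime_ideal_onD(7)[OF Z, of e]) auto
    qed
    ultimately have mem: "(\<Sum>i\<le>card E. c i * (a i * b ^ i - (\<Sum>e\<in>E. M i e * e)))
        + (\<Sum>e\<in>E. (\<Sum>i\<in>{..card E}. c i * M i e) * e) \<in> Z" by (rule prime_ideal_on_add[OF Z])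
    have 1: "(\<Sum>e\<in>E. (\<Sum>i\<in>{..card E}. c i * M i e) * e) = (\<Sum>i\<le>card E. c i * (\<Sum>e\<in>E. M i e * e))"
      unfolding sum_distrib_right sum_distrib_left by (subst sum.swap) (simp add: mult.assoc)
    have 2: "(\<Sum>i\<le>card E. c i * (a i * b ^ i - (\<Sum>e\<in>E. M i e * e))) + (\<Sum>i\<le>card E. c i * (\<Sum>e\<in>E. M i e * e))
        = (\<Sum>i\<le>card E. c' i * b ^ i)"
      unfolding sum.distrib[symmetric] by (intro sum.cong) (simp_all add: c'_def algebra_simps)
    show ?thesis using mem by (simp only: 1 2)
  qed
  ultimately show ?thesis by blast
qed

text \<open>\<open>b\<close> is algebraic along with \<open>y\<close>. In a relation of
  \<open>b\<close> the low terms with coefficients in \<open>Z\<close> are dropped and a power of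
  \<open>b\<close> is divided out, which primality allows. The constant term will force images of
  \<open>b\<close> to be nonzero.\<close>

lemma algebraic_relation_nonzero_const:
  assumes y: "y \<in> D" "algebraic_mod y" and b: "b \<in> adjoin R y" "b \<notin> Z"
  shows "\<exists>q\<in>polys_over R. poly q b \<in> Z \<and> coeff q 0 \<notin> Z"
proof -
  note A = subring_on_adjoin[OF R, of y]
  have bD: "b \<in> D" using b(1) adjoin_subset[OF D RD y(1)] by blast
  obtain E where E: "finite E" "E \<subseteq> D" "adjoin R y \<subseteq> span_mod D Z R E"
    using span_mod_adjoin_list[of "[y]"] y by auto
  have "b ^ i \<in> span_mod D Z R E" for i using E(3) subring_on_power[OF A b(1)] by blast
  then obtain c where c: "\<forall>i. c i \<in> R" "\<exists>i\<le>card E. c i \<notin> Z" "(\<Sum>i\<le>card E. c i * b ^ i) \<in> Z"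
    using powers_dependent[OF E(1,2) bD] by blast
  define n where "n = card E"
  define k where "k = (LEAST i. c i \<notin> Z)"
  have k: "c k \<notin> Z" unfolding k_def using c(2) by (metis LeastI)
  have kl: "c i \<in> Z" if "i < k" for i using not_less_Least[of i "\<lambda>i. c i \<notin> Z"] that by (auto simp: k_def)
  have kn: "k \<le> n" using c(2) Least_le[of "\<lambda>i. c i \<notin> Z"] by (auto simp: k_def n_def intro: order_trans)
  define q where "q = (\<Sum>i\<le>n - k. monom (c (i + k)) i)"
  have "(\<Sum>i\<le>n. c i * b ^ i) = (\<Sum>i<k. c i * b ^ i) + (\<Sum>i\<in>{k..n}. c i * b ^ i)"
    using kn by (subst sum.union_disjoint[symmetric]) (auto intro!: sum.cong)
  also have "(\<Sum>i\<in>{k..n}. c i * b ^ i) = (\<Sum>i\<le>n - k. c (i + k) * b ^ (i + k))"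
    using kn by (intro sum.reindex_bij_witness[of _ "\<lambda>i. i + k" "\<lambda>i. i - k"]) auto
  also have "\<dots> = b ^ k * poly q b"
    by (simp add: q_def poly_sum poly_monom sum_distrib_left power_add mult_ac)
  finally have e: "b ^ k * poly q b = (\<Sum>i\<le>n. c i * b ^ i) - (\<Sum>i<k. c i * b ^ i)" by simp
  have "(\<Sum>i<k. c i * b ^ i) \<in> Z"
    using kl subring_on_power[OF D bD] by (intro prime_ideal_on_sum[OF Z] prime_ideal_onD(7)[OF Z]) auto
  hence "b ^ k * poly q b \<in> Z" unfolding e using c(3) by (intro prime_ideal_onD(5)[OF Z]) (auto simp: n_def)
  moreover have qR: "q \<in> polys_over R"
    unfolding q_def using c(1) by (intro subring_on_sum[OF subring_on_polys_over[OF R]] monom_in_polys_over R) auto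
  hence "poly q b \<in> D" using poly_in_subring[OF D _ bD] polys_over_mono[OF RD] by blast
  ultimately have "b ^ k \<in> Z \<or> poly q b \<in> Z" using prime_ideal_onD(8)[OF Z subring_on_power[OF D bD]] by blast
  hence "poly q b \<in> Z" using prime_ideal_on_power[OF Z bD] b(2) by blast
  moreover have "coeff q 0 = c k" by (simp add: q_def coeff_sum)
  ultimately show ?thesis using qR k by auto
qed

section \<open>Extension of complex-valued homomorphisms\<close>

definition good_hom :: "('a \<Rightarrow> complex) \<Rightarrow> bool" where
  "good_hom \<phi> \<longleftrightarrow> ring_hom_on R \<phi> \<and> (\<forall>z\<in>R \<inter> Z. \<phi> z = 0)"

lemma good_hom_value:
  assumes "ring_hom_on (adjoin R y) \<psi>" "\<forall>r\<in>R. \<psi> r = \<phi> r" "p \<in> polys_over R"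
  shows "\<psi> (poly p y) = poly (map_poly \<phi> p) (\<psi> y)"
proof -
  have "p \<in> polys_over (adjoin R y)" using assms(3) polys_over_mono[OF adjoin_superset[OF R]] by blast
  hence "\<psi> (poly p y) = poly (map_poly \<psi> p) (\<psi> y)"
    by (rule poly_map_poly_hom[OF assms(1) _ adjoin_self[OF R]])
  moreover have "map_poly \<psi> p = map_poly \<phi> p"
    using assms(2) polys_overD[OF assms(3)] subring_on_0[OF R] ring_hom_on_0[OF assms(1)]
    by (intro poly_eqI) (auto simp: coeff_map_poly)
  ultimately show ?thesis by simp
qed

text \<open>If \<open>y\<close> is transcendental modulo \<open>Z\<close>, any complex image of
  \<open>y\<close> respects the relations; \<open>a\<close> is a coefficient outside
  \<open>Z\<close> of \<open>b\<close> as a polynomial in \<open>y\<close>, and the finitely many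
  roots of the transported polynomial are avoided. If \<open>y\<close> is algebraic,
  \<open>a\<close> is a product: the leading coefficient of a least relation of \<open>y\<close>
  must survive to provide a root, and the constant term of a relation of \<open>b\<close> must
  survive to keep the image of \<open>b\<close> nonzero.\<close>

lemma good_hom_extend:
  assumes y: "y \<in> D" and b: "b \<in> adjoin R y" "b \<notin> Z"
  shows "\<exists>a\<in>R - Z. \<forall>\<phi>. good_hom \<phi> \<and> \<phi> a \<noteq> 0 \<longrightarrow>
    (\<exists>\<psi>. ring_hom_on (adjoin R y) \<psi> \<and> (\<forall>z\<in>adjoin R y \<inter> Z. \<psi> z = 0) \<and> (\<forall>r\<in>R. \<psi> r = \<phi> r) \<and> \<psi> b \<noteq> 0)"
proof (cases "algebraic_mod y")
  case False
  obtain p where p: "p \<in> polys_over R" "b = poly p y" using b(1) by (auto simp: adjoin_def)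
  have "\<exists>i. coeff p i \<notin> Z"
  proof (rule ccontr)
    assume "\<not> ?thesis"
    hence "b \<in> Z" unfolding p(2) poly_altdef using subring_on_power[OF D y]
      by (intro prime_ideal_on_sum[OF Z] prime_ideal_onD(7)[OF Z]) auto
    thus False using b by simp
  qed
  then obtain i where i: "coeff p i \<notin> Z" by blast
  have "\<exists>\<psi>. ring_hom_on (adjoin R y) \<psi> \<and> (\<forall>z\<in>adjoin R y \<inter> Z. \<psi> z = 0) \<and> (\<forall>r\<in>R. \<psi> r = \<phi> r) \<and> \<psi> b \<noteq> 0"
    if \<phi>: "good_hom \<phi>" "\<phi> (coeff p i) \<noteq> 0" for \<phi>
  proof -
    have h: "ring_hom_on R \<phi>" and hz: "\<And>z. z \<in> R \<Longrightarrow> z \<in> Z \<Longrightarrow> \<phi> z = 0" using \<phi>(1) by (auto simp: good_hom_def)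
    have "map_poly \<phi> p \<noteq> 0" using \<phi>(2) coeff_map_poly_hom[OF h, of p i] by auto
    hence "finite {t. poly (map_poly \<phi> p) t = 0}" by (rule poly_roots_finite)
    then obtain t where t: "poly (map_poly \<phi> p) t \<noteq> 0" using ex_new_if_finite[OF infinite_UNIV_char_0] by blast
    have "poly (map_poly \<phi> q) t = 0" if q: "q \<in> polys_over R" "poly q y \<in> Z" for q
    proof -
      have "coeff q i \<in> Z" for i using False q by (auto simp: algebraic_mod_def)
      hence "map_poly \<phi> q = 0" using hz polys_overD[OF q(1)] by (intro poly_eqI) (auto simp: coeff_map_poly_hom[OF h])
      thus ?thesis by simp
    qed
    from hom_extend[OF h prime_ideal_onD(3)[OF Z] this] obtain \<psi> where
      \<psi>: "ring_hom_on (adjoin R y) \<psi>" "\<forall>r\<in>R. \<psi> r = \<phi> r" "\<psi> y = t" "\<forall>z\<in>adjoin R y \<inter> Z. \<psi> z = 0" by blast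
    have "\<psi> b \<noteq> 0" using good_hom_value[OF \<psi>(1,2) p(1)] \<psi>(3) t p(2) by simp
    thus ?thesis using \<psi> by blast
  qed
  thus ?thesis using i polys_overD[OF p(1)] by blast
next
  case True
  obtain p where p: "p \<in> polys_over R" "poly p y \<in> Z" "lead_coeff p \<notin> Z"
    "\<And>q. q \<in> polys_over R \<Longrightarrow> poly q y \<in> Z \<Longrightarrow> degree q < degree p \<Longrightarrow> \<forall>i. coeff q i \<in> Z"
    using True minimal_relation[OF Z R RD y] unfolding algebraic_mod_def by blast
  obtain q where q: "q \<in> polys_over R" "poly q b \<in> Z" "coeff q 0 \<notin> Z"
    using algebraic_relation_nonzero_const[OF y True b] by blast
  define a where "a = lead_coeff p * coeff q 0"
  have aR: "a \<in> R - Z" unfolding a_def using p(1,3) q by (intro not_Z_mult) (auto simp: polys_overD)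
  have "\<exists>\<psi>. ring_hom_on (adjoin R y) \<psi> \<and> (\<forall>z\<in>adjoin R y \<inter> Z. \<psi> z = 0) \<and> (\<forall>r\<in>R. \<psi> r = \<phi> r) \<and> \<psi> b \<noteq> 0"
    if \<phi>: "good_hom \<phi>" "\<phi> a \<noteq> 0" for \<phi>
  proof -
    have h: "ring_hom_on R \<phi>" and hz: "\<And>z. z \<in> R \<inter> Z \<Longrightarrow> \<phi> z = 0" using \<phi>(1) by (auto simp: good_hom_def)
    have l: "\<phi> (lead_coeff p) \<noteq> 0" "\<phi> (coeff q 0) \<noteq> 0"
      using \<phi>(2) ring_hom_on_mult[OF h polys_overD[OF p(1)] polys_overD[OF q(1)]] by (auto simp: a_def)
    have "degree p \<noteq> 0"
    proof
      assume "degree p = 0"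
      then obtain c where "p = [:c:]" by (auto elim: degree_eq_zeroE)
      thus False using p(2,3) by auto
    qed
    moreover have "degree (map_poly \<phi> p) = degree p"
      using l(1) degree_map_poly_hom_le[OF h, of p] coeff_map_poly_hom[OF h, of p "degree p"]
      by (metis le_antisym le_degree)
    ultimately have "\<not> constant (poly (map_poly \<phi> p))" by (simp add: constant_degree)
    then obtain t where t: "poly (map_poly \<phi> p) t = 0" using fundamental_theorem_of_algebra by blast
    have "poly (map_poly \<phi> r) t = 0" if "r \<in> polys_over R" "poly r y \<in> Z" for r
      by (rule hom_extend_algebraic[OF Z RD y h hz p(1,2) l(1) p(4) t that])
    from hom_extend[OF h prime_ideal_onD(3)[OF Z] this] obtain \<psi> where
      \<psi>: "ring_hom_on (adjoin R y) \<psi>" "\<forall>r\<in>R. \<psi> r = \<phi> r" "\<psi> y = t" "\<forall>z\<in>adjoin R y \<inter> Z. \<psi> z = 0" by blast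
    have "\<psi> b \<noteq> 0"
    proof
      assume b0: "\<psi> b = 0"
      have qA: "q \<in> polys_over (adjoin R y)" using q(1) polys_over_mono[OF adjoin_superset[OF R]] by blast
      have "poly q b \<in> adjoin R y" by (rule poly_in_subring[OF subring_on_adjoin[OF R] qA b(1)])
      hence "\<psi> (poly q b) = 0" using \<psi>(4) q(2) by blast
      hence "poly (map_poly \<psi> q) 0 = 0" using poly_map_poly_hom[OF \<psi>(1) qA b(1)] b0 by simp
      hence "\<psi> (coeff q 0) = 0" by (simp add: poly_0_coeff_0 coeff_map_poly_hom[OF \<psi>(1)])
      thus False using \<psi>(2) polys_overD[OF q(1)] l(2) by simp
    qed
    thus ?thesis using \<psi> by blast
  qed
  thus ?thesis using aR by blast
qed

text \<open>The element that the outermost extension requires to be nonzero is the one that the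
  inner extensions are asked to keep nonzero.\<close>

lemma good_hom_extend_list:
  assumes "\<And>y. y \<in> set ys \<Longrightarrow> y \<in> D" and "b \<in> foldr (\<lambda>y S. adjoin S y) ys R" "b \<notin> Z"
  shows "\<exists>a\<in>R - Z. \<forall>\<phi>. good_hom \<phi> \<and> \<phi> a \<noteq> 0 \<longrightarrow>
    (\<exists>\<psi>. ring_hom_on (foldr (\<lambda>y S. adjoin S y) ys R) \<psi> \<and> (\<forall>z\<in>foldr (\<lambda>y S. adjoin S y) ys R \<inter> Z. \<psi> z = 0) \<and>
      (\<forall>r\<in>R. \<psi> r = \<phi> r) \<and> \<psi> b \<noteq> 0)"
  using assms
proof (induction ys arbitrary: b)
  case Nil
  thus ?case by (intro bexI[of _ b]) (auto simp: good_hom_def)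
next
  case (Cons y ys)
  let ?S = "foldr (\<lambda>y S. adjoin S y) ys R"
  have S: "subring_on ?S" "R \<subseteq> ?S" "?S \<subseteq> D" using foldr_adjoin[of ys] Cons.prems(1) by auto
  interpret S: ring_mod_prime D Z ?S by unfold_locales (use Z S in auto)
  have "y \<in> D" "b \<in> adjoin ?S y" using Cons.prems by auto
  then obtain a where a: "a \<in> ?S - Z" "\<And>\<phi>. S.good_hom \<phi> \<Longrightarrow> \<phi> a \<noteq> 0 \<Longrightarrow>
    \<exists>\<psi>. ring_hom_on (adjoin ?S y) \<psi> \<and> (\<forall>z\<in>adjoin ?S y \<inter> Z. \<psi> z = 0) \<and> (\<forall>r\<in>?S. \<psi> r = \<phi> r) \<and> \<psi> b \<noteq> 0"
    using S.good_hom_extend[of y b] Cons.prems(3) by blast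
  have "\<exists>c\<in>R - Z. \<forall>\<phi>. good_hom \<phi> \<and> \<phi> c \<noteq> 0 \<longrightarrow>
    (\<exists>\<psi>. ring_hom_on ?S \<psi> \<and> (\<forall>z\<in>?S \<inter> Z. \<psi> z = 0) \<and> (\<forall>r\<in>R. \<psi> r = \<phi> r) \<and> \<psi> a \<noteq> 0)"
    using a(1) Cons.prems(1) by (intro Cons.IH) auto
  then obtain c where c: "c \<in> R - Z" "\<And>\<phi>. good_hom \<phi> \<Longrightarrow> \<phi> c \<noteq> 0 \<Longrightarrow>
    \<exists>\<psi>. ring_hom_on ?S \<psi> \<and> (\<forall>z\<in>?S \<inter> Z. \<psi> z = 0) \<and> (\<forall>r\<in>R. \<psi> r = \<phi> r) \<and> \<psi> a \<noteq> 0" by blast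
  have "\<exists>\<psi>. ring_hom_on (adjoin ?S y) \<psi> \<and> (\<forall>z\<in>adjoin ?S y \<inter> Z. \<psi> z = 0) \<and> (\<forall>r\<in>R. \<psi> r = \<phi> r) \<and> \<psi> b \<noteq> 0"
    if \<phi>: "good_hom \<phi>" "\<phi> c \<noteq> 0" for \<phi>
  proof -
    obtain \<eta> where \<eta>: "ring_hom_on ?S \<eta>" "\<forall>z\<in>?S \<inter> Z. \<eta> z = 0" "\<forall>r\<in>R. \<eta> r = \<phi> r" "\<eta> a \<noteq> 0"
      using c(2)[OF \<phi>] by blast
    obtain \<psi> where "ring_hom_on (adjoin ?S y) \<psi>" "\<forall>z\<in>adjoin ?S y \<inter> Z. \<psi> z = 0" "\<forall>r\<in>?S. \<psi> r = \<eta> r" "\<psi> b \<noteq> 0"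
      using a(2)[of \<eta>] \<eta> by (auto simp: S.good_hom_def)
    thus ?thesis using \<eta>(3) S(2) by (intro exI[of _ \<psi>]) (auto simp: subset_iff)
  qed
  thus ?case using c(1) by auto
qed

end

section \<open>Zariski closed subsets of the torus\<close>

abbreviation adjoin_list :: "'a::comm_ring_1 list \<Rightarrow> 'a set \<Rightarrow> 'a set" where
  "adjoin_list ys R \<equiv> foldr (\<lambda>y S. adjoin S y) ys R"

lemma adjoin_list_subset: "subring_on B \<Longrightarrow> R \<subseteq> B \<Longrightarrow> set ys \<subseteq> B \<Longrightarrow> adjoin_list ys R \<subseteq> B"
proof (induction ys)
  case (Cons y ys)
  thus ?case using adjoin_subset[of B "adjoin_list ys R" y] by simp
qed simp

lemma adjoin_list_superset:
  assumes "subring_on R"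
  shows "subring_on (adjoin_list ys R) \<and> R \<subseteq> adjoin_list ys R \<and> set ys \<subseteq> adjoin_list ys R"
proof (induction ys)
  case (Cons y ys)
  hence S: "subring_on (adjoin_list ys R)" by simp
  thus ?case using Cons subring_on_adjoin[OF S, of y] adjoin_superset[OF S, of y] adjoin_self[OF S, of y] by auto
qed (use assms in auto)

lemma noetherian_adjoin_list: "noetherian R \<Longrightarrow> noetherian (adjoin_list ys R)"
  by (induction ys) (auto intro: noetherian_adjoin)

definition const_funs :: "(complex^'n \<Rightarrow> complex) set" where "const_funs = range (\<lambda>c x. c)"

definition coord :: "'n \<Rightarrow> complex^'n \<Rightarrow> complex" where "coord i = (\<lambda>x. x $ i)"

definition icoord :: "'n \<Rightarrow> complex^'n \<Rightarrow> complex" where "icoord i = (\<lambda>x. inverse (x $ i))"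

definition poly_funs :: "(complex^('n::finite) \<Rightarrow> complex) set" where
  "poly_funs = adjoin_list (SOME ys. set ys = range coord) const_funs"

definition laurent_gens :: "(complex^('n::finite) \<Rightarrow> complex) list" where
  "laurent_gens = (SOME ys. set ys = range coord \<union> range icoord)"

text \<open>The coordinate ring of the torus, realised by functions on the whole space. By the
  convention \<open>inverse 0 = 0\<close>, \<open>icoord i\<close> inverts \<open>coord i\<close>
  exactly where the coordinate is nonzero, so the relation holds on the torus and modulo functions
  vanishing on a subset of it.\<close>

definition laurent_funs :: "(complex^('n::finite) \<Rightarrow> complex) set" where
  "laurent_funs = adjoin_list laurent_gens const_funs"

lemma fun_power_apply: "(f ^ k) x = (f x :: 'a::comm_ring_1) ^ k"
  by (induction k) auto

lemma fun_sum_apply: "(sum f A) x = (\<Sum>a\<in>A. (f a x :: 'a::comm_ring_1))"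
  by (induction A rule: infinite_finite_induct) auto

lemma fun_prod_apply: "(prod f A) x = (\<Prod>a\<in>A. (f a x :: 'a::comm_ring_1))"
  by (induction A rule: infinite_finite_induct) auto

lemma subring_on_const_funs: "subring_on const_funs"
  unfolding subring_on_def const_funs_def
  by (auto simp: one_fun_def fun_diff_def times_fun_def image_def)

lemma noetherian_const_funs: "noetherian const_funs"
proof (rule noetherian_field[OF subring_on_const_funs])
  fix f :: "complex^'n \<Rightarrow> complex" assume "f \<in> const_funs" "f \<noteq> 0"
  then obtain c where "f = (\<lambda>x. c)" "c \<noteq> 0" by (auto simp: const_funs_def zero_fun_def)
  thus "\<exists>g\<in>const_funs. f * g = 1"
    by (intro bexI[of _ "\<lambda>x. inverse c"]) (auto simp: const_funs_def times_fun_def one_fun_def)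
qed

lemma set_poly_gens: "set (SOME ys. set ys = range (coord :: 'n::finite \<Rightarrow> _)) = range (coord :: 'n \<Rightarrow> _)"
  by (rule someI_ex, rule finite_list) simp

lemma set_laurent_gens: "set (laurent_gens :: (complex^('n::finite) \<Rightarrow> complex) list) = range coord \<union> range icoord"
  unfolding laurent_gens_def by (rule someI_ex, rule finite_list) simp

lemma poly_funs:
  shows noetherian_poly_funs: "noetherian (poly_funs :: (complex^('n::finite) \<Rightarrow> complex) set)"
    and subring_on_poly_funs: "subring_on (poly_funs :: (complex^'n \<Rightarrow> complex) set)"
    and const_poly_funs: "const_funs \<subseteq> (poly_funs :: (complex^'n \<Rightarrow> complex) set)"
    and coord_poly_funs: "coord (i :: 'n) \<in> poly_funs"
proof -
  let ?ys = "SOME ys. set ys = range (coord :: 'n \<Rightarrow> _)"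
  show "noetherian (poly_funs :: (complex^'n \<Rightarrow> complex) set)"
    unfolding poly_funs_def by (rule noetherian_adjoin_list[OF noetherian_const_funs])
  note * = adjoin_list_superset[OF subring_on_const_funs, of ?ys, folded poly_funs_def]
  thus "subring_on (poly_funs :: (complex^'n \<Rightarrow> complex) set)" "const_funs \<subseteq> (poly_funs :: (complex^'n \<Rightarrow> complex) set)"
    by blast+
  show "coord i \<in> poly_funs" using * unfolding set_poly_gens by blast
qed

lemma poly_funs_subset:
  "subring_on B \<Longrightarrow> const_funs \<subseteq> B \<Longrightarrow> (\<And>i. coord i \<in> B) \<Longrightarrow> poly_funs \<subseteq> B"
  unfolding poly_funs_def by (rule adjoin_list_subset) (auto simp: set_poly_gens)

lemma laurent_funs:
  shows subring_on_laurent_funs: "subring_on laurent_funs"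
    and const_laurent_funs: "const_funs \<subseteq> laurent_funs"
    and coord_laurent_funs: "coord i \<in> laurent_funs"
    and icoord_laurent_funs: "icoord i \<in> laurent_funs"
  using adjoin_list_superset[OF subring_on_const_funs, of laurent_gens] set_laurent_gens
  unfolding laurent_funs_def by auto

lemma laurent_funs_subset:
  "subring_on B \<Longrightarrow> const_funs \<subseteq> B \<Longrightarrow> (\<And>i. coord i \<in> B) \<Longrightarrow> (\<And>i. icoord i \<in> B) \<Longrightarrow> laurent_funs \<subseteq> B"
  unfolding laurent_funs_def by (rule adjoin_list_subset) (auto simp: set_laurent_gens)

lemma poly_laurent_funs: "poly_funs \<subseteq> laurent_funs"
  by (rule poly_funs_subset[OF subring_on_laurent_funs const_laurent_funs coord_laurent_funs])

section \<open>Zero sets of polynomials and Laurent polynomials\<close>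

definition monom_fun :: "('n::finite \<Rightarrow>\<^sub>0 nat) \<Rightarrow> complex^'n \<Rightarrow> complex" where
  "monom_fun m x = (\<Prod>i\<in>UNIV. (x $ i) ^ Poly_Mapping.lookup m i)"

lemma monom_fun_add: "monom_fun (m + n) x = monom_fun m x * monom_fun n x"
  by (simp add: monom_fun_def lookup_add power_add prod.distrib)

lemma poly_eval_superset:
  assumes "finite A" "Poly_Mapping.keys f \<subseteq> A"
  shows "poly_eval f x = (\<Sum>m\<in>A. Poly_Mapping.lookup f m * monom_fun m x)"
  unfolding poly_eval_def monom_fun_def
  by (rule sum.mono_neutral_left[OF assms]) (auto simp: in_keys_iff)

lemma poly_eval_add: "poly_eval (f + g) x = poly_eval f x + poly_eval g x"
proof -
  let ?A = "Poly_Mapping.keys f \<union> Poly_Mapping.keys g"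
  have "Poly_Mapping.keys (f + g) \<subseteq> ?A" by (rule Poly_Mapping.keys_add)
  thus ?thesis
    by (subst (1 2 3) poly_eval_superset[of ?A]) (auto simp: lookup_add distrib_right sum.distrib)
qed

lemma poly_eval_single: "poly_eval (Poly_Mapping.single m c) x = c * monom_fun m x"
  by (subst poly_eval_superset[of "{m}"]) auto

lemma poly_eval_sum: "poly_eval (sum f A) x = (\<Sum>a\<in>A. poly_eval (f a) x)"
proof (induction A rule: infinite_finite_induct)
  case (insert a A)
  thus ?case by (simp add: poly_eval_add)
qed (auto simp: poly_eval_def)

lemma poly_eval_mult_ex: "\<exists>h. \<forall>x. poly_eval h x = poly_eval f x * poly_eval g x"
proof (intro exI allI)
  let ?h = "\<Sum>m\<in>Poly_Mapping.keys f. \<Sum>n\<in>Poly_Mapping.keys g.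
    Poly_Mapping.single (m + n) (Poly_Mapping.lookup f m * Poly_Mapping.lookup g n)"
  fix x
  have "poly_eval f x = (\<Sum>m\<in>Poly_Mapping.keys f. Poly_Mapping.lookup f m * monom_fun m x)"
    "poly_eval g x = (\<Sum>m\<in>Poly_Mapping.keys g. Poly_Mapping.lookup g m * monom_fun m x)"
    by (rule poly_eval_superset; simp)+
  thus "poly_eval ?h x = poly_eval f x * poly_eval g x"
    by (simp add: poly_eval_sum poly_eval_single monom_fun_add sum_product mult_ac)
qed

text \<open>Links the formal polynomials of the definitions to a ring generated by coordinates, for
  which the basis theorem is available.\<close>

lemma range_poly_eval: "range poly_eval = (poly_funs :: (complex^'n \<Rightarrow> complex) set)"
proof
  have monom: "monom_fun m \<in> poly_funs" for m :: "'n \<Rightarrow>\<^sub>0 nat"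
  proof -
    have "monom_fun m = (\<Prod>i\<in>UNIV. coord i ^ Poly_Mapping.lookup m i)"
      by (rule ext) (simp add: monom_fun_def fun_prod_apply fun_power_apply coord_def)
    thus ?thesis by (simp add: subring_on_prod subring_on_power subring_on_poly_funs coord_poly_funs)
  qed
  show "range poly_eval \<subseteq> (poly_funs :: (complex^'n \<Rightarrow> complex) set)"
  proof
    fix h :: "complex^'n \<Rightarrow> complex" assume "h \<in> range poly_eval"
    then obtain f where h: "h = poly_eval f" by blast
    have "poly_eval f = (\<Sum>m\<in>Poly_Mapping.keys f. (\<lambda>_. Poly_Mapping.lookup f m) * monom_fun m)"
      by (rule ext) (simp add: poly_eval_def monom_fun_def fun_sum_apply)
    moreover have "(\<lambda>_. c) * monom_fun m \<in> poly_funs" for c and m :: "'n \<Rightarrow>\<^sub>0 nat"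
      using const_poly_funs by (intro subring_on_mult[OF subring_on_poly_funs] monom) (auto simp: const_funs_def)
    ultimately show "h \<in> poly_funs" unfolding h by (simp add: subring_on_sum subring_on_poly_funs)
  qed
  show "(poly_funs :: (complex^'n \<Rightarrow> complex) set) \<subseteq> range poly_eval"
  proof (rule poly_funs_subset)
    have single: "(\<lambda>x. c * monom_fun m x) \<in> range poly_eval" for c and m :: "'n \<Rightarrow>\<^sub>0 nat"
      by (rule range_eqI[of _ _ "Poly_Mapping.single m c"]) (auto simp: poly_eval_single)
    have const: "(\<lambda>x::complex^'n. c) \<in> range poly_eval" for c using single[of c 0] by (simp add: monom_fun_def)
    thus "const_funs \<subseteq> (range poly_eval :: (complex^'n \<Rightarrow> complex) set)" by (auto simp: const_funs_def)
    show "coord i \<in> range poly_eval" for i :: 'n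
    proof -
      have "monom_fun (Poly_Mapping.single i 1) x = x $ i" for x :: "complex^'n"
        by (simp add: monom_fun_def lookup_single when_def if_distrib[of "\<lambda>k. _ ^ k"] cong: if_cong)
      thus ?thesis using single[of 1 "Poly_Mapping.single i 1"] by (simp add: coord_def)
    qed
    have mult: "f * g \<in> range poly_eval" if fg: "f \<in> range poly_eval" "g \<in> range poly_eval"
      for f g :: "complex^'n \<Rightarrow> complex"
    proof -
      obtain a b where ab: "f = poly_eval a" "g = poly_eval b" using fg by blast
      obtain h where "\<forall>x. poly_eval h x = poly_eval a x * poly_eval b x" using poly_eval_mult_ex by blast
      hence "f * g = poly_eval h" unfolding ab by (intro ext) simp
      thus ?thesis by blast
    qed
    have diff: "f - g \<in> range poly_eval" if fg: "f \<in> range poly_eval" "g \<in> range poly_eval"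
      for f g :: "complex^'n \<Rightarrow> complex"
    proof -
      obtain a b where ab: "f = poly_eval a" "(\<lambda>x. -1) * g = poly_eval b" using mult[OF const[of "-1"] fg(2)] fg(1) by blast
      have "f - g = f + (\<lambda>x. -1) * g" by (rule ext) simp
      also have "\<dots> = poly_eval (a + b)" unfolding ab by (rule ext) (simp add: poly_eval_add)
      finally show ?thesis by blast
    qed
    show "subring_on (range poly_eval :: (complex^'n \<Rightarrow> complex) set)"
      unfolding subring_on_def using const[of 1] mult diff by (auto simp: one_fun_def)
  qed
qed

lemma carrier_torus: "carrier torus = {x. \<forall>i. x $ i \<noteq> 0}"
  by (simp add: torus_def)

lemma zariski_closed_iff:
  "zariski_closed W \<longleftrightarrow> (\<exists>G\<subseteq>poly_funs. W = {x \<in> carrier torus. \<forall>g\<in>G. g x = 0})"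
proof
  assume "zariski_closed W"
  then obtain F where "W = torus_zeros F" by (auto simp: zariski_closed_def)
  thus "\<exists>G\<subseteq>poly_funs. W = {x \<in> carrier torus. \<forall>g\<in>G. g x = 0}"
    unfolding range_poly_eval[symmetric] by (intro exI[of _ "poly_eval ` F"]) (auto simp: torus_zeros_def)
next
  assume "\<exists>G\<subseteq>poly_funs. W = {x \<in> carrier torus. \<forall>g\<in>G. g x = 0}"
  then obtain G where G: "G \<subseteq> poly_funs" "W = {x \<in> carrier torus. \<forall>g\<in>G. g x = 0}" by blast
  then obtain F where "G = poly_eval ` F" unfolding range_poly_eval[symmetric] by (meson subset_imageE)
  thus "zariski_closed W" using G by (auto simp: zariski_closed_def torus_zeros_def)
qed

lemma zariski_closed_torus: "zariski_closed W \<Longrightarrow> W \<subseteq> carrier torus"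
  by (auto simp: zariski_closed_iff)

lemma zariski_closed_Int: "zariski_closed A \<Longrightarrow> zariski_closed B \<Longrightarrow> zariski_closed (A \<inter> B)"
proof -
  assume "zariski_closed A" "zariski_closed B"
  then obtain G H where GH: "G \<subseteq> poly_funs" "A = {x \<in> carrier torus. \<forall>g\<in>G. g x = 0}"
    "H \<subseteq> poly_funs" "B = {x \<in> carrier torus. \<forall>g\<in>H. g x = 0}"
    unfolding zariski_closed_iff by blast
  hence "A \<inter> B = {x \<in> carrier torus. \<forall>g\<in>G \<union> H. g x = 0}" by auto
  thus ?thesis using GH unfolding zariski_closed_iff by (intro exI[of _ "G \<union> H"]) auto
qed

text \<open>The product of all coordinates has no zero on the torus and clears every
  \<open>icoord\<close>; thus Laurent polynomials have the same kind of zero sets as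
  polynomials.\<close>

lemma laurent_clear_denominators:
  assumes "f \<in> (laurent_funs :: (complex^'n \<Rightarrow> complex) set)"
  shows "\<exists>k. \<exists>g\<in>poly_funs. \<forall>x\<in>carrier torus. f x * (\<Prod>i\<in>UNIV. x $ i) ^ k = g x"
proof -
  define p where "p x = (\<Prod>i\<in>UNIV. x $ i)" for x :: "complex^'n"
  have p: "p = (\<Prod>i\<in>UNIV. coord i)" by (rule ext) (simp add: p_def fun_prod_apply coord_def)
  define B where "B = {f. \<exists>k. \<exists>g\<in>poly_funs. \<forall>x\<in>carrier torus. f x * p x ^ k = g x}"
  note S = subring_on_poly_funs
  have pp: "p \<in> poly_funs" unfolding p by (intro subring_on_prod[OF S] coord_poly_funs)
  have PB: "poly_funs \<subseteq> B" unfolding B_def by (intro subsetI CollectI exI[of _ 0]) auto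
  have "laurent_funs \<subseteq> B"
  proof (rule laurent_funs_subset)
    show "const_funs \<subseteq> B" "coord i \<in> B" for i using PB const_poly_funs coord_poly_funs by blast+
    show "icoord i \<in> B" for i
    proof -
      have "icoord i x * p x ^ 1 = (\<Prod>j\<in>UNIV - {i}. coord j) x" if "x \<in> carrier torus" for x
        using that unfolding p_def by (subst prod.remove[of UNIV i])
          (auto simp: icoord_def fun_prod_apply coord_def carrier_torus)
      thus ?thesis unfolding B_def
        by (intro CollectI exI[of _ 1] bexI[of _ "\<Prod>j\<in>UNIV - {i}. coord j"] ballI subring_on_prod[OF S] coord_poly_funs)
    qed
    have "f - f' \<in> B \<and> f * f' \<in> B" if ff': "f \<in> B" "f' \<in> B" for f f'
    proof -
      obtain k g k' g' where g: "g \<in> poly_funs" "\<forall>x\<in>carrier torus. f x * p x ^ k = g x"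
        and g': "g' \<in> poly_funs" "\<forall>x\<in>carrier torus. f' x * p x ^ k' = g' x" using ff' by (auto simp: B_def)
      have "\<forall>x\<in>carrier torus. (f - f') x * p x ^ (k + k') = (g * p ^ k' - g' * p ^ k) x"
        using g(2) g'(2) by (auto simp: fun_power_apply algebra_simps power_add)
      moreover have "\<forall>x\<in>carrier torus. (f * f') x * p x ^ (k + k') = (g * g') x"
        using g(2) g'(2) by (auto simp: algebra_simps power_add)
      moreover have "g * p ^ k' - g' * p ^ k \<in> poly_funs" "g * g' \<in> poly_funs"
        using g(1) g'(1) pp by (auto intro!: subring_on_diff[OF S] subring_on_mult[OF S] subring_on_power[OF S])
      ultimately show ?thesis unfolding B_def by blast
    qed
    moreover have "1 \<in> B" using PB subring_on_1[OF S] by blast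
    ultimately show "subring_on B" by (simp add: subring_on_def)
  qed
  thus ?thesis using assms by (auto simp: B_def p_def)
qed

lemma zariski_closed_zeros:
  assumes "f \<in> (laurent_funs :: (complex^'n \<Rightarrow> complex) set)"
  shows "zariski_closed {x \<in> carrier torus. f x = 0}"
proof -
  obtain k g where g: "g \<in> poly_funs" "\<forall>x\<in>carrier torus. f x * (\<Prod>i\<in>UNIV. x $ i) ^ k = g x"
    using laurent_clear_denominators[OF assms] by blast
  have "{x \<in> carrier torus. f x = 0} = {x \<in> carrier torus. \<forall>h\<in>{g}. h x = 0}"
    using g(2) by (auto simp: carrier_torus)
  thus ?thesis unfolding zariski_closed_iff using g(1) by blast
qed

lemma zariski_closed_singleton:
  assumes "p \<in> carrier torus" shows "zariski_closed {p}"
proof -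
  have "{p} = {x \<in> carrier torus. \<forall>g\<in>range (\<lambda>i. coord i - (\<lambda>_. p $ i)). g x = 0}"
    using assms by (auto simp: coord_def vec_eq_iff)
  moreover have "coord i - (\<lambda>_. p $ i) \<in> poly_funs" for i
    using const_poly_funs by (intro subring_on_diff[OF subring_on_poly_funs] coord_poly_funs) (auto simp: const_funs_def)
  hence "range (\<lambda>i. coord i - (\<lambda>_. p $ i)) \<subseteq> poly_funs" by (rule image_subsetI)
  ultimately show ?thesis unfolding zariski_closed_iff by (intro exI[of _ "range (\<lambda>i. coord i - (\<lambda>_. p $ i))"] conjI)
qed

text \<open>Each strict inclusion is witnessed by a polynomial \<open>g k\<close> that vanishes on
  the smaller set but not on the larger one. By the basis theorem some \<open>g m\<close> is a
  combination of earlier ones, all of which vanish on \<open>W m\<close>.\<close>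

lemma zariski_descending_chain:
  assumes "\<And>k::nat. zariski_closed (W k :: (complex^'n) set)" shows "\<not> (\<forall>k. W (Suc k) \<subset> W k)"
proof
  assume strict: "\<forall>k. W (Suc k) \<subset> W k"
  hence anti: "W m \<subseteq> W k" if "k \<le> m" for k m using that by (induction m) (auto simp: le_Suc_eq)
  have "\<exists>g\<in>poly_funs. (\<forall>x\<in>W (Suc k). g x = 0) \<and> (\<exists>x\<in>W k. g x \<noteq> 0)" for k
  proof -
    obtain G where G: "G \<subseteq> poly_funs" "W (Suc k) = {x \<in> carrier torus. \<forall>g\<in>G. g x = 0}"
      using assms[of "Suc k"] unfolding zariski_closed_iff by blast
    obtain x where "x \<in> W k" "x \<notin> W (Suc k)" using strict by blast
    moreover from this obtain g where "g \<in> G" "g x \<noteq> 0" using G zariski_closed_torus[OF assms[of k]] by blast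
    ultimately show ?thesis using G by (intro bexI[of _ g]) auto
  qed
  then obtain g where g: "\<And>k. g k \<in> poly_funs" "\<And>k x. x \<in> W (Suc k) \<Longrightarrow> g k x = 0" "\<And>k. \<exists>x\<in>W k. g k x \<noteq> 0" by metis
  obtain m where "g m \<in> seq_span poly_funs g m" using noetherian_poly_funs g(1) unfolding noetherian_def by blast
  then obtain c where c: "g m = (\<Sum>i<m. c i * g i)" by (auto simp: seq_span_def)
  obtain x where x: "x \<in> W m" "g m x \<noteq> 0" using g(3) by blast
  have "g i x = 0" if "i < m" for i using g(2)[of x i] x(1) anti[of "Suc i" m] that by auto
  thus False using x(2) by (simp add: c fun_sum_apply)
qed

text \<open>A minimal infinite closed subset exists by the chain condition. It is irreducible: of
  two closed pieces covering it, one is infinite and hence everything.\<close>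

lemma infinite_closed_contains_irreducible:
  assumes "zariski_closed (W :: (complex^'n) set)" "infinite W"
  shows "\<exists>U\<subseteq>W. zariski_closed U \<and> zariski_irreducible U \<and> infinite U"
proof -
  have "\<exists>U. (U \<subseteq> W \<and> zariski_closed U \<and> infinite U) \<and> (\<forall>A. zariski_closed A \<longrightarrow> infinite A \<longrightarrow> \<not> A \<subset> U)"
  proof (rule ccontr)
    assume neg: "\<not> ?thesis"
    define nxt where "nxt U = (SOME A. zariski_closed A \<and> infinite A \<and> A \<subset> U)" for U :: "(complex^'n) set"
    have nxt: "\<forall>U. U \<subseteq> W \<and> zariski_closed U \<and> infinite U \<longrightarrow>
      zariski_closed (nxt U) \<and> infinite (nxt U) \<and> nxt U \<subset> U"
    proof (intro allI impI)
      fix U assume "U \<subseteq> W \<and> zariski_closed U \<and> infinite U"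
      hence "\<exists>A. zariski_closed A \<and> infinite A \<and> A \<subset> U" using neg by auto
      thus "zariski_closed (nxt U) \<and> infinite (nxt U) \<and> nxt U \<subset> U" unfolding nxt_def by (rule someI_ex)
    qed
    have inv: "(nxt ^^ k) W \<subseteq> W \<and> zariski_closed ((nxt ^^ k) W) \<and> infinite ((nxt ^^ k) W)" for k
    proof (induction k)
      case (Suc k)
      thus ?case using nxt[rule_format, OF Suc] by auto
    qed (use assms in auto)
    have "\<forall>k. (nxt ^^ Suc k) W \<subset> (nxt ^^ k) W" using nxt inv by simp
    thus False using zariski_descending_chain[of "\<lambda>k. (nxt ^^ k) W"] inv by blast
  qed
  then obtain U where U: "U \<subseteq> W" "zariski_closed U" "infinite U"
    "\<forall>A. zariski_closed A \<longrightarrow> infinite A \<longrightarrow> \<not> A \<subset> U" by blast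
  have "U \<subseteq> A \<or> U \<subseteq> B" if AB: "zariski_closed A" "zariski_closed B" "U \<subseteq> A \<union> B" for A B
  proof -
    have "U = (U \<inter> A) \<union> (U \<inter> B)" using AB(3) by blast
    hence "infinite (U \<inter> A) \<or> infinite (U \<inter> B)" using U(3) by (metis finite_UnI)
    moreover have "zariski_closed (U \<inter> A)" "zariski_closed (U \<inter> B)" using U(2) AB by (auto intro: zariski_closed_Int)
    ultimately show ?thesis using U(4) by blast
  qed
  moreover have "U \<noteq> {}" using U(3) by auto
  ultimately show ?thesis using U unfolding zariski_irreducible_def by blast
qed

text \<open>A point, \<open>U\<close> and \<open>V\<close> form a strict chain of length
  two.\<close>

lemma krull_dim_gt_1:
  assumes p: "p \<in> U" and U: "zariski_closed U" "zariski_irreducible U" "infinite U" "U \<subset> V"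
    and V: "zariski_closed V" "zariski_irreducible V"
  shows "krull_dim V > 1"
proof -
  define W where "W i = (if i = 0 then {p} else if i = 1 then U else V)" for i :: nat
  have pc: "zariski_closed {p}" using p zariski_closed_torus[OF U(1)] by (intro zariski_closed_singleton) auto
  have pi: "zariski_irreducible {p}" by (auto simp: zariski_irreducible_def)
  have ps: "{p} \<subset> U" using p U(3) by auto
  have "(\<forall>i\<le>2. zariski_closed (W i) \<and> zariski_irreducible (W i) \<and> W i \<subseteq> V) \<and> (\<forall>i<2. W i \<subset> W (Suc i))"
    using U V pc pi ps by (auto simp: W_def less_Suc_eq numeral_2_eq_2)
  hence "enat 2 \<le> krull_dim V" unfolding krull_dim_def by (intro Sup_upper) blast
  moreover have "(1::enat) < enat 2" by (simp add: one_enat_def)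
  ultimately show ?thesis by (rule less_le_trans[rotated])
qed

definition mono_fun :: "('n::finite \<Rightarrow> int) \<Rightarrow> complex^'n \<Rightarrow> complex" where
  "mono_fun b x = (\<Prod>i\<in>UNIV. (x $ i) powi b i)"

lemma mono_fun_laurent: "mono_fun b \<in> laurent_funs"
proof -
  have "mono_fun b = (\<Prod>i\<in>UNIV. if b i \<ge> 0 then coord i ^ nat (b i) else icoord i ^ nat (- b i))"
    by (rule ext) (auto simp: mono_fun_def fun_prod_apply fun_power_apply coord_def icoord_def power_int_def intro!: prod.cong)
  thus ?thesis
    by (auto intro!: subring_on_prod subring_on_power subring_on_laurent_funs coord_laurent_funs icoord_laurent_funs)
qed

lemma prod_powi: "(\<Prod>i\<in>A. (f i :: 'a::field) powi k) = (\<Prod>i\<in>A. f i) powi k"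
  by (induction A rule: infinite_finite_induct) (auto simp: power_int_mult_distrib)

lemma mono_fun_torus:
  assumes "x \<in> carrier torus"
  shows mono_fun_nonzero: "mono_fun b x \<noteq> 0"
    and mono_fun_add: "mono_fun (\<lambda>i. b i + c i) x = mono_fun b x * mono_fun c x"
    and mono_fun_scale: "mono_fun (\<lambda>i. k * b i) x = mono_fun b x powi k"
proof -
  have x: "x $ i \<noteq> 0" for i using assms by (simp add: carrier_torus)
  show "mono_fun b x \<noteq> 0" using x by (simp add: mono_fun_def)
  show "mono_fun (\<lambda>i. b i + c i) x = mono_fun b x * mono_fun c x"
    using x by (simp add: mono_fun_def power_int_add prod.distrib)
  show "mono_fun (\<lambda>i. k * b i) x = mono_fun b x powi k"
    by (simp add: mono_fun_def power_int_mult prod_powi mult.commute[of k])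
qed

lemma mono_fun_mult: "mono_fun b (x * y) = mono_fun b x * mono_fun b y"
  by (simp add: mono_fun_def power_int_mult_distrib prod.distrib)

lemma mono_fun_inverse: "mono_fun b (\<chi> i. inverse (x $ i)) = inverse (mono_fun b x)"
  by (simp add: mono_fun_def power_int_inverse prod_inversef[symmetric])

lemma mono_fun_single: "mono_fun (\<lambda>j. if j = i then 1 else 0) x = x $ i"
  by (simp add: mono_fun_def if_distrib[of "\<lambda>k. _ powi k"] cong: if_cong)

text \<open>Infinitude may be assumed, since every set of points on a finite curve is
  finite.\<close>

locale torus_curve =
  fixes V :: "(complex^'n) set"
  assumes closed: "zariski_closed V" and irreducible: "zariski_irreducible V" and dim: "krull_dim V = 1"
    and infinite: "infinite V"
    and not_in_coset: "\<And>g H. g \<in> carrier torus \<Longrightarrow> algebraic_subgroup H \<Longrightarrow> H \<noteq> carrier torus \<Longrightarrow>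
           \<not> V \<subseteq> g <#\<^bsub>torus\<^esub> H"
begin

lemma V_torus: "V \<subseteq> carrier torus"
  by (rule zariski_closed_torus[OF closed])

lemma coord_nonzero: "x \<in> V \<Longrightarrow> x $ i \<noteq> 0"
  using V_torus by (auto simp: carrier_torus)

text \<open>An infinite zero set on \<open>V\<close> contains an infinite irreducible closed set; if
  that were not all of \<open>V\<close>, the dimension would exceed one.\<close>

lemma vanishes_if_infinitely_many_zeros:
  assumes f: "f \<in> laurent_funs" and inf: "infinite {x \<in> V. f x = 0}" and x: "x \<in> V"
  shows "f x = 0"
proof -
  have e: "{x \<in> V. f x = 0} = V \<inter> {x \<in> carrier torus. f x = 0}" using V_torus by auto
  have "zariski_closed {x \<in> V. f x = 0}" unfolding e by (intro zariski_closed_Int closed zariski_closed_zeros f)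
  then obtain U where U: "U \<subseteq> {x \<in> V. f x = 0}" "zariski_closed U" "zariski_irreducible U" "infinite U"
    using infinite_closed_contains_irreducible[OF _ inf] by blast
  obtain p where p: "p \<in> U" using U(4) by (metis finite.emptyI ex_in_conv)
  have "U = V"
  proof (rule ccontr)
    assume "U \<noteq> V"
    hence "U \<subset> V" using U(1) by blast
    from krull_dim_gt_1[OF p U(2,3,4) this closed irreducible] show False using dim by simp
  qed
  thus ?thesis using U(1) x by blast
qed

definition vanishing :: "(complex^'n \<Rightarrow> complex) set" where
  "vanishing = {f \<in> laurent_funs. \<forall>x\<in>V. f x = 0}"

lemma prime_vanishing: "prime_ideal_on laurent_funs vanishing"
proof -
  have ne: "V \<noteq> {}" using irreducible by (simp add: zariski_irreducible_def)
  have "f \<in> vanishing \<or> g \<in> vanishing"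
    if fg: "f \<in> laurent_funs" "g \<in> laurent_funs" "f * g \<in> vanishing" for f g
  proof -
    have "V \<subseteq> {x \<in> carrier torus. f x = 0} \<union> {x \<in> carrier torus. g x = 0}"
      using V_torus fg(3) by (auto simp: vanishing_def)
    hence "V \<subseteq> {x \<in> carrier torus. f x = 0} \<or> V \<subseteq> {x \<in> carrier torus. g x = 0}"
      using irreducible zariski_closed_zeros[OF fg(1)] zariski_closed_zeros[OF fg(2)] by (simp add: zariski_irreducible_def)
    thus ?thesis using fg by (auto simp: vanishing_def)
  qed
  thus ?thesis using ne subring_on_laurent_funs
    by (auto simp: prime_ideal_on_def vanishing_def intro: subring_on_intros)
qed

lemma finite_fiber:
  assumes u: "u \<in> laurent_funs" and nc: "\<nexists>c. \<forall>x\<in>V. u x = c"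
  shows "finite {x \<in> V. u x = c}"
proof (rule ccontr)
  assume inf: "infinite {x \<in> V. u x = c}"
  have "(\<lambda>_. c) \<in> laurent_funs" using const_laurent_funs by (auto simp: const_funs_def)
  hence f: "u - (\<lambda>_. c) \<in> laurent_funs" using u by (intro subring_on_diff[OF subring_on_laurent_funs])
  have "(u - (\<lambda>_. c)) x = 0" if "x \<in> V" for x
    using vanishes_if_infinitely_many_zeros[OF f _ that] inf by simp
  thus False using nc by auto
qed

text \<open>Evaluation at the point \<open>1\<close>; on constant functions every point gives the
  same value.\<close>

definition const_value :: "(complex^'n \<Rightarrow> complex) \<Rightarrow> complex" where "const_value f = f 1"

lemma ring_hom_const_value: "ring_hom_on const_funs const_value"
  by (simp add: ring_hom_on_def subring_on_const_funs const_value_def)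

lemma const_funs_value: "f \<in> const_funs \<Longrightarrow> f x = const_value f"
  by (auto simp: const_funs_def const_value_def)

lemma poly_const_value:
  assumes "p \<in> polys_over const_funs" shows "poly p u x = poly (map_poly const_value p) (u x)"
proof -
  have "poly p u x = (\<Sum>i\<le>degree p. coeff p i x * u x ^ i)"
    by (simp add: poly_altdef fun_sum_apply fun_power_apply)
  also have "\<dots> = (\<Sum>i\<le>degree p. const_value (coeff p i) * u x ^ i)"
    using const_funs_value[OF polys_overD[OF assms]] by simp
  also have "\<dots> = (\<Sum>i\<le>degree p. coeff (map_poly const_value p) i * u x ^ i)"
    by (simp add: coeff_map_poly_hom[OF ring_hom_const_value])
  also have "\<dots> = poly (map_poly const_value p) (u x)"
    by (rule poly_sum_le[OF degree_map_poly_hom_le[OF ring_hom_const_value], symmetric])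
  finally show ?thesis .
qed

text \<open>A nonzero polynomial has finitely many roots, so \<open>V\<close> would be a finite
  union of finite fibers of \<open>u\<close>.\<close>

lemma nonconstant_transcendental:
  assumes u: "u \<in> laurent_funs" and nc: "\<nexists>c. \<forall>x\<in>V. u x = c"
    and q: "q \<in> polys_over const_funs" "poly q u \<in> vanishing"
  shows "map_poly const_value q = 0"
proof (rule ccontr)
  assume nz: "map_poly const_value q \<noteq> 0"
  hence fin: "finite {t. poly (map_poly const_value q) t = 0}" by (rule poly_roots_finite)
  have "V \<subseteq> (\<Union>t\<in>{t. poly (map_poly const_value q) t = 0}. {x \<in> V. u x = t})"
    using q(2) poly_const_value[OF q(1)] by (auto simp: vanishing_def)
  hence finV: "finite V" by (rule finite_subset) (use fin finite_fiber[OF u nc] in auto)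
  thus False using infinite by blast
qed

text \<open>The images of the coordinates are the coordinates of the point. They are nonzero because
  \<open>icoord\<close> inverts \<open>coord\<close> modulo \<open>vanishing\<close>, and they
  satisfy the equations of \<open>V\<close> because these belong to
  \<open>vanishing\<close>.\<close>

lemma hom_gives_point:
  assumes h: "ring_hom_on laurent_funs \<psi>" and z: "\<And>f. f \<in> vanishing \<Longrightarrow> \<psi> f = 0"
    and c: "\<And>f. f \<in> const_funs \<Longrightarrow> \<psi> f = const_value f"
  shows "\<exists>x\<in>V. \<forall>f\<in>laurent_funs. \<psi> f = f x"
proof -
  define x where "x = (\<chi> i. \<psi> (coord i))"
  have xi: "x $ i * \<psi> (icoord i) = 1" for i
  proof -
    have "coord i * icoord i - 1 \<in> vanishing"
      using coord_nonzero subring_on_laurent_funs unfolding vanishing_def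
      by (auto simp: coord_def[of i] icoord_def[of i]
        intro!: subring_on_diff[OF subring_on_laurent_funs] subring_on_mult[OF subring_on_laurent_funs] subring_on_1
          coord_laurent_funs[unfolded coord_def] icoord_laurent_funs[unfolded icoord_def])
    hence "\<psi> (coord i * icoord i - 1) = 0" by (rule z)
    moreover have "\<psi> (coord i * icoord i - 1) = \<psi> (coord i) * \<psi> (icoord i) - 1"
      by (simp only: ring_hom_on_diff[OF h] ring_hom_on_mult[OF h] ring_hom_on_1[OF h]
        coord_laurent_funs icoord_laurent_funs subring_on_mult[OF subring_on_laurent_funs] subring_on_1[OF subring_on_laurent_funs])
    ultimately show ?thesis by (simp add: x_def)
  qed
  have xt: "x \<in> carrier torus" using xi by (auto simp: carrier_torus) (metis mult_zero_left zero_neq_one)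
  have ev: "laurent_funs \<subseteq> {f \<in> laurent_funs. \<psi> f = f x}"
  proof (rule laurent_funs_subset)
    show "subring_on {f \<in> laurent_funs. \<psi> f = f x}"
      using subring_on_laurent_funs ring_hom_on_diff[OF h] ring_hom_on_mult[OF h] ring_hom_on_1[OF h]
      by (auto simp: subring_on_def)
    show "const_funs \<subseteq> {f \<in> laurent_funs. \<psi> f = f x}"
    proof
      fix f :: "complex^'n \<Rightarrow> complex" assume f: "f \<in> const_funs"
      thus "f \<in> {f \<in> laurent_funs. \<psi> f = f x}"
        using const_laurent_funs c[OF f] const_funs_value[OF f, of x] by auto
    qed
    show "coord i \<in> {f \<in> laurent_funs. \<psi> f = f x}" for i
      using coord_laurent_funs by (auto simp: x_def coord_def)
    show "icoord i \<in> {f \<in> laurent_funs. \<psi> f = f x}" for i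
    proof -
      have "\<psi> (icoord i) = inverse (x $ i)" using xi[of i] by (metis inverse_unique)
      thus ?thesis using icoord_laurent_funs by (auto simp: icoord_def)
    qed
  qed
  obtain G where G: "G \<subseteq> poly_funs" "V = {x \<in> carrier torus. \<forall>g\<in>G. g x = 0}"
    using closed unfolding zariski_closed_iff by blast
  have "g x = 0" if "g \<in> G" for g
  proof -
    have gl: "g \<in> laurent_funs" using that G(1) poly_laurent_funs by blast
    moreover have "\<forall>x\<in>V. g x = 0" using that G(2) by blast
    ultimately have "g \<in> vanishing" by (simp add: vanishing_def)
    thus ?thesis using z[of g] ev gl by auto
  qed
  hence "x \<in> V" using G(2) xt by blast
  thus ?thesis using ev by blast
qed

lemma ring_mod_prime_adjoin:
  "u \<in> laurent_funs \<Longrightarrow> ring_mod_prime laurent_funs vanishing (adjoin const_funs u)"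
  by unfold_locales (auto intro: prime_vanishing subring_on_adjoin subring_on_const_funs
    adjoin_subset[OF subring_on_laurent_funs const_laurent_funs, THEN subsetD])

text \<open>
  If \<open>v\<close> were transcendental over \<open>u\<close>, then for a suitable \<open>s\<close> and infinitely many \<open>t\<close> the
  homomorphism \<open>u \<mapsto> s, v \<mapsto> t\<close> would extend to the coordinate ring, producing infinitely many points
  in a fiber of \<open>u\<close>.
\<close>

lemma algebraic_over_nonconstant:
  assumes u: "u \<in> laurent_funs" and nc: "\<nexists>c. \<forall>x\<in>V. u x = c" and v: "v \<in> laurent_funs"
  shows "ring_mod_prime.algebraic_mod vanishing (adjoin const_funs u) v"
proof (rule ccontr)
  let ?R = "adjoin const_funs u"
  interpret R: ring_mod_prime laurent_funs vanishing ?R by (rule ring_mod_prime_adjoin[OF u])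
  let ?R2 = "adjoin ?R v"
  assume "\<not> R.algebraic_mod v"
  hence trans: "coeff q i \<in> vanishing" if "q \<in> polys_over ?R" "poly q v \<in> vanishing" for q i
    using that by (auto simp: R.algebraic_mod_def)
  interpret R2: ring_mod_prime laurent_funs vanishing ?R2
    by unfold_locales (rule prime_vanishing subring_on_adjoin R.R adjoin_subset[OF subring_on_laurent_funs R.RD v])+
  note one = prime_ideal_onD(4)[OF prime_vanishing]
  let ?D = "adjoin_list laurent_gens ?R2"
  have D: "?D \<subseteq> laurent_funs" "laurent_funs \<subseteq> ?D" "?R2 \<subseteq> ?D" "subring_on ?D"
  proof -
    have gens: "set laurent_gens \<subseteq> laurent_funs"
      using coord_laurent_funs icoord_laurent_funs by (auto simp: set_laurent_gens)
    show "?D \<subseteq> laurent_funs" by (rule adjoin_list_subset[OF subring_on_laurent_funs R2.RD gens])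
    note * = adjoin_list_superset[OF R2.R, of laurent_gens]
    show 1: "?R2 \<subseteq> ?D" "subring_on ?D" using * by auto
    have "const_funs \<subseteq> ?D" using 1(1) adjoin_superset[OF R.R, of v] adjoin_superset[OF subring_on_const_funs, of u] by blast
    thus "laurent_funs \<subseteq> ?D" using * by (intro laurent_funs_subset) (auto simp: set_laurent_gens)
  qed
  hence De: "?D = laurent_funs" by blast
  \<comment> \<open>With \<open>1\<close> as the element to be kept nonzero, the lemma provides the
    mere existence of extensions to the whole coordinate ring, away from the zeros of
    \<open>a\<close>.\<close>
  have "\<exists>a\<in>?R2 - vanishing. \<forall>\<phi>. R2.good_hom \<phi> \<and> \<phi> a \<noteq> 0 \<longrightarrow>
    (\<exists>\<psi>. ring_hom_on ?D \<psi> \<and> (\<forall>z\<in>?D \<inter> vanishing. \<psi> z = 0) \<and> (\<forall>r\<in>?R2. \<psi> r = \<phi> r) \<and> \<psi> 1 \<noteq> 0)"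
    using one coord_laurent_funs icoord_laurent_funs subring_on_1[OF D(4)]
    by (intro R2.good_hom_extend_list) (auto simp: set_laurent_gens)
  then obtain a where a: "a \<in> ?R2" "a \<notin> vanishing" "\<forall>\<phi>. R2.good_hom \<phi> \<and> \<phi> a \<noteq> 0 \<longrightarrow>
    (\<exists>\<psi>. ring_hom_on ?D \<psi> \<and> (\<forall>z\<in>?D \<inter> vanishing. \<psi> z = 0) \<and> (\<forall>r\<in>?R2. \<psi> r = \<phi> r) \<and> \<psi> 1 \<noteq> 0)" by blast
  obtain p where p: "p \<in> polys_over ?R" "a = poly p v" using a(1) by (auto simp: adjoin_def)
  have "\<exists>i. coeff p i \<notin> vanishing"
  proof (rule ccontr)
    assume "\<not> ?thesis"
    hence "a \<in> vanishing" unfolding p(2) poly_altdef using subring_on_power[OF subring_on_laurent_funs v]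
      by (intro prime_ideal_on_sum[OF prime_vanishing] prime_ideal_onD(7)[OF prime_vanishing]) auto
    thus False using a by simp
  qed
  then obtain i where i: "coeff p i \<notin> vanishing" by blast
  obtain q where q: "q \<in> polys_over const_funs" "coeff p i = poly q u"
    using polys_overD[OF p(1), of i] by (auto simp: adjoin_def)
  have "map_poly const_value q \<noteq> 0"
    using i poly_const_value[OF q(1), of u] polys_overD[OF p(1), of i] R.RD by (auto simp: vanishing_def q(2))
  hence "finite {t. poly (map_poly const_value q) t = 0}" by (rule poly_roots_finite)
  \<comment> \<open>\<open>s\<close> is such that one coefficient of \<open>a\<close>, as a
    polynomial in \<open>v\<close>, survives at \<open>u = s\<close>; then only finitely many values
    of \<open>v\<close> are excluded.\<close>
  then obtain s where s: "poly (map_poly const_value q) s \<noteq> 0" using ex_new_if_finite[OF infinite_UNIV_char_0] by blast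
  have "poly (map_poly const_value r) s = 0" if "r \<in> polys_over const_funs" "poly r u \<in> vanishing" for r
    using nonconstant_transcendental[OF u nc that] by simp
  from hom_extend[OF ring_hom_const_value prime_ideal_onD(3)[OF prime_vanishing] this] obtain \<phi> where
    \<phi>: "ring_hom_on ?R \<phi>" "\<forall>r\<in>const_funs. \<phi> r = const_value r" "\<phi> u = s" "\<forall>z\<in>?R \<inter> vanishing. \<phi> z = 0" by blast
  have "map_poly \<phi> q = map_poly const_value q"
    using \<phi>(2) polys_overD[OF q(1)] by (intro poly_eqI) (simp add: coeff_map_poly_hom[OF \<phi>(1)] coeff_map_poly_hom[OF ring_hom_const_value])
  moreover have "q \<in> polys_over ?R" using q(1) polys_over_mono[OF adjoin_superset[OF subring_on_const_funs]] by blast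
  ultimately have "\<phi> (coeff p i) = poly (map_poly const_value q) s"
    using poly_map_poly_hom[OF \<phi>(1) _ adjoin_self[OF subring_on_const_funs]] \<phi>(3) by (simp add: q(2))
  hence "map_poly \<phi> p \<noteq> 0" using s coeff_map_poly_hom[OF \<phi>(1), of p i] by auto
  hence fin: "finite {t. poly (map_poly \<phi> p) t = 0}" by (rule poly_roots_finite)
  have pt: "t \<in> v ` {x \<in> V. u x = s}" if t: "poly (map_poly \<phi> p) t \<noteq> 0" for t
  proof -
    have "poly (map_poly \<phi> r) t = 0" if r: "r \<in> polys_over ?R" "poly r v \<in> vanishing" for r
    proof -
      have "map_poly \<phi> r = 0" using \<phi>(4) trans[OF r] polys_overD[OF r(1)]
        by (intro poly_eqI) (simp add: coeff_map_poly_hom[OF \<phi>(1)])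
      thus ?thesis by simp
    qed
    from hom_extend[OF \<phi>(1) prime_ideal_onD(3)[OF prime_vanishing] this] obtain \<eta> where
      \<eta>: "ring_hom_on ?R2 \<eta>" "\<forall>r\<in>?R. \<eta> r = \<phi> r" "\<eta> v = t" "\<forall>z\<in>?R2 \<inter> vanishing. \<eta> z = 0" by blast
    have "\<eta> a = poly (map_poly \<phi> p) t" using R.good_hom_value[OF \<eta>(1,2) p(1)] \<eta>(3) p(2) by simp
    moreover have "R2.good_hom \<eta>" using \<eta>(1,4) by (auto simp: R2.good_hom_def)
    ultimately obtain \<psi> where \<psi>: "ring_hom_on laurent_funs \<psi>" "\<forall>z\<in>laurent_funs \<inter> vanishing. \<psi> z = 0" "\<forall>r\<in>?R2. \<psi> r = \<eta> r"
      using a(3) t unfolding De by metis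
    have sub: "const_funs \<subseteq> ?R" "u \<in> ?R" "?R \<subseteq> ?R2" "v \<in> ?R2"
      using adjoin_superset[OF subring_on_const_funs] adjoin_self[OF subring_on_const_funs]
        adjoin_superset[OF R.R] adjoin_self[OF R.R] by auto
    have "\<exists>x\<in>V. \<forall>f\<in>laurent_funs. \<psi> f = f x"
    proof (rule hom_gives_point[OF \<psi>(1)])
      show "\<psi> f = 0" if "f \<in> vanishing" for f using \<psi>(2) that by (auto simp: vanishing_def)
      show "\<psi> f = const_value f" if "f \<in> const_funs" for f using \<psi>(3) \<eta>(2) \<phi>(2) sub that by (metis subsetD)
    qed
    then obtain x where x: "x \<in> V" "\<forall>f\<in>laurent_funs. \<psi> f = f x" by blast
    have "u x = s" "v x = t" using x(2) u v \<psi>(3) \<eta>(2,3) \<phi>(3) sub by (metis subsetD)+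
    thus ?thesis using x(1) by blast
  qed
  \<comment> \<open>All but finitely many complex numbers would be values of \<open>v\<close> on a
    single finite fiber of \<open>u\<close>.\<close>
  have "UNIV \<subseteq> {t. poly (map_poly \<phi> p) t = 0} \<union> v ` {x \<in> V. u x = s}" using pt by blast
  hence "finite (UNIV :: complex set)" by (rule finite_subset) (use fin finite_fiber[OF u nc, of s] in blast)
  thus False using infinite_UNIV_char_0 by blast
qed

end

section \<open>Algebraic relations on the curve\<close>

text \<open>Gaussian elimination stays in the field of the coefficients, so a nontrivial complex
  solution can be replaced by an algebraic one. Only the unknowns are finitely many;
  \<open>S\<close> may be infinite.\<close>

lemma algebraic_solution:
  fixes c :: "'j \<Rightarrow> complex" and r :: "'s \<Rightarrow> 'j \<Rightarrow> complex"
  assumes "finite J" "\<And>s j. s \<in> S \<Longrightarrow> j \<in> J \<Longrightarrow> r s j \<in> Qbar" "\<exists>j\<in>J. c j \<noteq> 0"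
    "\<And>s. s \<in> S \<Longrightarrow> (\<Sum>j\<in>J. r s j * c j) = 0"
  shows "\<exists>c'. (\<forall>j\<in>J. c' j \<in> Qbar) \<and> (\<exists>j\<in>J. c' j \<noteq> 0) \<and> (\<forall>s\<in>S. (\<Sum>j\<in>J. r s j * c' j) = 0)"
  using assms
proof (induction J arbitrary: r rule: finite_induct)
  case (insert j J)
  note Q = subring_on_Qbar
  show ?case
  proof (cases "\<exists>s\<in>S. r s j \<noteq> 0")
    case False
    show ?thesis
    proof (intro exI[of _ "\<lambda>i. if i = j then 1 else 0"] conjI ballI)
      show "(if i = j then 1 else 0) \<in> Qbar" for i using subring_on_0[OF Q] subring_on_1[OF Q] by simp
      show "\<exists>i\<in>insert j J. (if i = j then 1 else 0 :: complex) \<noteq> 0" by auto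
      show "(\<Sum>i\<in>insert j J. r s i * (if i = j then 1 else 0)) = 0" if "s \<in> S" for s
        using False that by (intro sum.neutral) auto
    qed
  next
    case True
    then obtain t where t: "t \<in> S" "r t j \<noteq> 0" by blast
    define r' where "r' s i = r s i - r s j * inverse (r t j) * r t i" for s i
    have cj: "r t j * c j + (\<Sum>i\<in>J. r t i * c i) = 0" using insert.prems(3)[OF t(1)] insert.hyps by simp
    have rel: "(\<Sum>i\<in>J. r' s i * f i) = (\<Sum>i\<in>J. r s i * f i) - r s j * inverse (r t j) * (\<Sum>i\<in>J. r t i * f i)" for s f
      by (simp add: r'_def left_diff_distrib sum_subtractf sum_distrib_left mult.assoc)
    have "\<exists>c'. (\<forall>j\<in>J. c' j \<in> Qbar) \<and> (\<exists>j\<in>J. c' j \<noteq> 0) \<and> (\<forall>s\<in>S. (\<Sum>j\<in>J. r' s j * c' j) = 0)"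
    proof (rule insert.IH)
      show "r' s i \<in> Qbar" if "s \<in> S" "i \<in> J" for s i
        unfolding r'_def using insert.prems(1) that t
        by (intro subring_on_diff[OF Q] subring_on_mult[OF Q] Qbar_inverse) auto
      show "\<exists>i\<in>J. c i \<noteq> 0"
      proof (rule ccontr)
        assume "\<not> ?thesis"
        hence "r t j * c j = 0" "\<forall>i\<in>J. c i = 0" using cj by auto
        thus False using insert.prems(2) t(2) by auto
      qed
      show "(\<Sum>i\<in>J. r' s i * c i) = 0" if "s \<in> S" for s
      proof -
        have "(\<Sum>i\<in>J. r s i * c i) = - (r s j * c j)"
          using insert.prems(3)[OF that] insert.hyps by (simp add: add_eq_0_iff)
        moreover have "(\<Sum>i\<in>J. r t i * c i) = - (r t j * c j)" using cj by (simp add: add_eq_0_iff)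
        ultimately show ?thesis unfolding rel using t(2) by simp
      qed
    qed
    then obtain c' where c': "\<forall>j\<in>J. c' j \<in> Qbar" "\<exists>j\<in>J. c' j \<noteq> 0" "\<forall>s\<in>S. (\<Sum>j\<in>J. r' s j * c' j) = 0" by blast
    define c'' where "c'' = c'(j := - inverse (r t j) * (\<Sum>i\<in>J. r t i * c' i))"
    have eq: "(\<Sum>i\<in>J. f i * c'' i) = (\<Sum>i\<in>J. f i * c' i)" for f
      using insert.hyps by (intro sum.cong) (auto simp: c''_def)
    show ?thesis
    proof (intro exI[of _ c''] conjI ballI)
      show "c'' i \<in> Qbar" if i: "i \<in> insert j J" for i
      proof (cases "i = j")
        case True
        have "- inverse (r t j) * (\<Sum>i\<in>J. r t i * c' i) \<in> Qbar"
          using insert.prems(1) c'(1) t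
          by (intro subring_on_mult[OF Q] subring_on_uminus[OF Q] subring_on_sum[OF Q] Qbar_inverse) auto
        thus ?thesis using True by (simp add: c''_def)
      qed (use i c'(1) in \<open>auto simp: c''_def\<close>)
      show "\<exists>i\<in>insert j J. c'' i \<noteq> 0" using c'(2) insert.hyps by (auto simp: c''_def)
      show "(\<Sum>i\<in>insert j J. r s i * c'' i) = 0" if s: "s \<in> S" for s
      proof -
        have "(\<Sum>i\<in>insert j J. r s i * c'' i) = r s j * c'' j + (\<Sum>i\<in>J. r s i * c' i)"
          using insert.hyps by (simp add: eq)
        also have "\<dots> = (\<Sum>i\<in>J. r' s i * c' i)" unfolding rel by (simp add: c''_def)
        finally show ?thesis using c'(3) s by simp
      qed
    qed
  qed
qed auto

text \<open>At each point the relation is a linear equation for its coefficients, with algebraic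
  monomial values as entries. The new relation is therefore claimed only at the points of
  \<open>P\<close>.\<close>

lemma algebraic_curve_relation:
  fixes c :: "nat \<Rightarrow> nat \<Rightarrow> complex"
  assumes alg: "\<And>x. x \<in> P \<Longrightarrow> u x \<in> Qbar \<and> w x \<in> Qbar" and nz: "\<exists>k\<le>D. \<exists>e\<le>E. c k e \<noteq> 0"
    and rel: "\<And>x. x \<in> P \<Longrightarrow> (\<Sum>e\<le>E. (\<Sum>k\<le>D. c k e * u x ^ k) * w x ^ e) = 0"
  shows "\<exists>c'. (\<forall>k e. k \<le> D \<longrightarrow> e \<le> E \<longrightarrow> c' k e \<in> Qbar) \<and> (\<exists>k\<le>D. \<exists>e\<le>E. c' k e \<noteq> (0::complex)) \<and>
    (\<forall>x\<in>P. (\<Sum>e\<le>E. (\<Sum>k\<le>D. c' k e * u x ^ k) * w x ^ e) = 0)"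
proof -
  note Q = subring_on_Qbar
  let ?J = "{..E} \<times> {..D}"
  define r where "r x j = u x ^ snd j * w x ^ fst j" for x and j :: "nat \<times> nat"
  have e: "(\<Sum>e\<le>E. (\<Sum>k\<le>D. f k e * u x ^ k) * w x ^ e) = (\<Sum>j\<in>?J. r x j * f (snd j) (fst j))" for f x
    by (simp add: sum.cartesian_product' sum_distrib_right sum_distrib_left r_def mult_ac)
  have "\<exists>c'. (\<forall>j\<in>?J. c' j \<in> Qbar) \<and> (\<exists>j\<in>?J. c' j \<noteq> 0) \<and> (\<forall>x\<in>P. (\<Sum>j\<in>?J. r x j * c' j) = 0)"
  proof (rule algebraic_solution)
    show "r x j \<in> Qbar" if "x \<in> P" for x j
      unfolding r_def using alg[OF that] by (intro subring_on_mult[OF Q] subring_on_power[OF Q]) auto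
    show "\<exists>j\<in>?J. (\<lambda>j. c (snd j) (fst j)) j \<noteq> 0" using nz by force
    show "(\<Sum>j\<in>?J. r x j * c (snd j) (fst j)) = 0" if "x \<in> P" for x using rel[OF that] e by simp
  qed simp
  then obtain c' where c': "\<forall>j\<in>?J. c' j \<in> Qbar" "\<exists>j\<in>?J. c' j \<noteq> 0" "\<forall>x\<in>P. (\<Sum>j\<in>?J. r x j * c' j) = 0" by blast
  show ?thesis
  proof (intro exI[of _ "\<lambda>k e. c' (e, k)"] conjI)
    show "\<forall>x\<in>P. (\<Sum>e\<le>E. (\<Sum>k\<le>D. c' (e, k) * u x ^ k) * w x ^ e) = 0"
      using c'(3) e[of "\<lambda>k e. c' (e, k)"] by simp
  qed (use c'(1,2) in auto)
qed

context torus_curve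
begin

lemma relation_from_coefficients:
  assumes w: "w \<in> laurent_funs" and f: "\<And>k. f k \<in> adjoin const_funs w" "\<exists>k\<le>N. f k \<notin> vanishing"
    "(\<Sum>k\<le>N. f k * u ^ k) \<in> vanishing"
  shows "\<exists>E c. (\<exists>k\<le>N. \<exists>e\<le>E. c k e \<noteq> 0) \<and> (\<forall>x\<in>V. (\<Sum>e\<le>E. (\<Sum>k\<le>N. c k e * u x ^ k) * w x ^ e) = 0)"
proof -
  have "\<exists>p. p \<in> polys_over const_funs \<and> f k = poly p w" for k
    using f(1)[of k] unfolding adjoin_def by blast
  hence "\<exists>p. \<forall>k. p k \<in> polys_over const_funs \<and> f k = poly (p k) w" by (intro choice allI)
  then obtain p where p: "\<And>k. p k \<in> polys_over const_funs" "\<And>k. f k = poly (p k) w" by blast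
  define q where "q k = map_poly const_value (p k)" for k
  define E where "E = (\<Sum>k\<le>N. degree (q k))"
  have dE: "degree (q k) \<le> E" if "k \<le> N" for k unfolding E_def using that by (intro member_le_sum) auto
  have fx: "f k x = (\<Sum>e\<le>E. coeff (q k) e * w x ^ e)" if "k \<le> N" for k x
    using poly_const_value[OF p(1)] poly_sum_le[OF dE[OF that]] by (simp add: p(2) q_def)
  obtain k where k: "k \<le> N" "f k \<notin> vanishing" using f(2) by blast
  have "f k \<in> laurent_funs" using f(1) adjoin_subset[OF subring_on_laurent_funs const_laurent_funs w] by blast
  then obtain x where x: "f k x \<noteq> 0" using k(2) by (auto simp: vanishing_def)
  have "\<exists>e\<le>E. coeff (q k) e \<noteq> 0"
  proof (rule ccontr)
    assume "\<not> ?thesis"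
    hence "f k x = 0" unfolding fx[OF k(1)] by (intro sum.neutral) auto
    thus False using x by simp
  qed
  moreover have "(\<Sum>e\<le>E. (\<Sum>k\<le>N. coeff (q k) e * u x ^ k) * w x ^ e) = 0" if "x \<in> V" for x
  proof -
    have "(\<Sum>e\<le>E. (\<Sum>k\<le>N. coeff (q k) e * u x ^ k) * w x ^ e) = (\<Sum>k\<le>N. f k x * u x ^ k)"
      unfolding sum_distrib_right by (subst sum.swap) (auto simp: fx sum_distrib_right sum_distrib_left mult_ac intro!: sum.cong)
    also have "\<dots> = (\<Sum>k\<le>N. f k * u ^ k) x" by (simp add: fun_sum_apply fun_power_apply)
    finally show ?thesis using f(3) that by (auto simp: vanishing_def)
  qed
  ultimately show ?thesis using k(1) by (intro exI[of _ E] exI[of _ "\<lambda>k. coeff (q k)"]) blast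
qed

lemma relation_exists:
  assumes w: "w \<in> laurent_funs" and nc: "\<nexists>c. \<forall>x\<in>V. w x = c" and u: "u \<in> laurent_funs"
  shows "\<exists>N E c. (\<exists>k\<le>N. \<exists>e\<le>E. c k e \<noteq> 0) \<and> (\<forall>x\<in>V. (\<Sum>e\<le>E. (\<Sum>k\<le>N. c k e * u x ^ k) * w x ^ e) = 0)"
proof -
  interpret R: ring_mod_prime laurent_funs vanishing "adjoin const_funs w" by (rule ring_mod_prime_adjoin[OF w])
  obtain q i where q: "q \<in> polys_over (adjoin const_funs w)" "poly q u \<in> vanishing" "coeff q i \<notin> vanishing"
    using algebraic_over_nonconstant[OF w nc u] by (auto simp: R.algebraic_mod_def)
  have "i \<le> degree q" using q(3) prime_ideal_onD(3)[OF prime_vanishing] by (metis le_degree)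
  moreover have "(\<Sum>k\<le>degree q. coeff q k * u ^ k) \<in> vanishing" using q(2) by (simp add: poly_altdef)
  ultimately show ?thesis
    using relation_from_coefficients[OF w, of "coeff q" "degree q" u] polys_overD[OF q(1)] q(3) by blast
qed

text \<open>All functions on the curve lie in a space spanned by \<open>card B\<close> elements over
  the field generated by \<open>w\<close>, so for every \<open>u\<close> its powers up to
  \<open>card B\<close> are dependent.\<close>

lemma relation_bounded_degree:
  assumes w: "w \<in> laurent_funs" and nc: "\<nexists>c. \<forall>x\<in>V. w x = c"
  shows "\<exists>N. \<forall>u\<in>laurent_funs. \<exists>E c. (\<exists>k\<le>N. \<exists>e\<le>E. c k e \<noteq> 0) \<and>
    (\<forall>x\<in>V. (\<Sum>e\<le>E. (\<Sum>k\<le>N. c k e * u x ^ k) * w x ^ e) = 0)"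
proof -
  let ?R = "adjoin const_funs w"
  interpret R: ring_mod_prime laurent_funs vanishing ?R by (rule ring_mod_prime_adjoin[OF w])
  have "\<exists>E. finite E \<and> E \<subseteq> laurent_funs \<and> adjoin_list laurent_gens ?R \<subseteq> span_mod laurent_funs vanishing ?R E"
    using coord_laurent_funs icoord_laurent_funs algebraic_over_nonconstant[OF w nc]
    by (intro R.span_mod_adjoin_list) (auto simp: set_laurent_gens)
  then obtain B where B: "finite B" "B \<subseteq> laurent_funs" "adjoin_list laurent_gens ?R \<subseteq> span_mod laurent_funs vanishing ?R B"
    by blast
  have "laurent_funs \<subseteq> adjoin_list laurent_gens ?R"
  proof -
    note * = adjoin_list_superset[OF R.R, of laurent_gens]
    have "const_funs \<subseteq> adjoin_list laurent_gens ?R" using * adjoin_superset[OF subring_on_const_funs, of w] by blast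
    thus ?thesis using * by (intro laurent_funs_subset) (auto simp: set_laurent_gens)
  qed
  hence span: "laurent_funs \<subseteq> span_mod laurent_funs vanishing ?R B" using B(3) by blast
  show ?thesis
  proof (rule exI[of _ "card B"], rule ballI)
    fix u :: "complex^'n \<Rightarrow> complex" assume u: "u \<in> laurent_funs"
    have "u ^ k \<in> span_mod laurent_funs vanishing ?R B" for k
      using span subring_on_power[OF subring_on_laurent_funs u] by blast
    then obtain f where "\<forall>i. f i \<in> ?R" "\<exists>i\<le>card B. f i \<notin> vanishing" "(\<Sum>i\<le>card B. f i * u ^ i) \<in> vanishing"
      using R.powers_dependent[OF B(1,2) u] by blast
    thus "\<exists>E c. (\<exists>k\<le>card B. \<exists>e\<le>E. c k e \<noteq> 0) \<and>
      (\<forall>x\<in>V. (\<Sum>e\<le>E. (\<Sum>k\<le>card B. c k e * u x ^ k) * w x ^ e) = 0)"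
      using relation_from_coefficients[OF w, of f "card B" u] by blast
  qed
qed

text \<open>If \<open>x^b\<close> were constant, the curve would lie in a coset of the subgroup
  \<open>x^b = 1\<close>. That subgroup is proper: it misses the point with \<open>i\<close>-th
  coordinate \<open>2\<close> and all other coordinates \<open>1\<close>.\<close>

lemma mono_fun_nonconstant:
  assumes "b i \<noteq> 0" shows "\<nexists>c. \<forall>x\<in>V. mono_fun b x = c"
proof
  assume "\<exists>c. \<forall>x\<in>V. mono_fun b x = c"
  then obtain c where c: "\<forall>x\<in>V. mono_fun b x = c" by blast
  obtain g where g: "g \<in> V" using irreducible by (auto simp: zariski_irreducible_def)
  define H :: "(complex^'n) set" where "H = {x \<in> carrier torus. mono_fun b x = 1}"
  have one: "mono_fun b 1 = 1" by (simp add: mono_fun_def)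
  have "subgroup H torus"
  proof
    show "x \<otimes>\<^bsub>torus\<^esub> y \<in> H" if "x \<in> H" "y \<in> H" for x y
      using that by (auto simp: H_def torus_def mono_fun_mult)
    show "\<one>\<^bsub>torus\<^esub> \<in> H" using one by (auto simp: H_def torus_def)
    show "inv\<^bsub>torus\<^esub> x \<in> H" if x: "x \<in> H" for x
    proof -
      have xt: "\<forall>i. x $ i \<noteq> 0" using x by (simp add: H_def carrier_torus)
      let ?y = "\<chi> i. inverse (x $ i)"
      have "inv\<^bsub>torus\<^esub> x = ?y"
        unfolding m_inv_def
      proof (rule the_equality)
        show "?y \<in> carrier torus \<and> x \<otimes>\<^bsub>torus\<^esub> ?y = \<one>\<^bsub>torus\<^esub> \<and> ?y \<otimes>\<^bsub>torus\<^esub> x = \<one>\<^bsub>torus\<^esub>"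
          using xt by (simp add: torus_def vec_eq_iff)
        show "y = ?y" if "y \<in> carrier torus \<and> x \<otimes>\<^bsub>torus\<^esub> y = \<one>\<^bsub>torus\<^esub> \<and> y \<otimes>\<^bsub>torus\<^esub> x = \<one>\<^bsub>torus\<^esub>" for y
          using that xt by (simp add: torus_def vec_eq_iff) (metis inverse_unique)
      qed
      moreover have "?y \<in> carrier torus" using xt by (simp add: carrier_torus)
      ultimately show ?thesis using x by (simp add: H_def mono_fun_inverse)
    qed
  qed (auto simp: H_def)
  moreover have "zariski_closed H"
  proof -
    have "H = {x \<in> carrier torus. (mono_fun b - 1) x = 0}" by (simp add: H_def)
    thus ?thesis
      using zariski_closed_zeros[OF subring_on_diff[OF subring_on_laurent_funs mono_fun_laurent subring_on_1[OF subring_on_laurent_funs]]]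
      by simp
  qed
  ultimately have H: "algebraic_subgroup H" by (simp add: algebraic_subgroup_def)
  have "H \<noteq> carrier torus"
  proof
    assume eq: "H = carrier torus"
    define y :: "complex^'n" where "y = (\<chi> j. if j = i then 2 else 1)"
    have "y \<in> H" unfolding eq by (simp add: carrier_torus y_def)
    hence "mono_fun b y = 1" by (simp add: H_def)
    moreover have "mono_fun b y = 2 powi b i"
      by (simp add: mono_fun_def y_def if_distrib[of "\<lambda>z. z powi _"] cong: if_cong)
    ultimately have "cmod (2 powi b i) = 1" by simp
    hence "(2::real) powi b i = 1" by (simp add: norm_power_int)
    hence "2 powr real_of_int (b i) = 1" by (simp add: powr_real_of_int')
    thus False using assms by simp
  qed
  moreover have "V \<subseteq> g <#\<^bsub>torus\<^esub> H"
  proof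
    fix x assume x: "x \<in> V"
    have nz: "x $ j \<noteq> 0" "g $ j \<noteq> 0" for j using coord_nonzero x g by auto
    define h :: "complex^'n" where "h = x * (\<chi> j. inverse (g $ j))"
    have "mono_fun b h = mono_fun b x * inverse (mono_fun b g)" by (simp add: h_def mono_fun_mult mono_fun_inverse)
    also have "\<dots> = 1" using c x g mono_fun_nonzero[of g b] V_torus by auto
    finally have "h \<in> H" using nz by (simp add: H_def carrier_torus h_def)
    moreover have "x = g * h" using nz by (simp add: h_def vec_eq_iff)
    ultimately show "x \<in> g <#\<^bsub>torus\<^esub> H" by (auto simp: l_coset_def torus_def)
  qed
  ultimately show False using not_in_coset[OF _ H] g V_torus by blast
qed

lemma finite_mono_fiber: "b i \<noteq> 0 \<Longrightarrow> finite {x \<in> V. mono_fun b x = c}"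
  by (rule finite_fiber[OF mono_fun_laurent mono_fun_nonconstant])

text \<open>The pattern of zeros makes \<open>b\<close> and \<open>b'\<close> linearly independent.
  So each of the finitely many relations \<open>(r, s)\<close> between the two roots of unity yields
  a nonzero exponent \<open>m (r, s)\<close>, whose monomial has finite fibers on the curve.\<close>

lemma finite_torsion:
  assumes b: "b j \<noteq> 0" "b' j = 0" "b' i \<noteq> 0"
  shows "finite {x \<in> V. mono_fun b x \<in> roots_of_unity \<and> mono_fun b' x \<in> roots_of_unity}" (is "finite ?P")
proof -
  obtain D E c where c: "\<exists>k\<le>D. \<exists>e\<le>E. c k e \<noteq> 0"
    "\<forall>x\<in>V. (\<Sum>e\<le>E. (\<Sum>k\<le>D. c k e * mono_fun b x ^ k) * mono_fun b' x ^ e) = 0"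
    using relation_exists[OF mono_fun_laurent mono_fun_nonconstant[of b' i, OF b(3)] mono_fun_laurent[of b]] by blast
  have ru: "roots_of_unity \<subseteq> Qbar"
    using height_at_most_root_of_unity height_at_most_Qbar by (auto simp: roots_of_unity_def)
  have "\<exists>c'. (\<forall>k e. k \<le> D \<longrightarrow> e \<le> E \<longrightarrow> c' k e \<in> Qbar) \<and> (\<exists>k\<le>D. \<exists>e\<le>E. c' k e \<noteq> 0) \<and>
    (\<forall>x\<in>?P. (\<Sum>e\<le>E. (\<Sum>k\<le>D. c' k e * mono_fun b x ^ k) * mono_fun b' x ^ e) = 0)"
    by (rule algebraic_curve_relation[OF _ c(1)]) (use c(2) ru in auto)
  then obtain c' where c': "\<forall>k e. k \<le> D \<longrightarrow> e \<le> E \<longrightarrow> c' k e \<in> Qbar" "\<exists>k\<le>D. \<exists>e\<le>E. c' k e \<noteq> 0"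
    "\<forall>x\<in>?P. (\<Sum>e\<le>E. (\<Sum>k\<le>D. c' k e * mono_fun b x ^ k) * mono_fun b' x ^ e) = 0" by blast
  then obtain k0 e0 where "k0 \<le> D" "e0 \<le> E" "c' k0 e0 \<noteq> 0" by blast
  from torsion_points_on_curve[of D E c', OF _ this] c'(1) obtain T N where
    T: "finite T" "(0, 0) \<notin> T" "N > 0" "\<forall>u\<in>roots_of_unity. \<forall>v\<in>roots_of_unity.
      (\<Sum>e\<le>E. (\<Sum>k\<le>D. c' k e * u ^ k) * v ^ e) = 0 \<longrightarrow> (\<exists>(r, s)\<in>T. (u powi r * v powi s) ^ N = 1)" by blast
  define m where "m p i = int N * (fst p * b i + snd p * b' i)" for p :: "int \<times> int" and i
  have "?P \<subseteq> (\<Union>p\<in>T. {x \<in> V. mono_fun (m p) x = 1})"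
  proof
    fix x assume x: "x \<in> ?P"
    then obtain r s where rs: "(r, s) \<in> T" "(mono_fun b x powi r * mono_fun b' x powi s) ^ N = 1"
      using T(4) c'(3) by blast
    have xt: "x \<in> carrier torus" using x V_torus by blast
    have "mono_fun (m (r, s)) x = 1"
      unfolding m_def by (simp add: mono_fun_scale[OF xt] mono_fun_add[OF xt] rs(2))
    thus "x \<in> (\<Union>p\<in>T. {x \<in> V. mono_fun (m p) x = 1})" using x rs(1) by blast
  qed
  moreover have "finite {x \<in> V. mono_fun (m p) x = 1}" if p: "p \<in> T" for p
  proof (cases "fst p = 0")
    case True
    hence "snd p \<noteq> 0" using p T(2) by (metis prod.collapse)
    hence "m p i \<noteq> 0" using True T(3) b(3) by (simp add: m_def)
    thus ?thesis by (rule finite_mono_fiber)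
  next
    case False
    hence "m p j \<noteq> 0" using T(3) b(1,2) by (simp add: m_def)
    thus ?thesis by (rule finite_mono_fiber)
  qed
  ultimately show ?thesis using T(1) by (meson finite_UN finite_subset)
qed

end

section \<open>Primitively dependent points\<close>

text \<open>Dirichlet's theorem for the fractions \<open>a i / m\<close>, stated in integers: with
  \<open>n = CARD('n)\<close>, the \<open>Q ^ n + 1\<close> multiples fall into \<open>Q ^ n\<close>
  boxes according to their fractional parts, which \<open>f\<close> encodes.\<close>

lemma simultaneous_approximation:
  fixes a :: "'n::finite \<Rightarrow> int"
  assumes m: "m > 0" and Q: "Q \<ge> (1::nat)"
  shows "\<exists>(q::nat) b. q \<ge> 1 \<and> q \<le> Q ^ CARD('n) \<and> (\<forall>i. int Q * \<bar>b i * m - int q * a i\<bar> < m)"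
proof -
  define f where "f q = (\<lambda>i. int Q * (int q * a i mod m) div m)" for q :: nat
  let ?A = "{0..Q ^ CARD('n)}" and ?B = "PiE (UNIV :: 'n set) (\<lambda>_. {0..<int Q})"
  have "f ` ?A \<subseteq> ?B"
  proof
    fix g assume "g \<in> f ` ?A"
    then obtain q where g: "g = f q" by blast
    have "f q i \<in> {0..<int Q}" for i
    proof -
      have r: "0 \<le> int q * a i mod m" "int q * a i mod m < m" using m by auto
      hence "int Q * (int q * a i mod m) < int Q * m" using Q by simp
      moreover have "m * (int Q * (int q * a i mod m) div m) \<le> int Q * (int q * a i mod m)"
        using mult_div_mod_eq[of m "int Q * (int q * a i mod m)"] m pos_mod_sign[OF m, of "int Q * (int q * a i mod m)"]
        by linarith
      ultimately have "m * (int Q * (int q * a i mod m) div m) < m * int Q" by (simp add: mult.commute)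
      hence "int Q * (int q * a i mod m) div m < int Q" using m by (simp only: mult_less_cancel_left_pos)
      moreover have "0 \<le> int Q * (int q * a i mod m) div m" using r m by (simp add: pos_imp_zdiv_nonneg_iff)
      ultimately show ?thesis by (simp add: f_def)
    qed
    thus "g \<in> ?B" unfolding g by auto
  qed
  moreover have "card ?B = Q ^ CARD('n)" "finite ?B" by (auto simp: card_PiE intro: finite_PiE)
  ultimately have "card (f ` ?A) < card ?A" by (metis card_mono le_imp_less_Suc card_atLeastAtMost diff_zero)
  hence "\<not> inj_on f ?A" by (rule pigeonhole)
  then obtain p q where pq: "p < q" "q \<in> ?A" "f p = f q" unfolding inj_on_def by (metis linorder_neqE_nat)
  define b where "b i = int q * a i div m - int p * a i div m" for i
  have "int Q * \<bar>b i * m - int (q - p) * a i\<bar> < m" for i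
  proof -
    define r s where "r = int q * a i mod m" and "s = int p * a i mod m"
    have "int q * a i = m * (int q * a i div m) + r" "int p * a i = m * (int p * a i div m) + s"
      by (simp_all add: r_def s_def)
    moreover have "int (q - p) * a i = int q * a i - int p * a i" using pq(1) by (simp add: of_nat_diff algebra_simps)
    ultimately have e: "b i * m - int (q - p) * a i = s - r" by (simp add: b_def algebra_simps)
    have "int Q * r div m = int Q * s div m" using fun_cong[OF pq(3), of i] by (simp add: f_def r_def s_def)
    moreover have "int Q * r = m * (int Q * r div m) + int Q * r mod m" "int Q * s = m * (int Q * s div m) + int Q * s mod m"
      by simp_all
    moreover have "0 \<le> int Q * r mod m" "int Q * r mod m < m" "0 \<le> int Q * s mod m" "int Q * s mod m < m"
      using m by auto
    ultimately have "\<bar>int Q * s - int Q * r\<bar> < m" by (smt (verit))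
    moreover have "int Q * \<bar>s - r\<bar> = \<bar>int Q * s - int Q * r\<bar>" by (simp add: abs_mult right_diff_distrib[symmetric])
    ultimately show ?thesis unfolding e by simp
  qed
  moreover have "q - p \<ge> 1" "q - p \<le> Q ^ CARD('n)" using pq by auto
  ultimately show ?thesis by blast
qed

text \<open>
  A point satisfying \<open>x\<^sup>a = 1\<close> satisfies \<open>(x\<^sup>b)\<^sup>m = x\<^sup>e\<close> with \<open>e = m b - q a\<close>. Approximating \<open>a / m\<close> by \<open>b / q\<close>,
  where \<open>m = max \<bar>a\<^sub>i\<bar>\<close>, makes \<open>e / m\<close> small with \<open>b\<close> in a finite set, and so \<open>x\<^sup>b\<close> has small height.
\<close>

lemma small_height_monomial:
  fixes M :: nat
  assumes M: "M \<ge> 1"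
  shows "\<exists>Bd. \<forall>a :: 'n::finite \<Rightarrow> int. (\<exists>i. a i \<noteq> 0) \<longrightarrow>
    (\<exists>b. (\<exists>i. b i \<noteq> 0) \<and> (\<forall>i. \<bar>b i\<bar> \<le> int Bd) \<and> (\<forall>i. a i = 0 \<longrightarrow> b i = 0) \<and>
      (\<forall>x\<in>carrier torus. \<forall>G\<ge>1. mono_fun a x \<in> roots_of_unity \<longrightarrow> (\<forall>i. height_at_most (x $ i) (G ^ M)) \<longrightarrow>
        height_at_most (mono_fun b x) G))"
proof -
  \<comment> \<open>Each of the \<open>CARD('n)\<close> entries of \<open>m b - q a\<close> is below
    \<open>m / Q\<close>, so their absolute values add up to at most \<open>m / (2 * M)\<close>.
    Bounds \<open>G ^ M\<close> for the coordinates then give a bound \<open>G ^ m\<close> for the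
    \<open>m\<close>-th power of the monomial.\<close>
  define Q where "Q = 2 * CARD('n) * M"
  have Q: "Q \<ge> 2" using M by (simp add: Q_def)
  show ?thesis
  proof (rule exI[of _ "Q ^ CARD('n)"], intro allI impI)
    fix a :: "'n \<Rightarrow> int" assume "\<exists>i. a i \<noteq> 0"
    then obtain i0 where i0: "a i0 \<noteq> 0" by blast
    define m where "m = Max (range (\<lambda>i. \<bar>a i\<bar>))"
    have am: "\<bar>a i\<bar> \<le> m" for i unfolding m_def by (rule Max_ge) auto
    have "m \<in> range (\<lambda>i. \<bar>a i\<bar>)" unfolding m_def by (rule Max_in) auto
    then obtain i1 where i1: "m = \<bar>a i1\<bar>" by blast
    have m: "m > 0" using am[of i0] i0 by linarith
    obtain q :: nat and b where qb: "q \<ge> 1" "q \<le> Q ^ CARD('n)" "\<forall>i. int Q * \<bar>b i * m - int q * a i\<bar> < m"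
      using simultaneous_approximation[OF m, of Q a] Q by auto
    have small: "2 * \<bar>b i * m - int q * a i\<bar> < m" for i
    proof -
      have "2 * \<bar>b i * m - int q * a i\<bar> \<le> int Q * \<bar>b i * m - int q * a i\<bar>"
        using Q by (intro mult_right_mono) auto
      thus ?thesis using qb(3) by (meson le_less_trans)
    qed
    \<comment> \<open>A zero entry is approximated with error below \<open>m / 2\<close> and stays
      zero. The entry of largest absolute value stays nonzero for the same reason.\<close>
    have b0: "b i = 0" if "a i = 0" for i
    proof (rule ccontr)
      assume "b i \<noteq> 0"
      hence "1 * m \<le> \<bar>b i\<bar> * m" using m by (intro mult_right_mono) auto
      thus False using small[of i] that m by (simp add: abs_mult)
    qed
    have b1: "b i1 \<noteq> 0"
    proof
      assume "b i1 = 0"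
      hence "2 * (int q * m) < m" using small[of i1] i1 by (simp add: abs_mult)
      moreover have "1 * m \<le> int q * m" using qb(1) m by (intro mult_right_mono) auto
      ultimately show False using m by simp
    qed
    have bq: "\<bar>b i\<bar> \<le> int (Q ^ CARD('n))" for i
    proof -
      have "\<bar>b i\<bar> * m = \<bar>(b i * m - int q * a i) + int q * a i\<bar>" using m by (simp add: abs_mult)
      also have "\<dots> \<le> \<bar>b i * m - int q * a i\<bar> + int q * \<bar>a i\<bar>"
        using abs_triangle_ineq[of "b i * m - int q * a i" "int q * a i"] by (simp add: abs_mult)
      also have "\<dots> < m + int q * m"
        using small[of i] am[of i] m by (intro add_less_le_mono mult_left_mono) auto
      also have "\<dots> = (int q + 1) * m" by (simp add: algebra_simps)
      finally have "\<bar>b i\<bar> < int q + 1" using m by simp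
      moreover have "int q \<le> int (Q ^ CARD('n))" using qb(2) by (rule of_nat_mono)
      ultimately show ?thesis by linarith
    qed
    have ht: "height_at_most (mono_fun b x) G"
      if x: "x \<in> carrier torus" and G: "G \<ge> 1" and ru: "mono_fun a x \<in> roots_of_unity"
        and h: "\<forall>i. height_at_most (x $ i) (G ^ M)" for x G
    proof -
      define e where "e i = b i * m - int q * a i" for i
      have xi: "x $ i \<noteq> 0" for i using x by (simp add: carrier_torus)
      have "mono_fun b x powi m = mono_fun (\<lambda>i. e i + int q * a i) x"
        unfolding mono_fun_scale[OF x, symmetric] by (rule arg_cong[where f = "\<lambda>b. mono_fun b x"]) (auto simp: e_def)
      also have "\<dots> = mono_fun e x * mono_fun a x ^ q"
        by (simp add: mono_fun_add[OF x] mono_fun_scale[OF x])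
      finally have eq: "mono_fun b x ^ nat m = mono_fun e x * mono_fun a x ^ q" using m by (simp add: power_int_def)
      define s where "s = (\<Sum>i\<in>UNIV. nat \<bar>e i\<bar>)"
      have "height_at_most (mono_fun e x) ((G ^ M) ^ s)"
        unfolding mono_fun_def[abs_def] s_def using h xi by (intro height_at_most_prod height_at_most_powi) auto
      moreover have "height_at_most (mono_fun a x ^ q) 1"
        using roots_of_unity_power[OF ru, of q] height_at_most_root_of_unity by (auto simp: roots_of_unity_def)
      ultimately have "height_at_most (mono_fun b x ^ nat m) ((G ^ M) ^ s * 1)" unfolding eq by (rule height_at_most_mult)
      moreover have "(G ^ M) ^ s * 1 \<le> G ^ nat m"
      proof -
        have "int Q * int s = (\<Sum>i\<in>UNIV. int Q * \<bar>e i\<bar>)" by (simp add: s_def sum_distrib_left)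
        also have "\<dots> \<le> (\<Sum>i\<in>(UNIV :: 'n set). m)" using qb(3) by (intro sum_mono less_imp_le) (auto simp: e_def)
        finally have "int CARD('n) * (2 * (int M * int s)) \<le> int CARD('n) * m" by (simp add: Q_def mult_ac)
        hence "2 * (int M * int s) \<le> m" by (simp only: mult_le_cancel_left_pos of_nat_0_less_iff zero_less_card_finite)
        hence "int M * int s \<le> m" using m by (smt (verit) mult_nonneg_nonneg of_nat_0_le_iff)
        hence "M * s \<le> nat m" by (simp flip: of_nat_mult add: le_nat_iff)
        thus ?thesis using G by (simp flip: power_mult add: power_increasing)
      qed
      ultimately have "height_at_most (mono_fun b x ^ nat m) (G ^ nat m)" by (rule height_at_most_mono)
      thus ?thesis by (rule height_at_most_root) (use m G in auto)
    qed
    show "\<exists>b. (\<exists>i. b i \<noteq> 0) \<and> (\<forall>i. \<bar>b i\<bar> \<le> int (Q ^ CARD('n))) \<and> (\<forall>i. a i = 0 \<longrightarrow> b i = 0) \<and>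
      (\<forall>x\<in>carrier torus. \<forall>G\<ge>1. mono_fun a x \<in> roots_of_unity \<longrightarrow> (\<forall>i. height_at_most (x $ i) (G ^ M)) \<longrightarrow>
        height_at_most (mono_fun b x) G)"
      using b0 b1 bq ht by (intro exI[of _ b]) blast
  qed
qed

lemma finite_box: "finite {b :: 'n::finite \<Rightarrow> int. \<forall>i. \<bar>b i\<bar> \<le> B}"
proof -
  have "finite (PiE (UNIV :: 'n set) (\<lambda>_. {-B..B}))" by (intro finite_PiE) auto
  moreover have "{b :: 'n \<Rightarrow> int. \<forall>i. \<bar>b i\<bar> \<le> B} \<subseteq> PiE UNIV (\<lambda>_. {-B..B})" by (auto simp: abs_le_iff minus_le_iff)
  ultimately show ?thesis by (rule rev_finite_subset)
qed

section \<open>Bounded height of multiplicatively dependent points\<close>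

context torus_curve
begin

text \<open>\<open>N\<close> is a parameter of its own because it must not depend on
  \<open>b\<close>, while \<open>C\<close> and \<open>F\<close> may.\<close>

definition height_control :: "('n \<Rightarrow> int) \<Rightarrow> nat \<Rightarrow> real \<Rightarrow> (complex^'n) set \<Rightarrow> 'n \<Rightarrow> bool" where
  "height_control b N C F i \<longleftrightarrow> C \<ge> 1 \<and> finite F \<and> (\<forall>x\<in>V - F. (\<forall>j. x $ j \<in> Qbar) \<longrightarrow>
     (\<forall>B\<ge>1. height_at_most (mono_fun b x) B \<longrightarrow> height_at_most (x $ i) (C * B ^ N)))"

text \<open>The relation over the field generated by coordinate \<open>i\<close> has degree at most
  \<open>N\<close> in \<open>x^b\<close> for every \<open>b\<close>. \<open>F\<close> collects the
  points where one chosen nonzero coefficient polynomial vanishes at \<open>x^b\<close>; elsewhere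
  the relation remains nontrivial in the coordinate.\<close>

lemma coordinate_height: "\<exists>N. \<forall>b. (\<exists>j. b j \<noteq> 0) \<longrightarrow> (\<exists>C F. height_control b N C F i)"
proof -
  have "mono_fun (\<lambda>j. if j = i then 1 else 0) = coord i" by (rule ext) (simp add: mono_fun_single coord_def)
  hence nc: "\<nexists>c. \<forall>x\<in>V. coord i x = c" using mono_fun_nonconstant[of "\<lambda>j. if j = i then 1 else 0" i] by simp
  obtain N where N: "\<forall>u\<in>laurent_funs. \<exists>E c. (\<exists>k\<le>N. \<exists>e\<le>E. c k e \<noteq> 0) \<and>
    (\<forall>x\<in>V. (\<Sum>e\<le>E. (\<Sum>k\<le>N. c k e * u x ^ k) * coord i x ^ e) = 0)"
    using relation_bounded_degree[OF coord_laurent_funs nc] by blast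
  have "\<exists>C F. height_control b N C F i" if b: "b j \<noteq> 0" for b j
  proof -
    let ?P = "{x \<in> V. mono_fun b x \<in> Qbar \<and> x $ i \<in> Qbar}"
    obtain E c where c: "\<exists>k\<le>N. \<exists>e\<le>E. c k e \<noteq> 0"
      "\<forall>x\<in>V. (\<Sum>e\<le>E. (\<Sum>k\<le>N. c k e * mono_fun b x ^ k) * coord i x ^ e) = 0"
      using N mono_fun_laurent[of b] by blast
    have "\<exists>c'. (\<forall>k e. k \<le> N \<longrightarrow> e \<le> E \<longrightarrow> c' k e \<in> Qbar) \<and> (\<exists>k\<le>N. \<exists>e\<le>E. c' k e \<noteq> 0) \<and>
      (\<forall>x\<in>?P. (\<Sum>e\<le>E. (\<Sum>k\<le>N. c' k e * mono_fun b x ^ k) * coord i x ^ e) = 0)"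
      by (rule algebraic_curve_relation[OF _ c(1)]) (use c(2) in \<open>auto simp: coord_def\<close>)
    then obtain c' k0 e0 where c': "\<forall>k e. k \<le> N \<longrightarrow> e \<le> E \<longrightarrow> c' k e \<in> Qbar" "k0 \<le> N" "e0 \<le> E" "c' k0 e0 \<noteq> 0"
      "\<forall>x\<in>?P. (\<Sum>e\<le>E. (\<Sum>k\<le>N. c' k e * mono_fun b x ^ k) * coord i x ^ e) = 0" by blast
    obtain C where C: "C \<ge> 1" "\<forall>u x B. height_at_most u B \<longrightarrow> B \<ge> 1 \<longrightarrow>
      (\<Sum>e\<le>E. (\<Sum>k\<le>N. c' k e * u ^ k) * x ^ e) = 0 \<longrightarrow> (\<exists>e\<le>E. (\<Sum>k\<le>N. c' k e * u ^ k) \<noteq> 0) \<longrightarrow>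
      height_at_most x (C * B ^ N)"
      using height_at_most_relation[of N E c'] c'(1) by blast
    define p where "p = (\<Sum>k\<le>N. monom (c' k e0) k)"
    have pp: "poly p u = (\<Sum>k\<le>N. c' k e0 * u ^ k)" for u by (simp add: p_def poly_sum poly_monom)
    have "coeff p k0 = c' k0 e0" using c'(2) by (simp add: p_def coeff_sum)
    hence "p \<noteq> 0" using c'(4) by auto
    hence fin: "finite {u. poly p u = 0}" by (rule poly_roots_finite)
    define F where "F = (\<Union>u\<in>{u. poly p u = 0}. {x \<in> V. mono_fun b x = u})"
    have "finite F" unfolding F_def using fin finite_mono_fiber[of b j] b by blast
    moreover have "height_at_most (x $ i) (C * B ^ N)"
      if x: "x \<in> V - F" "\<forall>j. x $ j \<in> Qbar" "B \<ge> 1" "height_at_most (mono_fun b x) B" for x B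
    proof -
      have "x \<in> ?P" using x height_at_most_Qbar by blast
      hence "(\<Sum>e\<le>E. (\<Sum>k\<le>N. c' k e * mono_fun b x ^ k) * (x $ i) ^ e) = 0" using c'(5) by (simp add: coord_def)
      moreover have "\<exists>e\<le>E. (\<Sum>k\<le>N. c' k e * mono_fun b x ^ k) \<noteq> 0"
        using x(1) c'(3) by (intro exI[of _ e0]) (auto simp: F_def pp)
      ultimately show ?thesis using C(2) x(3,4) by blast
    qed
    ultimately have "height_control b N C F i" using C(1) unfolding height_control_def by blast
    thus ?thesis by blast
  qed
  thus ?thesis by blast
qed

lemma coordinates_height: "\<exists>N\<ge>1. \<forall>b. (\<exists>j. b j \<noteq> 0) \<longrightarrow> (\<exists>C F. \<forall>i. height_control b N C F i)"
proof -
  have "\<exists>N. \<forall>i b. (\<exists>j. b j \<noteq> 0) \<longrightarrow> (\<exists>C F. height_control b (N i) C F i)"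
    by (intro choice allI) (rule coordinate_height)
  then obtain N where N: "\<forall>i b. (\<exists>j. b j \<noteq> 0) \<longrightarrow> (\<exists>C F. height_control b (N i) C F i)" by blast
  define N' where "N' = Suc (\<Sum>i\<in>UNIV. N i)"
  have NN: "N i \<le> N'" for i using member_le_sum[of i UNIV N] by (simp add: N'_def)
  show ?thesis
  proof (rule exI[of _ N'], intro conjI allI impI)
    show "N' \<ge> 1" by (simp add: N'_def)
    fix b :: "'n \<Rightarrow> int" assume "\<exists>j. b j \<noteq> 0"
    hence "\<forall>i. \<exists>C F. height_control b (N i) C F i" using N by blast
    then obtain C F where CF: "\<forall>i. height_control b (N i) (C i) (F i) i" by metis
    hence C: "C i \<ge> 1" "finite (F i)" for i by (auto simp: height_control_def)
    define C' where "C' = (\<Sum>i\<in>UNIV. C i)"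
    have C0: "C i \<ge> 0" for i using C(1)[of i] by simp
    have CC: "C i \<le> C'" for i unfolding C'_def using C0 by (intro member_le_sum) auto
    have "C' \<ge> 1" using C(1) CC by (meson order_trans)
    moreover have "finite (\<Union>i. F i)" using C by auto
    moreover have "height_at_most (x $ i) (C' * B ^ N')"
      if x: "x \<in> V - (\<Union>i. F i)" "\<forall>j. x $ j \<in> Qbar" "B \<ge> 1" "height_at_most (mono_fun b x) B" for x B i
    proof (rule height_at_most_mono)
      show "height_at_most (x $ i) (C i * B ^ N i)"
        using spec[OF CF, of i] x unfolding height_control_def by blast
      show "C i * B ^ N i \<le> C' * B ^ N'" using x(3) C0 CC NN by (intro mult_mono power_increasing order_trans[OF C0 CC]) auto
    qed
    ultimately have "height_control b N' C' (\<Union>i. F i) i" for i unfolding height_control_def by blast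
    thus "\<exists>C F. \<forall>i. height_control b N' C F i" by blast
  qed
qed

text \<open>
  A small multiple of the height of \<open>x\<close> bounds the height of some \<open>x\<^sup>b\<close>, and this in turn controls the
  coordinates: from a bound \<open>H\<close> for the coordinates one obtains the bound \<open>K \<surd>H\<close>, hence \<open>2 K\<^sup>2\<close>.
\<close>

lemma bounded_height:
  "\<exists>H\<ge>1. \<exists>F. finite F \<and> (\<forall>x\<in>V - F. (\<forall>i. x $ i \<in> Qbar) \<longrightarrow>
     (\<exists>a. (\<exists>i. a i \<noteq> 0) \<and> mono_fun a x \<in> roots_of_unity) \<longrightarrow> (\<forall>i. height_at_most (x $ i) H))"
proof -
  obtain N where N: "N \<ge> 1" "\<forall>b. (\<exists>j. b j \<noteq> 0) \<longrightarrow> (\<exists>C F. \<forall>i. height_control b N C F i)"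
    using coordinates_height by blast
  hence "\<forall>b. \<exists>C F. (\<exists>j. b j \<noteq> 0) \<longrightarrow> (\<forall>i. height_control b N C F i)" by blast
  then obtain C F where CF: "\<forall>b. (\<exists>j. b j \<noteq> 0) \<longrightarrow> (\<forall>i. height_control b N (C b) (F b) i)" by metis
  \<comment> \<open>With this exponent the monomial gets the bound \<open>G\<close>, the
    \<open>2 * N\<close>-th root of \<open>H\<close>, and the control of the coordinates raises it
    to \<open>G ^ N = sqrt H\<close>.\<close>
  have M: "2 * N \<ge> 1" using N(1) by simp
  obtain Bd where Bd: "\<forall>a :: 'n \<Rightarrow> int. (\<exists>i. a i \<noteq> 0) \<longrightarrow>
    (\<exists>b. (\<exists>i. b i \<noteq> 0) \<and> (\<forall>i. \<bar>b i\<bar> \<le> int Bd) \<and> (\<forall>i. a i = 0 \<longrightarrow> b i = 0) \<and>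
      (\<forall>x\<in>carrier torus. \<forall>G\<ge>1. mono_fun a x \<in> roots_of_unity \<longrightarrow> (\<forall>i. height_at_most (x $ i) (G ^ (2 * N))) \<longrightarrow>
        height_at_most (mono_fun b x) G))" using small_height_monomial[OF M] by blast
  define S where "S = {b :: 'n \<Rightarrow> int. \<forall>i. \<bar>b i\<bar> \<le> int Bd} \<inter> {b. \<exists>j. b j \<noteq> 0}"
  have S: "finite S" unfolding S_def using finite_box by blast
  define K where "K = 1 + (\<Sum>b\<in>S. C b)"
  have CS: "C b \<ge> 0" "finite (F b)" if "b \<in> S" for b
  proof -
    have "height_control b N (C b) (F b) undefined" using CF that by (auto simp: S_def)
    thus "C b \<ge> 0" "finite (F b)" by (auto simp: height_control_def)
  qed
  have K1: "K \<ge> 1" unfolding K_def using CS by (simp add: sum_nonneg)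
  have CK: "C b \<le> K" if "b \<in> S" for b unfolding K_def using member_le_sum[OF that, of C] CS S by fastforce
  show ?thesis
  proof (intro exI[of _ "2 * K ^ 2"] conjI exI[of _ "\<Union>b\<in>S. F b"] ballI impI)
    have "1 \<le> K ^ 2" using K1 by simp
    thus "1 \<le> 2 * K ^ 2" by simp
    show "finite (\<Union>b\<in>S. F b)" using S CS by blast
    fix x assume x: "x \<in> V - (\<Union>b\<in>S. F b)" "\<forall>i. x $ i \<in> Qbar" "\<exists>a. (\<exists>i. a i \<noteq> 0) \<and> mono_fun a x \<in> roots_of_unity"
    obtain a i where a: "a i \<noteq> 0" "mono_fun a x \<in> roots_of_unity" using x(3) by blast
    obtain b where b: "\<exists>i. b i \<noteq> 0" "\<forall>i. \<bar>b i\<bar> \<le> int Bd" "\<forall>x\<in>carrier torus. \<forall>G\<ge>1. mono_fun a x \<in> roots_of_unity \<longrightarrow>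
       (\<forall>i. height_at_most (x $ i) (G ^ (2 * N))) \<longrightarrow> height_at_most (mono_fun b x) G"
      using Bd a(1) by blast
    have bS: "b \<in> S" using b(1,2) by (simp add: S_def)
    have xb: "x \<in> V - F b" and xt: "x \<in> carrier torus" using x(1) bS V_torus by auto
    \<comment> \<open>All admissible bounds for the point \<open>x\<close>. The exponent
      \<open>b\<close> was found before any bound, so the same \<open>b\<close> and the same
      constant serve every \<open>H\<close> in \<open>A\<close>.\<close>
    define A where "A = {H. H \<ge> 1 \<and> (\<forall>i. height_at_most (x $ i) H)}"
    have step: "K * sqrt H \<in> A" if H: "H \<in> A" for H
    proof -
      define G where "G = root (2 * N) H"
      have H1: "H \<ge> 1" "\<forall>i. height_at_most (x $ i) H" using H by (auto simp: A_def)
      have G: "G \<ge> 1" "G ^ (2 * N) = H" using H1 N(1) by (auto simp: G_def)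
      have "height_at_most (mono_fun b x) G" using b(3) xt G a(2) H1(2) by auto
      hence "\<forall>i. height_at_most (x $ i) (C b * G ^ N)"
        using CF b(1) xb x(2) G(1) unfolding height_control_def by blast
      moreover have "G ^ N = sqrt H" using G H1
        by (metis mult.commute order_trans power_mult real_sqrt_unique zero_le_one zero_le_power)
      moreover have "C b * sqrt H \<le> K * sqrt H" using CK[OF bS] H1(1) by (intro mult_right_mono) auto
      moreover have "1 * 1 \<le> K * sqrt H" using K1 H1(1) by (intro mult_mono) auto
      ultimately show ?thesis by (auto simp: A_def intro: height_at_most_mono)
    qed
    have "\<forall>i. \<exists>B. B \<ge> 1 \<and> height_at_most (x $ i) B" using height_at_most_exists x(2) by blast
    then obtain B where B: "\<forall>i. B i \<ge> 1 \<and> height_at_most (x $ i) (B i)" by metis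
    have B0: "B i \<ge> 0" for i using B by (meson order_trans zero_le_one)
    have "B i \<le> (\<Sum>i\<in>UNIV. B i)" for i using B0 by (intro member_le_sum) auto
    hence "(\<Sum>i\<in>UNIV. B i) \<in> A" using B unfolding A_def by (auto intro: height_at_most_mono) (meson order_trans)
    hence ne: "A \<noteq> {}" by blast
    have bb: "bdd_below A" by (rule bdd_belowI[of _ 1]) (simp add: A_def)
    \<comment> \<open>The iteration is replaced by an infimum: if all admissible bounds exceeded
      \<open>2 * K ^ 2\<close>, each would be at least \<open>2 * Inf A\<close>, so
      \<open>Inf A\<close> would be at least twice itself.\<close>
    have "\<exists>H\<in>A. H \<le> 2 * K ^ 2"
    proof (rule ccontr)
      assume "\<not> ?thesis"
      hence "2 * K ^ 2 \<le> H" if "H \<in> A" for H using that by fastforce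
      hence h: "2 * K ^ 2 \<le> Inf A" by (intro cInf_greatest ne) auto
      have K0: "K ^ 2 > 0" using K1 by simp
      have I0: "Inf A > 0" using h K0 by linarith
      have "2 * Inf A \<le> H" if H: "H \<in> A" for H
      proof -
        have H0: "H \<ge> 0" using H by (auto simp: A_def)
        have "Inf A \<le> K * sqrt H" by (rule cInf_lower[OF step[OF H] bb])
        hence "Inf A ^ 2 \<le> (K * sqrt H) ^ 2" using I0 by (intro power_mono) auto
        also have "\<dots> = K ^ 2 * H" using H0 by (simp add: power_mult_distrib)
        finally have 1: "Inf A ^ 2 \<le> K ^ 2 * H" .
        have "(2 * K ^ 2) * Inf A \<le> Inf A ^ 2" unfolding power2_eq_square[of "Inf A"] using h I0 by (intro mult_right_mono) auto
        hence "K ^ 2 * (2 * Inf A) \<le> K ^ 2 * H" using 1 by simp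
        thus ?thesis using K0 by (simp only: mult_le_cancel_left_pos)
      qed
      hence "2 * Inf A \<le> Inf A" by (intro cInf_greatest ne) auto
      thus False using h K0 by simp
    qed
    then obtain H where "H \<in> A" "H \<le> 2 * K ^ 2" by blast
    thus "\<forall>i. height_at_most (x $ i) (2 * K ^ 2)" by (auto simp: A_def intro: height_at_most_mono)
  qed
qed

end

section \<open>Roots of unity from the Bogomolov Property\<close>

lemma subfield_complexD:
  assumes "subfield L complex_field"
  shows "1 \<in> L" "x \<in> L \<Longrightarrow> y \<in> L \<Longrightarrow> x * y \<in> L" "x \<in> L \<Longrightarrow> x \<noteq> 0 \<Longrightarrow> inverse x \<in> L"
proof -
  interpret F: field complex_field by (rule field_from_type_algebra)
  have r: "subring L complex_field" by (rule subfieldE(1)[OF assms])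
  show "1 \<in> L" using subringE(3)[OF r] by simp
  show "x * y \<in> L" if "x \<in> L" "y \<in> L" using subringE(6)[OF r that] by simp
  show "inverse x \<in> L" if x: "x \<in> L" "x \<noteq> 0" using F.subfield_m_inv(1)[OF assms, of x] x by simp
qed

lemma mono_fun_subfield:
  assumes L: "subfield L complex_field" and x: "x \<in> carrier torus" "\<And>i. x $ i \<in> L"
  shows "mono_fun b x \<in> L"
proof -
  have pow: "z ^ k \<in> L" if "z \<in> L" for z k
    using that by (induction k) (auto intro: subfield_complexD[OF L])
  have "(x $ i) powi b i \<in> L" for i
    using x by (auto simp: power_int_def carrier_torus intro!: pow subfield_complexD[OF L])
  moreover have "(\<Prod>i\<in>I. f i) \<in> L" if "\<And>i. f i \<in> L" for f :: "'a \<Rightarrow> complex" and I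
    using that by (induction I rule: infinite_finite_induct) (auto intro: subfield_complexD[OF L])
  ultimately show ?thesis by (simp add: mono_fun_def)
qed

lemma roots_of_unity_inverse: "z \<in> roots_of_unity \<Longrightarrow> inverse z \<in> roots_of_unity"
  by (auto simp: roots_of_unity_def power_inverse)

lemma roots_of_unity_powi: "z \<in> roots_of_unity \<Longrightarrow> z powi k \<in> roots_of_unity"
  by (auto simp: power_int_def intro: roots_of_unity_power roots_of_unity_inverse)

context torus_curve
begin

text \<open>\<open>M\<close> is so large that the \<open>M\<close>-th root \<open>G\<close> of the
  uniform height bound satisfies \<open>2 * ln G < C\<close>, with \<open>C\<close> the Bogomolov
  constant. The monomial then has height below \<open>C\<close> and, lying in \<open>L\<close>, must
  be a root of unity.\<close>

lemma torsion_monomial: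
  assumes L: "subfield L complex_field" "L \<subseteq> Qbar" "bogomolov_property L"
  shows "\<exists>Bd F. finite F \<and> (\<forall>x\<in>V - F. (\<forall>i. x $ i \<in> L) \<longrightarrow> (\<forall>a. (\<exists>i. a i \<noteq> 0) \<longrightarrow> mono_fun a x \<in> roots_of_unity \<longrightarrow>
    (\<exists>b. (\<exists>i. b i \<noteq> 0) \<and> (\<forall>i. \<bar>b i\<bar> \<le> int Bd) \<and> (\<forall>i. a i = 0 \<longrightarrow> b i = 0) \<and> mono_fun b x \<in> roots_of_unity)))"
proof -
  obtain H F where HF: "H \<ge> 1" "finite F" "\<forall>x\<in>V - F. (\<forall>i. x $ i \<in> Qbar) \<longrightarrow>
     (\<exists>a. (\<exists>i. a i \<noteq> 0) \<and> mono_fun a x \<in> roots_of_unity) \<longrightarrow> (\<forall>i. height_at_most (x $ i) H)"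
    using bounded_height by (elim exE conjE) (rule that)
  obtain C where C: "C > 0" "\<forall>\<alpha>\<in>L - {0} - roots_of_unity. C \<le> weil_height \<alpha>"
    using L(3) by (auto simp: bogomolov_property_def)
  obtain M :: nat where M: "2 * ln H / C < real M" using reals_Archimedean2 by blast
  have lnH: "ln H \<ge> 0" using HF(1) by simp
  have M1: "M \<ge> 1"
  proof (rule ccontr)
    assume "\<not> M \<ge> 1"
    hence "2 * ln H / C < 0" using M by simp
    thus False using lnH C(1) by (simp add: divide_less_0_iff)
  qed
  define G where "G = root M H"
  have G: "G \<ge> 1" "G ^ M = H" using HF(1) M1 by (auto simp: G_def)
  have "real M * ln G = ln H" using G by (metis ln_realpow)
  hence "real M * (2 * ln G) < real M * C" using M C(1) by (simp add: field_simps)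
  hence lnG: "2 * ln G < C" using M1 by simp
  obtain Bd where Bd: "\<forall>a :: 'n \<Rightarrow> int. (\<exists>i. a i \<noteq> 0) \<longrightarrow>
    (\<exists>b. (\<exists>i. b i \<noteq> 0) \<and> (\<forall>i. \<bar>b i\<bar> \<le> int Bd) \<and> (\<forall>i. a i = 0 \<longrightarrow> b i = 0) \<and>
      (\<forall>x\<in>carrier torus. \<forall>G\<ge>1. mono_fun a x \<in> roots_of_unity \<longrightarrow> (\<forall>i. height_at_most (x $ i) (G ^ M)) \<longrightarrow>
        height_at_most (mono_fun b x) G))" using small_height_monomial[OF M1] by blast
  show ?thesis
  proof (rule exI[of _ Bd], rule exI[of _ F], intro conjI HF(2) ballI allI impI)
    fix x and a :: "'n \<Rightarrow> int"
    assume x: "x \<in> V - F" "\<forall>i. x $ i \<in> L" and a: "\<exists>i. a i \<noteq> 0" "mono_fun a x \<in> roots_of_unity"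
    have xt: "x \<in> carrier torus" using x V_torus by blast
    have "\<forall>i. x $ i \<in> Qbar" using x(2) L(2) by blast
    moreover have "\<exists>a. (\<exists>i. a i \<noteq> 0) \<and> mono_fun a x \<in> roots_of_unity" using a by (intro exI[of _ a] conjI)
    ultimately have hx: "\<forall>i. height_at_most (x $ i) (G ^ M)"
      unfolding G(2) using bspec[OF HF(3) x(1)] by (elim impE)
    from mp[OF spec[OF Bd, of a] a(1)] obtain b where b: "\<exists>i. b i \<noteq> 0" "\<forall>i. \<bar>b i\<bar> \<le> int Bd" "\<forall>i. a i = 0 \<longrightarrow> b i = 0"
      "\<forall>x\<in>carrier torus. \<forall>G\<ge>1. mono_fun a x \<in> roots_of_unity \<longrightarrow> (\<forall>i. height_at_most (x $ i) (G ^ M)) \<longrightarrow>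
        height_at_most (mono_fun b x) G" by (elim exE conjE) (rule that, rule exI, assumption+)
    have "height_at_most (mono_fun b x) G" using spec[OF bspec[OF b(4) xt], of G] G(1) a(2) hx by simp
    hence "weil_height (mono_fun b x) \<le> 2 * ln G" by (rule weil_height_le[OF _ mono_fun_nonzero[OF xt] G(1)])
    hence "weil_height (mono_fun b x) < C" using lnG by linarith
    moreover have "mono_fun b x \<in> L" using mono_fun_subfield[OF L(1) xt] x(2) by blast
    ultimately have "mono_fun b x \<in> roots_of_unity" using C(2) mono_fun_nonzero[OF xt, of b] by force
    thus "\<exists>b. (\<exists>i. b i \<noteq> 0) \<and> (\<forall>i. \<bar>b i\<bar> \<le> int Bd) \<and> (\<forall>i. a i = 0 \<longrightarrow> b i = 0) \<and> mono_fun b x \<in> roots_of_unity"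
      using b(1-3) by blast
  qed
qed

text \<open>As \<open>b i * a k = a i * b k\<close>, the entry \<open>a i\<close> divides all
  \<open>b i * a k\<close>, hence their greatest common divisor, which is \<open>b i\<close> up to
  sign.\<close>

lemma primitive_parallel_bound:
  fixes a b :: "'n \<Rightarrow> int"
  assumes gcd: "Gcd (range a) = 1" and b: "b j \<noteq> 0" "\<And>i. \<bar>b i\<bar> \<le> B" and par: "\<And>i k. a i * b k = a k * b i"
  shows "\<bar>a i\<bar> \<le> B"
proof (cases "b i = 0")
  case True
  hence "a i = 0" using par[of i j] b(1) by simp
  thus ?thesis using b(2)[of i] True by simp
next
  case False
  have "a i dvd Gcd ((*) (b i) ` range a)"
  proof (rule Gcd_greatest)
    fix y assume "y \<in> (*) (b i) ` range a"
    then obtain k where "y = b i * a k" by blast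
    hence "y = a i * b k" using par[of i k] by (simp add: mult.commute)
    thus "a i dvd y" by simp
  qed
  hence "a i dvd b i" using gcd by (simp add: Gcd_mult)
  thus ?thesis using dvd_imp_le_int[OF False, of "a i"] b(2)[of i] by simp
qed

lemma finite_primitively_dependent:
  assumes L: "subfield L complex_field" "L \<subseteq> Qbar" "bogomolov_property L"
  shows "finite {x \<in> rational_points V L. primitively_dependent x}"
proof -
  obtain Bd F where F: "finite F" and tors: "\<forall>x\<in>V - F. (\<forall>i. x $ i \<in> L) \<longrightarrow> (\<forall>a. (\<exists>i. a i \<noteq> 0) \<longrightarrow>
    mono_fun a x \<in> roots_of_unity \<longrightarrow> (\<exists>b. (\<exists>i. b i \<noteq> 0) \<and> (\<forall>i. \<bar>b i\<bar> \<le> int Bd) \<and> (\<forall>i. a i = 0 \<longrightarrow> b i = 0) \<and>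
      mono_fun b x \<in> roots_of_unity))"
    using torsion_monomial[OF L] by (elim exE conjE) (rule that)
  define S where "S = {b :: 'n \<Rightarrow> int. \<forall>i. \<bar>b i\<bar> \<le> int Bd}"
  have S: "finite S" unfolding S_def by (rule finite_box)
  \<comment> \<open>\<open>P\<close> receives the points whose primitive exponent is parallel to the
    small exponent found for them, \<open>T\<close> those for which it is not.\<close>
  define P where "P = (\<Union>a\<in>S \<inter> {a. \<exists>i. a i \<noteq> 0}. {x \<in> V. mono_fun a x = 1})"
  define I where "I = {(b, b'). \<exists>i j. b j \<noteq> 0 \<and> b' j = (0::int) \<and> b' i \<noteq> (0::int)} \<inter> S \<times> S"
  define T where "T = (\<Union>(b, b')\<in>I. {x \<in> V. mono_fun b x \<in> roots_of_unity \<and> mono_fun b' x \<in> roots_of_unity})"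
  have finP: "finite P" unfolding P_def using S finite_mono_fiber by blast
  have finT: "finite T" unfolding T_def
  proof (rule finite_UN_I)
    show "finite I" unfolding I_def using S by blast
    show "finite (case p of (b, b') \<Rightarrow> {x \<in> V. mono_fun b x \<in> roots_of_unity \<and> mono_fun b' x \<in> roots_of_unity})"
      if "p \<in> I" for p using that finite_torsion by (auto simp: I_def)
  qed
  have all: "x \<in> F \<union> P \<union> T" if x: "x \<in> rational_points V L" "primitively_dependent x" for x
  proof (rule ccontr)
    assume not: "x \<notin> F \<union> P \<union> T"
    have xV: "x \<in> V - F" and xL: "\<forall>i. x $ i \<in> L" using x(1) not by (auto simp: rational_points_def)
    have xt: "x \<in> carrier torus" using xV V_torus by blast
    have tx: "\<exists>b. (\<exists>i. b i \<noteq> 0) \<and> (\<forall>i. \<bar>b i\<bar> \<le> int Bd) \<and> (\<forall>i. a i = 0 \<longrightarrow> b i = 0) \<and> mono_fun b x \<in> roots_of_unity"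
      if "\<exists>i. a i \<noteq> 0" "mono_fun a x \<in> roots_of_unity" for a
      using tors xV xL that by blast
    obtain a where a: "Gcd (range a) = 1" "mono_fun a x = 1"
      using x(2) by (auto simp: primitively_dependent_def mono_fun_def)
    have a0: "\<exists>i. a i \<noteq> 0"
    proof (rule ccontr)
      assume "\<not> ?thesis"
      hence "range a = {0}" by auto
      thus False using a(1) by simp
    qed
    have one: "1 \<in> roots_of_unity" by (auto simp: roots_of_unity_def intro: exI[of _ 1])
    obtain b where b: "\<exists>i. b i \<noteq> 0" "\<forall>i. \<bar>b i\<bar> \<le> int Bd" "mono_fun b x \<in> roots_of_unity"
      using tx[OF a0] a(2) one by auto
    show False
    proof (cases "\<forall>i k. a i * b k = a k * b i")
      case True
      obtain j where "b j \<noteq> 0" using b(1) by blast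
      hence "\<bar>a i\<bar> \<le> int Bd" for i using True b(2) by (intro primitive_parallel_bound[OF a(1)]) auto
      hence "a \<in> S \<inter> {a. \<exists>i. a i \<noteq> 0}" using a0 by (simp add: S_def)
      hence "x \<in> P" unfolding P_def using a(2) xV by blast
      thus False using not by blast
    next
      case False
      then obtain i j where ij: "a i * b j \<noteq> a j * b i" "b j \<noteq> 0" by (metis mult_zero_right)
      \<comment> \<open>\<open>a'\<close> vanishes at \<open>j\<close>, and the approximation
        \<open>b'\<close> inherits this zero, whereas \<open>b j \<noteq> 0\<close>; this is the
        pattern that \<open>finite_torsion\<close> requires.\<close>
      define a' where "a' k = b j * a k + (- a j) * b k" for k
      have "mono_fun a' x = mono_fun a x powi b j * mono_fun b x powi (- a j)"
        unfolding a'_def by (simp only: mono_fun_add[OF xt] mono_fun_scale[OF xt])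
      hence "mono_fun a' x = mono_fun b x powi (- a j)" by (simp only: a(2) power_int_1_left mult_1_left)
      hence ru: "mono_fun a' x \<in> roots_of_unity" using roots_of_unity_powi[OF b(3)] by simp
      have "a' i \<noteq> 0" "a' j = 0" using ij by (auto simp: a'_def mult.commute)
      then obtain b' where b': "\<exists>i. b' i \<noteq> 0" "\<forall>i. \<bar>b' i\<bar> \<le> int Bd" "b' j = 0" "mono_fun b' x \<in> roots_of_unity"
        using tx[of a'] ru by blast
      have "(b, b') \<in> I" using ij(2) b(2) b' by (auto simp: I_def S_def)
      hence "x \<in> T" unfolding T_def using xV b(3) b'(4) by blast
      thus False using not by blast
    qed
  qed
  show ?thesis
    by (rule finite_subset[of _ "F \<union> P \<union> T"]) (use F finP finT all in auto)
qed

end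

theorem theorem2p11:
  fixes K L :: "complex set" and V :: "(complex^'n) set"
  assumes "CARD('n) \<ge> 2"
    and "number_field K"
    and "algebraic_curve V" and "zariski_irreducible V" and "defined_over K V"
    and "\<And>g H. g \<in> carrier torus \<Longrightarrow> algebraic_subgroup H \<Longrightarrow> H \<noteq> carrier torus \<Longrightarrow>
           \<not> V \<subseteq> g <#\<^bsub>torus\<^esub> H"
    and "subfield L complex_field" and "K \<subseteq> L" and "L \<subseteq> {z. algebraic z}"
    and "bogomolov_property L"
  shows "finite {P \<in> rational_points V L. primitively_dependent P}"
proof (rule ccontr)
  assume inf: "\<not> ?thesis"
  have "{P \<in> rational_points V L. primitively_dependent P} \<subseteq> V" by (auto simp: rational_points_def)
  \<comment> \<open>A counterexample consists of infinitely many points of \<open>V\<close>, which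
    supplies the infinitude assumed in the locale.\<close>
  hence "infinite V" using inf finite_subset by blast
  then interpret torus_curve V
    using assms(3,4,6) by unfold_locales (simp_all add: algebraic_curve_def)
  have "L \<subseteq> Qbar" using assms(9) by (simp add: Qbar_def)
  thus False using inf finite_primitively_dependent[OF assms(7) _ assms(10)] by blast
qed

end
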